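(* Let $k$ be a field, $Q$ a finite acyclic quiver, $a$ a sink of $Q$, $\underline{\mathbf d}=(\underline d^0,\dots,\underline d^\nu)$ a filtration and $M\in\mathrm{Rep}_Q(\underline d^\nu)\langle a\rangle$. The map $$S_a^+:\ \mathrm{Fl}_Q(\underline{\mathbf d},M)\langle a\rangle\longrightarrow \mathrm{Fl}_{\sigma_aQ}(\sigma_a\underline{\mathbf d},S_a^+M)\langle a\rangle,\qquad \mathbf U\mapsto S_a^+\mathbf U=(S_a^+U^0,\dots,S_a^+U^\nu)$$ is an isomorphism of varieties with inverse $\hat D\circ S_a^+\circ\hat D=S_a^-$.
   Context: Representations are finite-dimensional over $k$; only $k$-valued points are considered. A filtration is a sequence of dimension vectors $(\underline d^0,\dots,\underline d^\nu)$ with $\underline d^0=0$ and $\underline d^l\le\underline d^{l+1}$; it is a filtration of $M$ if $\underline d^\nu=\underline{\dim}M$. $\mathrm{Fl}_Q(\underline{\mathbf d},M)$ is the projective variety of flags $\mathbf U=(U^0\subset\dots\subset U^\nu=M)$ of subrepresentations with $\underline{\dim}\,U^l=\underline d^l$; it is empty if $\underline{\mathbf d}$ is not a filtration of $M$. Reflections: with $\langle\underline d,\underline e\rangle=\sum_i d_ie_i-\sum_{\alpha:i\to j}d_ie_j$ and $(\underline d,\underline e)=\langle\underline d,\underline e\rangle+\langle\underline e,\underline d\rangle$, put $\sigma_a\underline d=\underline d-(\underline d,\epsilon_a)\epsilon_a$, where $\epsilon_a$ is the unit vector at $a$; $\sigma_a\underline{\mathbf d}$ is defined termwise. $\sigma_aQ$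 is $Q$ with all arrows at $a$ reversed, an arrow $\alpha$ being replaced by $\alpha^*$. For a sink $a$, $\phi_a^M:\bigoplus_{\alpha:j\to a}M_j\to M_a$ is the map with components $M_\alpha$. $S_a^+M$ is the representation of $\sigma_aQ$ with $(S_a^+M)_i=M_i$ for $i\ne a$, $(S_a^+M)_a=\ker\phi_a^M$, $(S_a^+M)_{\alpha^*}$ the inclusion of $\ker\phi^M_a$ followed by the projection to the summand of $\alpha$, and all other maps unchanged. $S_a^+$ is a functor. For a source $a$, $S_a^-$ is the dual construction (with the cokernel of $M_a\to\bigoplus_{\alpha:a\to j}M_j$ at the vertex $a$). $S_a$ is the simple representation at $a$. If $a$ is a sink, $\mathrm{Rep}_Q(\underline d)\langle a\rangle$ is the set of $M\in \mathrm{Rep}_Q(\underline d)$ (representations of dimension vector $\underline d$) with $\operatorname{Hom}(M,S_a)=0$, and $\mathrm{Fl}_Q(\underline{\mathbf d},M)\langle a\rangle$ is the (open) set of $\mathbf U\in\mathrm{Fl}_Q(\underline{\mathbf d},M)$ with $\operatorname{Hom}(U^l,S_a)=0$ for all $l$. If $a$ is a source (as in $\sigma_aQ$), $\mathrm{Fl}_Q(\underline{\mathbf d},M)\langle a\rangle$ is the (open) set of $\mathbf U\in\mathrm{Fl}_Q(\underline{\mathbf d},M)$ with $\operatorname{Hom}(S_a,M/U^l)=0$ for all $l$. Duality: $D=\operatorname{Hom}_k(-,k)$ sends representations of $Q$ to representations of the opposite quiver $Q^{op}$. For $\mathbf U\in\mathrm{Fl}_Q(\underline{\mathbf d},M)$,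 with $\underline e^{\nu-l}:=\underline d^\nu-\underline d^l$, $\hat D\mathbf U\in\mathrm{Fl}_{Q^{op}}(\underline{\mathbf e},DM)$ is the flag with $(\hat D\mathbf U)^{\nu-l}=\ker(DM\to D(U^l))=D(M/U^l)$. In $\hat D\circ S_a^+\circ\hat D$, the functor $S_a^+$ is the one at the sink $a$ of $(\sigma_aQ)^{op}$. *)

theory Defs
  imports
    "HOL-Algebra.AbelCoset"
    "HOL-Analysis.Abstract_Topology"
    "Graph_Theory.Digraph"
    "Jordan_Normal_Form.Determinant"
    "Jordan_Normal_Form.VS_Connect"
begin

section \<open>Vector spaces with explicit carriers\<close>

text \<open>
  The ground field is the type \<^typ>\<open>'k::field\<close>, viewed as the ring record \<^term>\<open>class_ring\<close>; vector
  spaces are module records satisfying \<^const>\<open>vectorspace\<close>, whose \<^const>\<open>mult\<close> and \<^const>\<open>one\<close> fields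
  play no role.
\<close>

definition ground_space :: "('k::field, 'k) module" where
  "ground_space = \<lparr>carrier = UNIV, mult = (*), one = 1, zero = 0, add = (+), smult = (*)\<rparr>"

definition quot_space :: "('k::field, 'v) module \<Rightarrow> 'v set \<Rightarrow> ('k, 'v set) module" where
  "quot_space V W =
     \<lparr>carrier = a_rcosets\<^bsub>V\<^esub> W, mult = undefined, one = undefined, zero = W,
      add = (\<lambda>A B. A <+>\<^bsub>V\<^esub> B),
      smult = (\<lambda>c A. \<Union>x\<in>A. W +>\<^bsub>V\<^esub> (c \<odot>\<^bsub>V\<^esub> x))\<rparr>"

text \<open>Linear forms are extensional functions (\<^const>\<open>undefined\<close> off the carrier), so that equality of
  elements of the dual space is equality of forms on \<open>V\<close>.\<close>

definition dual_space :: "('k::field, 'v) module \<Rightarrow> ('k, 'v \<Rightarrow> 'k) module" where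
  "dual_space V =
     \<lparr>carrier = module_hom class_ring V ground_space \<inter> extensional (carrier V),
      mult = undefined, one = undefined,
      zero = (\<lambda>x\<in>carrier V. 0),
      add = (\<lambda>\<xi> \<eta>. \<lambda>x\<in>carrier V. \<xi> x + \<eta> x),
      smult = (\<lambda>c \<xi>. \<lambda>x\<in>carrier V. c * \<xi> x)\<rparr>"

definition sum_space :: "'e set \<Rightarrow> ('e \<Rightarrow> ('k::field, 'v) module) \<Rightarrow> ('k, 'e \<Rightarrow> 'v) module" where
  "sum_space E V =
     \<lparr>carrier = (\<Pi>\<^sub>E \<alpha>\<in>E. carrier (V \<alpha>)), mult = undefined, one = undefined,
      zero = (\<lambda>\<alpha>\<in>E. \<zero>\<^bsub>V \<alpha>\<^esub>),
      add = (\<lambda>f g. \<lambda>\<alpha>\<in>E. f \<alpha> \<oplus>\<^bsub>V \<alpha>\<^esub> g \<alpha>),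
      smult = (\<lambda>c f. \<lambda>\<alpha>\<in>E. c \<odot>\<^bsub>V \<alpha>\<^esub> f \<alpha>)\<rparr>"

text \<open>Transport of structure along an injection \<open>j\<close>; used only for \<^const>\<open>Inl\<close> and \<^const>\<open>Inr\<close>, to put
  spaces over different types into one sum type.\<close>

definition transport_space :: "('v \<Rightarrow> 'w) \<Rightarrow> ('k::field, 'v) module \<Rightarrow> ('k, 'w) module" where
  "transport_space j V =
     \<lparr>carrier = j ` carrier V, mult = undefined, one = undefined,
      zero = j \<zero>\<^bsub>V\<^esub>,
      add = (\<lambda>x y. j (inv_into UNIV j x \<oplus>\<^bsub>V\<^esub> inv_into UNIV j y)),
      smult = (\<lambda>c x. j (c \<odot>\<^bsub>V\<^esub> inv_into UNIV j x))\<rparr>"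


section \<open>Quivers and dimension vectors\<close>

text \<open>A finite quiver is a \<^const>\<open>fin_digraph\<close> (parallel arrows and loops allowed); it is acyclic if
  \<^term>\<open>acyclic (arcs_ends Q)\<close>, i.e. if it has no oriented cycle.\<close>

definition is_sink :: "('i, 'e) pre_digraph \<Rightarrow> 'i \<Rightarrow> bool" where
  "is_sink Q a \<longleftrightarrow> a \<in> verts Q \<and> out_arcs Q a = {}"

definition op_quiver :: "('i, 'e) pre_digraph \<Rightarrow> ('i, 'e) pre_digraph" where
  "op_quiver Q = Q\<lparr>tail := head Q, head := tail Q\<rparr>"

text \<open>The reversed arrow \<open>\<alpha>\<^sup>*\<close> keeps the name \<open>\<alpha>\<close>.\<close>

definition refl_quiver :: "'i \<Rightarrow> ('i, 'e) pre_digraph \<Rightarrow> ('i, 'e) pre_digraph" where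
  "refl_quiver a Q =
     Q\<lparr>tail := (\<lambda>\<alpha>. if tail Q \<alpha> = a \<or> head Q \<alpha> = a then head Q \<alpha> else tail Q \<alpha>),
       head := (\<lambda>\<alpha>. if tail Q \<alpha> = a \<or> head Q \<alpha> = a then tail Q \<alpha> else head Q \<alpha>)\<rparr>"

definition euler_form :: "('i, 'e) pre_digraph \<Rightarrow> ('i \<Rightarrow> int) \<Rightarrow> ('i \<Rightarrow> int) \<Rightarrow> int" where
  "euler_form Q d e = (\<Sum>i\<in>verts Q. d i * e i) - (\<Sum>\<alpha>\<in>arcs Q. d (tail Q \<alpha>) * e (head Q \<alpha>))"

definition sym_euler_form :: "('i, 'e) pre_digraph \<Rightarrow> ('i \<Rightarrow> int) \<Rightarrow> ('i \<Rightarrow> int) \<Rightarrow> int" where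
  "sym_euler_form Q d e = euler_form Q d e + euler_form Q e d"

definition unit_dim :: "'i \<Rightarrow> 'i \<Rightarrow> int" where
  "unit_dim a = (\<lambda>i. if i = a then 1 else 0)"

text \<open>Values are integers because \<open>\<sigma>\<^sub>a d\<close> may have a negative entry at \<open>a\<close>.\<close>

definition refl_dim :: "('i, 'e) pre_digraph \<Rightarrow> 'i \<Rightarrow> ('i \<Rightarrow> int) \<Rightarrow> 'i \<Rightarrow> int" where
  "refl_dim Q a d = (\<lambda>i. d i - sym_euler_form Q d (unit_dim a) * unit_dim a i)"

definition filtration :: "('i, 'e) pre_digraph \<Rightarrow> nat \<Rightarrow> (nat \<Rightarrow> 'i \<Rightarrow> int) \<Rightarrow> bool" where
  "filtration Q \<nu> d \<longleftrightarrow>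
     (\<forall>i\<in>verts Q. d 0 i = 0) \<and> (\<forall>l<\<nu>. \<forall>i\<in>verts Q. d l i \<le> d (Suc l) i)"


section \<open>Representations\<close>

record ('i, 'e, 'k, 'v) quiver_rep =
  rspace :: "'i \<Rightarrow> ('k, 'v) module"
  rmap :: "'e \<Rightarrow> 'v \<Rightarrow> 'v"

definition is_rep :: "('i, 'e) pre_digraph \<Rightarrow> ('i, 'e, 'k::field, 'v) quiver_rep \<Rightarrow> bool" where
  "is_rep Q M \<longleftrightarrow>
     (\<forall>i\<in>verts Q. vectorspace class_ring (rspace M i) \<and> vectorspace.fin_dim class_ring (rspace M i)) \<and>
     (\<forall>\<alpha>\<in>arcs Q. linear_map class_ring (rspace M (tail Q \<alpha>)) (rspace M (head Q \<alpha>)) (rmap M \<alpha>))"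

definition dimension_vector :: "('i, 'e, 'k::field, 'v) quiver_rep \<Rightarrow> 'i \<Rightarrow> int" where
  "dimension_vector M i = int (vectorspace.dim class_ring (rspace M i))"

definition Rep :: "('i, 'e) pre_digraph \<Rightarrow> ('i \<Rightarrow> int) \<Rightarrow> ('i, 'e, 'k::field, 'v) quiver_rep set" where
  "Rep Q d = {M. is_rep Q M \<and> (\<forall>i\<in>verts Q. dimension_vector M i = d i)}"

definition rep_hom ::
  "('i, 'e) pre_digraph \<Rightarrow> ('i, 'e, 'k::field, 'v) quiver_rep \<Rightarrow> ('i, 'e, 'k, 'w) quiver_rep
     \<Rightarrow> ('i \<Rightarrow> 'v \<Rightarrow> 'w) set" where
  "rep_hom Q M N =
     {f. (\<forall>i\<in>verts Q. linear_map class_ring (rspace M i) (rspace N i) (f i)) \<and>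
         (\<forall>\<alpha>\<in>arcs Q. \<forall>x\<in>carrier (rspace M (tail Q \<alpha>)).
            f (head Q \<alpha>) (rmap M \<alpha> x) = rmap N \<alpha> (f (tail Q \<alpha>) x))}"

text \<open>\<open>Hom(M, N) = 0\<close>.\<close>

definition hom_vanishes ::
  "('i, 'e) pre_digraph \<Rightarrow> ('i, 'e, 'k::field, 'v) quiver_rep \<Rightarrow> ('i, 'e, 'k, 'w) quiver_rep \<Rightarrow> bool"
  where
  "hom_vanishes Q M N \<longleftrightarrow>
     (\<forall>f\<in>rep_hom Q M N. \<forall>i\<in>verts Q. \<forall>x\<in>carrier (rspace M i). f i x = \<zero>\<^bsub>rspace N i\<^esub>)"

definition rep_iso ::
  "('i, 'e) pre_digraph \<Rightarrow> ('i, 'e, 'k::field, 'v) quiver_rep \<Rightarrow> ('i, 'e, 'k, 'w) quiver_rep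
     \<Rightarrow> ('i \<Rightarrow> 'v \<Rightarrow> 'w) \<Rightarrow> bool" where
  "rep_iso Q M N f \<longleftrightarrow>
     f \<in> rep_hom Q M N \<and>
     (\<forall>i\<in>verts Q. bij_betw (f i) (carrier (rspace M i)) (carrier (rspace N i)))"

definition simple_rep :: "'i \<Rightarrow> ('i, 'e, 'k::field, 'k) quiver_rep" where
  "simple_rep a =
     \<lparr>rspace = (\<lambda>i. if i = a then ground_space else ground_space\<lparr>carrier := {0}\<rparr>),
      rmap = (\<lambda>\<alpha> x. 0)\<rparr>"

definition is_subrep ::
  "('i, 'e) pre_digraph \<Rightarrow> ('i, 'e, 'k::field, 'v) quiver_rep \<Rightarrow> ('i \<Rightarrow> 'v set) \<Rightarrow> bool" where
  "is_subrep Q M U \<longleftrightarrow>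
     (\<forall>i\<in>verts Q. subspace class_ring (U i) (rspace M i)) \<and>
     (\<forall>\<alpha>\<in>arcs Q. rmap M \<alpha> ` U (tail Q \<alpha>) \<subseteq> U (head Q \<alpha>))"

definition subrep :: "('i, 'e, 'k::field, 'v) quiver_rep \<Rightarrow> ('i \<Rightarrow> 'v set) \<Rightarrow> ('i, 'e, 'k, 'v) quiver_rep"
  where
  "subrep M U = M\<lparr>rspace := (\<lambda>i. (rspace M i)\<lparr>carrier := U i\<rparr>)\<rparr>"

definition quot_rep ::
  "('i, 'e) pre_digraph \<Rightarrow> ('i, 'e, 'k::field, 'v) quiver_rep \<Rightarrow> ('i \<Rightarrow> 'v set)
     \<Rightarrow> ('i, 'e, 'k, 'v set) quiver_rep" where
  "quot_rep Q M U =
     \<lparr>rspace = (\<lambda>i. quot_space (rspace M i) (U i)),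
      rmap = (\<lambda>\<alpha> C. \<Union>x\<in>C. U (head Q \<alpha>) +>\<^bsub>rspace M (head Q \<alpha>)\<^esub> rmap M \<alpha> x)\<rparr>"

text \<open>The dual \<open>DM\<close> of a representation \<open>M\<close> of \<open>Q\<close> is a representation of \<^term>\<open>op_quiver Q\<close>.\<close>

definition dual_rep ::
  "('i, 'e) pre_digraph \<Rightarrow> ('i, 'e, 'k::field, 'v) quiver_rep \<Rightarrow> ('i, 'e, 'k, 'v \<Rightarrow> 'k) quiver_rep" where
  "dual_rep Q M =
     \<lparr>rspace = (\<lambda>i. dual_space (rspace M i)),
      rmap = (\<lambda>\<alpha> \<xi>. \<lambda>x\<in>carrier (rspace M (tail Q \<alpha>)). \<xi> (rmap M \<alpha> x))\<rparr>"


section \<open>Reflection functors\<close>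

text \<open>
  Both reflections of a representation over \<open>'v\<close> live over a sum type: the left summand carries the
  unchanged spaces, the right summand the new space at \<open>a\<close>.
\<close>

definition sink_map ::
  "('i, 'e) pre_digraph \<Rightarrow> 'i \<Rightarrow> ('i, 'e, 'k::field, 'v) quiver_rep \<Rightarrow> ('e \<Rightarrow> 'v) \<Rightarrow> 'v" where
  "sink_map Q a M f = (\<Oplus>\<^bsub>rspace M a\<^esub>\<alpha>\<in>in_arcs Q a. rmap M \<alpha> (f \<alpha>))"

definition S_plus ::
  "('i, 'e) pre_digraph \<Rightarrow> 'i \<Rightarrow> ('i, 'e, 'k::field, 'v) quiver_rep
     \<Rightarrow> ('i, 'e, 'k, 'v + ('e \<Rightarrow> 'v)) quiver_rep" where
  "S_plus Q a M =
     (let S = sum_space (in_arcs Q a) (\<lambda>\<alpha>. rspace M (tail Q \<alpha>)) in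
      \<lparr>rspace = (\<lambda>i. if i = a
                 then transport_space Inr
                        (S\<lparr>carrier := {f \<in> carrier S. sink_map Q a M f = \<zero>\<^bsub>rspace M a\<^esub>}\<rparr>)
                 else transport_space Inl (rspace M i)),
       rmap = (\<lambda>\<alpha> x. if \<alpha> \<in> in_arcs Q a then Inl (projr x \<alpha>) else Inl (rmap M \<alpha> (projl x)))\<rparr>)"

definition source_map ::
  "('i, 'e) pre_digraph \<Rightarrow> 'i \<Rightarrow> ('i, 'e, 'k::field, 'v) quiver_rep \<Rightarrow> 'v \<Rightarrow> ('e \<Rightarrow> 'v)" where
  "source_map Q a N x = (\<lambda>\<alpha>\<in>out_arcs Q a. rmap N \<alpha> x)"

definition source_sum ::
  "('i, 'e) pre_digraph \<Rightarrow> 'i \<Rightarrow> ('i, 'e, 'k::field, 'v) quiver_rep \<Rightarrow> ('k, 'e \<Rightarrow> 'v) module" where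
  "source_sum Q a N = sum_space (out_arcs Q a) (\<lambda>\<alpha>. rspace N (head Q \<alpha>))"

definition source_class ::
  "('i, 'e) pre_digraph \<Rightarrow> 'i \<Rightarrow> ('i, 'e, 'k::field, 'v) quiver_rep \<Rightarrow> ('e \<Rightarrow> 'v) \<Rightarrow> ('e \<Rightarrow> 'v) set" where
  "source_class Q a N f = (source_map Q a N ` carrier (rspace N a)) +>\<^bsub>source_sum Q a N\<^esub> f"

definition S_minus ::
  "('i, 'e) pre_digraph \<Rightarrow> 'i \<Rightarrow> ('i, 'e, 'k::field, 'v) quiver_rep
     \<Rightarrow> ('i, 'e, 'k, 'v + ('e \<Rightarrow> 'v) set) quiver_rep" where
  "S_minus Q a N =
     \<lparr>rspace = (\<lambda>i. if i = a
                then transport_space Inr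
                       (quot_space (source_sum Q a N) (source_map Q a N ` carrier (rspace N a)))
                else transport_space Inl (rspace N i)),
      rmap = (\<lambda>\<alpha> x. if \<alpha> \<in> out_arcs Q a
                then Inr (source_class Q a N
                       (\<lambda>\<beta>\<in>out_arcs Q a. if \<beta> = \<alpha> then projl x else \<zero>\<^bsub>rspace N (head Q \<beta>)\<^esub>))
                else Inl (rmap N \<alpha> (projl x)))\<rparr>"

text \<open>The action of \<open>S\<^sub>a\<^sup>-\<close> on a morphism with target \<open>N\<close>.\<close>

definition S_minus_hom ::
  "('i, 'e) pre_digraph \<Rightarrow> 'i \<Rightarrow> ('i, 'e, 'k::field, 'w) quiver_rep \<Rightarrow> ('i \<Rightarrow> 'v \<Rightarrow> 'w)
     \<Rightarrow> 'i \<Rightarrow> 'v + ('e \<Rightarrow> 'v) set \<Rightarrow> 'w + ('e \<Rightarrow> 'w) set" where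
  "S_minus_hom Q a N f i y =
     (if i = a
      then Inr (\<Union>g\<in>projr y. source_class Q a N (\<lambda>\<alpha>\<in>out_arcs Q a. f (head Q \<alpha>) (g \<alpha>)))
      else Inl (f i (projl y)))"

text \<open>
  The counit \<open>S\<^sub>a\<^sup>- S\<^sub>a\<^sup>+ M \<rightarrow> M\<close> at a sink \<open>a\<close> of \<open>Q\<close>: the identity away from \<open>a\<close>, and at \<open>a\<close> the map
  induced by \<open>\<phi>\<^sub>a\<^sup>M\<close> on the cokernel of the inclusion of its kernel.
\<close>

definition refl_counit ::
  "('i, 'e) pre_digraph \<Rightarrow> 'i \<Rightarrow> ('i, 'e, 'k::field, 'v) quiver_rep
     \<Rightarrow> 'i \<Rightarrow> ('v + ('e \<Rightarrow> 'v)) + ('e \<Rightarrow> 'v + ('e \<Rightarrow> 'v)) set \<Rightarrow> 'v" where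
  "refl_counit Q a M i y =
     (if i = a then sink_map Q a M (\<lambda>\<alpha>\<in>in_arcs Q a. projl ((SOME g. g \<in> projr y) \<alpha>))
      else projl (projl y))"

text \<open>\<open>D S\<^sub>a\<^sup>+ D N\<close> for a source \<open>a\<close> of \<open>Q\<close>, with the reflection at the sink \<open>a\<close> of \<open>Q\<^sup>o\<^sup>p\<close>.\<close>

definition D_S_plus_D ::
  "('i, 'e) pre_digraph \<Rightarrow> 'i \<Rightarrow> ('i, 'e, 'k::field, 'v) quiver_rep
     \<Rightarrow> ('i, 'e, 'k, ('v \<Rightarrow> 'k) + ('e \<Rightarrow> 'v \<Rightarrow> 'k) \<Rightarrow> 'k) quiver_rep" where
  "D_S_plus_D Q a N =
     dual_rep (refl_quiver a (op_quiver Q)) (S_plus (op_quiver Q) a (dual_rep Q N))"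

text \<open>
  The canonical map \<open>S\<^sub>a\<^sup>- N \<rightarrow> D S\<^sub>a\<^sup>+ D N\<close>: evaluation away from \<open>a\<close>; at \<open>a\<close>, the class of \<open>(f\<^sub>\<alpha>)\<^sub>\<alpha>\<close> is
  sent to the form \<open>(\<eta>\<^sub>\<alpha>)\<^sub>\<alpha> \<mapsto> \<Sum>\<^sub>\<alpha> \<eta>\<^sub>\<alpha>(f\<^sub>\<alpha>)\<close>.
\<close>

definition refl_dual_map ::
  "('i, 'e) pre_digraph \<Rightarrow> 'i \<Rightarrow> ('i, 'e, 'k::field, 'v) quiver_rep
     \<Rightarrow> 'i \<Rightarrow> 'v + ('e \<Rightarrow> 'v) set \<Rightarrow> (('v \<Rightarrow> 'k) + ('e \<Rightarrow> 'v \<Rightarrow> 'k) \<Rightarrow> 'k)" where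
  "refl_dual_map Q a N i y =
     (\<lambda>\<eta>\<in>carrier (rspace (S_plus (op_quiver Q) a (dual_rep Q N)) i).
        if i = a then (\<Sum>\<alpha>\<in>out_arcs Q a. projr \<eta> \<alpha> ((SOME f. f \<in> projr y) \<alpha>))
        else projl \<eta> (projl y))"


section \<open>Flags of subrepresentations\<close>

text \<open>
  A flag \<open>U\<close> of length \<open>\<nu>\<close> is given by the sets \<open>U l i\<close>, the space of \<open>U\<^sup>l\<close> at the vertex \<open>i\<close>; these
  are empty for indices out of range, which makes equality of flags equality of functions.
\<close>

type_synonym ('i, 'v) flag = "nat \<Rightarrow> 'i \<Rightarrow> 'v set"

definition Fl ::
  "('i, 'e) pre_digraph \<Rightarrow> nat \<Rightarrow> (nat \<Rightarrow> 'i \<Rightarrow> int) \<Rightarrow> ('i, 'e, 'k::field, 'v) quiver_rep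
     \<Rightarrow> ('i, 'v) flag set" where
  "Fl Q \<nu> d M =
     {U. filtration Q \<nu> d \<and> (\<forall>i\<in>verts Q. d \<nu> i = dimension_vector M i) \<and>
         (\<forall>l i. \<not> (l \<le> \<nu> \<and> i \<in> verts Q) \<longrightarrow> U l i = {}) \<and>
         (\<forall>l\<le>\<nu>. is_subrep Q M (U l)) \<and>
         (\<forall>l\<le>\<nu>. \<forall>i\<in>verts Q. dimension_vector (subrep M (U l)) i = d l i) \<and>
         (\<forall>l<\<nu>. \<forall>i\<in>verts Q. U l i \<subseteq> U (Suc l) i) \<and>
         (\<forall>i\<in>verts Q. U \<nu> i = carrier (rspace M i))}"

definition Fl_sink ::
  "('i, 'e) pre_digraph \<Rightarrow> nat \<Rightarrow> (nat \<Rightarrow> 'i \<Rightarrow> int) \<Rightarrow> ('i, 'e, 'k::field, 'v) quiver_rep \<Rightarrow> 'i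
     \<Rightarrow> ('i, 'v) flag set" where
  "Fl_sink Q \<nu> d M a =
     {U \<in> Fl Q \<nu> d M. \<forall>l\<le>\<nu>. hom_vanishes Q (subrep M (U l)) (simple_rep a)}"

definition Fl_source ::
  "('i, 'e) pre_digraph \<Rightarrow> nat \<Rightarrow> (nat \<Rightarrow> 'i \<Rightarrow> int) \<Rightarrow> ('i, 'e, 'k::field, 'v) quiver_rep \<Rightarrow> 'i
     \<Rightarrow> ('i, 'v) flag set" where
  "Fl_source Q \<nu> d M a =
     {U \<in> Fl Q \<nu> d M. \<forall>l\<le>\<nu>. hom_vanishes Q (simple_rep a) (quot_rep Q M (U l))}"

text \<open>
  \<open>S\<^sub>a\<^sup>+\<close> preserves monomorphisms, and in the present encoding \<open>S\<^sub>a\<^sup>+ U\<^sup>l\<close> is literally a subset of \<open>S\<^sub>a\<^sup>+ M\<close>.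
\<close>

definition S_plus_flag ::
  "('i, 'e) pre_digraph \<Rightarrow> 'i \<Rightarrow> nat \<Rightarrow> ('i, 'e, 'k::field, 'v) quiver_rep
     \<Rightarrow> ('i, 'v) flag \<Rightarrow> ('i, 'v + ('e \<Rightarrow> 'v)) flag" where
  "S_plus_flag Q a \<nu> M U =
     (\<lambda>l i. if l \<le> \<nu> \<and> i \<in> verts Q then carrier (rspace (S_plus Q a (subrep M (U l))) i) else {})"

text \<open>
  Cosets in \<open>S\<^sub>a\<^sup>- V\<^sup>l\<close> and in \<open>S\<^sub>a\<^sup>- N\<close> are different sets, so \<open>S\<^sub>a\<^sup>- V\<^sup>l\<close> is placed inside \<open>S\<^sub>a\<^sup>- N\<close> by applying
  the functor \<open>S\<^sub>a\<^sup>-\<close> to the inclusion of \<open>V\<^sup>l\<close> into \<open>N\<close>.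
\<close>

definition S_minus_flag ::
  "('i, 'e) pre_digraph \<Rightarrow> 'i \<Rightarrow> nat \<Rightarrow> ('i, 'e, 'k::field, 'v) quiver_rep
     \<Rightarrow> ('i, 'v) flag \<Rightarrow> ('i, 'v + ('e \<Rightarrow> 'v) set) flag" where
  "S_minus_flag Q a \<nu> N V =
     (\<lambda>l i. if l \<le> \<nu> \<and> i \<in> verts Q
            then S_minus_hom Q a N (\<lambda>j x. x) i ` carrier (rspace (S_minus Q a (subrep N (V l))) i)
            else {})"

definition D_flag ::
  "('i, 'e) pre_digraph \<Rightarrow> nat \<Rightarrow> ('i, 'e, 'k::field, 'v) quiver_rep
     \<Rightarrow> ('i, 'v) flag \<Rightarrow> ('i, 'v \<Rightarrow> 'k) flag" where
  "D_flag Q \<nu> M U =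
     (\<lambda>l i. if l \<le> \<nu> \<and> i \<in> verts Q
            then {\<xi> \<in> carrier (rspace (dual_rep Q M) i). \<forall>x\<in>U (\<nu> - l) i. \<xi> x = 0}
            else {})"

definition map_flag :: "('i \<Rightarrow> 'v \<Rightarrow> 'w) \<Rightarrow> ('i, 'v) flag \<Rightarrow> ('i, 'w) flag" where
  "map_flag f U = (\<lambda>l i. f i ` U l i)"


section \<open>Sets of flags as varieties\<close>

text \<open>
  A variety is considered through its \<open>k\<close>-valued points only: a set of points (the
  \<^const>\<open>topspace\<close>) with its Zariski topology and, for every open set, the regular functions on it.
\<close>

record ('p, 'k) variety =
  ztop :: "'p topology"
  regular :: "'p set \<Rightarrow> ('p \<Rightarrow> 'k) set"

definition variety_morphism :: "('p, 'k) variety \<Rightarrow> ('q, 'k) variety \<Rightarrow> ('p \<Rightarrow> 'q) \<Rightarrow> bool" where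
  "variety_morphism X Y g \<longleftrightarrow>
     continuous_map (ztop X) (ztop Y) g \<and>
     (\<forall>W f. openin (ztop Y) W \<and> f \<in> regular Y W \<longrightarrow>
        f \<circ> g \<in> regular X {x \<in> topspace (ztop X). g x \<in> W})"

definition variety_iso_with_inverse ::
  "('p, 'k) variety \<Rightarrow> ('q, 'k) variety \<Rightarrow> ('p \<Rightarrow> 'q) \<Rightarrow> ('q \<Rightarrow> 'p) \<Rightarrow> bool" where
  "variety_iso_with_inverse X Y g h \<longleftrightarrow>
     variety_morphism X Y g \<and> variety_morphism Y X h \<and>
     (\<forall>x\<in>topspace (ztop X). h (g x) = x) \<and> (\<forall>y\<in>topspace (ztop Y). g (h y) = y)"

text \<open>
  A set of flags in \<open>Fl Q \<nu> d M\<close> sits, via \<open>U \<mapsto> (U\<^sup>l\<^sub>i)\<close>, in the product over \<open>(l, i)\<close> of the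
  Grassmannians of \<open>d\<^sup>l\<^sub>i\<close>-dimensional subspaces of \<open>M\<^sub>i\<close>, each of which is a projective variety by the
  Pluecker embedding. The Pluecker coordinates are taken without choosing a basis of \<open>M\<^sub>i\<close>: a
  tuple \<open>\<xi>s\<close> of \<open>n\<close> linear forms on \<open>M\<^sub>i\<close> gives the linear form
  \<open>w\<^sub>1 \<and> \<dots> \<and> w\<^sub>n \<mapsto> det (\<xi>\<^sub>s(w\<^sub>t))\<close> on the \<open>n\<close>-th exterior power, and these span its dual. For forms
  taken from the basis dual to a basis of \<open>M\<^sub>i\<close> they are the usual maximal minors.
\<close>

definition pluecker_coord :: "('v \<Rightarrow> 'k::field) list \<Rightarrow> 'v list \<Rightarrow> 'k" where
  "pluecker_coord \<xi>s ws = det (mat (length ws) (length ws) (\<lambda>(s, t). (\<xi>s ! s) (ws ! t)))"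

definition is_frame ::
  "('i, 'e) pre_digraph \<Rightarrow> nat \<Rightarrow> ('i, 'e, 'k::field, 'v) quiver_rep
     \<Rightarrow> ('i, 'v) flag \<Rightarrow> (nat \<Rightarrow> 'i \<Rightarrow> 'v list) \<Rightarrow> bool" where
  "is_frame Q \<nu> M U b \<longleftrightarrow>
     (\<forall>l\<le>\<nu>. \<forall>i\<in>verts Q. distinct (b l i) \<and>
        vectorspace.basis class_ring ((rspace M i)\<lparr>carrier := U l i\<rparr>) (set (b l i)))"

text \<open>
  The choice of a frame only scales the coordinates of \<open>U\<^sup>l\<^sub>i\<close>, for each \<open>(l, i)\<close>, by a common non-zero
  factor; vanishing of multihomogeneous polynomials and quotients of multihomogeneous polynomials of
  equal multidegree do not depend on it.
\<close>

definition frame_of ::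
  "('i, 'e) pre_digraph \<Rightarrow> nat \<Rightarrow> ('i, 'e, 'k::field, 'v) quiver_rep
     \<Rightarrow> ('i, 'v) flag \<Rightarrow> (nat \<Rightarrow> 'i \<Rightarrow> 'v list)" where
  "frame_of Q \<nu> M U = (SOME b. is_frame Q \<nu> M U b)"

text \<open>\<open>multihom Q \<nu> d M m F\<close>: \<open>F\<close> is a polynomial in the Pluecker coordinates, homogeneous of degree
  \<open>m l i\<close> in those of the factor \<open>(l, i)\<close>.\<close>

inductive multihom ::
  "('i, 'e) pre_digraph \<Rightarrow> nat \<Rightarrow> (nat \<Rightarrow> 'i \<Rightarrow> int) \<Rightarrow> ('i, 'e, 'k::field, 'v) quiver_rep
     \<Rightarrow> (nat \<Rightarrow> 'i \<Rightarrow> nat) \<Rightarrow> ((nat \<Rightarrow> 'i \<Rightarrow> 'v list) \<Rightarrow> 'k) \<Rightarrow> bool"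
  for Q :: "('i, 'e) pre_digraph" and \<nu> :: nat and d :: "nat \<Rightarrow> 'i \<Rightarrow> int"
    and M :: "('i, 'e, 'k::field, 'v) quiver_rep"
where
  const: "multihom Q \<nu> d M (\<lambda>l i. 0) (\<lambda>b. c)"
| coord: "l \<le> \<nu> \<Longrightarrow> i \<in> verts Q \<Longrightarrow> set \<xi>s \<subseteq> carrier (dual_space (rspace M i)) \<Longrightarrow>
    int (length \<xi>s) = d l i \<Longrightarrow>
    multihom Q \<nu> d M (\<lambda>l' i'. if l' = l \<and> i' = i then 1 else 0) (\<lambda>b. pluecker_coord \<xi>s (b l i))"
| add: "multihom Q \<nu> d M m F \<Longrightarrow> multihom Q \<nu> d M m G \<Longrightarrow> multihom Q \<nu> d M m (\<lambda>b. F b + G b)"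
| mult: "multihom Q \<nu> d M m F \<Longrightarrow> multihom Q \<nu> d M n G \<Longrightarrow>
    multihom Q \<nu> d M (\<lambda>l i. m l i + n l i) (\<lambda>b. F b * G b)"

definition zariski_topology ::
  "('i, 'e) pre_digraph \<Rightarrow> nat \<Rightarrow> (nat \<Rightarrow> 'i \<Rightarrow> int) \<Rightarrow> ('i, 'e, 'k::field, 'v) quiver_rep
     \<Rightarrow> ('i, 'v) flag set \<Rightarrow> ('i, 'v) flag topology" where
  "zariski_topology Q \<nu> d M X =
     topology_generated_by
       {{U \<in> X. F (frame_of Q \<nu> M U) \<noteq> 0} | m F. multihom Q \<nu> d M m F}"

definition flag_variety ::
  "('i, 'e) pre_digraph \<Rightarrow> nat \<Rightarrow> (nat \<Rightarrow> 'i \<Rightarrow> int) \<Rightarrow> ('i, 'e, 'k::field, 'v) quiver_rep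
     \<Rightarrow> ('i, 'v) flag set \<Rightarrow> (('i, 'v) flag, 'k) variety" where
  "flag_variety Q \<nu> d M X =
     \<lparr>ztop = zariski_topology Q \<nu> d M X,
      regular = (\<lambda>W. {f. \<forall>U\<in>W. \<exists>N m F G. openin (zariski_topology Q \<nu> d M X) N \<and> U \<in> N \<and> N \<subseteq> W \<and>
         multihom Q \<nu> d M m F \<and> multihom Q \<nu> d M m G \<and>
         (\<forall>U'\<in>N. G (frame_of Q \<nu> M U') \<noteq> 0 \<and>
            f U' = F (frame_of Q \<nu> M U') / G (frame_of Q \<nu> M U'))})\<rparr>"

lemma topspace_flag_variety [simp]:
  fixes M :: "('i, 'e, 'k::field, 'v) quiver_rep"
  shows "topspace (ztop (flag_variety Q \<nu> d M X)) = X"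
proof -
  let ?B = "{{U \<in> X. F (frame_of Q \<nu> M U) \<noteq> 0} | m F. multihom Q \<nu> d M m F}"
  have "{U \<in> X. (\<lambda>b. 1 :: 'k) (frame_of Q \<nu> M U) \<noteq> 0} \<in> ?B"
    using multihom.const[of Q \<nu> d M "1 :: 'k"] by (intro CollectI exI conjI) (rule refl)
  then have "X \<subseteq> \<Union>?B" by (intro Union_upper) simp
  moreover have "\<Union>?B \<subseteq> X" by blast
  ultimately show ?thesis
    by (simp only: flag_variety_def zariski_topology_def topology_generated_by_topspace variety.simps subset_antisym)
qed

text \<open>The reflected quiver of the reflected quiver is the original one, so \<open>S\<^sub>a\<^sup>- S\<^sub>a\<^sup>+ M\<close> and \<open>D S\<^sub>a\<^sup>+ D S\<^sub>a\<^sup>+ M\<close>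
  are representations of \<open>Q\<close> itself.\<close>

lemma refl_quiver_involution [simp]: "refl_quiver a (refl_quiver a Q) = Q"
  by (rule pre_digraph.equality) (simp_all add: refl_quiver_def fun_eq_iff)

lemma op_refl_op_refl [simp]:
  "op_quiver (refl_quiver a (op_quiver (refl_quiver a Q))) = Q"
  by (rule pre_digraph.equality) (simp_all add: refl_quiver_def op_quiver_def fun_eq_iff)

end

theory Submission
  imports Defs
begin

text \<open>
  Let \<open>a\<close> be a sink of \<open>Q\<close>, and for a subrepresentation \<open>W\<close> of \<open>M\<close> let \<open>A(W)\<close> be the direct sum of the
  spaces of \<open>W\<close> at the tails of the arrows into \<open>a\<close>. A non-zero map from \<open>W\<close> to the simple representation
  at \<open>a\<close> is the same as a non-zero linear form on \<open>W\<^sub>a\<close> that kills \<open>\<phi> A(W)\<close>; so there is none iff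
  \<open>W\<^sub>a = \<phi> A(W)\<close> (\<open>hom_subrep_to_simple_iff\<close>). In the reflected representation \<open>N\<close>, whose space at the source
  \<open>a\<close> is \<open>ker \<phi>\<close>, a non-zero map from the simple representation to \<open>N/V\<close> is a vector of \<open>ker \<phi>\<close> that
  lies outside \<open>V\<^sub>a\<close> but has all its components in \<open>V\<close>; so there is none iff \<open>V\<^sub>a = ker \<phi> \<inter> A(V)\<close>
  (\<open>source_condition_iff\<close>). On both sides the space at \<open>a\<close> is therefore determined by the spaces at the
  other vertices, which the reflections do not change: \<open>S\<^sub>a\<^sup>+\<close> trades \<open>\<phi> A\<close> for \<open>ker \<phi> \<inter> A\<close>, and \<open>S\<^sub>a\<^sup>-\<close> trades
  it back (\<open>refl_down_up\<close>, \<open>refl_up_down\<close>). The exact sequence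
  \<open>0 \<rightarrow> ker \<phi> \<inter> A \<rightarrow> A \<rightarrow> \<phi> A \<rightarrow> 0\<close> says that the dimension vectors correspond under \<open>\<sigma>\<^sub>a\<close> (\<open>refl_up_dim\<close>).

  It remains to see that both bijections are morphisms, and the same exact sequence is the reason. Its
  top exterior powers satisfy \<open>\<Lambda>A = \<Lambda>(ker \<phi> \<inter> A) \<otimes> \<Lambda>(\<phi> A)\<close>. In Pluecker coordinates (\<open>pluecker_exact\<close>): the
  coordinate of \<open>A\<close> along a tuple of forms followed by pulled back forms is, up to a factor, the product of
  a coordinate of the kernel and a coordinate of the image. If one of the two outer spaces is known, fix
  a tuple at which its coordinate does not vanish near the given flag; then every coordinate of the
  other space is, up to a common factor, a coordinate of \<open>A\<close> (\<open>locpoly_kernel\<close>, \<open>locpoly_quotient\<close>). The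
  coordinates of \<open>A\<close> are polynomials in those of its summands, because the values of linear forms on a
  suitable basis of each summand are Pluecker coordinates by Cramer's rule (\<open>locpoly_direct_sum\<close>).
  A map of flags whose spaces vary in this polynomial way pulls vanishing loci and quotients of
  multihomogeneous polynomials back to such (\<open>flag_map.morphism\<close>).

  The comparison of \<open>S\<^sub>a\<^sup>- N\<close> with \<open>M\<close> is the first isomorphism theorem for \<open>\<phi>\<close> (\<open>counit_iso\<close>). The comparison
  with \<open>D S\<^sub>a\<^sup>+ D N\<close> is biduality: the space of \<open>S\<^sub>a\<^sup>+ D N\<close> at \<open>a\<close> is the annihilator of the image \<open>B\<close> of \<open>N\<^sub>a\<close> in
  the direct sum \<open>S\<close> over the arrows out of \<open>a\<close>, and the dual of the annihilator of \<open>B\<close> is \<open>S/B\<close>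
  (locale \<open>annihilator\<close>); on flags this becomes the double annihilator theorem (\<open>double_annihilator\<close>).
\<close>

section \<open>Linear algebra over explicit carriers\<close>

abbreviation vsp :: "('k::field, 'v) module \<Rightarrow> bool" where
  "vsp V \<equiv> vectorspace class_ring V"

abbreviation lin :: "('k::field, 'v) module \<Rightarrow> ('k, 'w) module \<Rightarrow> ('v \<Rightarrow> 'w) \<Rightarrow> bool" where
  "lin V W f \<equiv> linear_map class_ring V W f"

abbreviation sub :: "('k::field, 'v) module \<Rightarrow> 'v set \<Rightarrow> bool" where
  "sub V U \<equiv> subspace class_ring U V"

abbreviation fdim :: "('k::field, 'v) module \<Rightarrow> bool" where
  "fdim V \<equiv> vectorspace.fin_dim class_ring V"

abbreviation vdim :: "('k::field, 'v) module \<Rightarrow> nat" where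
  "vdim V \<equiv> vectorspace.dim class_ring V"

abbreviation forms :: "('k::field, 'v) module \<Rightarrow> ('v \<Rightarrow> 'k) set" where
  "forms V \<equiv> carrier (dual_space V)"

text \<open>Module records have no field for negation, so the additive inverse is given as \<open>(- 1) \<odot> v\<close>.\<close>

lemma vspI:
  fixes V :: "('k::field, 'v) module"
  assumes "\<zero>\<^bsub>V\<^esub> \<in> carrier V"
    and "\<And>v w. v \<in> carrier V \<Longrightarrow> w \<in> carrier V \<Longrightarrow> v \<oplus>\<^bsub>V\<^esub> w \<in> carrier V"
    and "\<And>c v. v \<in> carrier V \<Longrightarrow> c \<odot>\<^bsub>V\<^esub> v \<in> carrier V"
    and "\<And>v w. v \<in> carrier V \<Longrightarrow> w \<in> carrier V \<Longrightarrow> v \<oplus>\<^bsub>V\<^esub> w = w \<oplus>\<^bsub>V\<^esub> v"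
    and "\<And>v w x. v \<in> carrier V \<Longrightarrow> w \<in> carrier V \<Longrightarrow> x \<in> carrier V \<Longrightarrow>
           (v \<oplus>\<^bsub>V\<^esub> w) \<oplus>\<^bsub>V\<^esub> x = v \<oplus>\<^bsub>V\<^esub> (w \<oplus>\<^bsub>V\<^esub> x)"
    and "\<And>v. v \<in> carrier V \<Longrightarrow> v \<oplus>\<^bsub>V\<^esub> \<zero>\<^bsub>V\<^esub> = v"
    and "\<And>v. v \<in> carrier V \<Longrightarrow> v \<oplus>\<^bsub>V\<^esub> ((- 1) \<odot>\<^bsub>V\<^esub> v) = \<zero>\<^bsub>V\<^esub>"
    and "\<And>a b v. v \<in> carrier V \<Longrightarrow> (a * b) \<odot>\<^bsub>V\<^esub> v = a \<odot>\<^bsub>V\<^esub> (b \<odot>\<^bsub>V\<^esub> v)"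
    and "\<And>v. v \<in> carrier V \<Longrightarrow> 1 \<odot>\<^bsub>V\<^esub> v = v"
    and "\<And>a b v. v \<in> carrier V \<Longrightarrow> (a + b) \<odot>\<^bsub>V\<^esub> v = a \<odot>\<^bsub>V\<^esub> v \<oplus>\<^bsub>V\<^esub> b \<odot>\<^bsub>V\<^esub> v"
    and "\<And>a v w. v \<in> carrier V \<Longrightarrow> w \<in> carrier V \<Longrightarrow>
           a \<odot>\<^bsub>V\<^esub> (v \<oplus>\<^bsub>V\<^esub> w) = a \<odot>\<^bsub>V\<^esub> v \<oplus>\<^bsub>V\<^esub> a \<odot>\<^bsub>V\<^esub> w"
  shows "vsp V"
proof (rule vs_criteria[OF class_field])
  show "\<forall>v\<in>carrier V. \<exists>neg_v\<in>carrier V. v \<oplus>\<^bsub>V\<^esub> neg_v = \<zero>\<^bsub>V\<^esub>"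
    using assms(3,7) by blast
qed (use assms in \<open>simp_all add: class_ring_simps\<close>)

text \<open>The spaces below change from vertex to vertex and include duals, sums, quotients and subspaces. The
  laws of a vector space are therefore used as rules with the premise \<open>vsp V\<close>, instead of one
  interpretation of the library locale for each space.\<close>

context
  fixes V :: "('k::field, 'v) module"
  assumes V: "vsp V"
begin

interpretation V: vectorspace class_ring V by (rule V)

lemma vsp_zero: "\<zero>\<^bsub>V\<^esub> \<in> carrier V" by simp
lemma vsp_add: "x \<in> carrier V \<Longrightarrow> y \<in> carrier V \<Longrightarrow> x \<oplus>\<^bsub>V\<^esub> y \<in> carrier V" by simp
lemma vsp_smult: "x \<in> carrier V \<Longrightarrow> c \<odot>\<^bsub>V\<^esub> x \<in> carrier V" by (simp add: class_ring_simps)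
lemma vsp_assoc: "x \<in> carrier V \<Longrightarrow> y \<in> carrier V \<Longrightarrow> z \<in> carrier V \<Longrightarrow>
  (x \<oplus>\<^bsub>V\<^esub> y) \<oplus>\<^bsub>V\<^esub> z = x \<oplus>\<^bsub>V\<^esub> (y \<oplus>\<^bsub>V\<^esub> z)" by (rule V.a_assoc)
lemma vsp_comm: "x \<in> carrier V \<Longrightarrow> y \<in> carrier V \<Longrightarrow> x \<oplus>\<^bsub>V\<^esub> y = y \<oplus>\<^bsub>V\<^esub> x" by (rule V.a_comm)
lemma vsp_lcomm: "x \<in> carrier V \<Longrightarrow> y \<in> carrier V \<Longrightarrow> z \<in> carrier V \<Longrightarrow>
  x \<oplus>\<^bsub>V\<^esub> (y \<oplus>\<^bsub>V\<^esub> z) = y \<oplus>\<^bsub>V\<^esub> (x \<oplus>\<^bsub>V\<^esub> z)" by (rule V.a_lcomm)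
lemma vsp_l0: "x \<in> carrier V \<Longrightarrow> \<zero>\<^bsub>V\<^esub> \<oplus>\<^bsub>V\<^esub> x = x" by simp
lemma vsp_r0: "x \<in> carrier V \<Longrightarrow> x \<oplus>\<^bsub>V\<^esub> \<zero>\<^bsub>V\<^esub> = x" by simp
lemma vsp_mult: "x \<in> carrier V \<Longrightarrow> (a * b) \<odot>\<^bsub>V\<^esub> x = a \<odot>\<^bsub>V\<^esub> (b \<odot>\<^bsub>V\<^esub> x)"
  using V.smult_assoc1[of a b x] by (simp add: class_ring_simps)
lemma vsp_one: "x \<in> carrier V \<Longrightarrow> 1 \<odot>\<^bsub>V\<^esub> x = x"
  using V.smult_one[of x] by (simp add: class_ring_simps)
lemma vsp_distl: "x \<in> carrier V \<Longrightarrow> (a + b) \<odot>\<^bsub>V\<^esub> x = a \<odot>\<^bsub>V\<^esub> x \<oplus>\<^bsub>V\<^esub> b \<odot>\<^bsub>V\<^esub> x"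
  using V.smult_l_distr[of a b x] by (simp add: class_ring_simps)
lemma vsp_distr: "x \<in> carrier V \<Longrightarrow> y \<in> carrier V \<Longrightarrow>
  a \<odot>\<^bsub>V\<^esub> (x \<oplus>\<^bsub>V\<^esub> y) = a \<odot>\<^bsub>V\<^esub> x \<oplus>\<^bsub>V\<^esub> a \<odot>\<^bsub>V\<^esub> y"
  using V.smult_r_distr[of a x y] by (simp add: class_ring_simps)
lemma vsp_smult0: "x \<in> carrier V \<Longrightarrow> 0 \<odot>\<^bsub>V\<^esub> x = \<zero>\<^bsub>V\<^esub>"
  using V.smult_l_null[of x] by (simp add: class_ring_simps)
lemma vsp_smult_zero: "c \<odot>\<^bsub>V\<^esub> \<zero>\<^bsub>V\<^esub> = \<zero>\<^bsub>V\<^esub>"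
  using V.smult_r_null[of c] by (simp add: class_ring_simps)
lemma vsp_neg: "x \<in> carrier V \<Longrightarrow> x \<oplus>\<^bsub>V\<^esub> ((- 1) \<odot>\<^bsub>V\<^esub> x) = \<zero>\<^bsub>V\<^esub>"
  using vsp_distl[of x 1 "-1"] by (simp add: vsp_one vsp_smult0)
lemma vsp_neg': "x \<in> carrier V \<Longrightarrow> ((- 1) \<odot>\<^bsub>V\<^esub> x) \<oplus>\<^bsub>V\<^esub> x = \<zero>\<^bsub>V\<^esub>"
  using vsp_distl[of x "-1" 1] by (simp add: vsp_one vsp_smult0)
lemma vsp_finsum: "(\<And>t. t \<in> A \<Longrightarrow> f t \<in> carrier V) \<Longrightarrow> finsum V f A \<in> carrier V"
  by (rule V.finsum_closed) auto
lemma vsp_finsum_insert: "finite A \<Longrightarrow> t \<notin> A \<Longrightarrow> (\<And>t. t \<in> A \<Longrightarrow> f t \<in> carrier V) \<Longrightarrow> f t \<in> carrier V \<Longrightarrow>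
  finsum V f (insert t A) = f t \<oplus>\<^bsub>V\<^esub> finsum V f A"
  by (rule V.finsum_insert) auto
lemma vsp_finsum_empty: "finsum V f {} = \<zero>\<^bsub>V\<^esub>" by simp
lemma vsp_finsum_cong: "A = B \<Longrightarrow> (\<And>t. t \<in> B \<Longrightarrow> g t \<in> carrier V) \<Longrightarrow> (\<And>t. t \<in> B \<Longrightarrow> f t = g t) \<Longrightarrow> finsum V f A = finsum V g B"
  by (rule V.finsum_cong') auto
lemma vsp_finsum_add: "(\<And>t. t \<in> A \<Longrightarrow> f t \<in> carrier V) \<Longrightarrow> (\<And>t. t \<in> A \<Longrightarrow> g t \<in> carrier V) \<Longrightarrow>
  finsum V (\<lambda>t. f t \<oplus>\<^bsub>V\<^esub> g t) A = finsum V f A \<oplus>\<^bsub>V\<^esub> finsum V g A"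
  by (rule V.finsum_addf) auto
lemma vsp_finsum_smult: "(\<And>t. t \<in> A \<Longrightarrow> f t \<in> carrier V) \<Longrightarrow>
  finsum V (\<lambda>t. c \<odot>\<^bsub>V\<^esub> f t) A = c \<odot>\<^bsub>V\<^esub> finsum V f A"
proof (induction A rule: infinite_finite_induct)
  case (infinite A)
  then show ?case by (simp add: vsp_smult_zero)
next
  case empty
  then show ?case by (simp add: vsp_smult_zero)
next
  case (insert t A)
  then show ?case by (simp add: vsp_finsum_insert vsp_finsum vsp_smult vsp_distr)
qed
lemma vsp_finsum_zero: "(\<And>t. t \<in> A \<Longrightarrow> f t = \<zero>\<^bsub>V\<^esub>) \<Longrightarrow> finsum V f A = \<zero>\<^bsub>V\<^esub>"
  using V.add.finprod_one_eqI[of A f] by simp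

lemma vsp_cancel: "x \<in> carrier V \<Longrightarrow> y \<in> carrier V \<Longrightarrow> z \<in> carrier V \<Longrightarrow> x \<oplus>\<^bsub>V\<^esub> y = x \<oplus>\<^bsub>V\<^esub> z \<longleftrightarrow> y = z"
  by simp

lemma sub_iff:
  "sub V U \<longleftrightarrow> U \<subseteq> carrier V \<and> \<zero>\<^bsub>V\<^esub> \<in> U \<and> (\<forall>x\<in>U. \<forall>y\<in>U. x \<oplus>\<^bsub>V\<^esub> y \<in> U) \<and> (\<forall>c. \<forall>x\<in>U. c \<odot>\<^bsub>V\<^esub> x \<in> U)"
  using V V.module_axioms by (auto simp: subspace_def submodule_def class_ring_simps)

lemma sub_vsp: "sub V U \<Longrightarrow> vsp (V\<lparr>carrier := U\<rparr>)"
  by (rule V.subspace_is_vs)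

lemma sub_finsum:
  "sub V U \<Longrightarrow> (\<And>t. t \<in> A \<Longrightarrow> f t \<in> U) \<Longrightarrow> finsum V f A \<in> U"
proof (induction A rule: infinite_finite_induct)
  case (insert t A)
  then have "f ` insert t A \<subseteq> carrier V" by (auto simp: sub_iff)
  with insert show ?case by (simp add: vsp_finsum_insert sub_iff image_subset_iff)
qed (auto simp: sub_iff)

text \<open>A finite sum depends on the carrier, because \<^const>\<open>finsum\<close> is only specified for functions into
  it. This is what makes \<^const>\<open>sink_map\<close> of a subrepresentation agree with that of the whole.\<close>

lemma sub_finsum_eq:
  assumes U: "sub V U" and f: "\<And>t. t \<in> A \<Longrightarrow> f t \<in> U"
  shows "finsum (V\<lparr>carrier := U\<rparr>) f A = finsum V f A"
  using f
proof (induction A rule: infinite_finite_induct)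
  case (infinite A)
  then show ?case by (simp add: finsum_def finprod_def)
next
  case empty
  interpret U: vectorspace class_ring "V\<lparr>carrier := U\<rparr>" by (rule sub_vsp[OF U])
  show ?case using U.finsum_empty by simp
next
  case (insert t A)
  interpret U: vectorspace class_ring "V\<lparr>carrier := U\<rparr>" by (rule sub_vsp[OF U])
  have "f ` insert t A \<subseteq> carrier V" using U insert.prems by (auto simp: sub_iff)
  moreover have "finsum (V\<lparr>carrier := U\<rparr>) f (insert t A) = f t \<oplus>\<^bsub>V\<^esub> finsum (V\<lparr>carrier := U\<rparr>) f A"
    using U.finsum_insert[of A t f] insert by auto
  ultimately show ?case using insert by (simp add: vsp_finsum_insert image_subset_iff)
qed

lemma sub_carrier: "sub V (carrier V)" by (simp add: sub_iff vsp_zero vsp_add vsp_smult)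

end

lemma subD:
  assumes "sub V U"
  shows "vsp V" "U \<subseteq> carrier V" "\<zero>\<^bsub>V\<^esub> \<in> U" "\<And>x y. x \<in> U \<Longrightarrow> y \<in> U \<Longrightarrow> x \<oplus>\<^bsub>V\<^esub> y \<in> U"
    "\<And>c x. x \<in> U \<Longrightarrow> c \<odot>\<^bsub>V\<^esub> x \<in> U"
proof -
  show V: "vsp V" using assms by (simp add: subspace_def)
  show "U \<subseteq> carrier V" "\<zero>\<^bsub>V\<^esub> \<in> U" "\<And>x y. x \<in> U \<Longrightarrow> y \<in> U \<Longrightarrow> x \<oplus>\<^bsub>V\<^esub> y \<in> U"
    "\<And>c x. x \<in> U \<Longrightarrow> c \<odot>\<^bsub>V\<^esub> x \<in> U"
    using assms by (simp_all add: sub_iff[OF V])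
qed

lemmas vsp_simps = vsp_zero vsp_add vsp_smult vsp_l0 vsp_r0 vsp_one vsp_smult0 vsp_smult_zero

lemma lin_iff:
  "lin V W f \<longleftrightarrow> vsp V \<and> vsp W \<and> (\<forall>x\<in>carrier V. f x \<in> carrier W) \<and>
     (\<forall>x\<in>carrier V. \<forall>y\<in>carrier V. f (x \<oplus>\<^bsub>V\<^esub> y) = f x \<oplus>\<^bsub>W\<^esub> f y) \<and>
     (\<forall>c. \<forall>x\<in>carrier V. f (c \<odot>\<^bsub>V\<^esub> x) = c \<odot>\<^bsub>W\<^esub> f x)"
  by (auto simp: linear_map_def mod_hom_def mod_hom_axioms_def module_hom_def class_ring_simps vectorspace_def)

lemma linI:
  assumes "vsp V" "vsp W" "\<And>x. x \<in> carrier V \<Longrightarrow> f x \<in> carrier W"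
    "\<And>x y. x \<in> carrier V \<Longrightarrow> y \<in> carrier V \<Longrightarrow> f (x \<oplus>\<^bsub>V\<^esub> y) = f x \<oplus>\<^bsub>W\<^esub> f y"
    "\<And>c x. x \<in> carrier V \<Longrightarrow> f (c \<odot>\<^bsub>V\<^esub> x) = c \<odot>\<^bsub>W\<^esub> f x"
  shows "lin V W f"
  using assms by (simp add: lin_iff)

lemma linD:
  assumes "lin V W f"
  shows "vsp V" "vsp W" "\<And>x. x \<in> carrier V \<Longrightarrow> f x \<in> carrier W"
    "\<And>x y. x \<in> carrier V \<Longrightarrow> y \<in> carrier V \<Longrightarrow> f (x \<oplus>\<^bsub>V\<^esub> y) = f x \<oplus>\<^bsub>W\<^esub> f y"
    "\<And>c x. x \<in> carrier V \<Longrightarrow> f (c \<odot>\<^bsub>V\<^esub> x) = c \<odot>\<^bsub>W\<^esub> f x"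
  using assms by (simp_all add: lin_iff)

lemma lin_zero:
  assumes "lin V W f" shows "f \<zero>\<^bsub>V\<^esub> = \<zero>\<^bsub>W\<^esub>"
  using linD(5)[OF assms, of "\<zero>\<^bsub>V\<^esub>" 0] linD(1-3)[OF assms] by (simp add: vsp_simps)

lemma lin_finsum:
  assumes f: "lin V W f" and g: "\<And>t. t \<in> A \<Longrightarrow> g t \<in> carrier V"
  shows "f (finsum V g A) = finsum W (\<lambda>t. f (g t)) A"
  using g
proof (induction A rule: infinite_finite_induct)
  case (infinite A)
  then show ?case by (simp add: finsum_def finprod_def lin_zero[OF f])
next
  case empty
  then show ?case using linD[OF f] by (simp add: vsp_finsum_empty lin_zero[OF f])
next
  case (insert t A)
  then show ?case using linD[OF f] by (simp add: vsp_finsum_insert vsp_finsum)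
qed

lemma lin_sub_cong:
  "lin V W f \<Longrightarrow> (\<And>x. x \<in> carrier V \<Longrightarrow> g x = f x) \<Longrightarrow> lin V W g"
  by (auto simp: lin_iff vsp_add vsp_smult)

lemma lin_comp: "lin V W f \<Longrightarrow> lin W Z g \<Longrightarrow> lin V Z (\<lambda>x. g (f x))"
  by (simp add: lin_iff)

lemma lin_image_sub:
  assumes f: "lin V W f" and U: "sub V U"
  shows "sub W (f ` U)"
proof -
  note [simp] = linD(1-3)[OF f]
  have "x \<in> U \<Longrightarrow> x \<in> carrier V" for x using subD(2)[OF U] by auto
  note f' = linD(4,5)[OF f, symmetric]
  have "\<zero>\<^bsub>W\<^esub> \<in> f ` U" using lin_zero[OF f] subD(3)[OF U] by (metis imageI)
  moreover have "f x \<oplus>\<^bsub>W\<^esub> f y \<in> f ` U" if "x \<in> U" "y \<in> U" for x y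
    using f'(1)[of x y] subD(2,4)[OF U] that by auto
  moreover have "c \<odot>\<^bsub>W\<^esub> f x \<in> f ` U" if "x \<in> U" for c x
    using f'(2)[of x c] subD(2,5)[OF U] that by auto
  ultimately show ?thesis using subD(2)[OF U] by (auto simp: sub_iff[OF linD(2)[OF f]])
qed

lemma lin_kernel_sub:
  assumes f: "lin V W f" and U: "sub V U"
  shows "sub V {x \<in> U. f x = \<zero>\<^bsub>W\<^esub>}"
  using subD[OF U] linD[OF f] lin_zero[OF f]
  by (auto simp: sub_iff subset_iff vsp_simps)

subsection \<open>Linear forms\<close>

lemma form_iff:
  "\<xi> \<in> forms V \<longleftrightarrow> \<xi> \<in> extensional (carrier V) \<and>
     (\<forall>x\<in>carrier V. \<forall>y\<in>carrier V. \<xi> (x \<oplus>\<^bsub>V\<^esub> y) = \<xi> x + \<xi> y) \<and>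
     (\<forall>c. \<forall>x\<in>carrier V. \<xi> (c \<odot>\<^bsub>V\<^esub> x) = c * \<xi> x)"
  by (auto simp: dual_space_def module_hom_def ground_space_def class_ring_simps)

lemma formD:
  assumes "\<xi> \<in> forms V"
  shows "\<xi> \<in> extensional (carrier V)" 
    "\<And>x y. x \<in> carrier V \<Longrightarrow> y \<in> carrier V \<Longrightarrow> \<xi> (x \<oplus>\<^bsub>V\<^esub> y) = \<xi> x + \<xi> y"
    "\<And>c x. x \<in> carrier V \<Longrightarrow> \<xi> (c \<odot>\<^bsub>V\<^esub> x) = c * \<xi> x"
  using assms by (simp_all add: form_iff)

lemma form_zero:
  assumes "\<xi> \<in> forms V" "vsp V" shows "\<xi> \<zero>\<^bsub>V\<^esub> = 0"
  using formD(3)[OF assms(1), of "\<zero>\<^bsub>V\<^esub>" 0] assms(2) by (simp add: vsp_simps)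

lemma form_finsum:
  assumes \<xi>: "\<xi> \<in> forms V" and V: "vsp V" and "finite A" and g: "\<And>t. t \<in> A \<Longrightarrow> g t \<in> carrier V"
  shows "\<xi> (finsum V g A) = (\<Sum>t\<in>A. \<xi> (g t))"
  using \<open>finite A\<close> g
  by (induction A rule: finite_induct)
    (simp_all add: vsp_finsum_empty[OF V] vsp_finsum_insert[OF V] form_zero[OF \<xi> V] formD[OF \<xi>] vsp_finsum[OF V])

lemma form_comp:
  assumes f: "lin V W f" and \<xi>: "\<xi> \<in> forms W"
  shows "(\<lambda>x\<in>carrier V. \<xi> (f x)) \<in> forms V"
  using linD[OF f] formD[OF \<xi>] by (auto simp: form_iff vsp_simps)

lemma form_add: "vsp V \<Longrightarrow> \<xi> \<in> forms V \<Longrightarrow> \<eta> \<in> forms V \<Longrightarrow> (\<lambda>x\<in>carrier V. \<xi> x + \<eta> x) \<in> forms V"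
  by (auto simp: form_iff vsp_simps algebra_simps)

lemma form_smult: "vsp V \<Longrightarrow> \<xi> \<in> forms V \<Longrightarrow> (\<lambda>x\<in>carrier V. c * \<xi> x) \<in> forms V"
  by (auto simp: form_iff vsp_simps algebra_simps)

lemma dual_space_simps [simp]:
  "\<zero>\<^bsub>dual_space V\<^esub> = (\<lambda>x\<in>carrier V. 0)"
  "\<xi> \<oplus>\<^bsub>dual_space V\<^esub> \<eta> = (\<lambda>x\<in>carrier V. \<xi> x + \<eta> x)"
  "c \<odot>\<^bsub>dual_space V\<^esub> \<xi> = (\<lambda>x\<in>carrier V. c * \<xi> x)"
  by (simp_all add: dual_space_def)

lemma vsp_dual_space: "vsp V \<Longrightarrow> vsp (dual_space V)"
proof (rule vspI, goal_cases)
  case 1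
  then show ?case by (auto simp: form_iff vsp_simps)
next
  case (6 \<xi>)
  then show ?case using formD(1)[of \<xi> V] by (auto simp: extensional_def fun_eq_iff)
next
  case (9 \<xi>)
  then show ?case using formD(1)[of \<xi> V] by (auto simp: extensional_def fun_eq_iff)
qed (auto simp: form_add form_smult fun_eq_iff algebra_simps vsp_simps)

lemma vsp_ground_space: "vsp ground_space"
  by (rule vspI) (auto simp: ground_space_def algebra_simps)

lemma dual_finsum_apply:
  assumes V: "vsp V" and "finite A" and g: "\<And>t. t \<in> A \<Longrightarrow> g t \<in> forms V" and v: "v \<in> carrier V"
  shows "finsum (dual_space V) g A v = (\<Sum>t\<in>A. g t v)"
  using \<open>finite A\<close> g
proof (induction A rule: finite_induct)
  case empty
  then show ?case using v by (simp add: vsp_finsum_empty[OF vsp_dual_space[OF V]])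
next
  case (insert t A)
  have "finsum (dual_space V) g (insert t A) = g t \<oplus>\<^bsub>dual_space V\<^esub> finsum (dual_space V) g A"
    using insert.prems by (intro vsp_finsum_insert[OF vsp_dual_space[OF V] insert.hyps]) auto
  with insert v show ?case by simp
qed

section \<open>Frames\<close>

text \<open>Bases are lists here: Pluecker coordinates depend on the order of the vectors, and with
  coefficients indexed by position a combination makes sense before the vectors are known to be
  distinct.\<close>

definition lcomb :: "('k::field, 'v) module \<Rightarrow> (nat \<Rightarrow> 'k) \<Rightarrow> 'v list \<Rightarrow> 'v" where
  "lcomb V c ws = (\<Oplus>\<^bsub>V\<^esub>t\<in>{..<length ws}. c t \<odot>\<^bsub>V\<^esub> ws ! t)"

definition indep :: "('k::field, 'v) module \<Rightarrow> 'v list \<Rightarrow> bool" where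
  "indep V ws \<longleftrightarrow> set ws \<subseteq> carrier V \<and> (\<forall>c. lcomb V c ws = \<zero>\<^bsub>V\<^esub> \<longrightarrow> (\<forall>t<length ws. c t = 0))"

definition frame :: "('k::field, 'v) module \<Rightarrow> 'v set \<Rightarrow> 'v list \<Rightarrow> bool" where
  "frame V U ws \<longleftrightarrow> indep V ws \<and> set ws \<subseteq> U \<and> (\<forall>u\<in>U. \<exists>c. u = lcomb V c ws)"

lemma nth_subset: "set ws \<subseteq> U \<Longrightarrow> t < length ws \<Longrightarrow> ws ! t \<in> U"
  by auto

lemma lcomb_closed: "vsp V \<Longrightarrow> set ws \<subseteq> carrier V \<Longrightarrow> lcomb V c ws \<in> carrier V"
  unfolding lcomb_def by (rule vsp_finsum) (auto intro!: vsp_smult)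

lemma lcomb_in_sub: "sub V U \<Longrightarrow> set ws \<subseteq> U \<Longrightarrow> lcomb V c ws \<in> U"
  unfolding lcomb_def by (rule sub_finsum) (auto intro: subD nth_subset)

lemma lcomb_cong: "vsp V \<Longrightarrow> set ws \<subseteq> carrier V \<Longrightarrow> (\<And>t. t < length ws \<Longrightarrow> c t = c' t) \<Longrightarrow>
  lcomb V c ws = lcomb V c' ws"
  unfolding lcomb_def by (rule vsp_finsum_cong) (auto intro!: vsp_smult)

lemma lcomb_add: "vsp V \<Longrightarrow> set ws \<subseteq> carrier V \<Longrightarrow>
  lcomb V (\<lambda>t. c t + c' t) ws = lcomb V c ws \<oplus>\<^bsub>V\<^esub> lcomb V c' ws"
  unfolding lcomb_def
  by (subst vsp_finsum_add[symmetric]) (auto intro!: vsp_smult vsp_finsum_cong vsp_add vsp_distl nth_subset)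

lemma lcomb_smult: "vsp V \<Longrightarrow> set ws \<subseteq> carrier V \<Longrightarrow>
  lcomb V (\<lambda>t. a * c t) ws = a \<odot>\<^bsub>V\<^esub> lcomb V c ws"
  unfolding lcomb_def
  by (subst vsp_finsum_smult[symmetric]) (auto intro!: vsp_smult vsp_finsum_cong vsp_mult nth_subset)

lemma lcomb_diff_zero:
  assumes "vsp V" "set ws \<subseteq> carrier V" "lcomb V c ws = lcomb V c' ws"
  shows "lcomb V (\<lambda>t. c t + (- 1) * c' t) ws = \<zero>\<^bsub>V\<^esub>"
  using assms by (simp only: lcomb_add lcomb_smult vsp_neg lcomb_closed)

lemma lcomb_delta:
  assumes V: "vsp V" and ws: "set ws \<subseteq> carrier V" and t: "t < length ws"
  shows "lcomb V (\<lambda>s. if s = t then 1 else 0) ws = ws ! t"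
proof -
  have "lcomb V (\<lambda>s. if s = t then 1 else 0) ws
      = (\<Oplus>\<^bsub>V\<^esub>s\<in>insert t ({..<length ws} - {t}). (if s = t then 1 else 0) \<odot>\<^bsub>V\<^esub> ws ! s)"
    unfolding lcomb_def using t by (simp add: insert_absorb)
  also have "\<dots> = ws ! t \<oplus>\<^bsub>V\<^esub> (\<Oplus>\<^bsub>V\<^esub>s\<in>{..<length ws} - {t}. (if s = t then 1 else 0) \<odot>\<^bsub>V\<^esub> ws ! s)"
    using t ws by (subst vsp_finsum_insert[OF V]) (auto simp: vsp_simps[OF V] subset_iff)
  also have "\<dots> = ws ! t \<oplus>\<^bsub>V\<^esub> \<zero>\<^bsub>V\<^esub>"
    using ws by (subst vsp_finsum_zero[OF V]) (auto simp: vsp_simps[OF V] subset_iff)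
  finally show ?thesis using t ws by (simp add: vsp_simps[OF V] subset_iff)
qed

lemma lcomb_Nil: "vsp V \<Longrightarrow> lcomb V c [] = \<zero>\<^bsub>V\<^esub>"
  by (simp add: lcomb_def vsp_finsum_empty)

lemma lcomb_append:
  assumes V: "vsp V" and ws: "set ws \<subseteq> carrier V" "set ws' \<subseteq> carrier V"
  shows "lcomb V c (ws @ ws') = lcomb V c ws \<oplus>\<^bsub>V\<^esub> lcomb V (\<lambda>t. c (t + length ws)) ws'"
  using ws(2)
proof (induction ws' rule: rev_induct)
  case Nil
  then show ?case using ws by (simp add: lcomb_Nil V vsp_simps lcomb_closed)
next
  case (snoc w ws')
  have snoc_eq: "lcomb V c (us @ [u]) = c (length us) \<odot>\<^bsub>V\<^esub> u \<oplus>\<^bsub>V\<^esub> lcomb V c us"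
    if us: "set us \<subseteq> carrier V" and u: "u \<in> carrier V" for c us u
  proof -
    have "lcomb V c (us @ [u]) = (\<Oplus>\<^bsub>V\<^esub>t\<in>insert (length us) {..<length us}. c t \<odot>\<^bsub>V\<^esub> (us @ [u]) ! t)"
      unfolding lcomb_def by (simp add: lessThan_Suc)
    also have "\<dots> = c (length us) \<odot>\<^bsub>V\<^esub> u \<oplus>\<^bsub>V\<^esub> (\<Oplus>\<^bsub>V\<^esub>t\<in>{..<length us}. c t \<odot>\<^bsub>V\<^esub> (us @ [u]) ! t)"
      using us u
      by (subst vsp_finsum_insert[OF V]) (auto simp: vsp_simps[OF V] nth_append subset_iff)
    also have "(\<Oplus>\<^bsub>V\<^esub>t\<in>{..<length us}. c t \<odot>\<^bsub>V\<^esub> (us @ [u]) ! t) = lcomb V c us"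
      unfolding lcomb_def using us by (intro vsp_finsum_cong[OF V]) (auto simp: nth_append V intro!: vsp_smult nth_subset)
    finally show ?thesis .
  qed
  have w: "w \<in> carrier V" "set ws' \<subseteq> carrier V" using snoc.prems by auto
  show ?case
    using snoc.IH w ws(1) snoc_eq[of "ws @ ws'" w c] snoc_eq[of "ws'" w "\<lambda>t. c (t + length ws)"]
    by (simp add: V vsp_simps lcomb_closed vsp_lcomm add.commute)
qed

lemma lin_lcomb:
  assumes f: "lin V W f" and ws: "set ws \<subseteq> carrier V"
  shows "f (lcomb V c ws) = lcomb W c (map f ws)"
proof -
  note V = linD(1)[OF f] and W = linD(2)[OF f]
  have "f (lcomb V c ws) = (\<Oplus>\<^bsub>W\<^esub>t\<in>{..<length ws}. f (c t \<odot>\<^bsub>V\<^esub> ws ! t))"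
    unfolding lcomb_def using ws by (intro lin_finsum[OF f]) (auto simp: vsp_smult[OF V] subset_iff)
  also have "\<dots> = lcomb W c (map f ws)"
    unfolding lcomb_def using ws linD(3,5)[OF f]
    by (intro vsp_finsum_cong[OF W]) (auto intro!: vsp_smult[OF W] simp: subset_iff)
  finally show ?thesis .
qed

lemma form_lcomb:
  assumes "\<xi> \<in> forms V" "vsp V" "set ws \<subseteq> carrier V"
  shows "\<xi> (lcomb V c ws) = (\<Sum>t<length ws. c t * \<xi> (ws ! t))"
proof -
  have w: "\<And>t. t < length ws \<Longrightarrow> ws ! t \<in> carrier V" using assms(3) by (rule nth_subset)
  show ?thesis unfolding lcomb_def
    by (subst form_finsum[OF assms(1,2)]) (auto simp: formD(3)[OF assms(1)] w intro!: vsp_smult[OF assms(2)])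
qed

lemma frameD:
  assumes "frame V U ws"
  shows "set ws \<subseteq> U" "\<And>u. u \<in> U \<Longrightarrow> \<exists>c. u = lcomb V c ws" "set ws \<subseteq> carrier V"
    "\<And>c t. lcomb V c ws = \<zero>\<^bsub>V\<^esub> \<Longrightarrow> t < length ws \<Longrightarrow> c t = 0" "indep V ws"
  using assms by (auto simp: frame_def indep_def)

lemma indep_coord_unique:
  assumes V: "vsp V" and ws: "indep V ws" and "lcomb V c ws = lcomb V c' ws" "t < length ws"
  shows "c t = c' t"
  using assms lcomb_diff_zero[OF V _ assms(3)] unfolding indep_def by fastforce

lemma indep_distinct:
  assumes V: "vsp V" and ws: "indep V ws"
  shows "distinct ws"
  unfolding distinct_conv_nth
proof (intro allI impI notI)
  fix s t assume st: "s < length ws" "t < length ws" "s \<noteq> t" "ws ! s = ws ! t"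
  have c: "set ws \<subseteq> carrier V" using ws by (simp add: indep_def)
  have "lcomb V (\<lambda>r. if r = s then 1 else 0) ws = lcomb V (\<lambda>r. if r = t then 1 else 0) ws"
    using st by (simp add: lcomb_delta[OF V c])
  from indep_coord_unique[OF V ws this st(1)] st(3) show False by simp
qed

lemma indep_snoc:
  assumes V: "vsp V" and ws: "indep V ws" and v: "v \<in> carrier V" and nv: "\<And>c. v \<noteq> lcomb V c ws"
  shows "indep V (ws @ [v])"
proof -
  have wsV: "set ws \<subseteq> carrier V" using ws by (simp add: indep_def)
  { fix c t assume eq: "lcomb V c (ws @ [v]) = \<zero>\<^bsub>V\<^esub>" and t: "t < length (ws @ [v])"
    have 1: "lcomb V (\<lambda>t. c (t + length ws)) [v] = c (length ws) \<odot>\<^bsub>V\<^esub> v"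
      using v lcomb_smult[OF V, of "[v]" "c (length ws)" "\<lambda>t. 1"] lcomb_delta[OF V, of "[v]" 0]
        lcomb_cong[OF V, of "[v]" "\<lambda>s. if s = 0 then 1 else 0" "\<lambda>t. 1"]
        lcomb_cong[OF V, of "[v]" "\<lambda>t. c (t + length ws)" "\<lambda>t. c (length ws) * 1"] by simp
    have sum: "lcomb V c ws \<oplus>\<^bsub>V\<^esub> c (length ws) \<odot>\<^bsub>V\<^esub> v = \<zero>\<^bsub>V\<^esub>"
      using eq v wsV by (simp add: lcomb_append[OF V] 1)
    have c0: "c (length ws) = 0"
    proof (rule ccontr)
      assume n: "c (length ws) \<noteq> 0"
      let ?b = "c (length ws)"
      have "?b \<odot>\<^bsub>V\<^esub> v = (-1) \<odot>\<^bsub>V\<^esub> lcomb V c ws"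
        using sum v wsV vsp_cancel[OF V, of "lcomb V c ws" "?b \<odot>\<^bsub>V\<^esub> v" "(-1) \<odot>\<^bsub>V\<^esub> lcomb V c ws"]
        by (simp add: lcomb_closed V vsp_simps vsp_neg)
      then have "(1 / ?b) \<odot>\<^bsub>V\<^esub> (?b \<odot>\<^bsub>V\<^esub> v) = (1 / ?b) \<odot>\<^bsub>V\<^esub> ((-1) \<odot>\<^bsub>V\<^esub> lcomb V c ws)" by simp
      then have "v = (- 1 / ?b) \<odot>\<^bsub>V\<^esub> lcomb V c ws"
        using n v wsV by (simp add: vsp_mult[OF V, symmetric] vsp_one[OF V] lcomb_closed[OF V])
      then have "v = lcomb V (\<lambda>t. (- 1 / ?b) * c t) ws"
        using lcomb_smult[OF V wsV, of "- 1 / ?b" c] by simp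
      with nv show False by blast
    qed
    then have "lcomb V c ws = \<zero>\<^bsub>V\<^esub>" using sum v wsV by (simp add: V vsp_simps lcomb_closed)
    then have "c t = 0" using ws t c0 by (cases "t = length ws") (auto simp: indep_def) }
  then show ?thesis using v wsV by (auto simp: indep_def)
qed

subsection \<open>Comparison with bases as sets\<close>

lemma lcomb_eq_lincomb:
  assumes V: "vsp V" and ws: "set ws \<subseteq> carrier V" "distinct ws"
  shows "lcomb V (\<lambda>t. c (ws ! t)) ws = module.lincomb V c (set ws)"
proof -
  interpret V: vectorspace class_ring V by (rule V)
  have "set ws = (!) ws ` {..<length ws}" by (auto simp: set_conv_nth)
  moreover have "inj_on ((!) ws) {..<length ws}" using ws(2) by (auto simp: inj_on_def nth_eq_iff_index_eq)
  ultimately show ?thesis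
    unfolding lcomb_def V.lincomb_def
    using ws(1) V.finsum_reindex[of "\<lambda>v. c v \<odot>\<^bsub>V\<^esub> v" "(!) ws" "{..<length ws}"]
    by (simp add: Pi_def vsp_smult[OF V] subset_iff)
qed

lemma lcomb_index:
  assumes "distinct ws"
  obtains b where "\<And>t. t < length ws \<Longrightarrow> b (ws ! t) = (c t :: 'k::field)"
proof -
  have "(\<lambda>v. c (THE s. s < length ws \<and> ws ! s = v)) (ws ! t) = c t" if t: "t < length ws" for t
  proof -
    have "(THE s. s < length ws \<and> ws ! s = ws ! t) = t"
      using t assms by (intro the_equality) (auto simp: nth_eq_iff_index_eq)
    then show ?thesis by simp
  qed
  then show thesis by (rule that)
qed

lemma indep_iff:
  assumes V: "vsp V" and ws: "set ws \<subseteq> carrier V" "distinct ws"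
  shows "indep V ws \<longleftrightarrow> \<not> module.lin_dep class_ring V (set ws)"
proof -
  interpret V: vectorspace class_ring V by (rule V)
  show ?thesis
  proof
    assume i: "indep V ws"
    show "\<not> V.lin_dep (set ws)"
    proof (rule V.finite_lin_indpt2)
      fix a assume "V.lincomb a (set ws) = \<zero>\<^bsub>V\<^esub>"
      then have "lcomb V (\<lambda>t. a (ws ! t)) ws = \<zero>\<^bsub>V\<^esub>" by (simp add: lcomb_eq_lincomb[OF V ws])
      with i have "\<forall>t<length ws. a (ws ! t) = 0" unfolding indep_def by blast
      then show "\<forall>v\<in>set ws. a v = \<zero>\<^bsub>class_ring\<^esub>" by (auto simp: class_ring_simps set_conv_nth)
    qed (use ws in auto)
  next
    assume i: "\<not> V.lin_dep (set ws)"
    have "c t = 0" if c: "lcomb V c ws = \<zero>\<^bsub>V\<^esub>" "t < length ws" for c t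
    proof -
      obtain b where b: "\<And>t. t < length ws \<Longrightarrow> b (ws ! t) = c t" using lcomb_index[OF ws(2), of c] by blast
      have "lcomb V (\<lambda>t. b (ws ! t)) ws = \<zero>\<^bsub>V\<^esub>" using c(1) b lcomb_cong[OF V ws(1)] by metis
      then have "V.lincomb b (set ws) = \<zero>\<^bsub>V\<^esub>" by (simp add: lcomb_eq_lincomb[OF V ws])
      then have "b (ws ! t) = 0"
        using i c(2) V.lin_dep_crit[of "set ws" "set ws" b "ws ! t"] by (force simp: class_ring_simps)
      then show ?thesis using b c(2) by simp
    qed
    then show "indep V ws" using ws by (auto simp: indep_def)
  qed
qed

lemma span_iff_lcomb:
  assumes V: "vsp V" and ws: "set ws \<subseteq> carrier V" "distinct ws"
  shows "v \<in> module.span class_ring V (set ws) \<longleftrightarrow> (\<exists>c. v = lcomb V c ws)"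
proof -
  interpret V: vectorspace class_ring V by (rule V)
  show ?thesis
  proof
    assume "v \<in> V.span (set ws)"
    then obtain a where "v = V.lincomb a (set ws)" using ws by (auto simp: V.finite_span)
    then show "\<exists>c. v = lcomb V c ws" using lcomb_eq_lincomb[OF V ws] by metis
  next
    assume "\<exists>c. v = lcomb V c ws"
    then obtain c where c: "v = lcomb V c ws" ..
    obtain b where b: "\<And>t. t < length ws \<Longrightarrow> b (ws ! t) = c t" using lcomb_index[OF ws(2), of c] by blast
    have "v = lcomb V (\<lambda>t. b (ws ! t)) ws" using c b lcomb_cong[OF V ws(1)] by metis
    then show "v \<in> V.span (set ws)" using ws by (auto simp: V.finite_span lcomb_eq_lincomb[OF V] class_ring_simps)
  qed
qed

lemma lcomb_sub_eq: "sub V U \<Longrightarrow> set ws \<subseteq> U \<Longrightarrow> lcomb (V\<lparr>carrier := U\<rparr>) c ws = lcomb V c ws"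
  unfolding lcomb_def by (subst sub_finsum_eq) (auto intro: subD nth_subset)

lemma frame_sub_iff:
  assumes U: "sub V U" and W: "W \<subseteq> U"
  shows "frame (V\<lparr>carrier := U\<rparr>) W ws \<longleftrightarrow> frame V W ws"
  using subD(2)[OF U] W by (auto simp: frame_def indep_def lcomb_sub_eq[OF U])

text \<open>The bridge from \<^const>\<open>is_frame\<close>, which speaks of bases as sets, to lists.\<close>

lemma basis_iff_frame:
  assumes U: "sub V U"
  shows "distinct ws \<and> vectorspace.basis class_ring (V\<lparr>carrier := U\<rparr>) (set ws) \<longleftrightarrow> frame V U ws"
proof -
  note V' = sub_vsp[OF subD(1)[OF U] U]
  interpret U: vectorspace class_ring "V\<lparr>carrier := U\<rparr>" by (rule V')
  have "frame V U ws \<longleftrightarrow> frame (V\<lparr>carrier := U\<rparr>) U ws" by (simp add: frame_sub_iff[OF U])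
  also have "\<dots> \<longleftrightarrow> distinct ws \<and> set ws \<subseteq> U \<and> \<not> U.lin_dep (set ws) \<and> U \<subseteq> U.span (set ws)"
    unfolding frame_def using indep_iff[OF V', of ws] span_iff_lcomb[OF V', of ws] indep_distinct[OF V', of ws]
    by auto
  also have "\<dots> \<longleftrightarrow> distinct ws \<and> U.basis (set ws)"
    using U.span_is_subset2[of "set ws"] by (auto simp: U.basis_def)
  finally show ?thesis by simp
qed

lemma frame_dim:
  assumes U: "sub V U" and ws: "frame V U ws"
  shows "vdim (V\<lparr>carrier := U\<rparr>) = length ws" "fdim (V\<lparr>carrier := U\<rparr>)"
proof -
  interpret U: vectorspace class_ring "V\<lparr>carrier := U\<rparr>" by (rule sub_vsp[OF subD(1)[OF U] U])
  have b: "distinct ws" "U.basis (set ws)" using basis_iff_frame[OF U] ws by auto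
  show "vdim (V\<lparr>carrier := U\<rparr>) = length ws" using U.dim_basis[OF _ b(2)] b(1) by (simp add: distinct_card)
  show "fdim (V\<lparr>carrier := U\<rparr>)" using b(2) unfolding U.fin_dim_def U.basis_def by blast
qed

lemma indep_length_le:
  assumes V: "vsp V" "fdim V" and ws: "indep V ws"
  shows "length ws \<le> vdim V"
proof -
  interpret V: vectorspace class_ring V by (rule V)
  have "distinct ws" "set ws \<subseteq> carrier V" using indep_distinct[OF V(1) ws] ws by (auto simp: indep_def)
  then show ?thesis using V.li_le_dim(2)[OF V(2), of "set ws"] indep_iff[OF V(1), of ws] ws
    by (auto simp: distinct_card)
qed

text \<open>An independent extension inside \<open>U\<close> of maximal length spans \<open>U\<close>, since a vector outside its span
  could be appended; lengths are bounded by the dimension of \<open>V\<close>.\<close>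

lemma extend_frame:
  assumes V: "vsp V" "fdim V" and U: "sub V U" and ws: "indep V ws" "set ws \<subseteq> U"
  obtains vs where "frame V U (ws @ vs)"
proof -
  let ?P = "\<lambda>vs. indep V (ws @ vs) \<and> set vs \<subseteq> U"
  have "?P []" using ws by simp
  moreover have "length vs \<le> vdim V" if "?P vs" for vs
    using indep_length_le[OF V, of "ws @ vs"] that by simp
  ultimately obtain vs where vs: "?P vs" and max: "\<And>vs'. ?P vs' \<Longrightarrow> length vs' \<le> length vs"
    using ex_has_greatest_nat[of ?P "[]" length "Suc (vdim V)"] by (metis le_imp_less_Suc)
  have "\<exists>c. u = lcomb V c (ws @ vs)" if u: "u \<in> U" for u
  proof (rule ccontr)
    assume "\<nexists>c. u = lcomb V c (ws @ vs)"
    then have "indep V ((ws @ vs) @ [u])" using vs u subD(2)[OF U] by (intro indep_snoc[OF V(1)]) auto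
    then have "?P (vs @ [u])" using vs u by simp
    from max[OF this] show False by simp
  qed
  then have "frame V U (ws @ vs)" using vs ws by (auto simp: frame_def)
  then show thesis by (rule that)
qed

lemma indep_Nil: "indep V []" by (simp add: indep_def)

lemma ex_frame:
  assumes V: "vsp V" "fdim V" and U: "sub V U"
  obtains ws where "frame V U ws"
  using extend_frame[OF V U indep_Nil] by force

lemma frame_length_unique:
  assumes "sub V U" "frame V U ws" "frame V U ws'"
  shows "length ws = length ws'"
  using frame_dim[OF assms(1)] assms by metis

lemma frame_of_length:
  assumes V: "vsp V" "fdim V" and U: "sub V U" and ws: "indep V ws" "set ws \<subseteq> U" "frame V U us" "length us \<le> length ws"
  shows "frame V U ws"
proof -
  obtain vs where vs: "frame V U (ws @ vs)" using extend_frame[OF V U ws(1,2)] .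
  from frame_length_unique[OF U this ws(3)] ws(4) have "length vs = 0" by (simp del: length_0_conv)
  then have "vs = []" by simp
  with vs show ?thesis by simp
qed

subsection \<open>Images and sums\<close>

lemma frame_image:
  assumes f: "lin V W f" and inj: "\<And>x. x \<in> U \<Longrightarrow> f x = \<zero>\<^bsub>W\<^esub> \<Longrightarrow> x = \<zero>\<^bsub>V\<^esub>" and U: "sub V U" and ws: "frame V U ws"
  shows "frame W (f ` U) (map f ws)"
  unfolding frame_def indep_def
proof (intro conjI allI impI ballI)
  show "set (map f ws) \<subseteq> carrier W" using frameD(3)[OF ws] linD(3)[OF f] by (auto simp: subset_iff)
  show "set (map f ws) \<subseteq> f ` U" using frameD(1)[OF ws] by auto
  fix c t assume c: "lcomb W c (map f ws) = \<zero>\<^bsub>W\<^esub>" and t: "t < length (map f ws)"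
  have "lcomb V c ws = \<zero>\<^bsub>V\<^esub>"
    using c lcomb_in_sub[OF U frameD(1)[OF ws]] by (intro inj) (simp_all add: lin_lcomb[OF f frameD(3)[OF ws]])
  then show "c t = 0" using frameD(4)[OF ws] t by simp
next
  fix u assume "u \<in> f ` U"
  then obtain c where "u = f (lcomb V c ws)" using frameD(2)[OF ws] by blast
  then show "\<exists>c. u = lcomb W c (map f ws)" by (auto simp: lin_lcomb[OF f frameD(3)[OF ws]])
qed

lemma frame_direct_sum:
  assumes f: "lin V W f" and S: "sub V S" and T: "sub W T"
    and inj: "\<And>x y. x \<in> S \<Longrightarrow> y \<in> T \<Longrightarrow> f x \<oplus>\<^bsub>W\<^esub> y = \<zero>\<^bsub>W\<^esub> \<Longrightarrow> x = \<zero>\<^bsub>V\<^esub> \<and> y = \<zero>\<^bsub>W\<^esub>"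
    and ss: "frame V S ss" and ts: "frame W T ts"
  shows "frame W {f x \<oplus>\<^bsub>W\<^esub> y | x y. x \<in> S \<and> y \<in> T} (map f ss @ ts)"
proof -
  note V = linD(1)[OF f] and W = linD(2)[OF f]
  have fs: "set (map f ss) \<subseteq> carrier W" using frameD(3)[OF ss] linD(3)[OF f] by (auto simp: subset_iff)
  have split: "lcomb W c (map f ss @ ts) = f (lcomb V c ss) \<oplus>\<^bsub>W\<^esub> lcomb W (\<lambda>t. c (t + length ss)) ts" for c
    by (simp add: lcomb_append[OF W fs frameD(3)[OF ts]] lin_lcomb[OF f frameD(3)[OF ss]])
  have sS: "lcomb V c ss \<in> S" for c by (rule lcomb_in_sub[OF S frameD(1)[OF ss]])
  have tT: "lcomb W c ts \<in> T" for c by (rule lcomb_in_sub[OF T frameD(1)[OF ts]])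
  show ?thesis
    unfolding frame_def indep_def
  proof (intro conjI allI impI ballI)
    show "set (map f ss @ ts) \<subseteq> carrier W" using fs frameD(3)[OF ts] by simp
    have "f x \<in> {f x \<oplus>\<^bsub>W\<^esub> y | x y. x \<in> S \<and> y \<in> T}" if "x \<in> S" for x
    proof -
      have "f x \<in> carrier W" using that subD(2)[OF S] linD(3)[OF f] by blast
      then have "f x = f x \<oplus>\<^bsub>W\<^esub> \<zero>\<^bsub>W\<^esub>" by (simp add: vsp_r0[OF W])
      then show ?thesis using that subD(3)[OF T] by blast
    qed
    moreover have "y \<in> {f x \<oplus>\<^bsub>W\<^esub> y | x y. x \<in> S \<and> y \<in> T}" if "y \<in> T" for y
    proof -
      have "y \<in> carrier W" using that subD(2)[OF T] by blast
      then have "y = f \<zero>\<^bsub>V\<^esub> \<oplus>\<^bsub>W\<^esub> y" by (simp add: vsp_l0[OF W] lin_zero[OF f])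
      then show ?thesis using that subD(3)[OF S] by blast
    qed
    ultimately show "set (map f ss @ ts) \<subseteq> {f x \<oplus>\<^bsub>W\<^esub> y | x y. x \<in> S \<and> y \<in> T}"
      using frameD(1)[OF ss] frameD(1)[OF ts] unfolding set_append set_map image_subset_iff Un_subset_iff by blast
  next
    fix c t assume c: "lcomb W c (map f ss @ ts) = \<zero>\<^bsub>W\<^esub>" and t: "t < length (map f ss @ ts)"
    then have "lcomb V c ss = \<zero>\<^bsub>V\<^esub>" "lcomb W (\<lambda>t. c (t + length ss)) ts = \<zero>\<^bsub>W\<^esub>"
      using inj[OF sS tT] unfolding split by auto
    then have c12: "s < length ss \<Longrightarrow> c s = 0" "s < length ts \<Longrightarrow> c (s + length ss) = 0" for s
      using frameD(4)[OF ss] frameD(4)[OF ts] by auto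
    show "c t = 0" using c12(1)[of t] c12(2)[of "t - length ss"] t by (cases "t < length ss") auto
  next
    fix u assume "u \<in> {f x \<oplus>\<^bsub>W\<^esub> y | x y. x \<in> S \<and> y \<in> T}"
    then obtain c c' where u: "u = f (lcomb V c ss) \<oplus>\<^bsub>W\<^esub> lcomb W c' ts"
      using frameD(2)[OF ss] frameD(2)[OF ts] by blast
    let ?c = "\<lambda>t. if t < length ss then c t else c' (t - length ss)"
    have "lcomb V c ss = lcomb V ?c ss" by (rule lcomb_cong[OF V frameD(3)[OF ss]]) simp
    with u have "u = lcomb W ?c (map f ss @ ts)" unfolding split by simp
    then show "\<exists>c. u = lcomb W c (map f ss @ ts)" by blast
  qed
qed

subsection \<open>Forms with prescribed values\<close>

lemma ex_form_values:
  assumes V: "vsp V" "fdim V" and ws: "indep V ws"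
  obtains \<xi> where "\<xi> \<in> forms V" "\<And>t. t < length ws \<Longrightarrow> \<xi> (ws ! t) = f t"
proof -
  have "set ws \<subseteq> carrier V" using ws by (simp add: indep_def)
  then obtain vs where fr: "frame V (carrier V) (ws @ vs)"
    using extend_frame[OF V sub_carrier[OF V(1)] ws] by blast
  let ?bs = "ws @ vs"
  note bs = frameD[OF fr]
  define crd where "crd v = (SOME c. v = lcomb V c ?bs)" for v
  have crd: "v = lcomb V (crd v) ?bs" if "v \<in> carrier V" for v
    unfolding crd_def using bs(2)[OF that] by (rule someI_ex)
  have uniq: "crd (lcomb V c ?bs) t = c t" if "t < length ?bs" for c t
    using indep_coord_unique[OF V(1) bs(5) crd[symmetric] that] lcomb_closed[OF V(1) bs(3)] by blast
  define \<xi> where "\<xi> = (\<lambda>v\<in>carrier V. \<Sum>t<length ws. f t * crd v t)"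
  have add: "crd (x \<oplus>\<^bsub>V\<^esub> y) t = crd x t + crd y t" if "x \<in> carrier V" "y \<in> carrier V" "t < length ?bs" for x y t
    using uniq[OF that(3), of "\<lambda>t. crd x t + crd y t"] crd[OF that(1)] crd[OF that(2)]
    by (simp add: lcomb_add[OF V(1) bs(3)])
  have sm: "crd (a \<odot>\<^bsub>V\<^esub> x) t = a * crd x t" if "x \<in> carrier V" "t < length ?bs" for x t a
    using uniq[OF that(2), of "\<lambda>t. a * crd x t"] crd[OF that(1)]
    by (simp add: lcomb_smult[OF V(1) bs(3)])
  have "\<xi> \<in> forms V"
    by (auto simp: form_iff \<xi>_def vsp_simps[OF V(1)] add sm algebra_simps sum.distrib sum_distrib_left)
  moreover have "\<xi> (ws ! t) = f t" if t: "t < length ws" for t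
  proof -
    have w: "ws ! t = lcomb V (\<lambda>s. if s = t then 1 else 0) ?bs"
      using lcomb_delta[OF V(1) bs(3), of t] t by (simp add: nth_append)
    have "\<xi> (ws ! t) = (\<Sum>s<length ws. f s * crd (ws ! t) s)"
      using nth_subset[of ws "carrier V" t] t bs(3) by (simp add: \<xi>_def)
    also have "\<dots> = (\<Sum>s<length ws. if s = t then f s else 0)"
      by (rule sum.cong[OF refl], subst w, subst uniq) auto
    finally show ?thesis using t by simp
  qed
  ultimately show thesis by (rule that)
qed

lemma ex_dual_forms:
  assumes V: "vsp V" "fdim V" and ws: "indep V ws"
  obtains \<xi>s where "set \<xi>s \<subseteq> forms V" "length \<xi>s = length ws"
    "\<And>s t. s < length ws \<Longrightarrow> t < length ws \<Longrightarrow> (\<xi>s ! s) (ws ! t) = (if s = t then 1 else 0)"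
proof -
  have "\<exists>\<xi>. \<xi> \<in> forms V \<and> (\<forall>t<length ws. \<xi> (ws ! t) = (if s = t then 1 else 0))" for s
    using ex_form_values[OF V ws, of "\<lambda>t. if s = t then 1 else 0"] by metis
  then obtain \<xi> where \<xi>: "\<And>s. \<xi> s \<in> forms V \<and> (\<forall>t<length ws. \<xi> s (ws ! t) = (if s = t then 1 else 0))" by metis
  show thesis by (rule that[of "map \<xi> [0..<length ws]"]) (use \<xi> in auto)
qed

lemma ex_separating_form:
  assumes V: "vsp V" "fdim V" and U: "sub V U" and v: "v \<in> carrier V" "v \<notin> U"
  obtains \<xi> where "\<xi> \<in> forms V" "\<xi> v = 1" "\<And>u. u \<in> U \<Longrightarrow> \<xi> u = 0"
proof -
  obtain us where us: "frame V U us" using ex_frame[OF V U] .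
  have "indep V (us @ [v])"
    by (rule indep_snoc[OF V(1) frameD(5)[OF us] v(1)])
      (metis lcomb_in_sub[OF U frameD(1)[OF us]] v(2))
  from ex_form_values[OF V this, of "\<lambda>t. if t = length us then 1 else 0"]
  obtain \<xi> where \<xi>: "\<xi> \<in> forms V" "\<And>t. t < length (us @ [v]) \<Longrightarrow> \<xi> ((us @ [v]) ! t) = (if t = length us then 1 else 0)"
    by blast
  have "\<xi> (us ! t) = 0" if "t < length us" for t using \<xi>(2)[of t] that by (simp add: nth_append)
  then have "\<xi> u = 0" if "u \<in> U" for u
    using frameD(2)[OF us that] form_lcomb[OF \<xi>(1) V(1) frameD(3)[OF us]] by auto
  moreover have "\<xi> v = 1" using \<xi>(2)[of "length us"] by simp
  ultimately show thesis using \<xi>(1) that by blast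
qed

lemma lcomb_dual_apply:
  assumes V: "vsp V" and \<beta>: "set \<beta> \<subseteq> forms V" and v: "v \<in> carrier V"
  shows "lcomb (dual_space V) c \<beta> v = (\<Sum>t<length \<beta>. c t * (\<beta> ! t) v)"
proof -
  have "c t \<odot>\<^bsub>dual_space V\<^esub> \<beta> ! t \<in> forms V" if "t \<in> {..<length \<beta>}" for t
    using that by (intro vsp_smult[OF vsp_dual_space[OF V]] nth_subset[OF \<beta>]) simp
  from dual_finsum_apply[OF V finite_lessThan this v] show ?thesis unfolding lcomb_def using v by simp
qed

text \<open>The expansion of a form in the basis \<open>\<beta>\<close> dual to \<open>bs\<close>. Off the carrier both sides are
  \<^const>\<open>undefined\<close>.\<close>

lemma form_expansion:
  assumes V: "vsp V" and bs: "frame V (carrier V) bs"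
    and \<beta>: "set \<beta> \<subseteq> forms V" "length \<beta> = length bs"
      "\<And>s t. s < length bs \<Longrightarrow> t < length bs \<Longrightarrow> (\<beta> ! s) (bs ! t) = (if s = t then 1 else 0)"
    and \<xi>: "\<xi> \<in> forms V"
  shows "\<xi> = lcomb (dual_space V) (\<lambda>t. \<xi> (bs ! t)) \<beta>"
proof
  fix v
  note D = vsp_dual_space[OF V]
  show "\<xi> v = lcomb (dual_space V) (\<lambda>t. \<xi> (bs ! t)) \<beta> v"
  proof (cases "v \<in> carrier V")
    case True
    obtain c where c: "v = lcomb V c bs" using frameD(2)[OF bs True] by blast
    have "(\<Sum>t<length bs. \<xi> (bs ! t) * (\<beta> ! t) v) = (\<Sum>t<length bs. \<xi> (bs ! t) * c t)"
    proof (rule sum.cong[OF refl])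
      fix t assume t: "t \<in> {..<length bs}"
      then have bt: "\<beta> ! t \<in> forms V" using \<beta>(2) nth_subset[OF \<beta>(1)] by simp
      have "(\<beta> ! t) v = (\<Sum>s<length bs. c s * (\<beta> ! t) (bs ! s))"
        unfolding c by (rule form_lcomb[OF bt V frameD(3)[OF bs]])
      also have "\<dots> = (\<Sum>s<length bs. if s = t then c s else 0)" using t \<beta>(3) by (intro sum.cong) auto
      finally show "\<xi> (bs ! t) * (\<beta> ! t) v = \<xi> (bs ! t) * c t" using t by simp
    qed
    then show ?thesis
      using lcomb_dual_apply[OF V \<beta>(1) True] form_lcomb[OF \<xi> V frameD(3)[OF bs], of c] c
      by (simp add: mult.commute \<beta>(2))
  next
    case False
    have "lcomb (dual_space V) (\<lambda>t. \<xi> (bs ! t)) \<beta> \<in> forms V" by (rule lcomb_closed[OF D \<beta>(1)])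
    then show ?thesis using extensional_arb[OF formD(1)[OF \<xi>] False] extensional_arb[OF formD(1)] False by metis
  qed
qed

lemma fdim_dual_space:
  assumes V: "vsp V" "fdim V"
  shows "fdim (dual_space V)"
proof -
  obtain bs where bs: "frame V (carrier V) bs" using ex_frame[OF V sub_carrier[OF V(1)]] .
  obtain \<beta> where \<beta>: "set \<beta> \<subseteq> forms V" "length \<beta> = length bs"
    "\<And>s t. s < length bs \<Longrightarrow> t < length bs \<Longrightarrow> (\<beta> ! s) (bs ! t) = (if s = t then 1 else 0)"
    by (rule ex_dual_forms[OF V frameD(5)[OF bs]]) blast
  note D = vsp_dual_space[OF V(1)]
  have "frame (dual_space V) (forms V) \<beta>"
    unfolding frame_def indep_def
  proof (intro conjI allI impI ballI)
    fix c t assume c: "lcomb (dual_space V) c \<beta> = \<zero>\<^bsub>dual_space V\<^esub>" and t: "t < length \<beta>"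
    have b: "bs ! t \<in> carrier V" using nth_subset[OF frameD(3)[OF bs]] t \<beta>(2) by simp
    have "0 = (\<Sum>s<length bs. c s * (\<beta> ! s) (bs ! t))"
      using lcomb_dual_apply[OF V(1) \<beta>(1) b, of c] c b \<beta>(2) by simp
    also have "\<dots> = (\<Sum>s<length bs. if s = t then c s else 0)" using t \<beta>(2,3) by (intro sum.cong) auto
    finally show "c t = 0" using t \<beta>(2) by simp
  next
    fix \<xi> assume \<xi>: "\<xi> \<in> forms V"
    show "\<exists>c. \<xi> = lcomb (dual_space V) c \<beta>" using form_expansion[OF V(1) bs \<beta> \<xi>] by blast
  qed (use \<beta> in auto)
  from frame_dim(2)[OF sub_carrier[OF D] this] show ?thesis by simp
qed

section \<open>Pluecker coordinates\<close>

definition value_mat :: "('v \<Rightarrow> 'k::field) list \<Rightarrow> 'v list \<Rightarrow> 'k mat" where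
  "value_mat \<xi>s ws = mat (length ws) (length ws) (\<lambda>(s, t). (\<xi>s ! s) (ws ! t))"

lemma pluecker_det: "pluecker_coord \<xi>s ws = det (value_mat \<xi>s ws)"
  by (simp add: pluecker_coord_def value_mat_def)

lemma value_mat_carrier: "value_mat \<xi>s ws \<in> carrier_mat (length ws) (length ws)"
  by (simp add: value_mat_def)

text \<open>The matrix of values on \<open>us\<close> is the one on \<open>ws\<close> times the matrix of coefficients.\<close>

lemma pluecker_change:
  assumes V: "vsp V" and ws: "set ws \<subseteq> carrier V" and us: "length us = length ws"
    "\<And>t. t < length us \<Longrightarrow> us ! t = lcomb V (C t) ws"
    and \<xi>s: "set \<xi>s \<subseteq> forms V" "length \<xi>s = length ws"
  shows "pluecker_coord \<xi>s us = pluecker_coord \<xi>s ws * det (mat (length ws) (length ws) (\<lambda>(r, t). C t r))"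
proof -
  let ?n = "length ws"
  let ?C = "mat ?n ?n (\<lambda>(r, t). C t r)"
  have "value_mat \<xi>s us = value_mat \<xi>s ws * ?C"
  proof (rule eq_matI)
    fix s t assume "s < dim_row (value_mat \<xi>s ws * ?C)" "t < dim_col (value_mat \<xi>s ws * ?C)"
    then have s: "s < ?n" and t: "t < ?n" by (auto simp: value_mat_def)
    have "\<xi>s ! s \<in> forms V" using s \<xi>s by (auto intro: nth_subset)
    then have "(\<xi>s ! s) (us ! t) = (\<Sum>r<?n. C t r * (\<xi>s ! s) (ws ! r))"
      using t us form_lcomb[OF _ V ws] by simp
    then show "value_mat \<xi>s us $$ (s, t) = (value_mat \<xi>s ws * ?C) $$ (s, t)"
      using s t us by (simp add: value_mat_def scalar_prod_def lessThan_atLeast0 mult.commute)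
  qed (use us in \<open>auto simp: value_mat_def\<close>)
  then show ?thesis
    unfolding pluecker_det by (simp add: det_mult[OF value_mat_carrier, of ?C])
qed

lemma det_delta: "det (mat n n (\<lambda>(s, t). if s = t then 1 else (0::'k::field))) = 1"
proof -
  have "mat n n (\<lambda>(s, t). if s = t then 1 else (0::'k)) = 1\<^sub>m n" by (rule eq_matI) auto
  then show ?thesis by simp
qed

lemma ex_pluecker_one:
  assumes V: "vsp V" "fdim V" and ws: "indep V ws"
  obtains \<zeta> where "set \<zeta> \<subseteq> forms V" "length \<zeta> = length ws" "pluecker_coord \<zeta> ws = 1"
proof -
  obtain \<zeta> where \<zeta>: "set \<zeta> \<subseteq> forms V" "length \<zeta> = length ws"
    "\<And>s t. s < length ws \<Longrightarrow> t < length ws \<Longrightarrow> (\<zeta> ! s) (ws ! t) = (if s = t then 1 else 0)"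
    by (rule ex_dual_forms[OF V ws]) blast
  have "value_mat \<zeta> ws = mat (length ws) (length ws) (\<lambda>(s, t). if s = t then 1 else 0)"
    by (rule eq_matI) (auto simp: value_mat_def \<zeta>(3))
  then have "pluecker_coord \<zeta> ws = 1" by (simp add: pluecker_det det_delta)
  with \<zeta> that show thesis by blast
qed

text \<open>The scalar is the determinant of the change of basis. It does not depend on the forms, and it is
  not zero because some tuple of forms has coordinate \<open>1\<close> on \<open>us\<close>.\<close>

lemma pluecker_frames:
  assumes V: "vsp V" "fdim V" and U: "sub V U" and ws: "frame V U ws" and us: "frame V U us"
  obtains D where "D \<noteq> 0"
    "\<And>\<xi>s. set \<xi>s \<subseteq> forms V \<Longrightarrow> length \<xi>s = length ws \<Longrightarrow> pluecker_coord \<xi>s us = D * pluecker_coord \<xi>s ws"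
proof -
  have len: "length us = length ws" by (rule frame_length_unique[OF U us ws])
  have "\<exists>c. us ! t = lcomb V c ws" if "t < length us" for t
    using frameD(2)[OF ws] nth_subset[OF frameD(1)[OF us] that] by blast
  then obtain C where C: "\<And>t. t < length us \<Longrightarrow> us ! t = lcomb V (C t) ws" by metis
  define D where "D = det (mat (length ws) (length ws) (\<lambda>(r, t). C t r))"
  have eq: "pluecker_coord \<xi>s us = D * pluecker_coord \<xi>s ws" if "set \<xi>s \<subseteq> forms V" "length \<xi>s = length ws" for \<xi>s
    using pluecker_change[OF V(1) frameD(3)[OF ws] len C that] by (simp add: D_def mult.commute)
  obtain \<zeta> where "set \<zeta> \<subseteq> forms V" "length \<zeta> = length us" "pluecker_coord \<zeta> us = 1"
    by (rule ex_pluecker_one[OF V frameD(5)[OF us]])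
  then have "D \<noteq> 0" using eq[of \<zeta>] len by auto
  with eq that show thesis by blast
qed

lemma pluecker_nonzero_indep:
  assumes V: "vsp V" and ws: "set ws \<subseteq> carrier V" and \<xi>s: "set \<xi>s \<subseteq> forms V" "length \<xi>s = length ws"
    and nz: "pluecker_coord \<xi>s ws \<noteq> 0"
  shows "indep V ws"
  unfolding indep_def
proof (intro conjI ws allI impI)
  fix c t assume c: "lcomb V c ws = \<zero>\<^bsub>V\<^esub>" and t: "t < length ws"
  let ?n = "length ws" and ?A = "value_mat \<xi>s ws"
  have "?A *\<^sub>v vec ?n c = 0\<^sub>v ?n"
  proof (rule eq_vecI)
    fix s assume "s < dim_vec (0\<^sub>v ?n :: 'a vec)"
    then have s: "s < ?n" by simp
    then have f: "\<xi>s ! s \<in> forms V" using \<xi>s by (auto intro: nth_subset)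
    have "(\<Sum>r<?n. c r * (\<xi>s ! s) (ws ! r)) = 0"
      using form_lcomb[OF f V ws, of c] c form_zero[OF f V] by simp
    then show "(?A *\<^sub>v vec ?n c) $ s = 0\<^sub>v ?n $ s"
      using s by (simp add: value_mat_def scalar_prod_def lessThan_atLeast0 mult.commute)
  qed (simp add: value_mat_def)
  then have "vec ?n c = 0\<^sub>v ?n"
    using det_0_iff_vec_prod_zero_field[OF value_mat_carrier, of \<xi>s ws] nz
    unfolding pluecker_det by (metis vec_carrier)
  then show "c t = 0" using t by (metis index_vec index_zero_vec(1))
qed

lemma pluecker_map:
  assumes f: "lin V W f" and ws: "set ws \<subseteq> carrier V" and "length \<xi>s = length ws"
  shows "pluecker_coord \<xi>s (map f ws) = pluecker_coord (map (\<lambda>\<xi>. \<lambda>x\<in>carrier V. \<xi> (f x)) \<xi>s) ws"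
proof -
  have "value_mat \<xi>s (map f ws) = value_mat (map (\<lambda>\<xi>. \<lambda>x\<in>carrier V. \<xi> (f x)) \<xi>s) ws"
    by (rule eq_matI) (use assms nth_subset[OF ws] in \<open>auto simp: value_mat_def\<close>)
  then show ?thesis by (simp add: pluecker_det)
qed

subsection \<open>Short exact sequences\<close>

lemma exact_frame:
  assumes f: "lin V Z f" and W: "sub V W"
    and ks: "frame V {x \<in> W. f x = \<zero>\<^bsub>Z\<^esub>} ks" and rs: "frame Z (f ` W) (map f ls)" and ls: "set ls \<subseteq> W"
  shows "frame V W (ks @ ls)"
proof -
  note V = linD(1)[OF f] and Z = linD(2)[OF f]
  have WV: "W \<subseteq> carrier V" by (rule subD(2)[OF W])
  have lsV: "set ls \<subseteq> carrier V" using ls WV by blast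
  note ksV = frameD(3)[OF ks]
  have fk: "f (lcomb V c ks) = \<zero>\<^bsub>Z\<^esub>" for c
    using lcomb_in_sub[OF lin_kernel_sub[OF f W] frameD(1)[OF ks]] by auto
  have split: "lcomb V c (ks @ ls) = lcomb V c ks \<oplus>\<^bsub>V\<^esub> lcomb V (\<lambda>t. c (t + length ks)) ls" for c
    by (rule lcomb_append[OF V ksV lsV])
  have f_split: "f (lcomb V c (ks @ ls)) = lcomb Z (\<lambda>t. c (t + length ks)) (map f ls)" for c
    using linD(3)[OF f lcomb_closed[OF V lsV]]
    by (simp add: split linD(4)[OF f] lcomb_closed V ksV lsV fk vsp_l0[OF Z] flip: lin_lcomb[OF f lsV])
  show ?thesis
    unfolding frame_def indep_def
  proof (intro conjI allI impI ballI)
    show "set (ks @ ls) \<subseteq> carrier V" "set (ks @ ls) \<subseteq> W" using ksV lsV ls frameD(1)[OF ks] by auto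
  next
    fix c t assume 0: "lcomb V c (ks @ ls) = \<zero>\<^bsub>V\<^esub>" and t: "t < length (ks @ ls)"
    have "lcomb Z (\<lambda>t. c (t + length ks)) (map f ls) = \<zero>\<^bsub>Z\<^esub>" using f_split[of c] 0 lin_zero[OF f] by simp
    then have c2: "c (s + length ks) = 0" if "s < length ls" for s using frameD(4)[OF rs] that by simp
    then have "lcomb V (\<lambda>t. c (t + length ks)) ls = lcomb V (\<lambda>t. 0 * 1) ls" by (intro lcomb_cong[OF V lsV]) auto
    then have "lcomb V (\<lambda>t. c (t + length ks)) ls = \<zero>\<^bsub>V\<^esub>"
      by (simp only: lcomb_smult[OF V lsV] vsp_smult0[OF V lcomb_closed[OF V lsV]])
    then have "lcomb V c ks = \<zero>\<^bsub>V\<^esub>" using split[of c] 0 by (simp add: vsp_r0 V lcomb_closed ksV)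
    then have c1: "c s = 0" if "s < length ks" for s using frameD(4)[OF ks] that by blast
    show "c t = 0" using c1[of t] c2[of "t - length ks"] t by (cases "t < length ks") auto
  next
    fix u assume u: "u \<in> W"
    obtain c where c: "f u = lcomb Z c (map f ls)" using frameD(2)[OF rs] u by blast
    define l where "l = lcomb V c ls"
    have l: "l \<in> W" "l \<in> carrier V" using lcomb_in_sub[OF W ls] WV by (auto simp: l_def)
    have fl: "f l = f u" using c by (simp add: l_def lin_lcomb[OF f lsV])
    define x where "x = u \<oplus>\<^bsub>V\<^esub> (- 1) \<odot>\<^bsub>V\<^esub> l"
    have uV: "u \<in> carrier V" using u WV by blast
    have "f x = f u \<oplus>\<^bsub>Z\<^esub> (- 1) \<odot>\<^bsub>Z\<^esub> f u"
      using l uV fl by (simp add: x_def linD[OF f] vsp_smult V)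
    then have "x \<in> {x \<in> W. f x = \<zero>\<^bsub>Z\<^esub>}"
      using u l subD(4,5)[OF W] linD(3)[OF f uV] by (simp add: x_def vsp_neg[OF Z])
    then obtain c' where c': "x = lcomb V c' ks" using frameD(2)[OF ks] by blast
    have "u = x \<oplus>\<^bsub>V\<^esub> l" using l uV by (simp add: x_def vsp_assoc V vsp_neg' vsp_simps)
    also have "\<dots> = lcomb V (\<lambda>t. if t < length ks then c' t else c (t - length ks)) (ks @ ls)"
      unfolding split c' l_def by (intro arg_cong2[where f="add V"] lcomb_cong[OF V] ksV lsV) auto
    finally show "\<exists>c. u = lcomb V c (ks @ ls)" by blast
  qed
qed

lemma frame_lift:
  assumes "set rs \<subseteq> f ` W"
  obtains ls where "set ls \<subseteq> W" "map f ls = rs"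
  using assms
proof -
  have "\<exists>l. l \<in> W \<and> f l = r" if "r \<in> set rs" for r using assms that by auto
  then obtain l where "\<And>r. r \<in> set rs \<Longrightarrow> l r \<in> W \<and> f (l r) = r" by metis
  then show thesis by (intro that[of "map l rs"]) (auto simp: map_idI)
qed

text \<open>The pulled back forms vanish on \<open>ks\<close>, so the matrix of values is block triangular.\<close>

lemma pluecker_block:
  assumes f: "lin V Z f" and ks: "set ks \<subseteq> carrier V" "\<And>x. x \<in> set ks \<Longrightarrow> f x = \<zero>\<^bsub>Z\<^esub>"
    and ls: "set ls \<subseteq> carrier V" and \<xi>s: "length \<xi>s = length ks"
    and \<eta>s: "length \<eta>s = length ls" "set \<eta>s \<subseteq> forms Z"
  shows "pluecker_coord (\<xi>s @ map (\<lambda>\<eta>. \<lambda>x\<in>carrier V. \<eta> (f x)) \<eta>s) (ks @ ls)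
    = pluecker_coord \<xi>s ks * pluecker_coord \<eta>s (map f ls)"
proof -
  let ?n = "length ks" and ?m = "length ls"
  let ?B = "mat ?n ?m (\<lambda>(s, t). (\<xi>s ! s) (ls ! t))"
  have "value_mat (\<xi>s @ map (\<lambda>\<eta>. \<lambda>x\<in>carrier V. \<eta> (f x)) \<eta>s) (ks @ ls)
    = four_block_mat (value_mat \<xi>s ks) ?B (0\<^sub>m ?m ?n) (value_mat \<eta>s (map f ls))"
  proof (rule eq_matI, goal_cases)
    case (1 s t)
    then have st: "s < ?n + ?m" "t < ?n + ?m" by (auto simp: value_mat_def)
    have z: "(\<eta>s ! (s - ?n)) \<zero>\<^bsub>Z\<^esub> = 0" if "\<not> s < ?n"
      using that st \<eta>s nth_subset[OF \<eta>s(2), of "s - ?n"] by (intro form_zero[OF _ linD(2)[OF f]]) auto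
    show ?case
      using st z \<xi>s \<eta>s ks nth_subset[OF ks(1), of t] nth_subset[OF ls, of "t - ?n"]
      by (auto simp: value_mat_def nth_append)
  qed (auto simp: value_mat_def)
  then show ?thesis
    unfolding pluecker_det
    using det_four_block_mat_lower_left_zero[OF value_mat_carrier, of ?B ks ?m "0\<^sub>m ?m ?n" "value_mat \<eta>s (map f ls)" \<xi>s]
    by (simp add: value_mat_def)
qed

lemma exact_length:
  assumes f: "lin V Z f" and fV: "fdim V" and W: "sub V W" and ws: "frame V W ws"
    and ks: "frame V {x \<in> W. f x = \<zero>\<^bsub>Z\<^esub>} ks" and rs: "frame Z (f ` W) rs"
  shows "length ws = length ks + length rs"
proof -
  obtain ls where ls: "set ls \<subseteq> W" "map f ls = rs" by (rule frame_lift[OF frameD(1)[OF rs]])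
  have "frame V W (ks @ ls)" by (rule exact_frame[OF f W ks _ ls(1)]) (simp add: ls rs)
  from frame_length_unique[OF W ws this] show ?thesis using ls(2) by auto
qed

text \<open>The isomorphism of top exterior powers \<open>\<Lambda>W = \<Lambda>(ker) \<otimes> \<Lambda>(im)\<close> for the restriction of \<open>f\<close> to \<open>W\<close>, in
  coordinates. A basis of the kernel followed by lifts of a basis of the image is a basis of \<open>W\<close> that
  makes the identity hold with factor \<open>1\<close>; the given basis \<open>ws\<close> differs from it by a determinant.\<close>

lemma pluecker_exact:
  assumes f: "lin V Z f" and fV: "fdim V" and W: "sub V W" and ws: "frame V W ws"
    and ks: "frame V {x \<in> W. f x = \<zero>\<^bsub>Z\<^esub>} ks" and rs: "frame Z (f ` W) rs"
  shows "\<exists>D. D \<noteq> 0 \<and> length ws = length ks + length rs \<and>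
    (\<forall>\<xi>s \<eta>s. set \<xi>s \<subseteq> forms V \<longrightarrow> length \<xi>s = length ks \<longrightarrow> set \<eta>s \<subseteq> forms Z \<longrightarrow> length \<eta>s = length rs \<longrightarrow>
       pluecker_coord \<xi>s ks * pluecker_coord \<eta>s rs
         = D * pluecker_coord (\<xi>s @ map (\<lambda>\<eta>. \<lambda>x\<in>carrier V. \<eta> (f x)) \<eta>s) ws)"
proof -
  note V = linD(1)[OF f]
  obtain ls where ls: "set ls \<subseteq> W" "map f ls = rs" by (rule frame_lift[OF frameD(1)[OF rs]])
  have lsV: "set ls \<subseteq> carrier V" using ls subD(2)[OF W] by blast
  have fr: "frame V W (ks @ ls)" by (rule exact_frame[OF f W ks _ ls(1)]) (simp add: ls rs)
  have len: "length ls = length rs" using ls(2) by auto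
  obtain D where D: "D \<noteq> 0" "\<And>\<xi>s. set \<xi>s \<subseteq> forms V \<Longrightarrow> length \<xi>s = length ws \<Longrightarrow>
      pluecker_coord \<xi>s (ks @ ls) = D * pluecker_coord \<xi>s ws"
    by (rule pluecker_frames[OF V fV W ws fr]) blast
  have lw: "length ws = length ks + length rs" using frame_length_unique[OF W ws fr] len by simp
  show ?thesis
  proof (intro exI[of _ D] conjI allI impI)
    show "D \<noteq> 0" by (rule D(1))
    show "length ws = length ks + length rs" by (rule lw)
    fix \<xi>s \<eta>s assume \<xi>: "set \<xi>s \<subseteq> forms V" "length \<xi>s = length ks" "set \<eta>s \<subseteq> forms Z" "length \<eta>s = length rs"
    have "pluecker_coord \<xi>s ks * pluecker_coord \<eta>s rs
        = pluecker_coord (\<xi>s @ map (\<lambda>\<eta>. \<lambda>x\<in>carrier V. \<eta> (f x)) \<eta>s) (ks @ ls)"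
    proof -
      have "f x = \<zero>\<^bsub>Z\<^esub>" if "x \<in> set ks" for x using frameD(1)[OF ks] that by blast
      from pluecker_block[OF f frameD(3)[OF ks] this lsV \<xi>(2) _ \<xi>(3)] show ?thesis
        using \<xi>(4) len ls(2) by simp
    qed
    also have "\<dots> = D * pluecker_coord (\<xi>s @ map (\<lambda>\<eta>. \<lambda>x\<in>carrier V. \<eta> (f x)) \<eta>s) ws"
    proof (rule D(2))
      show "set (\<xi>s @ map (\<lambda>\<eta>. \<lambda>x\<in>carrier V. \<eta> (f x)) \<eta>s) \<subseteq> forms V"
        using \<xi>(1,3) form_comp[OF f] by auto
    qed (use \<xi> lw in simp)
    finally show "pluecker_coord \<xi>s ks * pluecker_coord \<eta>s rs
         = D * pluecker_coord (\<xi>s @ map (\<lambda>\<eta>. \<lambda>x\<in>carrier V. \<eta> (f x)) \<eta>s) ws" .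
  qed
qed

subsection \<open>Cramer's rule\<close>

text \<open>The columns of the adjugate of the matrix of values, as coefficients for \<open>ws\<close>. If the coordinate of \<open>ws\<close>
  at \<open>\<zeta>\<close> is a non-zero \<open>d\<close>, this is \<open>d\<close> times the basis of the span of \<open>ws\<close> that is dual to \<open>\<zeta>\<close>. Its
  use is that single vectors of it, unlike those of \<open>ws\<close>, are governed by Pluecker coordinates.\<close>

definition cramer_frame :: "('k::field, 'v) module \<Rightarrow> ('v \<Rightarrow> 'k) list \<Rightarrow> 'v list \<Rightarrow> 'v list" where
  "cramer_frame V \<zeta> ws = map (\<lambda>t. lcomb V (\<lambda>r. cofactor (value_mat \<zeta> ws) t r) ws) [0..<length ws]"

lemma length_cramer_frame [simp]: "length (cramer_frame V \<zeta> ws) = length ws"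
  by (simp add: cramer_frame_def)

text \<open>Laplace expansion along row \<open>t\<close>: the cofactors of that row do not see the form in it.\<close>

lemma cramer_frame_value:
  assumes V: "vsp V" and ws: "set ws \<subseteq> carrier V" and \<zeta>: "length \<zeta> = length ws"
    and \<xi>: "\<xi> \<in> forms V" and t: "t < length ws"
  shows "\<xi> (cramer_frame V \<zeta> ws ! t) = pluecker_coord (\<zeta>[t := \<xi>]) ws"
proof -
  let ?A = "value_mat \<zeta> ws" and ?B = "value_mat (\<zeta>[t := \<xi>]) ws"
  have "mat_delete ?B t r = mat_delete ?A t r" for r
    by (rule eq_matI) (use \<zeta> in \<open>auto simp: value_mat_def mat_delete_def\<close>)
  then have "cofactor ?B t r = cofactor ?A t r" for r by (simp add: cofactor_def)
  then have "pluecker_coord (\<zeta>[t := \<xi>]) ws = (\<Sum>r<length ws. \<xi> (ws ! r) * cofactor ?A t r)"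
    unfolding pluecker_det laplace_expansion_row[OF value_mat_carrier t]
    by (intro sum.cong) (use t \<zeta> in \<open>auto simp: value_mat_def\<close>)
  also have "\<dots> = \<xi> (cramer_frame V \<zeta> ws ! t)"
    using t by (simp add: cramer_frame_def form_lcomb[OF \<xi> V ws] mult.commute)
  finally show ?thesis by simp
qed

text \<open>Evaluating \<open>\<zeta>\<^sub>s\<close> on the \<open>t\<close>-th vector puts \<open>\<zeta>\<^sub>s\<close> into row \<open>t\<close>, which repeats a row unless \<open>s = t\<close>. The
  matrix of values is thus the scalar matrix of \<open>d\<close>, with determinant \<open>d ^ n \<noteq> 0\<close>.\<close>

lemma frame_cramer_frame:
  assumes V: "vsp V" "fdim V" and U: "sub V U" and ws: "frame V U ws"
    and \<zeta>: "set \<zeta> \<subseteq> forms V" "length \<zeta> = length ws" and nz: "pluecker_coord \<zeta> ws \<noteq> 0"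
  shows "frame V U (cramer_frame V \<zeta> ws)"
proof -
  let ?us = "cramer_frame V \<zeta> ws"
  let ?d = "pluecker_coord \<zeta> ws"
  have usU: "set ?us \<subseteq> U"
    unfolding cramer_frame_def using lcomb_in_sub[OF U frameD(1)[OF ws]] by (simp add: image_subset_iff)
  have "value_mat \<zeta> ?us = ?d \<cdot>\<^sub>m 1\<^sub>m (length ws)"
  proof (rule eq_matI)
    fix s t assume "s < dim_row (?d \<cdot>\<^sub>m 1\<^sub>m (length ws))" "t < dim_col (?d \<cdot>\<^sub>m 1\<^sub>m (length ws))"
    then have st: "s < length ws" "t < length ws" by auto
    have "(\<zeta> ! s) (?us ! t) = pluecker_coord (\<zeta>[t := \<zeta> ! s]) ws"
      by (rule cramer_frame_value[OF V(1) frameD(3)[OF ws] \<zeta>(2) nth_subset[OF \<zeta>(1)] st(2)])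
        (simp add: st(1) \<zeta>(2))
    also have "\<dots> = (if s = t then ?d else 0)"
    proof (cases "s = t")
      case False
      have "pluecker_coord (\<zeta>[t := \<zeta> ! s]) ws = 0"
        unfolding pluecker_det
        by (rule det_identical_rows[OF value_mat_carrier, of s t])
          (use st False \<zeta>(2) in \<open>simp_all add: value_mat_def vec_eq_iff\<close>)
      then show ?thesis using False by simp
    qed simp
    finally show "value_mat \<zeta> ?us $$ (s, t) = (?d \<cdot>\<^sub>m 1\<^sub>m (length ws)) $$ (s, t)"
      using st by (simp add: value_mat_def)
  qed (simp_all add: value_mat_def)
  then have "pluecker_coord \<zeta> ?us = ?d ^ length ws" by (simp only: pluecker_det[of \<zeta> ?us]) simp
  then have "pluecker_coord \<zeta> ?us \<noteq> 0" using nz by simp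
  then have "indep V ?us"
    using pluecker_nonzero_indep[OF V(1) subset_trans[OF usU subD(2)[OF U]] \<zeta>(1)] \<zeta>(2) by simp
  then show ?thesis by (rule frame_of_length[OF V U _ usU ws]) simp
qed

section \<open>Subspaces, quotients and transported spaces\<close>

text \<open>Transported spaces and quotients are both images of a known space under a map \<open>q\<close> that respects
  the operations; for quotients \<open>q\<close> is not injective.\<close>

lemma vsp_image:
  assumes V: "vsp V" and c: "carrier W = q ` carrier V" and z: "\<zero>\<^bsub>W\<^esub> = q \<zero>\<^bsub>V\<^esub>"
    and a: "\<And>x y. x \<in> carrier V \<Longrightarrow> y \<in> carrier V \<Longrightarrow> q x \<oplus>\<^bsub>W\<^esub> q y = q (x \<oplus>\<^bsub>V\<^esub> y)"
    and s: "\<And>r x. x \<in> carrier V \<Longrightarrow> r \<odot>\<^bsub>W\<^esub> q x = q (r \<odot>\<^bsub>V\<^esub> x)"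
  shows "vsp W" "lin V W q"
proof -
  note [simp] = vsp_simps[OF V] a s
  show W: "vsp W"
  proof (rule vspI)
    fix v w assume "v \<in> carrier W" "w \<in> carrier W"
    then show "v \<oplus>\<^bsub>W\<^esub> w = w \<oplus>\<^bsub>W\<^esub> v" by (auto simp: c vsp_comm[OF V])
  next
    fix u v w assume "u \<in> carrier W" "v \<in> carrier W" "w \<in> carrier W"
    then show "u \<oplus>\<^bsub>W\<^esub> v \<oplus>\<^bsub>W\<^esub> w = u \<oplus>\<^bsub>W\<^esub> (v \<oplus>\<^bsub>W\<^esub> w)" by (auto simp: c vsp_assoc[OF V])
  qed (auto simp: c z vsp_neg[OF V] vsp_mult[OF V] vsp_distl[OF V] vsp_distr[OF V])
  show "lin V W q" by (rule linI[OF V W]) (auto simp: c)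
qed

text \<open>The universal property of the surjection \<open>q\<close>.\<close>

lemma lin_factor:
  assumes q: "lin V W q" and c: "carrier W = q ` carrier V" and f: "lin V Z f"
    and gq: "\<And>x. x \<in> carrier V \<Longrightarrow> g (q x) = f x"
  shows "lin W Z g"
proof (rule linI)
  show "vsp W" "vsp Z" using linD(2)[OF q] linD(2)[OF f] by auto
  note V = linD(1)[OF q]
  show "g x \<in> carrier Z" if "x \<in> carrier W" for x using that linD(3)[OF f] by (auto simp: c gq)
  show "g (x \<oplus>\<^bsub>W\<^esub> y) = g x \<oplus>\<^bsub>Z\<^esub> g y" if "x \<in> carrier W" "y \<in> carrier W" for x y
  proof -
    obtain u v where uv: "u \<in> carrier V" "x = q u" "v \<in> carrier V" "y = q v" using \<open>x \<in> carrier W\<close> \<open>y \<in> carrier W\<close> by (auto simp: c)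
    then have "x \<oplus>\<^bsub>W\<^esub> y = q (u \<oplus>\<^bsub>V\<^esub> v)" by (simp add: linD(4)[OF q])
    then show ?thesis using uv by (simp add: gq vsp_add[OF V] linD(4)[OF f])
  qed
  show "g (r \<odot>\<^bsub>W\<^esub> x) = r \<odot>\<^bsub>Z\<^esub> g x" if "x \<in> carrier W" for r x
  proof -
    obtain u where u: "u \<in> carrier V" "x = q u" using \<open>x \<in> carrier W\<close> by (auto simp: c)
    then have "r \<odot>\<^bsub>W\<^esub> x = q (r \<odot>\<^bsub>V\<^esub> u)" by (simp add: linD(5)[OF q])
    then show ?thesis using u by (simp add: gq vsp_smult[OF V] linD(5)[OF f])
  qed
qed

lemma lin_restrict:
  assumes f: "lin V W f" and U: "sub V U"
  shows "lin (V\<lparr>carrier := U\<rparr>) W f"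
  by (rule linI[OF sub_vsp[OF linD(1)[OF f] U] linD(2)[OF f]])
    (use linD(3-5)[OF f] subD(2)[OF U] in \<open>auto simp: subset_iff\<close>)

lemma lin_corestrict:
  assumes f: "lin V W f" and U: "sub W U" and "\<And>x. x \<in> carrier V \<Longrightarrow> f x \<in> U"
  shows "lin V (W\<lparr>carrier := U\<rparr>) f"
  by (rule linI[OF linD(1)[OF f] sub_vsp[OF linD(2)[OF f] U]])
    (use linD(3-5)[OF f] assms(3) in auto)

lemma lin_inclusion:
  assumes U: "sub V U"
  shows "lin (V\<lparr>carrier := U\<rparr>) V (\<lambda>x. x)"
  by (rule linI[OF sub_vsp[OF subD(1)[OF U] U] subD(1)[OF U]]) (use subD(2)[OF U] in auto)

lemma sub_sub_iff:
  assumes K: "sub V K" shows "sub (V\<lparr>carrier := K\<rparr>) U \<longleftrightarrow> sub V U \<and> U \<subseteq> K"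
  using sub_iff[OF sub_vsp[OF subD(1)[OF K] K], of U] sub_iff[OF subD(1)[OF K], of U] subD(2)[OF K] by auto

subsection \<open>Dimensions\<close>

lemma fdim_sub:
  assumes V: "vsp V" "fdim V" and U: "sub V U" shows "fdim (V\<lparr>carrier := U\<rparr>)"
  using ex_frame[OF V U] frame_dim(2)[OF U] by metis

lemma vdim_image:
  assumes f: "lin V W f" and fd: "fdim V" and U: "sub V U"
    and inj: "\<And>x. x \<in> U \<Longrightarrow> f x = \<zero>\<^bsub>W\<^esub> \<Longrightarrow> x = \<zero>\<^bsub>V\<^esub>"
  shows "vdim (W\<lparr>carrier := f ` U\<rparr>) = vdim (V\<lparr>carrier := U\<rparr>)"
proof -
  obtain ws where ws: "frame V U ws" using ex_frame[OF linD(1)[OF f] fd U] .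
  from frame_dim(1)[OF U ws] frame_dim(1)[OF lin_image_sub[OF f U] frame_image[OF f inj U ws]]
  show ?thesis by simp
qed

lemma fdim_image:
  assumes f: "lin V W f" and fd: "fdim V" and c: "carrier W = f ` carrier V"
  shows "fdim W"
proof -
  interpret f: linear_map class_ring V W f by (rule f)
  show ?thesis by (rule f.rank_nullity_main(2)[OF fd]) (use c in simp)
qed

lemma vdim_exact:
  assumes f: "lin V Z f" and fd: "fdim V" "fdim Z" and W: "sub V W"
  shows "vdim (V\<lparr>carrier := W\<rparr>) = vdim (V\<lparr>carrier := {x \<in> W. f x = \<zero>\<^bsub>Z\<^esub>}\<rparr>) + vdim (Z\<lparr>carrier := f ` W\<rparr>)"
proof -
  note K = lin_kernel_sub[OF f W] and R = lin_image_sub[OF f W]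
  obtain ws where ws: "frame V W ws" using ex_frame[OF linD(1)[OF f] fd(1) W] .
  obtain ks where ks: "frame V {x \<in> W. f x = \<zero>\<^bsub>Z\<^esub>} ks" using ex_frame[OF linD(1)[OF f] fd(1) K] .
  obtain rs where rs: "frame Z (f ` W) rs" using ex_frame[OF linD(2)[OF f] fd(2) R] .
  have "length ws = length ks + length rs"
    using exact_length[OF f fd(1) W ws ks rs] .
  then show ?thesis using frame_dim(1)[OF W ws] frame_dim(1)[OF K ks] frame_dim(1)[OF R rs] by simp
qed

lemma vdim_mono:
  assumes V: "vsp V" "fdim V" and U: "sub V U" and U': "sub V U'" and "U \<subseteq> U'"
  shows "vdim (V\<lparr>carrier := U\<rparr>) \<le> vdim (V\<lparr>carrier := U'\<rparr>)"
proof -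
  obtain ws where ws: "frame V U ws" using ex_frame[OF V U] .
  have "set ws \<subseteq> U'" using frameD(1)[OF ws] \<open>U \<subseteq> U'\<close> by blast
  then obtain vs where vs: "frame V U' (ws @ vs)" using extend_frame[OF V U' frameD(5)[OF ws]] by blast
  show ?thesis using frame_dim(1)[OF U ws] frame_dim(1)[OF U' vs] by simp
qed

text \<open>Extend a basis of \<open>K\<close> to \<open>V\<close> and prescribe the values there.\<close>

lemma form_extend:
  assumes V: "vsp V" "fdim V" and K: "sub V K" and \<xi>: "\<xi> \<in> forms (V\<lparr>carrier := K\<rparr>)"
  obtains \<eta> where "\<eta> \<in> forms V" "\<And>x. x \<in> K \<Longrightarrow> \<eta> x = \<xi> x"
proof -
  obtain ws where ws: "frame V K ws" using ex_frame[OF V K] .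
  obtain \<eta> where \<eta>: "\<eta> \<in> forms V" "\<And>t. t < length ws \<Longrightarrow> \<eta> (ws ! t) = \<xi> (ws ! t)"
    using ex_form_values[OF V frameD(5)[OF ws], of "\<lambda>t. \<xi> (ws ! t)"] by metis
  have "\<eta> x = \<xi> x" if x: "x \<in> K" for x
  proof -
    obtain c where c: "x = lcomb V c ws" using frameD(2)[OF ws x] by blast
    have "\<xi> x = (\<Sum>t<length ws. c t * \<xi> (ws ! t))"
      using form_lcomb[OF \<xi> sub_vsp[OF V(1) K], of ws c] frameD(1)[OF ws] c by (simp add: lcomb_sub_eq[OF K])
    also have "\<dots> = \<eta> x" unfolding c form_lcomb[OF \<eta>(1) V(1) frameD(3)[OF ws]] using \<eta>(2) by simp
    finally show ?thesis by simp
  qed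
  with \<eta>(1) that show thesis by blast
qed

subsection \<open>Biduality\<close>

text \<open>Extended from \<open>A\<close> to the whole dual, \<open>\<Lambda>\<close> is evaluation at the vector whose coordinates are its values
  on a dual basis.\<close>

lemma biduality:
  assumes V: "vsp V" "fdim V" and A: "sub (dual_space V) A"
    and add: "\<And>\<xi> \<eta>. \<xi> \<in> A \<Longrightarrow> \<eta> \<in> A \<Longrightarrow> \<Lambda> (\<xi> \<oplus>\<^bsub>dual_space V\<^esub> \<eta>) = \<Lambda> \<xi> + \<Lambda> \<eta>"
    and sm: "\<And>c \<xi>. \<xi> \<in> A \<Longrightarrow> \<Lambda> (c \<odot>\<^bsub>dual_space V\<^esub> \<xi>) = c * \<Lambda> \<xi>"
  obtains v where "v \<in> carrier V" "\<And>\<xi>. \<xi> \<in> A \<Longrightarrow> \<Lambda> \<xi> = \<xi> v"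
proof -
  note D = vsp_dual_space[OF V(1)] fdim_dual_space[OF V]
  have AD: "A \<subseteq> forms V" by (rule subD(2)[OF A])
  have "(\<lambda>\<xi>\<in>A. \<Lambda> \<xi>) \<in> forms ((dual_space V)\<lparr>carrier := A\<rparr>)"
    using add sm subD(4,5)[OF A] by (simp add: form_iff del: dual_space_simps)
  then obtain \<Lambda>' where L: "\<Lambda>' \<in> forms (dual_space V)" "\<And>\<xi>. \<xi> \<in> A \<Longrightarrow> \<Lambda>' \<xi> = (\<lambda>\<xi>\<in>A. \<Lambda> \<xi>) \<xi>"
    using form_extend[OF D A] by blast
  obtain bs where bs: "frame V (carrier V) bs" using ex_frame[OF V sub_carrier[OF V(1)]] .
  obtain \<beta> where \<beta>: "set \<beta> \<subseteq> forms V" "length \<beta> = length bs"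
    "\<And>s t. s < length bs \<Longrightarrow> t < length bs \<Longrightarrow> (\<beta> ! s) (bs ! t) = (if s = t then 1 else 0)"
    by (rule ex_dual_forms[OF V frameD(5)[OF bs]]) blast
  define v where "v = lcomb V (\<lambda>t. \<Lambda>' (\<beta> ! t)) bs"
  have v: "v \<in> carrier V" unfolding v_def by (rule lcomb_closed[OF V(1) frameD(3)[OF bs]])
  have "\<Lambda> \<xi> = \<xi> v" if \<xi>: "\<xi> \<in> A" for \<xi>
  proof -
    have \<xi>V: "\<xi> \<in> forms V" using \<xi> AD by blast
    have "\<xi> = lcomb (dual_space V) (\<lambda>t. \<xi> (bs ! t)) \<beta>" by (rule form_expansion[OF V(1) bs \<beta> \<xi>V])
    then have "\<Lambda>' \<xi> = (\<Sum>t<length bs. \<xi> (bs ! t) * \<Lambda>' (\<beta> ! t))"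
      using form_lcomb[OF L(1) D(1) \<beta>(1), of "\<lambda>t. \<xi> (bs ! t)"] \<beta>(2) by metis
    also have "\<dots> = \<xi> v" unfolding v_def form_lcomb[OF \<xi>V V(1) frameD(3)[OF bs]] by (simp add: mult.commute)
    finally show ?thesis using L(2)[OF \<xi>] \<xi> by simp
  qed
  with v that show thesis by blast
qed

subsection \<open>Transport\<close>

lemma transport_simps:
  assumes "inj j"
  shows "carrier (transport_space j V) = j ` carrier V" "\<zero>\<^bsub>transport_space j V\<^esub> = j \<zero>\<^bsub>V\<^esub>"
    "j x \<oplus>\<^bsub>transport_space j V\<^esub> j y = j (x \<oplus>\<^bsub>V\<^esub> y)" "c \<odot>\<^bsub>transport_space j V\<^esub> j x = j (c \<odot>\<^bsub>V\<^esub> x)"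
  using assms by (simp_all add: transport_space_def)

lemma transport:
  assumes j: "inj j" and V: "vsp V"
  shows "vsp (transport_space j V)" "lin V (transport_space j V) j"
proof -
  show "vsp (transport_space j V)"
    by (rule vsp_image(1)[OF V, where q = j]) (simp_all add: transport_simps[OF j])
  show "lin V (transport_space j V) j"
    by (rule vsp_image(2)[OF V, where q = j]) (simp_all add: transport_simps[OF j])
qed

lemma lin_from_transport:
  assumes j: "inj j" and f: "lin V Z f" and "\<And>x. x \<in> carrier V \<Longrightarrow> g (j x) = f x"
  shows "lin (transport_space j V) Z g"
  by (rule lin_factor[OF transport(2)[OF j linD(1)[OF f]] _ f assms(3)]) (simp_all add: transport_simps[OF j])

lemma fdim_transport: "inj j \<Longrightarrow> vsp V \<Longrightarrow> fdim V \<Longrightarrow> fdim (transport_space j V)"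
  by (rule fdim_image[OF transport(2)]) (simp_all add: transport_simps)

lemma transport_projl: "vsp V \<Longrightarrow> lin (transport_space Inl V) V projl"
  by (rule lin_from_transport[where f = "\<lambda>x. x"]) (auto intro: linI)

lemma transport_projr: "vsp V \<Longrightarrow> lin (transport_space Inr V) V projr"
  by (rule lin_from_transport[where f = "\<lambda>x. x"]) (auto intro: linI)

subsection \<open>Quotients\<close>

abbreviation coset :: "('k::field, 'v) module \<Rightarrow> 'v set \<Rightarrow> 'v \<Rightarrow> 'v set" where
  "coset V W x \<equiv> W +>\<^bsub>V\<^esub> x"

lemma coset_mem: "y \<in> coset V W x \<longleftrightarrow> (\<exists>h\<in>W. y = h \<oplus>\<^bsub>V\<^esub> x)"
  by (auto simp: a_r_coset_def r_coset_def)

context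
  fixes V :: "('k::field, 'v) module" and W
  assumes W: "sub V W"
begin

private lemma V: "vsp V" by (rule subD(1)[OF W])
private lemma WV: "x \<in> W \<Longrightarrow> x \<in> carrier V" using subD(2)[OF W] by blast
private lemmas simps = vsp_simps[OF V] WV subD(3-5)[OF W]

lemma coset_self: "x \<in> carrier V \<Longrightarrow> x \<in> coset V W x"
  unfolding coset_mem by (rule bexI[of _ "\<zero>\<^bsub>V\<^esub>"]) (simp_all add: simps)

lemma coset_carrier: "x \<in> carrier V \<Longrightarrow> y \<in> coset V W x \<Longrightarrow> y \<in> carrier V"
  unfolding coset_mem by (auto simp: simps)

lemma coset_shift:
  assumes "x \<in> carrier V" "h \<in> W" shows "coset V W (h \<oplus>\<^bsub>V\<^esub> x) = coset V W x"
proof safe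
  fix y assume "y \<in> coset V W (h \<oplus>\<^bsub>V\<^esub> x)"
  then obtain k where k: "k \<in> W" "y = k \<oplus>\<^bsub>V\<^esub> (h \<oplus>\<^bsub>V\<^esub> x)" unfolding coset_mem by blast
  then have "y = (k \<oplus>\<^bsub>V\<^esub> h) \<oplus>\<^bsub>V\<^esub> x" using assms by (simp add: vsp_assoc[OF V] WV)
  then show "y \<in> coset V W x" unfolding coset_mem using k assms subD(4)[OF W] by blast
next
  fix y assume "y \<in> coset V W x"
  then obtain k where k: "k \<in> W" "y = k \<oplus>\<^bsub>V\<^esub> x" unfolding coset_mem by blast
  have "x = ((- 1) \<odot>\<^bsub>V\<^esub> h) \<oplus>\<^bsub>V\<^esub> (h \<oplus>\<^bsub>V\<^esub> x)"
    using assms by (simp add: simps vsp_assoc[OF V, symmetric] vsp_neg'[OF V])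
  then have "y = (k \<oplus>\<^bsub>V\<^esub> (- 1) \<odot>\<^bsub>V\<^esub> h) \<oplus>\<^bsub>V\<^esub> (h \<oplus>\<^bsub>V\<^esub> x)"
    using k assms by (simp add: simps vsp_assoc[OF V])
  then show "y \<in> coset V W (h \<oplus>\<^bsub>V\<^esub> x)" unfolding coset_mem using k assms subD(4,5)[OF W] by blast
qed

lemma coset_eq_W: "x \<in> carrier V \<Longrightarrow> coset V W x = W \<longleftrightarrow> x \<in> W"
proof
  assume "x \<in> carrier V" "coset V W x = W" then show "x \<in> W" using coset_self by blast
next
  assume x: "x \<in> carrier V" "x \<in> W"
  have z: "coset V W \<zero>\<^bsub>V\<^esub> = W"
    unfolding set_eq_iff coset_mem by (auto simp: simps)
  have "coset V W (x \<oplus>\<^bsub>V\<^esub> \<zero>\<^bsub>V\<^esub>) = coset V W \<zero>\<^bsub>V\<^esub>" by (rule coset_shift) (simp_all add: simps x)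
  then show "coset V W x = W" using x by (simp add: simps z)
qed

lemma quot_space: "vsp (quot_space V W)" "lin V (quot_space V W) (coset V W)"
proof -
  have c: "carrier (quot_space V W) = coset V W ` carrier V"
    by (auto simp: quot_space_def A_RCOSETS_def RCOSETS_def a_r_coset_def)
  have z: "\<zero>\<^bsub>quot_space V W\<^esub> = coset V W \<zero>\<^bsub>V\<^esub>"
    using coset_eq_W[of "\<zero>\<^bsub>V\<^esub>"] by (simp add: quot_space_def simps)
  have a: "coset V W x \<oplus>\<^bsub>quot_space V W\<^esub> coset V W y = coset V W (x \<oplus>\<^bsub>V\<^esub> y)"
    if xy: "x \<in> carrier V" "y \<in> carrier V" for x y
  proof -
    have "coset V W x <+>\<^bsub>V\<^esub> coset V W y = coset V W (x \<oplus>\<^bsub>V\<^esub> y)"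
    proof safe
      fix z assume "z \<in> coset V W x <+>\<^bsub>V\<^esub> coset V W y"
      then obtain h k where hk: "h \<in> W" "k \<in> W" "z = (h \<oplus>\<^bsub>V\<^esub> x) \<oplus>\<^bsub>V\<^esub> (k \<oplus>\<^bsub>V\<^esub> y)"
        by (auto simp: set_add_def set_mult_def coset_mem)
      then have "z = (h \<oplus>\<^bsub>V\<^esub> k) \<oplus>\<^bsub>V\<^esub> (x \<oplus>\<^bsub>V\<^esub> y)"
        using xy by (simp add: vsp_assoc[OF V] vsp_lcomm[OF V] simps)
      then show "z \<in> coset V W (x \<oplus>\<^bsub>V\<^esub> y)" unfolding coset_mem using hk subD(4)[OF W] by blast
    next
      fix z assume "z \<in> coset V W (x \<oplus>\<^bsub>V\<^esub> y)"
      then obtain h where h: "h \<in> W" "z = h \<oplus>\<^bsub>V\<^esub> (x \<oplus>\<^bsub>V\<^esub> y)" unfolding coset_mem by blast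
      then have "z = (h \<oplus>\<^bsub>V\<^esub> x) \<oplus>\<^bsub>V\<^esub> y" using xy by (simp add: vsp_assoc[OF V] simps)
      moreover have "h \<oplus>\<^bsub>V\<^esub> x \<in> coset V W x" unfolding coset_mem using h by blast
      ultimately show "z \<in> coset V W x <+>\<^bsub>V\<^esub> coset V W y"
        using coset_self[OF xy(2)] by (auto simp: set_add_def set_mult_def)
    qed
    then show ?thesis by (simp add: quot_space_def)
  qed
  have s: "r \<odot>\<^bsub>quot_space V W\<^esub> coset V W x = coset V W (r \<odot>\<^bsub>V\<^esub> x)" if x: "x \<in> carrier V" for r x
  proof -
    have "coset V W (r \<odot>\<^bsub>V\<^esub> y) = coset V W (r \<odot>\<^bsub>V\<^esub> x)" if y: "y \<in> coset V W x" for y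
    proof -
      obtain h where h: "h \<in> W" "y = h \<oplus>\<^bsub>V\<^esub> x" using y unfolding coset_mem by blast
      then show ?thesis using x coset_shift[of "r \<odot>\<^bsub>V\<^esub> x" "r \<odot>\<^bsub>V\<^esub> h"] by (simp add: simps vsp_distr[OF V])
    qed
    then have "(\<Union>y\<in>coset V W x. coset V W (r \<odot>\<^bsub>V\<^esub> y)) = coset V W (r \<odot>\<^bsub>V\<^esub> x)"
      using coset_self[OF x] by blast
    then show ?thesis by (simp add: quot_space_def)
  qed
  show "vsp (quot_space V W)" by (rule vsp_image(1)[OF V c z a s])
  show "lin V (quot_space V W) (coset V W)" by (rule vsp_image(2)[OF V c z a s])
qed

lemma quot_simps: "carrier (quot_space V W) = coset V W ` carrier V" "\<zero>\<^bsub>quot_space V W\<^esub> = W"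
  by (auto simp: quot_space_def A_RCOSETS_def RCOSETS_def a_r_coset_def)

lemma some_coset: "x \<in> carrier V \<Longrightarrow> (SOME y. y \<in> coset V W x) \<in> coset V W x"
  by (rule someI_ex) (use coset_self in blast)

text \<open>The maps on quotients in the definitions choose a representative of a coset; a linear map that
  kills \<open>W\<close> does not see the choice.\<close>

lemma lin_some_coset:
  assumes f: "lin V Z f" and f0: "\<And>x. x \<in> W \<Longrightarrow> f x = \<zero>\<^bsub>Z\<^esub>" and x: "x \<in> carrier V"
  shows "f (SOME y. y \<in> coset V W x) = f x"
proof -
  obtain h where "h \<in> W" "(SOME y. y \<in> coset V W x) = h \<oplus>\<^bsub>V\<^esub> x"
    using some_coset[OF x] unfolding coset_mem by blast
  then show ?thesis using x f0 linD[OF f] by (simp add: simps vsp_l0)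
qed

lemma coset_eq_iff:
  assumes "x \<in> carrier V" "y \<in> carrier V"
  shows "coset V W x = coset V W y \<longleftrightarrow> x \<oplus>\<^bsub>V\<^esub> (- 1) \<odot>\<^bsub>V\<^esub> y \<in> W"
proof
  assume "coset V W x = coset V W y"
  then obtain h where h: "h \<in> W" "x = h \<oplus>\<^bsub>V\<^esub> y" using coset_self[OF assms(1)] coset_mem by metis
  then show "x \<oplus>\<^bsub>V\<^esub> (- 1) \<odot>\<^bsub>V\<^esub> y \<in> W" using assms by (simp add: simps vsp_assoc[OF V] vsp_neg[OF V])
next
  assume d: "x \<oplus>\<^bsub>V\<^esub> (- 1) \<odot>\<^bsub>V\<^esub> y \<in> W"
  have "x = (x \<oplus>\<^bsub>V\<^esub> (- 1) \<odot>\<^bsub>V\<^esub> y) \<oplus>\<^bsub>V\<^esub> y" using assms by (simp add: simps vsp_assoc[OF V] vsp_neg'[OF V])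
  then show "coset V W x = coset V W y" using coset_shift[OF assms(2) d] by simp
qed

end

section \<open>Finite direct sums\<close>

lemma sum_simps:
  "carrier (sum_space E V) = (\<Pi>\<^sub>E \<alpha>\<in>E. carrier (V \<alpha>))"
  "\<zero>\<^bsub>sum_space E V\<^esub> = (\<lambda>\<alpha>\<in>E. \<zero>\<^bsub>V \<alpha>\<^esub>)"
  "f \<oplus>\<^bsub>sum_space E V\<^esub> g = (\<lambda>\<alpha>\<in>E. f \<alpha> \<oplus>\<^bsub>V \<alpha>\<^esub> g \<alpha>)"
  "c \<odot>\<^bsub>sum_space E V\<^esub> f = (\<lambda>\<alpha>\<in>E. c \<odot>\<^bsub>V \<alpha>\<^esub> f \<alpha>)"
  by (simp_all add: sum_space_def)

definition inj_sum :: "'e set \<Rightarrow> ('e \<Rightarrow> ('k::field, 'v) module) \<Rightarrow> 'e \<Rightarrow> 'v \<Rightarrow> 'e \<Rightarrow> 'v" where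
  "inj_sum E V \<alpha> x = (\<lambda>\<beta>\<in>E. if \<beta> = \<alpha> then x else \<zero>\<^bsub>V \<beta>\<^esub>)"

locale sum_spaces =
  fixes E :: "'e set" and V :: "'e \<Rightarrow> ('k::field, 'v) module"
  assumes finE: "finite E" and V: "\<And>\<alpha>. \<alpha> \<in> E \<Longrightarrow> vsp (V \<alpha>)" and fdV: "\<And>\<alpha>. \<alpha> \<in> E \<Longrightarrow> fdim (V \<alpha>)"
begin

abbreviation "S \<equiv> sum_space E V"
abbreviation "inc \<equiv> inj_sum E V"

lemma S_mem: "f \<in> carrier S \<Longrightarrow> \<alpha> \<in> E \<Longrightarrow> f \<alpha> \<in> carrier (V \<alpha>)"
  by (auto simp: sum_simps)

lemma S_eqI: "f \<in> carrier S \<Longrightarrow> g \<in> carrier S \<Longrightarrow> (\<And>\<alpha>. \<alpha> \<in> E \<Longrightarrow> f \<alpha> = g \<alpha>) \<Longrightarrow> f = g"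
  unfolding sum_simps by (rule PiE_ext)

lemma vsp_S: "vsp S"
proof (rule vspI)
  note [simp] = vsp_simps[OF V] vsp_neg[OF V]
  show "\<zero>\<^bsub>S\<^esub> \<in> carrier S" by (auto simp: sum_simps)
  show add: "v \<oplus>\<^bsub>S\<^esub> w \<in> carrier S" if "v \<in> carrier S" "w \<in> carrier S" for v w
    using S_mem[OF that(1)] S_mem[OF that(2)] by (auto simp: sum_simps)
  show smult: "c \<odot>\<^bsub>S\<^esub> v \<in> carrier S" if "v \<in> carrier S" for c v
    using S_mem[OF that] by (auto simp: sum_simps)
  show "v \<oplus>\<^bsub>S\<^esub> w = w \<oplus>\<^bsub>S\<^esub> v" if "v \<in> carrier S" "w \<in> carrier S" for v w
    unfolding sum_simps using S_mem[OF that(1)] S_mem[OF that(2)] vsp_comm[OF V] by (auto intro!: restrict_ext)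
  show "v \<oplus>\<^bsub>S\<^esub> w \<oplus>\<^bsub>S\<^esub> x = v \<oplus>\<^bsub>S\<^esub> (w \<oplus>\<^bsub>S\<^esub> x)"
    if "v \<in> carrier S" "w \<in> carrier S" "x \<in> carrier S" for v w x
    unfolding sum_simps using S_mem[OF that(1)] S_mem[OF that(2)] S_mem[OF that(3)]
    by (auto intro!: restrict_ext simp: vsp_assoc[OF V])
  show "v \<oplus>\<^bsub>S\<^esub> \<zero>\<^bsub>S\<^esub> = v" if "v \<in> carrier S" for v
    by (rule S_eqI[OF add[OF that]]) (use that S_mem[OF that] in \<open>auto simp: sum_simps\<close>)
  show "v \<oplus>\<^bsub>S\<^esub> (- 1) \<odot>\<^bsub>S\<^esub> v = \<zero>\<^bsub>S\<^esub>" if "v \<in> carrier S" for v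
    unfolding sum_simps using S_mem[OF that] by (auto intro!: restrict_ext)
  show "(a * b) \<odot>\<^bsub>S\<^esub> v = a \<odot>\<^bsub>S\<^esub> (b \<odot>\<^bsub>S\<^esub> v)" if "v \<in> carrier S" for a b v
    unfolding sum_simps using S_mem[OF that] by (auto intro!: restrict_ext simp: vsp_mult[OF V])
  show "1 \<odot>\<^bsub>S\<^esub> v = v" if "v \<in> carrier S" for v
    by (rule S_eqI[OF smult[OF that] that]) (use S_mem[OF that] in \<open>auto simp: sum_simps\<close>)
  show "(a + b) \<odot>\<^bsub>S\<^esub> v = a \<odot>\<^bsub>S\<^esub> v \<oplus>\<^bsub>S\<^esub> b \<odot>\<^bsub>S\<^esub> v" if "v \<in> carrier S" for a b v
    unfolding sum_simps using S_mem[OF that] by (auto intro!: restrict_ext simp: vsp_distl[OF V])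
  show "a \<odot>\<^bsub>S\<^esub> (v \<oplus>\<^bsub>S\<^esub> w) = a \<odot>\<^bsub>S\<^esub> v \<oplus>\<^bsub>S\<^esub> a \<odot>\<^bsub>S\<^esub> w" if "v \<in> carrier S" "w \<in> carrier S" for a v w
    unfolding sum_simps using S_mem[OF that(1)] S_mem[OF that(2)]
    by (auto intro!: restrict_ext simp: vsp_distr[OF V])
qed

lemma lin_proj: "\<alpha> \<in> E \<Longrightarrow> lin S (V \<alpha>) (\<lambda>f. f \<alpha>)"
  by (rule linI[OF vsp_S V]) (auto simp: sum_simps)

lemma lin_inc: "\<alpha> \<in> E \<Longrightarrow> lin (V \<alpha>) S (inc \<alpha>)"
proof (rule linI[OF V vsp_S])
  note [simp] = vsp_simps[OF V]
  assume \<alpha>: "\<alpha> \<in> E"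
  show "inc \<alpha> x \<in> carrier S" if "x \<in> carrier (V \<alpha>)" for x
    using that by (auto simp: inj_sum_def sum_simps)
  show "inc \<alpha> (x \<oplus>\<^bsub>V \<alpha>\<^esub> y) = inc \<alpha> x \<oplus>\<^bsub>S\<^esub> inc \<alpha> y" if "x \<in> carrier (V \<alpha>)" "y \<in> carrier (V \<alpha>)" for x y
    unfolding sum_simps inj_sum_def by (auto intro!: restrict_ext)
  show "inc \<alpha> (c \<odot>\<^bsub>V \<alpha>\<^esub> x) = c \<odot>\<^bsub>S\<^esub> inc \<alpha> x" if "x \<in> carrier (V \<alpha>)" for c x
    unfolding sum_simps inj_sum_def by (auto intro!: restrict_ext)
qed auto

lemma inc_apply: "\<beta> \<in> E \<Longrightarrow> inc \<alpha> x \<beta> = (if \<beta> = \<alpha> then x else \<zero>\<^bsub>V \<beta>\<^esub>)"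
  by (simp add: inj_sum_def)

lemma S_decompose:
  assumes f: "f \<in> carrier S" shows "f = (\<Oplus>\<^bsub>S\<^esub>\<alpha>\<in>E. inc \<alpha> (f \<alpha>))"
proof (rule S_eqI[OF f])
  have inc: "inc \<alpha> (f \<alpha>) \<in> carrier S" if "\<alpha> \<in> E" for \<alpha>
    using linD(3)[OF lin_inc[OF that]] S_mem[OF f that] by simp
  show "(\<Oplus>\<^bsub>S\<^esub>\<alpha>\<in>E. inc \<alpha> (f \<alpha>)) \<in> carrier S" using inc by (rule vsp_finsum[OF vsp_S])
  fix \<beta> assume \<beta>: "\<beta> \<in> E"
  note simps = vsp_simps[OF V[OF \<beta>]]
  have "(\<Oplus>\<^bsub>S\<^esub>\<alpha>\<in>E. inc \<alpha> (f \<alpha>)) \<beta> = (\<Oplus>\<^bsub>V \<beta>\<^esub>\<alpha>\<in>E. inc \<alpha> (f \<alpha>) \<beta>)"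
    using inc by (intro lin_finsum[OF lin_proj[OF \<beta>]])
  also have "\<dots> = (\<Oplus>\<^bsub>V \<beta>\<^esub>\<alpha>\<in>insert \<beta> (E - {\<beta>}). inc \<alpha> (f \<alpha>) \<beta>)" using \<beta> by (simp add: insert_absorb)
  also have "\<dots> = inc \<beta> (f \<beta>) \<beta> \<oplus>\<^bsub>V \<beta>\<^esub> (\<Oplus>\<^bsub>V \<beta>\<^esub>\<alpha>\<in>E - {\<beta>}. inc \<alpha> (f \<alpha>) \<beta>)"
    using finE S_mem[OF f \<beta>]
    by (intro vsp_finsum_insert[OF V[OF \<beta>]]) (auto simp: inc_apply[OF \<beta>] simps)
  also have "(\<Oplus>\<^bsub>V \<beta>\<^esub>\<alpha>\<in>E - {\<beta>}. inc \<alpha> (f \<alpha>) \<beta>) = \<zero>\<^bsub>V \<beta>\<^esub>"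
    by (rule vsp_finsum_zero[OF V[OF \<beta>]]) (auto simp: inc_apply[OF \<beta>])
  finally show "f \<beta> = (\<Oplus>\<^bsub>S\<^esub>\<alpha>\<in>E. inc \<alpha> (f \<alpha>)) \<beta>"
    using S_mem[OF f \<beta>] by (simp add: inc_apply[OF \<beta>] simps)
qed

text \<open>A product of subspaces is built up one factor at a time: \<open>B\<close> is the set of the indices treated so
  far, and the factors not yet treated are zero.\<close>

definition prod_sub :: "('e \<Rightarrow> 'v set) \<Rightarrow> 'e set \<Rightarrow> ('e \<Rightarrow> 'v) set" where
  "prod_sub U B = (\<Pi>\<^sub>E \<alpha>\<in>E. if \<alpha> \<in> B then U \<alpha> else {\<zero>\<^bsub>V \<alpha>\<^esub>})"

lemma sub_PiE:
  assumes U: "\<And>\<alpha>. \<alpha> \<in> E \<Longrightarrow> sub (V \<alpha>) (U \<alpha>)"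
  shows "sub S (\<Pi>\<^sub>E \<alpha>\<in>E. U \<alpha>)"
  unfolding sub_iff[OF vsp_S]
proof (intro conjI ballI allI)
  show "(\<Pi>\<^sub>E \<alpha>\<in>E. U \<alpha>) \<subseteq> carrier S"
    unfolding sum_simps by (rule PiE_mono) (rule subD(2)[OF U])
  show "\<zero>\<^bsub>S\<^esub> \<in> (\<Pi>\<^sub>E \<alpha>\<in>E. U \<alpha>)"
    unfolding sum_simps by (rule restrict_PiE_iff[THEN iffD2]) (use subD(3)[OF U] in blast)
  fix x y assume xy: "x \<in> (\<Pi>\<^sub>E \<alpha>\<in>E. U \<alpha>)" "y \<in> (\<Pi>\<^sub>E \<alpha>\<in>E. U \<alpha>)"
  show "x \<oplus>\<^bsub>S\<^esub> y \<in> (\<Pi>\<^sub>E \<alpha>\<in>E. U \<alpha>)"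
    unfolding sum_simps
    by (rule restrict_PiE_iff[THEN iffD2]) (use PiE_mem[OF xy(1)] PiE_mem[OF xy(2)] subD(4)[OF U] in blast)
next
  fix c x assume x: "x \<in> (\<Pi>\<^sub>E \<alpha>\<in>E. U \<alpha>)"
  show "c \<odot>\<^bsub>S\<^esub> x \<in> (\<Pi>\<^sub>E \<alpha>\<in>E. U \<alpha>)"
    unfolding sum_simps
    by (rule restrict_PiE_iff[THEN iffD2]) (use PiE_mem[OF x] subD(5)[OF U] in blast)
qed

lemma sub_prod_sub:
  assumes U: "\<And>\<alpha>. \<alpha> \<in> E \<Longrightarrow> sub (V \<alpha>) (U \<alpha>)"
  shows "sub S (prod_sub U B)"
  unfolding prod_sub_def
proof (rule sub_PiE)
  fix \<alpha> assume \<alpha>: "\<alpha> \<in> E"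
  have "sub (V \<alpha>) {\<zero>\<^bsub>V \<alpha>\<^esub>}" using sub_iff[OF V[OF \<alpha>]] by (simp add: vsp_simps[OF V[OF \<alpha>]])
  then show "sub (V \<alpha>) (if \<alpha> \<in> B then U \<alpha> else {\<zero>\<^bsub>V \<alpha>\<^esub>})" using U[OF \<alpha>] by simp
qed

lemma prod_sub_whole: "prod_sub U E = (\<Pi>\<^sub>E \<alpha>\<in>E. U \<alpha>)"
  unfolding prod_sub_def by (rule PiE_cong) simp

lemma prod_sub_empty: "prod_sub U {} = {\<zero>\<^bsub>S\<^esub>}"
proof -
  have "prod_sub U {} = (\<Pi>\<^sub>E \<alpha>\<in>E. {(\<lambda>\<alpha>\<in>E. \<zero>\<^bsub>V \<alpha>\<^esub>) \<alpha>})"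
    unfolding prod_sub_def by (rule PiE_cong) simp
  also have "\<dots> = {\<lambda>\<alpha>\<in>E. \<zero>\<^bsub>V \<alpha>\<^esub>}" by (rule PiE_singleton) (rule restrict_extensional)
  finally show ?thesis by (simp add: sum_simps)
qed

lemma prod_sub_insert:
  assumes U: "\<And>\<alpha>. \<alpha> \<in> E \<Longrightarrow> sub (V \<alpha>) (U \<alpha>)" and \<alpha>: "\<alpha> \<in> E" "\<alpha> \<notin> B"
  shows "prod_sub U (insert \<alpha> B) = {inc \<alpha> x \<oplus>\<^bsub>S\<^esub> y | x y. x \<in> U \<alpha> \<and> y \<in> prod_sub U B}"
    and "\<And>x y. x \<in> U \<alpha> \<Longrightarrow> y \<in> prod_sub U B \<Longrightarrow> inc \<alpha> x \<oplus>\<^bsub>S\<^esub> y = \<zero>\<^bsub>S\<^esub> \<Longrightarrow> x = \<zero>\<^bsub>V \<alpha>\<^esub> \<and> y = \<zero>\<^bsub>S\<^esub>"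
proof -
  note simps = vsp_simps[OF V]
  have Uc: "x \<in> carrier (V \<beta>)" if "x \<in> U \<beta>" "\<beta> \<in> E" for x \<beta> using subD(2)[OF U] that by blast
  have sum: "(inc \<alpha> x \<oplus>\<^bsub>S\<^esub> y) \<beta> = (if \<beta> = \<alpha> then x else y \<beta>)"
    if "x \<in> U \<alpha>" "y \<in> prod_sub U B" "\<beta> \<in> E" for x y \<beta>
  proof -
    have "y \<in> carrier S" using that(2) subD(2)[OF sub_prod_sub[OF U]] by blast
    then have y1: "y \<beta> \<in> carrier (V \<beta>)" using that(3) by (rule S_mem)
    have "y \<beta> \<in> (if \<beta> \<in> B then U \<beta> else {\<zero>\<^bsub>V \<beta>\<^esub>})"
      using that(2,3) unfolding prod_sub_def by (rule PiE_mem)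
    then have y2: "\<beta> = \<alpha> \<Longrightarrow> y \<beta> = \<zero>\<^bsub>V \<beta>\<^esub>" using \<alpha>(2) by auto
    show ?thesis using y1 y2 that(3) Uc[OF that(1) \<alpha>(1)] by (auto simp: sum_simps inc_apply simps)
  qed
  show "prod_sub U (insert \<alpha> B) = {inc \<alpha> x \<oplus>\<^bsub>S\<^esub> y | x y. x \<in> U \<alpha> \<and> y \<in> prod_sub U B}"
  proof (intro equalityI subsetI)
    fix f assume f: "f \<in> prod_sub U (insert \<alpha> B)"
    have fm: "f \<beta> \<in> (if \<beta> \<in> insert \<alpha> B then U \<beta> else {\<zero>\<^bsub>V \<beta>\<^esub>})" if "\<beta> \<in> E" for \<beta>
      using f that unfolding prod_sub_def by (rule PiE_mem)
    have fS: "f \<in> carrier S" using f subD(2)[OF sub_prod_sub[OF U]] by blast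
    define y where "y = (\<lambda>\<beta>\<in>E. if \<beta> = \<alpha> then \<zero>\<^bsub>V \<beta>\<^esub> else f \<beta>)"
    have y: "y \<in> prod_sub U B" unfolding prod_sub_def y_def
    proof (rule restrict_PiE_iff[THEN iffD2], rule ballI)
      fix \<beta> assume "\<beta> \<in> E"
      from fm[OF this] show "(if \<beta> = \<alpha> then \<zero>\<^bsub>V \<beta>\<^esub> else f \<beta>) \<in> (if \<beta> \<in> B then U \<beta> else {\<zero>\<^bsub>V \<beta>\<^esub>})"
        using \<alpha>(2) by (auto split: if_splits)
    qed
    have fa: "f \<alpha> \<in> U \<alpha>" using fm[OF \<alpha>(1)] by simp
    have "f = inc \<alpha> (f \<alpha>) \<oplus>\<^bsub>S\<^esub> y"
    proof (rule S_eqI[OF fS])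
      show "inc \<alpha> (f \<alpha>) \<oplus>\<^bsub>S\<^esub> y \<in> carrier S"
        using linD(3)[OF lin_inc[OF \<alpha>(1)] S_mem[OF fS \<alpha>(1)]] y subD(2)[OF sub_prod_sub[OF U]]
        by (blast intro: vsp_add[OF vsp_S])
      fix \<beta> assume \<beta>: "\<beta> \<in> E"
      then have "\<beta> \<noteq> \<alpha> \<Longrightarrow> y \<beta> = f \<beta>" by (simp add: y_def)
      then show "f \<beta> = (inc \<alpha> (f \<alpha>) \<oplus>\<^bsub>S\<^esub> y) \<beta>" unfolding sum[OF fa y \<beta>] by auto
    qed
    with fa y show "f \<in> {inc \<alpha> x \<oplus>\<^bsub>S\<^esub> y | x y. x \<in> U \<alpha> \<and> y \<in> prod_sub U B}" by blast
  next
    fix f assume "f \<in> {inc \<alpha> x \<oplus>\<^bsub>S\<^esub> y | x y. x \<in> U \<alpha> \<and> y \<in> prod_sub U B}"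
    then obtain x y where xy: "f = inc \<alpha> x \<oplus>\<^bsub>S\<^esub> y" "x \<in> U \<alpha>" "y \<in> prod_sub U B" by blast
    have ym: "y \<beta> \<in> (if \<beta> \<in> B then U \<beta> else {\<zero>\<^bsub>V \<beta>\<^esub>})" if "\<beta> \<in> E" for \<beta>
      using xy(3) that unfolding prod_sub_def by (rule PiE_mem)
    have ext: "f \<in> extensional E" unfolding xy(1) sum_simps by simp
    show "f \<in> prod_sub U (insert \<alpha> B)"
      unfolding prod_sub_def PiE_iff
    proof (intro conjI ballI ext)
      fix \<beta> assume \<beta>: "\<beta> \<in> E"
      show "f \<beta> \<in> (if \<beta> \<in> insert \<alpha> B then U \<beta> else {\<zero>\<^bsub>V \<beta>\<^esub>})"
        unfolding xy(1) sum[OF xy(2,3) \<beta>] using xy(2) ym[OF \<beta>] by (auto split: if_splits)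
    qed
  qed
  fix x y assume xy: "x \<in> U \<alpha>" "y \<in> prod_sub U B" "inc \<alpha> x \<oplus>\<^bsub>S\<^esub> y = \<zero>\<^bsub>S\<^esub>"
  have eq: "(if \<beta> = \<alpha> then x else y \<beta>) = \<zero>\<^bsub>V \<beta>\<^esub>" if "\<beta> \<in> E" for \<beta>
    using sum[OF xy(1,2) that] that unfolding xy(3) by (simp add: sum_simps)
  have yS: "y \<in> carrier S" using xy(2) subD(2)[OF sub_prod_sub[OF U]] by blast
  have "y \<alpha> \<in> (if \<alpha> \<in> B then U \<alpha> else {\<zero>\<^bsub>V \<alpha>\<^esub>})"
    using xy(2) \<alpha>(1) unfolding prod_sub_def by (rule PiE_mem)
  then have ya: "y \<alpha> = \<zero>\<^bsub>V \<alpha>\<^esub>" using \<alpha>(2) by simp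
  have "y = \<zero>\<^bsub>S\<^esub>"
  proof (rule S_eqI[OF yS vsp_zero[OF vsp_S]])
    fix \<beta> assume \<beta>: "\<beta> \<in> E"
    show "y \<beta> = \<zero>\<^bsub>S\<^esub> \<beta>" using eq[OF \<beta>] ya \<beta> by (cases "\<beta> = \<alpha>") (auto simp: sum_simps)
  qed
  then show "x = \<zero>\<^bsub>V \<alpha>\<^esub> \<and> y = \<zero>\<^bsub>S\<^esub>" using eq[OF \<alpha>(1)] by simp
qed

lemma frame_zero: "vsp W \<Longrightarrow> frame W {\<zero>\<^bsub>W\<^esub>} []"
  by (simp add: frame_def indep_Nil lcomb_Nil)

lemma frame_prod_sub:
  assumes U: "\<And>\<alpha>. \<alpha> \<in> E \<Longrightarrow> sub (V \<alpha>) (U \<alpha>)" and "B \<subseteq> E"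
  shows "\<exists>ws. frame S (prod_sub U B) ws \<and> length ws = (\<Sum>\<alpha>\<in>B. vdim ((V \<alpha>)\<lparr>carrier := U \<alpha>\<rparr>))"
proof -
  have "finite B" using \<open>B \<subseteq> E\<close> finE finite_subset by blast
  then show ?thesis using \<open>B \<subseteq> E\<close>
  proof (induction B rule: finite_induct)
    case empty
    show ?case using frame_zero[OF vsp_S] by (auto simp: prod_sub_empty)
  next
    case (insert \<alpha> B)
    then have \<alpha>: "\<alpha> \<in> E" by simp
    obtain ws where ws: "frame S (prod_sub U B) ws" "length ws = (\<Sum>\<alpha>\<in>B. vdim ((V \<alpha>)\<lparr>carrier := U \<alpha>\<rparr>))"
      using insert by auto
    obtain us where us: "frame (V \<alpha>) (U \<alpha>) us" using ex_frame[OF V[OF \<alpha>] fdV[OF \<alpha>] U[OF \<alpha>]] .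
    have P: "sub S (prod_sub U B)" by (rule sub_prod_sub) (rule U)
    have eq: "prod_sub U (insert \<alpha> B) = {inc \<alpha> x \<oplus>\<^bsub>S\<^esub> y | x y. x \<in> U \<alpha> \<and> y \<in> prod_sub U B}"
      by (rule prod_sub_insert(1)[OF _ \<alpha> insert.hyps(2)]) (rule U)
    have "frame S (prod_sub U (insert \<alpha> B)) (map (inc \<alpha>) us @ ws)"
      unfolding eq
      by (rule frame_direct_sum[OF lin_inc[OF \<alpha>] U[OF \<alpha>] P _ us ws(1)])
        (rule prod_sub_insert(2)[OF _ \<alpha> insert.hyps(2)], rule U)
    moreover have "length (map (inc \<alpha>) us @ ws) = (\<Sum>\<alpha>\<in>insert \<alpha> B. vdim ((V \<alpha>)\<lparr>carrier := U \<alpha>\<rparr>))"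
      using insert.hyps ws(2) frame_dim(1)[OF U[OF \<alpha>] us] by simp
    ultimately show ?case by blast
  qed
qed

lemma vdim_PiE:
  assumes U: "\<And>\<alpha>. \<alpha> \<in> E \<Longrightarrow> sub (V \<alpha>) (U \<alpha>)"
  shows "vdim (S\<lparr>carrier := \<Pi>\<^sub>E \<alpha>\<in>E. U \<alpha>\<rparr>) = (\<Sum>\<alpha>\<in>E. vdim ((V \<alpha>)\<lparr>carrier := U \<alpha>\<rparr>))"
proof -
  have s: "sub S (\<Pi>\<^sub>E \<alpha>\<in>E. U \<alpha>)" by (rule sub_PiE) (rule U)
  have "\<exists>ws. frame S (prod_sub U E) ws \<and> length ws = (\<Sum>\<alpha>\<in>E. vdim ((V \<alpha>)\<lparr>carrier := U \<alpha>\<rparr>))"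
    by (rule frame_prod_sub[OF _ order_refl]) (rule U)
  then show ?thesis using frame_dim(1)[OF s] by (auto simp: prod_sub_whole)
qed

lemma fdim_S: "fdim S"
proof -
  have s: "sub S (\<Pi>\<^sub>E \<alpha>\<in>E. carrier (V \<alpha>))" by (rule sub_PiE) (rule sub_carrier[OF V])
  have "\<exists>ws. frame S (prod_sub (\<lambda>\<alpha>. carrier (V \<alpha>)) E) ws \<and>
    length ws = (\<Sum>\<alpha>\<in>E. vdim ((V \<alpha>)\<lparr>carrier := carrier (V \<alpha>)\<rparr>))"
    by (rule frame_prod_sub[OF _ order_refl]) (rule sub_carrier[OF V])
  then obtain ws where "frame S (\<Pi>\<^sub>E \<alpha>\<in>E. carrier (V \<alpha>)) ws"
    unfolding prod_sub_whole by blast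
  from frame_dim(2)[OF s this] show ?thesis by (simp add: sum_simps(1)[symmetric])
qed

lemma lin_sum:
  assumes Z: "vsp Z" and g: "\<And>\<alpha>. \<alpha> \<in> E \<Longrightarrow> lin (V \<alpha>) Z (g \<alpha>)"
  shows "lin S Z (\<lambda>f. \<Oplus>\<^bsub>Z\<^esub>\<alpha>\<in>E. g \<alpha> (f \<alpha>))"
proof (rule linI[OF vsp_S Z])
  have gc: "g \<alpha> (f \<alpha>) \<in> carrier Z" if "f \<in> carrier S" "\<alpha> \<in> E" for f \<alpha>
    using linD(3)[OF g[OF that(2)] S_mem[OF that]] .
  show "(\<Oplus>\<^bsub>Z\<^esub>\<alpha>\<in>E. g \<alpha> (f \<alpha>)) \<in> carrier Z" if "f \<in> carrier S" for f
    by (rule vsp_finsum[OF Z gc[OF that]])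
  show "(\<Oplus>\<^bsub>Z\<^esub>\<alpha>\<in>E. g \<alpha> ((f \<oplus>\<^bsub>S\<^esub> h) \<alpha>)) = (\<Oplus>\<^bsub>Z\<^esub>\<alpha>\<in>E. g \<alpha> (f \<alpha>)) \<oplus>\<^bsub>Z\<^esub> (\<Oplus>\<^bsub>Z\<^esub>\<alpha>\<in>E. g \<alpha> (h \<alpha>))"
    if "f \<in> carrier S" "h \<in> carrier S" for f h
  proof -
    have "(\<Oplus>\<^bsub>Z\<^esub>\<alpha>\<in>E. g \<alpha> ((f \<oplus>\<^bsub>S\<^esub> h) \<alpha>)) = (\<Oplus>\<^bsub>Z\<^esub>\<alpha>\<in>E. g \<alpha> (f \<alpha>) \<oplus>\<^bsub>Z\<^esub> g \<alpha> (h \<alpha>))"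
      using that by (intro vsp_finsum_cong[OF Z refl])
        (auto simp: sum_simps(3) linD(4)[OF g] S_mem intro!: vsp_add[OF Z] gc)
    then show ?thesis using vsp_finsum_add[OF Z gc[OF that(1)] gc[OF that(2)]] by simp
  qed
  show "(\<Oplus>\<^bsub>Z\<^esub>\<alpha>\<in>E. g \<alpha> ((c \<odot>\<^bsub>S\<^esub> f) \<alpha>)) = c \<odot>\<^bsub>Z\<^esub> (\<Oplus>\<^bsub>Z\<^esub>\<alpha>\<in>E. g \<alpha> (f \<alpha>))" if "f \<in> carrier S" for c f
  proof -
    have "(\<Oplus>\<^bsub>Z\<^esub>\<alpha>\<in>E. g \<alpha> ((c \<odot>\<^bsub>S\<^esub> f) \<alpha>)) = (\<Oplus>\<^bsub>Z\<^esub>\<alpha>\<in>E. c \<odot>\<^bsub>Z\<^esub> g \<alpha> (f \<alpha>))"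
      using that by (intro vsp_finsum_cong[OF Z refl])
        (auto simp: sum_simps(4) linD(5)[OF g] S_mem intro!: vsp_smult[OF Z] gc)
    then show ?thesis using vsp_finsum_smult[OF Z gc[OF that]] by simp
  qed
qed

lemma sum_at_inc:
  assumes Z: "vsp Z" and g: "\<And>\<alpha>. \<alpha> \<in> E \<Longrightarrow> lin (V \<alpha>) Z (g \<alpha>)" and \<alpha>: "\<alpha> \<in> E" and x: "x \<in> carrier (V \<alpha>)"
  shows "(\<Oplus>\<^bsub>Z\<^esub>\<beta>\<in>E. g \<beta> (inc \<alpha> x \<beta>)) = g \<alpha> x"
proof -
  have "(\<Oplus>\<^bsub>Z\<^esub>\<beta>\<in>E. g \<beta> (inc \<alpha> x \<beta>)) = (\<Oplus>\<^bsub>Z\<^esub>\<beta>\<in>insert \<alpha> (E - {\<alpha>}). g \<beta> (inc \<alpha> x \<beta>))"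
    using \<alpha> by (simp add: insert_absorb)
  also have "\<dots> = g \<alpha> (inc \<alpha> x \<alpha>) \<oplus>\<^bsub>Z\<^esub> (\<Oplus>\<^bsub>Z\<^esub>\<beta>\<in>E - {\<alpha>}. g \<beta> (inc \<alpha> x \<beta>))"
    using finE \<alpha> x by (intro vsp_finsum_insert[OF Z])
      (auto simp: inc_apply lin_zero[OF g] vsp_zero[OF Z] linD(3)[OF g])
  also have "(\<Oplus>\<^bsub>Z\<^esub>\<beta>\<in>E - {\<alpha>}. g \<beta> (inc \<alpha> x \<beta>)) = \<zero>\<^bsub>Z\<^esub>"
    by (rule vsp_finsum_zero[OF Z]) (auto simp: inc_apply lin_zero[OF g])
  finally show ?thesis using \<alpha> x by (simp add: inc_apply vsp_r0[OF Z] linD(3)[OF g])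
qed

subsection \<open>Forms on a direct sum\<close>

definition sum_form :: "('e \<Rightarrow> 'v \<Rightarrow> 'k) \<Rightarrow> ('e \<Rightarrow> 'v) \<Rightarrow> 'k" where
  "sum_form \<xi> = (\<lambda>f\<in>carrier S. \<Sum>\<alpha>\<in>E. \<xi> \<alpha> (f \<alpha>))"

lemma sum_form:
  assumes \<xi>: "\<And>\<alpha>. \<alpha> \<in> E \<Longrightarrow> \<xi> \<alpha> \<in> forms (V \<alpha>)"
  shows "sum_form \<xi> \<in> forms S"
  unfolding form_iff
proof (intro conjI ballI allI)
  show "sum_form \<xi> \<in> extensional (carrier S)" by (simp add: sum_form_def)
  fix f g assume fg: "f \<in> carrier S" "g \<in> carrier S"
  have "\<xi> \<alpha> ((f \<oplus>\<^bsub>S\<^esub> g) \<alpha>) = \<xi> \<alpha> (f \<alpha>) + \<xi> \<alpha> (g \<alpha>)" if "\<alpha> \<in> E" for \<alpha>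
    using formD(2)[OF \<xi>[OF that] S_mem[OF fg(1) that] S_mem[OF fg(2) that]] that by (simp add: sum_simps(3))
  then show "sum_form \<xi> (f \<oplus>\<^bsub>S\<^esub> g) = sum_form \<xi> f + sum_form \<xi> g"
    using fg by (simp add: sum_form_def vsp_add[OF vsp_S] sum.distrib)
next
  fix c f assume f: "f \<in> carrier S"
  have "\<xi> \<alpha> ((c \<odot>\<^bsub>S\<^esub> f) \<alpha>) = c * \<xi> \<alpha> (f \<alpha>)" if "\<alpha> \<in> E" for \<alpha>
    using formD(3)[OF \<xi>[OF that] S_mem[OF f that]] that by (simp add: sum_simps(4))
  then show "sum_form \<xi> (c \<odot>\<^bsub>S\<^esub> f) = c * sum_form \<xi> f"
    using f by (simp add: sum_form_def vsp_smult[OF vsp_S] sum_distrib_left)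
qed

text \<open>The inverse of \<open>sum_form\<close>: the dual of a finite direct sum is the direct sum of the duals.\<close>

definition component_forms :: "(('e \<Rightarrow> 'v) \<Rightarrow> 'k) \<Rightarrow> 'e \<Rightarrow> 'v \<Rightarrow> 'k" where
  "component_forms \<Xi> = (\<lambda>\<alpha>\<in>E. \<lambda>x\<in>carrier (V \<alpha>). \<Xi> (inc \<alpha> x))"

lemma component_forms:
  assumes "\<Xi> \<in> forms S"
  shows "component_forms \<Xi> \<in> (\<Pi>\<^sub>E \<alpha>\<in>E. forms (V \<alpha>))"
  unfolding component_forms_def by (rule restrict_PiE_iff[THEN iffD2]) (use form_comp[OF lin_inc assms] in blast)

lemma sum_component_forms:
  assumes \<Xi>: "\<Xi> \<in> forms S"
  shows "sum_form (component_forms \<Xi>) = \<Xi>"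
proof
  fix f
  show "sum_form (component_forms \<Xi>) f = \<Xi> f"
  proof (cases "f \<in> carrier S")
    case True
    have "\<Xi> f = \<Xi> (\<Oplus>\<^bsub>S\<^esub>\<alpha>\<in>E. inc \<alpha> (f \<alpha>))" using S_decompose[OF True] by simp
    also have "\<dots> = (\<Sum>\<alpha>\<in>E. \<Xi> (inc \<alpha> (f \<alpha>)))"
      using linD(3)[OF lin_inc] S_mem[OF True] by (intro form_finsum[OF \<Xi> vsp_S finE]) simp
    finally show ?thesis using True S_mem[OF True] by (simp add: sum_form_def component_forms_def)
  next
    case False
    then show ?thesis using extensional_arb[OF formD(1)[OF \<Xi>]] by (simp add: sum_form_def)
  qed
qed

lemma component_sum_form:
  assumes \<xi>: "\<xi> \<in> (\<Pi>\<^sub>E \<alpha>\<in>E. forms (V \<alpha>))"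
  shows "component_forms (sum_form \<xi>) = \<xi>"
proof (rule PiE_ext[OF component_forms[OF sum_form] \<xi>])
  have \<xi>f: "\<xi> \<alpha> \<in> forms (V \<alpha>)" if "\<alpha> \<in> E" for \<alpha> using \<xi> that by (rule PiE_mem)
  show "\<xi> \<alpha> \<in> forms (V \<alpha>)" if "\<alpha> \<in> E" for \<alpha> using \<xi>f[OF that] .
  fix \<alpha> assume \<alpha>: "\<alpha> \<in> E"
  show "component_forms (sum_form \<xi>) \<alpha> = \<xi> \<alpha>"
  proof
    fix x
    show "component_forms (sum_form \<xi>) \<alpha> x = \<xi> \<alpha> x"
    proof (cases "x \<in> carrier (V \<alpha>)")
      case True
      have "(\<Sum>\<beta>\<in>E. \<xi> \<beta> (inc \<alpha> x \<beta>)) = (\<Sum>\<beta>\<in>E. if \<beta> = \<alpha> then \<xi> \<alpha> x else 0)"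
        by (rule sum.cong[OF refl]) (use form_zero[OF \<xi>f V] in \<open>auto simp: inc_apply\<close>)
      then show ?thesis
        using True \<alpha> finE linD(3)[OF lin_inc[OF \<alpha>] True] by (simp add: component_forms_def sum_form_def)
    next
      case False
      then show ?thesis using \<alpha> extensional_arb[OF formD(1)[OF \<xi>f[OF \<alpha>]]] by (simp add: component_forms_def)
    qed
  qed
qed

end

section \<open>Evaluation against annihilators\<close>

lemma lin_eval:
  assumes p: "lin P (dual_space V) p" and V: "vsp V"
  shows "lin V (dual_space P) (\<lambda>v. \<lambda>\<eta>\<in>carrier P. p \<eta> v)"
proof (rule linI[OF V vsp_dual_space[OF linD(1)[OF p]]])
  note P = linD(1)[OF p]
  have pf: "p \<eta> \<in> forms V" if "\<eta> \<in> carrier P" for \<eta> using linD(3)[OF p that] .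
  fix v assume v: "v \<in> carrier V"
  show "(\<lambda>\<eta>\<in>carrier P. p \<eta> v) \<in> forms P"
    unfolding form_iff using v vsp_simps[OF P] linD(4,5)[OF p] by auto
  show "(\<lambda>\<eta>\<in>carrier P. p \<eta> (c \<odot>\<^bsub>V\<^esub> v)) = c \<odot>\<^bsub>dual_space P\<^esub> (\<lambda>\<eta>\<in>carrier P. p \<eta> v)" for c
    using formD(3)[OF pf v] by (auto intro!: restrict_ext)
  fix w assume w: "w \<in> carrier V"
  show "(\<lambda>\<eta>\<in>carrier P. p \<eta> (v \<oplus>\<^bsub>V\<^esub> w)) = (\<lambda>\<eta>\<in>carrier P. p \<eta> v) \<oplus>\<^bsub>dual_space P\<^esub> (\<lambda>\<eta>\<in>carrier P. p \<eta> w)"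
    using formD(2)[OF pf v w] by (auto intro!: restrict_ext)
qed

lemma lin_transpose:
  assumes f: "lin V W f"
  shows "lin (dual_space W) (dual_space V) (\<lambda>\<xi>. \<lambda>x\<in>carrier V. \<xi> (f x))"
proof (rule linI[OF vsp_dual_space[OF linD(2)[OF f]] vsp_dual_space[OF linD(1)[OF f]] form_comp[OF f]])
  note fW = linD(3)[OF f]
  show "(\<lambda>x\<in>carrier V. (\<xi> \<oplus>\<^bsub>dual_space W\<^esub> \<eta>) (f x))
      = (\<lambda>x\<in>carrier V. \<xi> (f x)) \<oplus>\<^bsub>dual_space V\<^esub> (\<lambda>x\<in>carrier V. \<eta> (f x))" for \<xi> \<eta>
    using fW by (auto intro!: restrict_ext)
  show "(\<lambda>x\<in>carrier V. (c \<odot>\<^bsub>dual_space W\<^esub> \<xi>) (f x)) = c \<odot>\<^bsub>dual_space V\<^esub> (\<lambda>x\<in>carrier V. \<xi> (f x))" for c \<xi>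
    using fW by (auto intro!: restrict_ext)
qed

text \<open>The situation that duality produces at every vertex: \<open>p\<close> identifies \<open>P\<close> with the annihilator of \<open>B\<close> in
  the dual of \<open>V\<close>. Then evaluation identifies \<open>V/B\<close> with the dual of \<open>P\<close>. At the reflected vertex \<open>V\<close> is
  the sum over the arrows and \<open>B\<close> the image of the space at that vertex; at the other vertices \<open>B = 0\<close>.\<close>

locale annihilator =
  fixes V :: "('k::field, 'v) module" and B :: "'v set" and P :: "('k, 'p) module" and p :: "'p \<Rightarrow> 'v \<Rightarrow> 'k"
  assumes V: "vsp V" "fdim V" and B: "sub V B" and p: "lin P (dual_space V) p"
    and inj: "\<And>\<eta>. \<eta> \<in> carrier P \<Longrightarrow> p \<eta> = \<zero>\<^bsub>dual_space V\<^esub> \<Longrightarrow> \<eta> = \<zero>\<^bsub>P\<^esub>"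
    and image: "p ` carrier P = {\<xi> \<in> forms V. \<forall>b\<in>B. \<xi> b = 0}"
begin

abbreviation "ev v \<equiv> (\<lambda>\<eta>\<in>carrier P. p \<eta> v)"

lemma P: "vsp P" by (rule linD(1)[OF p])

lemma p_form: "\<eta> \<in> carrier P \<Longrightarrow> p \<eta> \<in> forms V" by (rule linD(3)[OF p])

lemma p_zero: "\<eta> \<in> carrier P \<Longrightarrow> b \<in> B \<Longrightarrow> p \<eta> b = 0" using image by blast

lemma p_inj:
  assumes "\<eta> \<in> carrier P" "\<theta> \<in> carrier P" "p \<eta> = p \<theta>" shows "\<eta> = \<theta>"
proof -
  have "p (\<eta> \<oplus>\<^bsub>P\<^esub> (- 1) \<odot>\<^bsub>P\<^esub> \<theta>) = \<zero>\<^bsub>dual_space V\<^esub>"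
    using assms vsp_neg[OF vsp_dual_space[OF V(1)] p_form[OF assms(2)]]
    by (simp add: linD(4,5)[OF p] vsp_smult[OF P] del: dual_space_simps)
  then have "\<eta> \<oplus>\<^bsub>P\<^esub> (- 1) \<odot>\<^bsub>P\<^esub> \<theta> = \<zero>\<^bsub>P\<^esub>" using assms by (intro inj vsp_add[OF P] vsp_smult[OF P])
  then have "(\<eta> \<oplus>\<^bsub>P\<^esub> (- 1) \<odot>\<^bsub>P\<^esub> \<theta>) \<oplus>\<^bsub>P\<^esub> \<theta> = \<theta>" using assms by (simp add: vsp_l0[OF P])
  then show ?thesis using assms by (simp add: vsp_assoc[OF P] vsp_smult[OF P] vsp_neg'[OF P] vsp_r0[OF P])
qed

lemma ev_zero_iff:
  assumes v: "v \<in> carrier V" shows "ev v = \<zero>\<^bsub>dual_space P\<^esub> \<longleftrightarrow> v \<in> B"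
proof
  assume 0: "ev v = \<zero>\<^bsub>dual_space P\<^esub>"
  show "v \<in> B"
  proof (rule ccontr)
    assume "v \<notin> B"
    then obtain \<xi> where \<xi>: "\<xi> \<in> forms V" "\<xi> v = 1" "\<And>u. u \<in> B \<Longrightarrow> \<xi> u = 0"
      using ex_separating_form[OF V B v] by metis
    then have "\<xi> \<in> p ` carrier P" unfolding image by simp
    then obtain \<eta> where \<eta>: "\<eta> \<in> carrier P" "\<xi> = p \<eta>" by blast
    have "ev v \<eta> = 0" unfolding 0 using \<eta>(1) by simp
    then show False using \<eta> \<xi>(2) by simp
  qed
next
  assume "v \<in> B"
  then show "ev v = \<zero>\<^bsub>dual_space P\<^esub>" using p_zero by (auto intro!: restrict_ext)
qed

lemma ev_surj: "\<Lambda> \<in> forms P \<Longrightarrow> \<exists>v\<in>carrier V. \<Lambda> = ev v"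
proof -
  assume L: "\<Lambda> \<in> forms P"
  let ?A = "p ` carrier P"
  \<comment> \<open>\<open>\<Lambda>\<close> is carried over along \<open>p\<close> to its image, a subspace of the dual of \<open>V\<close>, where \<open>biduality\<close> applies\<close>
  define r where "r = inv_into (carrier P) p"
  have r: "r (p \<eta>) = \<eta>" if "\<eta> \<in> carrier P" for \<eta>
    unfolding r_def by (rule inv_into_f_f) (use p_inj that in \<open>auto intro!: inj_onI\<close>)
  obtain v where v: "v \<in> carrier V" "\<And>\<xi>. \<xi> \<in> ?A \<Longrightarrow> \<Lambda> (r \<xi>) = \<xi> v"
  proof (rule biduality[OF V lin_image_sub[OF p sub_carrier[OF P]], where \<Lambda> = "\<lambda>\<xi>. \<Lambda> (r \<xi>)"])
    show "\<Lambda> (r (\<xi> \<oplus>\<^bsub>dual_space V\<^esub> \<eta>)) = \<Lambda> (r \<xi>) + \<Lambda> (r \<eta>)" if "\<xi> \<in> ?A" "\<eta> \<in> ?A" for \<xi> \<eta>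
    proof -
      obtain x y where xy: "x \<in> carrier P" "\<xi> = p x" "y \<in> carrier P" "\<eta> = p y" using \<open>\<xi> \<in> ?A\<close> \<open>\<eta> \<in> ?A\<close> by blast
      have "\<xi> \<oplus>\<^bsub>dual_space V\<^esub> \<eta> = p (x \<oplus>\<^bsub>P\<^esub> y)" unfolding xy(2,4) by (rule linD(4)[OF p xy(1,3), symmetric])
      then have "r (\<xi> \<oplus>\<^bsub>dual_space V\<^esub> \<eta>) = x \<oplus>\<^bsub>P\<^esub> y" using r[OF vsp_add[OF P xy(1,3)]] by (simp only:)
      then show ?thesis using formD(2)[OF L xy(1,3)] by (simp only: xy(2,4) r[OF xy(1)] r[OF xy(3)])
    qed
    show "\<Lambda> (r (c \<odot>\<^bsub>dual_space V\<^esub> \<xi>)) = c * \<Lambda> (r \<xi>)" if "\<xi> \<in> ?A" for c \<xi>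
    proof -
      obtain x where x: "x \<in> carrier P" "\<xi> = p x" using \<open>\<xi> \<in> ?A\<close> by blast
      have "c \<odot>\<^bsub>dual_space V\<^esub> \<xi> = p (c \<odot>\<^bsub>P\<^esub> x)" unfolding x(2) by (rule linD(5)[OF p x(1), symmetric])
      then have "r (c \<odot>\<^bsub>dual_space V\<^esub> \<xi>) = c \<odot>\<^bsub>P\<^esub> x" using r[OF vsp_smult[OF P x(1)]] by (simp only:)
      then show ?thesis using formD(3)[OF L x(1)] by (simp only: x(2) r[OF x(1)])
    qed
  qed blast
  have "\<Lambda> = ev v"
  proof
    fix \<eta>
    show "\<Lambda> \<eta> = ev v \<eta>"
    proof (cases "\<eta> \<in> carrier P")
      case True
      then show ?thesis using v(2)[of "p \<eta>"] r[OF True] by simp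
    next
      case False
      then show ?thesis using extensional_arb[OF formD(1)[OF L]] by simp
    qed
  qed
  with v(1) show ?thesis by blast
qed

text \<open>The outer annihilator is taken in the dual of \<open>P\<close>, that is in \<open>V/B\<close>, so that \<open>W\<close> is recovered up to
  \<open>B\<close>, which evaluation forgets.\<close>

lemma double_annihilator:
  assumes W: "sub V W"
  shows "{\<Lambda> \<in> forms P. \<forall>\<eta>\<in>carrier P. (\<forall>w\<in>W. p \<eta> w = 0) \<longrightarrow> \<Lambda> \<eta> = 0} = ev ` W"
proof (intro equalityI subsetI)
  fix \<Lambda> assume L: "\<Lambda> \<in> {\<Lambda> \<in> forms P. \<forall>\<eta>\<in>carrier P. (\<forall>w\<in>W. p \<eta> w = 0) \<longrightarrow> \<Lambda> \<eta> = 0}"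
  obtain v where v: "v \<in> carrier V" "\<Lambda> = ev v" using ev_surj L by blast
  note e = lin_eval[OF p V(1)]
  \<comment> \<open>\<open>v\<close> lies in \<open>B + W\<close>, because a form that separates it from \<open>B + W\<close> comes from \<open>P\<close>.\<close>
  define C where "C = {b \<oplus>\<^bsub>V\<^esub> w | b w. b \<in> B \<and> w \<in> W}"
  have BV: "b \<in> carrier V" if "b \<in> B" for b using subD(2)[OF B] that by blast
  have WV: "w \<in> carrier V" if "w \<in> W" for w using subD(2)[OF W] that by blast
  have inC: "b \<oplus>\<^bsub>V\<^esub> w \<in> C" if "b \<in> B" "w \<in> W" for b w using that unfolding C_def by blast
  have C: "sub V C"
    unfolding sub_iff[OF V(1)]
  proof (intro conjI ballI allI subsetI)
    show "x \<in> carrier V" if "x \<in> C" for x using that BV WV vsp_add[OF V(1)] unfolding C_def by blast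
    show "\<zero>\<^bsub>V\<^esub> \<in> C" using inC[OF subD(3)[OF B] subD(3)[OF W]] by (simp add: vsp_simps[OF V(1)])
  next
    fix x y assume "x \<in> C" "y \<in> C"
    then obtain b w b' w' where bw: "b \<in> B" "w \<in> W" "b' \<in> B" "w' \<in> W" "x = b \<oplus>\<^bsub>V\<^esub> w" "y = b' \<oplus>\<^bsub>V\<^esub> w'"
      unfolding C_def by blast
    have "x \<oplus>\<^bsub>V\<^esub> y = (b \<oplus>\<^bsub>V\<^esub> b') \<oplus>\<^bsub>V\<^esub> (w \<oplus>\<^bsub>V\<^esub> w')"
      using bw by (simp add: vsp_simps[OF V(1)] vsp_assoc[OF V(1)] vsp_lcomm[OF V(1)] BV WV)
    then show "x \<oplus>\<^bsub>V\<^esub> y \<in> C" using inC[OF subD(4)[OF B bw(1,3)] subD(4)[OF W bw(2,4)]] by simp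
  next
    fix c x assume "x \<in> C"
    then obtain b w where bw: "b \<in> B" "w \<in> W" "x = b \<oplus>\<^bsub>V\<^esub> w" unfolding C_def by blast
    then have "c \<odot>\<^bsub>V\<^esub> x = c \<odot>\<^bsub>V\<^esub> b \<oplus>\<^bsub>V\<^esub> c \<odot>\<^bsub>V\<^esub> w" by (simp add: vsp_distr[OF V(1)] BV WV)
    then show "c \<odot>\<^bsub>V\<^esub> x \<in> C" using inC[OF subD(5)[OF B bw(1)] subD(5)[OF W bw(2)]] by simp
  qed
  have BC: "b \<in> C" if "b \<in> B" for b
    using inC[OF that subD(3)[OF W]] by (simp add: BV[OF that] vsp_simps[OF V(1)])
  have WC: "w \<in> C" if "w \<in> W" for w
    using inC[OF subD(3)[OF B] that] by (simp add: WV[OF that] vsp_simps[OF V(1)])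
  have "v \<in> C"
  proof (rule ccontr)
    assume "v \<notin> C"
    then obtain \<xi> where \<xi>: "\<xi> \<in> forms V" "\<xi> v = 1" "\<And>u. u \<in> C \<Longrightarrow> \<xi> u = 0"
      using ex_separating_form[OF V C v(1)] by metis
    then have "\<xi> \<in> p ` carrier P" unfolding image using BC by simp
    then obtain \<eta> where \<eta>: "\<eta> \<in> carrier P" "\<xi> = p \<eta>" by blast
    have "\<Lambda> \<eta> = 0" using L \<eta> \<xi>(3) WC by blast
    then show False using \<eta> \<xi>(2) v(2) by simp
  qed
  then obtain b w where bw: "b \<in> B" "w \<in> W" "v = b \<oplus>\<^bsub>V\<^esub> w" unfolding C_def by blast
  have "ev v = ev b \<oplus>\<^bsub>dual_space P\<^esub> ev w" unfolding bw(3) by (rule linD(4)[OF e BV[OF bw(1)] WV[OF bw(2)]])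
  also have "\<dots> = ev w"
    using ev_zero_iff[OF BV[OF bw(1)]] bw(1) vsp_l0[OF linD(2)[OF e] linD(3)[OF e WV[OF bw(2)]]]
    by (simp del: dual_space_simps)
  finally show "\<Lambda> \<in> ev ` W" using v(2) bw(2) by blast
next
  fix \<Lambda> assume "\<Lambda> \<in> ev ` W"
  then obtain w where w: "w \<in> W" "\<Lambda> = ev w" by blast
  have "ev w \<in> forms P" using linD(3)[OF lin_eval[OF p V(1)]] w(1) subD(2)[OF W] by blast
  then show "\<Lambda> \<in> {\<Lambda> \<in> forms P. \<forall>\<eta>\<in>carrier P. (\<forall>w\<in>W. p \<eta> w = 0) \<longrightarrow> \<Lambda> \<eta> = 0}"
    using w by simp
qed

end

section \<open>Locally polynomial families of subspaces\<close>

lemma det_mat_cols: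
  "det (mat n n (\<lambda>(s, t). f s t)) = (\<Sum>p | p permutes {0..<n}. signof p * (\<Prod>t\<in>{0..<n}. (f (p t) t :: 'k::field)))"
proof -
  have "det (mat n n (\<lambda>(s, t). f s t)) = (\<Sum>p | p permutes {0..<n}. signof p * (\<Prod>t\<in>{0..<n}. mat n n (\<lambda>(s, t). f s t) $$ (p t, t)))"
    using det_col[of "mat n n (\<lambda>(s, t). f s t)" n] by (simp add: lessThan_atLeast0)
  also have "\<dots> = (\<Sum>p | p permutes {0..<n}. signof p * (\<Prod>t\<in>{0..<n}. f (p t) t))"
  proof (intro sum.cong refl arg_cong2[where f="(*)"] prod.cong)
    fix p t assume "p \<in> {p. p permutes {0..<n}}" "t \<in> {0..<n}"
    then show "mat n n (\<lambda>(s, t). f s t) $$ (p t, t) = f (p t) t"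
      using permutes_in_image[of p "{0..<n}" t] by simp
  qed
  finally show ?thesis .
qed

lemma det_scale_cols:
  "det (mat n n (\<lambda>(s, t). c t * f s t)) = (\<Prod>t\<in>{0..<n}. c t) * (det (mat n n (\<lambda>(s, t). f s t)) :: 'k::field)"
  unfolding det_mat_cols by (simp add: prod.distrib sum_distrib_left algebra_simps)

locale flags =
  fixes Q :: "('i, 'e) pre_digraph" and \<nu> :: nat and d :: "nat \<Rightarrow> 'i \<Rightarrow> int"
    and M :: "('i, 'e, 'k::field, 'v) quiver_rep" and X :: "('i, 'v) flag set"
  assumes finQ: "finite (verts Q)" and rep: "is_rep Q M" and X: "X \<subseteq> Fl Q \<nu> d M"
begin

abbreviation "Zar \<equiv> zariski_topology Q \<nu> d M X"
abbreviation "mh \<equiv> multihom Q \<nu> d M"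
abbreviation "fr \<equiv> frame_of Q \<nu> M"

lemma topspace_Zar: "topspace Zar = X"
  using topspace_flag_variety[of Q \<nu> d M X] by (simp add: flag_variety_def)

lemma openin_nonvanishing: "mh m F \<Longrightarrow> openin Zar {U \<in> X. F (fr U) \<noteq> 0}"
  unfolding zariski_topology_def by (rule topology_generated_by_Basis) blast

lemma openin_whole: "openin Zar X"
  using openin_topspace[of Zar] by (simp add: topspace_Zar)

lemma openin_sub: "openin Zar N \<Longrightarrow> N \<subseteq> X"
  using openin_subset[of Zar N] by (simp add: topspace_Zar)

lemma rspace_vsp: "i \<in> verts Q \<Longrightarrow> vsp (rspace M i)" "i \<in> verts Q \<Longrightarrow> fdim (rspace M i)"
  using rep by (auto simp: is_rep_def)

lemma flag_sub: "U \<in> X \<Longrightarrow> l \<le> \<nu> \<Longrightarrow> i \<in> verts Q \<Longrightarrow> sub (rspace M i) (U l i)"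
  using X by (auto simp: Fl_def is_subrep_def)

lemma flag_dim: "U \<in> X \<Longrightarrow> l \<le> \<nu> \<Longrightarrow> i \<in> verts Q \<Longrightarrow> int (vdim ((rspace M i)\<lparr>carrier := U l i\<rparr>)) = d l i"
  using X by (auto simp: Fl_def dimension_vector_def subrep_def)

lemma frame_fr:
  assumes U: "U \<in> X" and li: "l \<le> \<nu>" "i \<in> verts Q"
  shows "frame (rspace M i) (U l i) (fr U l i)" "int (length (fr U l i)) = d l i"
proof -
  have "\<exists>ws. l \<le> \<nu> \<and> i \<in> verts Q \<longrightarrow> frame (rspace M i) (U l i) ws" for l i
    using ex_frame[OF rspace_vsp flag_sub[OF U]] by metis
  then obtain b where b: "\<And>l i. l \<le> \<nu> \<Longrightarrow> i \<in> verts Q \<Longrightarrow> frame (rspace M i) (U l i) (b l i)" by metis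
  have "is_frame Q \<nu> M U b"
    unfolding is_frame_def using b basis_iff_frame[OF flag_sub[OF U]] by blast
  then have "is_frame Q \<nu> M U (fr U)" unfolding frame_of_def by (rule someI[of "is_frame Q \<nu> M U"])
  then show fr: "frame (rspace M i) (U l i) (fr U l i)"
    unfolding is_frame_def using li basis_iff_frame[OF flag_sub[OF U li]] by blast
  show "int (length (fr U l i)) = d l i"
    using frame_dim(1)[OF flag_sub[OF U li] fr] flag_dim[OF U li] by simp
qed

lemma mh_scale: "mh m F \<Longrightarrow> mh m (\<lambda>b. c * F b)"
  using multihom.mult[OF multihom.const[of Q \<nu> d M c], of m F] by simp

lemma mh_sum:
  assumes "finite T" "T \<noteq> {}" "\<And>t. t \<in> T \<Longrightarrow> mh m (F t)"
  shows "mh m (\<lambda>b. \<Sum>t\<in>T. F t b)"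
  using assms by (induction T rule: finite_ne_induct) (auto intro: multihom.add)

lemma mh_prod:
  assumes "finite T" "\<And>t. t \<in> T \<Longrightarrow> mh (e t) (F t)"
  shows "mh (\<lambda>l i. \<Sum>t\<in>T. e t l i) (\<lambda>b. \<Prod>t\<in>T. F t b)"
  using assms
proof (induction T rule: finite_induct)
  case empty
  then show ?case using multihom.const[of Q \<nu> d M 1] by simp
next
  case (insert t T)
  then show ?case using multihom.mult[of Q \<nu> d M "e t" "F t" "\<lambda>l i. \<Sum>t\<in>T. e t l i"] by simp
qed

text \<open>Every term of the Leibniz formula takes one entry from each column. The determinant is therefore
  homogeneous as soon as the degree of an entry depends on its column only.\<close>

lemma mh_det:
  assumes "\<And>s t. s < n \<Longrightarrow> t < n \<Longrightarrow> mh (e t) (F s t)"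
  shows "mh (\<lambda>l i. \<Sum>t\<in>{0..<n}. e t l i) (\<lambda>b. det (mat n n (\<lambda>(s, t). F s t b)))"
  unfolding det_mat_cols
proof (rule mh_sum)
  show "finite {p. p permutes {0..<n}}" by (simp add: finite_permutations)
  show "{p. p permutes {0..<n}} \<noteq> {}" using permutes_id by blast
  fix p assume "p \<in> {p. p permutes {0..<n}}"
  then have "p t < n" if "t < n" for t using permutes_in_image[of p "{0..<n}" t] that by simp
  then show "mh (\<lambda>l i. \<Sum>t\<in>{0..<n}. e t l i) (\<lambda>b. signof p * (\<Prod>t\<in>{0..<n}. F (p t) t b))"
    by (intro mh_scale mh_prod assms) auto
qed

text \<open>On the open set \<open>N\<close> the subspaces \<open>S U\<close> have bases \<open>b U\<close> whose Pluecker coordinates are polynomials \<open>P \<xi>s\<close>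
  in the coordinates of \<open>U\<close>, up to a factor \<open>c U\<close>. The factor and the degree \<open>e\<close> must be the same for all
  \<open>\<xi>s\<close>: both then cancel in quotients of equal degree. The factor absorbs the bases chosen by
  \<^const>\<open>frame_of\<close>, which do not vary with \<open>U\<close> in any regular way.\<close>

definition chart where
  "chart E S n N e b c P \<longleftrightarrow>
     openin Zar N \<and>
     (\<forall>U\<in>N. frame E (S U) (b U) \<and> length (b U) = n \<and> c U \<noteq> 0) \<and>
     (\<forall>\<xi>s. set \<xi>s \<subseteq> forms E \<and> length \<xi>s = n \<longrightarrow>
        mh e (P \<xi>s) \<and> (\<forall>U\<in>N. pluecker_coord \<xi>s (b U) = c U * P \<xi>s (fr U)))"

definition locpoly :: "('k, 'w) module \<Rightarrow> (('i, 'v) flag \<Rightarrow> 'w set) \<Rightarrow> nat \<Rightarrow> ('i, 'v) flag \<Rightarrow> bool" where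
  "locpoly E S n U0 \<longleftrightarrow> (\<exists>N e b c P. chart E S n N e b c P \<and> U0 \<in> N)"

lemma locpolyI:
  assumes "openin Zar N" "U0 \<in> N" "\<And>U. U \<in> N \<Longrightarrow> frame E (S U) (b U)" "\<And>U. U \<in> N \<Longrightarrow> length (b U) = n"
    "\<And>U. U \<in> N \<Longrightarrow> c U \<noteq> 0"
    "\<And>\<xi>s. set \<xi>s \<subseteq> forms E \<Longrightarrow> length \<xi>s = n \<Longrightarrow>
       \<exists>P. mh e P \<and> (\<forall>U\<in>N. pluecker_coord \<xi>s (b U) = c U * P (fr U))"
  shows "locpoly E S n U0"
proof -
  let ?T = "{\<xi>s. set \<xi>s \<subseteq> forms E \<and> length \<xi>s = n}"
  have "\<forall>\<xi>s\<in>?T. \<exists>P. mh e P \<and> (\<forall>U\<in>N. pluecker_coord \<xi>s (b U) = c U * P (fr U))"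
    using assms(6) by simp
  from bchoice[OF this] obtain P where
    P: "\<forall>\<xi>s\<in>?T. mh e (P \<xi>s) \<and> (\<forall>U\<in>N. pluecker_coord \<xi>s (b U) = c U * P \<xi>s (fr U))" ..
  have "chart E S n N e b c P"
    unfolding chart_def using assms(1,3-5) P by simp
  with assms(2) show ?thesis unfolding locpoly_def by blast
qed

lemma chartD:
  assumes "chart E S n N e b c P" "U0 \<in> N"
  shows "openin Zar N" "U0 \<in> N" "\<And>U. U \<in> N \<Longrightarrow> frame E (S U) (b U)" "\<And>U. U \<in> N \<Longrightarrow> length (b U) = n"
    "\<And>U. U \<in> N \<Longrightarrow> c U \<noteq> 0"
    "\<And>\<xi>s. set \<xi>s \<subseteq> forms E \<Longrightarrow> length \<xi>s = n \<Longrightarrow> mh e (P \<xi>s)"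
    "\<And>\<xi>s U. set \<xi>s \<subseteq> forms E \<Longrightarrow> length \<xi>s = n \<Longrightarrow> U \<in> N \<Longrightarrow> pluecker_coord \<xi>s (b U) = c U * P \<xi>s (fr U)"
  using assms by (simp_all add: chart_def)

lemma locpoly_coord:
  assumes "U0 \<in> X" "l \<le> \<nu>" "i \<in> verts Q"
  shows "locpoly (rspace M i) (\<lambda>U. U l i) (nat (d l i)) U0"
proof (rule locpolyI[where N = X and b = "\<lambda>U. fr U l i" and c = "\<lambda>_. 1"
      and e = "\<lambda>l' i'. if l' = l \<and> i' = i then 1 else 0"])
  fix \<xi>s assume "set \<xi>s \<subseteq> forms (rspace M i)" "length \<xi>s = nat (d l i)"
  moreover have "0 \<le> d l i" using flag_dim[OF assms] by (metis of_nat_0_le_iff)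
  ultimately show "\<exists>P. mh (\<lambda>l' i'. if l' = l \<and> i' = i then 1 else 0) P \<and> (\<forall>U\<in>X. pluecker_coord \<xi>s (fr U l i) = 1 * P (fr U))"
    using assms by (intro exI[of _ "\<lambda>b. pluecker_coord \<xi>s (b l i)"] conjI multihom.coord) auto
next
  fix U assume "U \<in> X"
  then show "length (fr U l i) = nat (d l i)" using frame_fr(2)[of U l i] assms by simp
qed (use assms openin_whole frame_fr in auto)

lemma locpoly_cong:
  assumes "locpoly E S n U0" and "\<And>U. U \<in> X \<Longrightarrow> S U = S' U"
  shows "locpoly E S' n U0"
proof -
  obtain N e b c P where "chart E S n N e b c P" "U0 \<in> N"
    using assms(1) unfolding locpoly_def by blast
  note N = chartD[OF this]
  show ?thesis
  proof (rule locpolyI[OF N(1,2) _ N(4,5)])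
    fix U assume U: "U \<in> N"
    then have "U \<in> X" using openin_sub[OF N(1)] by blast
    then show "frame E (S' U) (b U)" using N(3)[OF U] assms(2) by simp
  qed (use N(6,7) in blast)+
qed

text \<open>The coordinates of the image are those of \<open>S U\<close> at the pulled back forms.\<close>

lemma locpoly_image:
  assumes f: "lin E F f" and inj: "\<And>U x. U \<in> X \<Longrightarrow> x \<in> S U \<Longrightarrow> f x = \<zero>\<^bsub>F\<^esub> \<Longrightarrow> x = \<zero>\<^bsub>E\<^esub>"
    and S: "\<And>U. U \<in> X \<Longrightarrow> sub E (S U)" and lp: "locpoly E S n U0"
  shows "locpoly F (\<lambda>U. f ` S U) n U0"
proof -
  obtain N e b c P where "chart E S n N e b c P" "U0 \<in> N"
    using lp unfolding locpoly_def by blast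
  note N = chartD[OF this]
  have NX: "U \<in> X" if "U \<in> N" for U using openin_sub[OF N(1)] that by blast
  show ?thesis
  proof (rule locpolyI[where N = N and b = "\<lambda>U. map f (b U)" and c = c and e = e])
    fix U assume U: "U \<in> N"
    show "frame F (f ` S U) (map f (b U))"
      by (rule frame_image[OF f _ S[OF NX[OF U]] N(3)[OF U]]) (rule inj[OF NX[OF U]])
  next
    fix \<xi>s assume \<xi>s: "set \<xi>s \<subseteq> forms F" "length \<xi>s = n"
    let ?\<eta>s = "map (\<lambda>\<xi>. \<lambda>x\<in>carrier E. \<xi> (f x)) \<xi>s"
    have \<eta>s: "set ?\<eta>s \<subseteq> forms E" "length ?\<eta>s = n" using \<xi>s form_comp[OF f] by auto
    have "pluecker_coord \<xi>s (map f (b U)) = c U * P ?\<eta>s (fr U)" if U: "U \<in> N" for U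
      using pluecker_map[OF f frameD(3)[OF N(3)[OF U]], of \<xi>s] N(7)[OF \<eta>s U] N(4)[OF U] \<xi>s(2) by simp
    with N(6)[OF \<eta>s] show "\<exists>P. mh e P \<and> (\<forall>U\<in>N. pluecker_coord \<xi>s (map f (b U)) = c U * P (fr U))" by blast
  qed (use N in simp_all)
qed

text \<open>The matrix of values on a concatenated basis mixes values on both parts, so the two
  determinants alone do not determine its determinant. For the bases given by Cramer's rule the
  single values are coordinates, hence polynomials, and so is the determinant of the whole matrix.\<close>

lemma locpoly_direct_sum:
  assumes f: "lin E F f" and fd: "fdim E" "fdim F"
    and S: "\<And>U. U \<in> X \<Longrightarrow> sub E (S U)" and T: "\<And>U. U \<in> X \<Longrightarrow> sub F (T U)"
    and inj: "\<And>U x y. U \<in> X \<Longrightarrow> x \<in> S U \<Longrightarrow> y \<in> T U \<Longrightarrow> f x \<oplus>\<^bsub>F\<^esub> y = \<zero>\<^bsub>F\<^esub> \<Longrightarrow> x = \<zero>\<^bsub>E\<^esub> \<and> y = \<zero>\<^bsub>F\<^esub>"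
    and lp: "locpoly E S n U0" "locpoly F T m U0"
  shows "locpoly F (\<lambda>U. {f x \<oplus>\<^bsub>F\<^esub> y | x y. x \<in> S U \<and> y \<in> T U}) (n + m) U0"
proof -
  note E = linD(1)[OF f] and F = linD(2)[OF f]
  obtain N1 e1 b1 c1 P1 where "chart E S n N1 e1 b1 c1 P1" "U0 \<in> N1"
    using lp(1) unfolding locpoly_def by blast
  note N1 = chartD[OF this]
  obtain N2 e2 b2 c2 P2 where "chart F T m N2 e2 b2 c2 P2" "U0 \<in> N2"
    using lp(2) unfolding locpoly_def by blast
  note N2 = chartD[OF this]
  obtain \<zeta> where \<zeta>: "set \<zeta> \<subseteq> forms E" "length \<zeta> = n" "pluecker_coord \<zeta> (b1 U0) = 1"
    using ex_pluecker_one[OF E fd(1) frameD(5)[OF N1(3)[OF N1(2)]]] N1(4)[OF N1(2)] by metis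
  obtain \<theta> where \<theta>: "set \<theta> \<subseteq> forms F" "length \<theta> = m" "pluecker_coord \<theta> (b2 U0) = 1"
    using ex_pluecker_one[OF F fd(2) frameD(5)[OF N2(3)[OF N2(2)]]] N2(4)[OF N2(2)] by metis
  \<comment> \<open>the coordinates at \<open>\<zeta>\<close> and \<open>\<theta>\<close> do not vanish at \<open>U0\<close>, so this is a neighbourhood of \<open>U0\<close>\<close>
  define N where "N = N1 \<inter> N2 \<inter> {U \<in> X. P1 \<zeta> (fr U) \<noteq> 0} \<inter> {U \<in> X. P2 \<theta> (fr U) \<noteq> 0}"
  define b where "b U = map f (cramer_frame E \<zeta> (b1 U)) @ cramer_frame F \<theta> (b2 U)" for U
  \<comment> \<open>the first \<open>n\<close> columns carry the factor of the first family, the others that of the second\<close>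
  define cc where "cc U t = (if t < n then c1 U else c2 U)" for U t
  define c where "c U = (\<Prod>t\<in>{0..<n + m}. cc U t)" for U
  define e where "e l i = (\<Sum>t\<in>{0..<n + m}. (if t < n then e1 else e2) l i)" for l i
  have NX: "U \<in> X" if "U \<in> N" for U using that by (simp add: N_def)
  have N12: "U \<in> N1" "U \<in> N2" if "U \<in> N" for U using that by (simp_all add: N_def)
  show ?thesis
  proof (rule locpolyI[where N = N and b = b and c = c and e = e])
    show "openin Zar N" unfolding N_def
      by (intro openin_Int N1(1) N2(1) openin_nonvanishing[OF N1(6)[OF \<zeta>(1,2)]] openin_nonvanishing[OF N2(6)[OF \<theta>(1,2)]])
    have "U0 \<in> X" using openin_sub[OF N1(1)] N1(2) by blast
    moreover have "P1 \<zeta> (fr U0) \<noteq> 0" "P2 \<theta> (fr U0) \<noteq> 0"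
      using N1(7)[OF \<zeta>(1,2) N1(2)] \<zeta>(3) N2(7)[OF \<theta>(1,2) N2(2)] \<theta>(3) by auto
    ultimately show "U0 \<in> N" using N1(2) N2(2) by (simp add: N_def)
  next
    fix U assume U: "U \<in> N"
    note UX = NX[OF U] and U1 = N12(1)[OF U] and U2 = N12(2)[OF U]
    have "pluecker_coord \<zeta> (b1 U) \<noteq> 0" "pluecker_coord \<theta> (b2 U) \<noteq> 0"
      using N1(7)[OF \<zeta>(1,2) U1] N1(5)[OF U1] N2(7)[OF \<theta>(1,2) U2] N2(5)[OF U2] U by (simp_all add: N_def)
    then have "frame E (S U) (cramer_frame E \<zeta> (b1 U))" "frame F (T U) (cramer_frame F \<theta> (b2 U))"
      using frame_cramer_frame[OF E fd(1) S[OF UX] N1(3)[OF U1] \<zeta>(1)] N1(4)[OF U1] \<zeta>(2)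
        frame_cramer_frame[OF F fd(2) T[OF UX] N2(3)[OF U2] \<theta>(1)] N2(4)[OF U2] \<theta>(2) by simp_all
    then show "frame F {f x \<oplus>\<^bsub>F\<^esub> y | x y. x \<in> S U \<and> y \<in> T U} (b U)"
      unfolding b_def by (intro frame_direct_sum[OF f S[OF UX] T[OF UX] inj[OF UX]])
    show "length (b U) = n + m" using N1(4)[OF U1] N2(4)[OF U2] by (simp add: b_def)
    show "c U \<noteq> 0" using N1(5)[OF U1] N2(5)[OF U2] by (simp add: c_def cc_def)
  next
    fix \<xi>s assume \<xi>s: "set \<xi>s \<subseteq> forms F" "length \<xi>s = n + m"
    define R1 where "R1 s t = \<zeta>[t := \<lambda>x\<in>carrier E. (\<xi>s ! s) (f x)]" for s t
    define R2 where "R2 s t = \<theta>[t - n := \<xi>s ! s]" for s t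
    have \<xi>: "\<xi>s ! s \<in> forms F" if "s < n + m" for s using nth_subset[OF \<xi>s(1)] that \<xi>s(2) by simp
    have R1: "set (R1 s t) \<subseteq> forms E" "length (R1 s t) = n" if "s < n + m" for s t
      using set_update_subset_insert[of \<zeta> t "\<lambda>x\<in>carrier E. (\<xi>s ! s) (f x)"] \<zeta>(1,2) form_comp[OF f \<xi>[OF that]]
      unfolding R1_def by auto
    have R2: "set (R2 s t) \<subseteq> forms F" "length (R2 s t) = m" if "s < n + m" for s t
      using set_update_subset_insert[of \<theta> "t - n" "\<xi>s ! s"] \<theta>(1,2) \<xi>[OF that]
      unfolding R2_def by auto
    define G where "G s t = (if t < n then P1 (R1 s t) else P2 (R2 s t))" for s t
    have "mh (\<lambda>l i. \<Sum>t\<in>{0..<n + m}. (if t < n then e1 else e2) l i) (\<lambda>b. det (mat (n + m) (n + m) (\<lambda>(s, t). G s t b)))"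
    proof (rule mh_det)
      fix s t assume st: "s < n + m" "t < n + m"
      show "mh (if t < n then e1 else e2) (G s t)"
        using N1(6)[OF R1[OF st(1)]] N2(6)[OF R2[OF st(1)]] by (simp add: G_def)
    qed
    then have mh: "mh e (\<lambda>b. det (mat (n + m) (n + m) (\<lambda>(s, t). G s t b)))" by (simp add: e_def[abs_def])
    have "pluecker_coord \<xi>s (b U) = c U * det (mat (n + m) (n + m) (\<lambda>(s, t). G s t (fr U)))" if U: "U \<in> N" for U
    proof -
      note U1 = N12(1)[OF U] and U2 = N12(2)[OF U]
      note l1 = N1(4)[OF U1] and l2 = N2(4)[OF U2]
      note b1V = frameD(3)[OF N1(3)[OF U1]] and b2V = frameD(3)[OF N2(3)[OF U2]]
      have lb: "length (b U) = n + m" by (simp add: b_def l1 l2)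
      have fcE: "cramer_frame E \<zeta> (b1 U) ! t \<in> carrier E" if "t < n" for t
        using that lcomb_closed[OF E b1V] by (simp add: cramer_frame_def l1)
      have "value_mat \<xi>s (b U) = mat (n + m) (n + m) (\<lambda>(s, t). cc U t * G s t (fr U))"
      proof (rule eq_matI)
        fix s t assume "s < dim_row (mat (n + m) (n + m) (\<lambda>(s, t). cc U t * G s t (fr U)))"
          "t < dim_col (mat (n + m) (n + m) (\<lambda>(s, t). cc U t * G s t (fr U)))"
        then have st: "s < n + m" "t < n + m" by auto
        have "(\<xi>s ! s) (b U ! t) = cc U t * G s t (fr U)"
        proof (cases "t < n")
          case True
          have "(\<xi>s ! s) (b U ! t) = (\<lambda>x\<in>carrier E. (\<xi>s ! s) (f x)) (cramer_frame E \<zeta> (b1 U) ! t)"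
            using True fcE[OF True] by (simp add: b_def nth_append l1)
          also have "\<dots> = pluecker_coord (R1 s t) (b1 U)"
            unfolding R1_def using \<zeta>(2) l1 True
            by (intro cramer_frame_value[OF E b1V _ form_comp[OF f \<xi>[OF st(1)]]]) simp_all
          finally show ?thesis using True N1(7)[OF R1[OF st(1)] U1] by (simp add: cc_def G_def)
        next
          case False
          have "(\<xi>s ! s) (b U ! t) = (\<xi>s ! s) (cramer_frame F \<theta> (b2 U) ! (t - n))"
            using False by (simp add: b_def nth_append l1)
          also have "\<dots> = pluecker_coord (R2 s t) (b2 U)"
            unfolding R2_def using \<theta>(2) l2 False st
            by (intro cramer_frame_value[OF F b2V _ \<xi>[OF st(1)]]) simp_all
          finally show ?thesis using False N2(7)[OF R2[OF st(1)] U2] by (simp add: cc_def G_def)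
        qed
        then show "value_mat \<xi>s (b U) $$ (s, t) = mat (n + m) (n + m) (\<lambda>(s, t). cc U t * G s t (fr U)) $$ (s, t)"
          using st by (simp add: value_mat_def lb)
      qed (simp_all add: value_mat_def lb)
      then show ?thesis by (simp add: pluecker_det det_scale_cols c_def)
    qed
    with mh show "\<exists>P. mh e P \<and> (\<forall>U\<in>N. pluecker_coord \<xi>s (b U) = c U * P (fr U))" by blast
  qed
qed

text \<open>By \<open>pluecker_exact\<close> a coordinate of the kernel at \<open>\<xi>s\<close>, times the coordinate of the image at a fixed \<open>\<eta>\<close>, is
  a coordinate of \<open>W U\<close> at \<open>\<xi>s\<close> followed by the pulled back \<open>\<eta>\<close>. With \<open>\<eta>\<close> chosen so that the coordinate of
  the image does not vanish at \<open>U0\<close>, hence nearby, that coordinate goes into the factor \<open>c\<close>.\<close>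

lemma locpoly_kernel:
  assumes f: "lin E F f" and fd: "fdim E" "fdim F" and W: "\<And>U. U \<in> X \<Longrightarrow> sub E (W U)"
    and lp: "locpoly E W n U0" "locpoly F (\<lambda>U. f ` W U) r U0"
  shows "locpoly E (\<lambda>U. {x \<in> W U. f x = \<zero>\<^bsub>F\<^esub>}) (n - r) U0"
proof -
  note E = linD(1)[OF f] and F = linD(2)[OF f]
  obtain N1 e1 b1 c1 P1 where "chart E W n N1 e1 b1 c1 P1" "U0 \<in> N1"
    using lp(1) unfolding locpoly_def by blast
  note N1 = chartD[OF this]
  obtain N2 e2 b2 c2 P2 where "chart F (\<lambda>U. f ` W U) r N2 e2 b2 c2 P2" "U0 \<in> N2"
    using lp(2) unfolding locpoly_def by blast
  note N2 = chartD[OF this]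
  obtain \<eta> where \<eta>: "set \<eta> \<subseteq> forms F" "length \<eta> = r" "pluecker_coord \<eta> (b2 U0) = 1"
    using ex_pluecker_one[OF F fd(2) frameD(5)[OF N2(3)[OF N2(2)]]] N2(4)[OF N2(2)] by metis
  define N where "N = N1 \<inter> N2 \<inter> {U \<in> X. P2 \<eta> (fr U) \<noteq> 0}"
  have N: "U \<in> X" "U \<in> N1" "U \<in> N2" "P2 \<eta> (fr U) \<noteq> 0" if "U \<in> N" for U using that by (simp_all add: N_def)
  let ?\<eta>f = "map (\<lambda>\<eta>. \<lambda>x\<in>carrier E. \<eta> (f x)) \<eta>"
  define good where "good U ks D \<longleftrightarrow> frame E {x \<in> W U. f x = \<zero>\<^bsub>F\<^esub>} ks \<and> n = length ks + r \<and> D \<noteq> 0 \<and>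
    (\<forall>\<xi>s. set \<xi>s \<subseteq> forms E \<and> length \<xi>s = length ks \<longrightarrow>
      pluecker_coord \<xi>s ks * pluecker_coord \<eta> (b2 U) = D * pluecker_coord (\<xi>s @ ?\<eta>f) (b1 U))" for U ks D
  have "\<exists>ks D. good U ks D" if "U \<in> N" for U
  proof -
    note UX = N(1)[OF that] and U1 = N(2)[OF that] and U2 = N(3)[OF that]
    obtain ks where ks: "frame E {x \<in> W U. f x = \<zero>\<^bsub>F\<^esub>} ks"
      using ex_frame[OF E fd(1) lin_kernel_sub[OF f W[OF UX]]] .
    obtain D where D: "D \<noteq> 0" "length (b1 U) = length ks + length (b2 U)"
      "\<forall>\<xi>s \<eta>s. set \<xi>s \<subseteq> forms E \<longrightarrow> length \<xi>s = length ks \<longrightarrow> set \<eta>s \<subseteq> forms F \<longrightarrow> length \<eta>s = length (b2 U) \<longrightarrow>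
       pluecker_coord \<xi>s ks * pluecker_coord \<eta>s (b2 U)
         = D * pluecker_coord (\<xi>s @ map (\<lambda>\<eta>. \<lambda>x\<in>carrier E. \<eta> (f x)) \<eta>s) (b1 U)"
      using pluecker_exact[OF f fd(1) W[OF UX] N1(3)[OF U1] ks N2(3)[OF U2]] by (elim exE conjE) (rule that)
    have "\<forall>\<xi>s. set \<xi>s \<subseteq> forms E \<and> length \<xi>s = length ks \<longrightarrow>
      pluecker_coord \<xi>s ks * pluecker_coord \<eta> (b2 U) = D * pluecker_coord (\<xi>s @ ?\<eta>f) (b1 U)"
      using D(3) \<eta>(1,2) N2(4)[OF U2] by simp
    moreover have "n = length ks + r" using D(2) N1(4)[OF U1] N2(4)[OF U2] by simp
    ultimately have "good U ks D" unfolding good_def using ks D(1) by blast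
    then show ?thesis by blast
  qed
  then obtain b D where good: "\<And>U. U \<in> N \<Longrightarrow> good U (b U) (D U)" by metis
  have b: "frame E {x \<in> W U. f x = \<zero>\<^bsub>F\<^esub>} (b U)" "n = length (b U) + r" "D U \<noteq> 0"
    "\<And>\<xi>s. set \<xi>s \<subseteq> forms E \<Longrightarrow> length \<xi>s = length (b U) \<Longrightarrow>
      pluecker_coord \<xi>s (b U) * pluecker_coord \<eta> (b2 U) = D U * pluecker_coord (\<xi>s @ ?\<eta>f) (b1 U)"
    if "U \<in> N" for U
    using good[OF that] unfolding good_def by blast+
  show ?thesis
  proof (rule locpolyI[where N = N and b = b and c = "\<lambda>U. D U * c1 U / (c2 U * P2 \<eta> (fr U))" and e = e1])
    show "openin Zar N" unfolding N_def
      by (intro openin_Int N1(1) N2(1) openin_nonvanishing[OF N2(6)[OF \<eta>(1,2)]])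
    have "U0 \<in> X" using openin_sub[OF N1(1)] N1(2) by blast
    moreover have "P2 \<eta> (fr U0) \<noteq> 0" using N2(7)[OF \<eta>(1,2) N2(2)] \<eta>(3) by auto
    ultimately show U0: "U0 \<in> N" using N1(2) N2(2) by (simp add: N_def)
    fix U assume U: "U \<in> N"
    show "frame E {x \<in> W U. f x = \<zero>\<^bsub>F\<^esub>} (b U)" by (rule b(1)[OF U])
    show "length (b U) = n - r" using b(2)[OF U] by simp
    show "D U * c1 U / (c2 U * P2 \<eta> (fr U)) \<noteq> 0"
      using b(3)[OF U] N1(5)[OF N(2)[OF U]] N2(5)[OF N(3)[OF U]] N(4)[OF U] by simp
  next
    fix \<xi>s assume \<xi>s: "set \<xi>s \<subseteq> forms E" "length \<xi>s = n - r"
    have rn: "r \<le> n"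
    proof -
      have "U0 \<in> X" using openin_sub[OF N1(1)] N1(2) by blast
      moreover have "P2 \<eta> (fr U0) \<noteq> 0" using N2(7)[OF \<eta>(1,2) N2(2)] \<eta>(3) by auto
      ultimately have "U0 \<in> N" using N1(2) N2(2) by (simp add: N_def)
      from b(2)[OF this] show ?thesis by simp
    qed
    have \<xi>f: "set (\<xi>s @ ?\<eta>f) \<subseteq> forms E" "length (\<xi>s @ ?\<eta>f) = n"
      using \<xi>s \<eta>(1,2) rn form_comp[OF f] by auto
    have "pluecker_coord \<xi>s (b U) = D U * c1 U / (c2 U * P2 \<eta> (fr U)) * P1 (\<xi>s @ ?\<eta>f) (fr U)" if U: "U \<in> N" for U
      using b(4)[OF U \<xi>s(1)] b(2)[OF U] \<xi>s(2) N1(7)[OF \<xi>f N(2)[OF U]] N2(7)[OF \<eta>(1,2) N(3)[OF U]]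
        N2(5)[OF N(3)[OF U]] N(4)[OF U]
      by (simp add: field_simps)
    with N1(6)[OF \<xi>f] show "\<exists>P. mh e1 P \<and> (\<forall>U\<in>N. pluecker_coord \<xi>s (b U) = D U * c1 U / (c2 U * P2 \<eta> (fr U)) * P (fr U))"
      by blast
  qed
qed

text \<open>As for the kernel, with the roles exchanged: now a tuple \<open>\<zeta>\<close> is fixed at which the coordinate of the
  kernel does not vanish.\<close>

lemma locpoly_quotient:
  assumes f: "lin E F f" and fd: "fdim E" "fdim F" and W: "\<And>U. U \<in> X \<Longrightarrow> sub E (W U)"
    and lp: "locpoly E W n U0" "locpoly E (\<lambda>U. {x \<in> W U. f x = \<zero>\<^bsub>F\<^esub>}) k U0"
  shows "locpoly F (\<lambda>U. f ` W U) (n - k) U0"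
proof -
  note E = linD(1)[OF f] and F = linD(2)[OF f]
  obtain N1 e1 b1 c1 P1 where "chart E W n N1 e1 b1 c1 P1" "U0 \<in> N1"
    using lp(1) unfolding locpoly_def by blast
  note N1 = chartD[OF this]
  obtain N2 e2 b2 c2 P2 where "chart E (\<lambda>U. {x \<in> W U. f x = \<zero>\<^bsub>F\<^esub>}) k N2 e2 b2 c2 P2" "U0 \<in> N2"
    using lp(2) unfolding locpoly_def by blast
  note N2 = chartD[OF this]
  obtain \<zeta> where \<zeta>: "set \<zeta> \<subseteq> forms E" "length \<zeta> = k" "pluecker_coord \<zeta> (b2 U0) = 1"
    using ex_pluecker_one[OF E fd(1) frameD(5)[OF N2(3)[OF N2(2)]]] N2(4)[OF N2(2)] by metis
  define N where "N = N1 \<inter> N2 \<inter> {U \<in> X. P2 \<zeta> (fr U) \<noteq> 0}"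
  have N: "U \<in> X" "U \<in> N1" "U \<in> N2" "P2 \<zeta> (fr U) \<noteq> 0" if "U \<in> N" for U using that by (simp_all add: N_def)
  let ?f = "map (\<lambda>\<eta>. \<lambda>x\<in>carrier E. \<eta> (f x))"
  define good where "good U rs D \<longleftrightarrow> frame F (f ` W U) rs \<and> n = k + length rs \<and> D \<noteq> 0 \<and>
    (\<forall>\<eta>s. set \<eta>s \<subseteq> forms F \<and> length \<eta>s = length rs \<longrightarrow>
      pluecker_coord \<zeta> (b2 U) * pluecker_coord \<eta>s rs = D * pluecker_coord (\<zeta> @ ?f \<eta>s) (b1 U))" for U rs D
  have "\<exists>rs D. good U rs D" if "U \<in> N" for U
  proof -
    note UX = N(1)[OF that] and U1 = N(2)[OF that] and U2 = N(3)[OF that]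
    obtain rs where rs: "frame F (f ` W U) rs"
      using ex_frame[OF F fd(2) lin_image_sub[OF f W[OF UX]]] .
    obtain D where D: "D \<noteq> 0" "length (b1 U) = length (b2 U) + length rs"
      "\<forall>\<xi>s \<eta>s. set \<xi>s \<subseteq> forms E \<longrightarrow> length \<xi>s = length (b2 U) \<longrightarrow> set \<eta>s \<subseteq> forms F \<longrightarrow> length \<eta>s = length rs \<longrightarrow>
       pluecker_coord \<xi>s (b2 U) * pluecker_coord \<eta>s rs
         = D * pluecker_coord (\<xi>s @ map (\<lambda>\<eta>. \<lambda>x\<in>carrier E. \<eta> (f x)) \<eta>s) (b1 U)"
      using pluecker_exact[OF f fd(1) W[OF UX] N1(3)[OF U1] N2(3)[OF U2] rs] by (elim exE conjE) (rule that)
    have "\<forall>\<eta>s. set \<eta>s \<subseteq> forms F \<and> length \<eta>s = length rs \<longrightarrow>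
      pluecker_coord \<zeta> (b2 U) * pluecker_coord \<eta>s rs = D * pluecker_coord (\<zeta> @ ?f \<eta>s) (b1 U)"
      using D(3) \<zeta>(1,2) N2(4)[OF U2] by simp
    moreover have "n = k + length rs" using D(2) N1(4)[OF U1] N2(4)[OF U2] by simp
    ultimately have "good U rs D" unfolding good_def using rs D(1) by blast
    then show ?thesis by blast
  qed
  then obtain b D where good: "\<And>U. U \<in> N \<Longrightarrow> good U (b U) (D U)" by metis
  have b: "frame F (f ` W U) (b U)" "n = k + length (b U)" "D U \<noteq> 0"
    "\<And>\<eta>s. set \<eta>s \<subseteq> forms F \<Longrightarrow> length \<eta>s = length (b U) \<Longrightarrow>
      pluecker_coord \<zeta> (b2 U) * pluecker_coord \<eta>s (b U) = D U * pluecker_coord (\<zeta> @ ?f \<eta>s) (b1 U)"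
    if "U \<in> N" for U
    using good[OF that] unfolding good_def by blast+
  have U0: "U0 \<in> N"
  proof -
    have "U0 \<in> X" using openin_sub[OF N1(1)] N1(2) by blast
    moreover have "P2 \<zeta> (fr U0) \<noteq> 0" using N2(7)[OF \<zeta>(1,2) N2(2)] \<zeta>(3) by auto
    ultimately show ?thesis using N1(2) N2(2) by (simp add: N_def)
  qed
  show ?thesis
  proof (rule locpolyI[where N = N and b = b and c = "\<lambda>U. D U * c1 U / (c2 U * P2 \<zeta> (fr U))" and e = e1])
    show "openin Zar N" unfolding N_def
      by (intro openin_Int N1(1) N2(1) openin_nonvanishing[OF N2(6)[OF \<zeta>(1,2)]])
    show "U0 \<in> N" by (rule U0)
    fix U assume U: "U \<in> N"
    show "frame F (f ` W U) (b U)" by (rule b(1)[OF U])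
    show "length (b U) = n - k" using b(2)[OF U] by simp
    show "D U * c1 U / (c2 U * P2 \<zeta> (fr U)) \<noteq> 0"
      using b(3)[OF U] N1(5)[OF N(2)[OF U]] N2(5)[OF N(3)[OF U]] N(4)[OF U] by simp
  next
    fix \<eta>s assume \<eta>s: "set \<eta>s \<subseteq> forms F" "length \<eta>s = n - k"
    have \<xi>f: "set (\<zeta> @ ?f \<eta>s) \<subseteq> forms E" "length (\<zeta> @ ?f \<eta>s) = n"
      using \<eta>s \<zeta>(1,2) b(2)[OF U0] form_comp[OF f] by auto
    have "pluecker_coord \<eta>s (b U) = D U * c1 U / (c2 U * P2 \<zeta> (fr U)) * P1 (\<zeta> @ ?f \<eta>s) (fr U)" if U: "U \<in> N" for U
      using b(4)[OF U \<eta>s(1)] b(2)[OF U] \<eta>s(2) N1(7)[OF \<xi>f N(2)[OF U]] N2(7)[OF \<zeta>(1,2) N(3)[OF U]]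
        N2(5)[OF N(3)[OF U]] N(4)[OF U]
      by (simp add: field_simps)
    with N1(6)[OF \<xi>f] show "\<exists>P. mh e1 P \<and> (\<forall>U\<in>N. pluecker_coord \<eta>s (b U) = D U * c1 U / (c2 U * P2 \<zeta> (fr U)) * P (fr U))"
      by blast
  qed
qed

lemma locpoly_zero:
  assumes E: "vsp E" and U0: "U0 \<in> X" shows "locpoly E (\<lambda>U. {\<zero>\<^bsub>E\<^esub>}) 0 U0"
proof (rule locpolyI[where N = X and b = "\<lambda>U. []" and c = "\<lambda>_. 1" and e = "\<lambda>_ _. 0"])
  fix \<xi>s :: "('b \<Rightarrow> 'k) list"
  show "\<exists>P. mh (\<lambda>_ _. 0) P \<and> (\<forall>U\<in>X. pluecker_coord \<xi>s [] = 1 * P (fr U))"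
    by (rule exI[of _ "\<lambda>_. pluecker_coord \<xi>s []"]) (simp add: multihom.const)
qed (use U0 openin_whole in \<open>simp_all add: frame_def indep_Nil lcomb_Nil[OF E]\<close>)

lemma locpoly_PiE:
  assumes E: "sum_spaces I V" and U0: "U0 \<in> X"
    and A: "\<And>U \<alpha>. U \<in> X \<Longrightarrow> \<alpha> \<in> I \<Longrightarrow> sub (V \<alpha>) (A U \<alpha>)"
    and lp: "\<And>\<alpha>. \<alpha> \<in> I \<Longrightarrow> locpoly (V \<alpha>) (\<lambda>U. A U \<alpha>) (n \<alpha>) U0"
  shows "locpoly (sum_space I V) (\<lambda>U. \<Pi>\<^sub>E \<alpha>\<in>I. A U \<alpha>) (\<Sum>\<alpha>\<in>I. n \<alpha>) U0"
proof -
  interpret sum_spaces I V by (rule E)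
  have "locpoly S (\<lambda>U. prod_sub (A U) B) (\<Sum>\<alpha>\<in>B. n \<alpha>) U0" if "B \<subseteq> I" for B
    using finite_subset[OF that finE] that
  proof (induction B rule: finite_induct)
    case empty
    show ?case unfolding prod_sub_empty sum.empty by (rule locpoly_zero[OF vsp_S U0])
  next
    case (insert \<alpha> B)
    then have \<alpha>: "\<alpha> \<in> I" "\<alpha> \<notin> B" "B \<subseteq> I" by auto

    have sum: "locpoly S (\<lambda>U. {inc \<alpha> x \<oplus>\<^bsub>S\<^esub> y | x y. x \<in> A U \<alpha> \<and> y \<in> prod_sub (A U) B}) (n \<alpha> + (\<Sum>\<alpha>\<in>B. n \<alpha>)) U0"
    proof (rule locpoly_direct_sum[OF lin_inc[OF \<alpha>(1)] fdV[OF \<alpha>(1)] fdim_S])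
      fix U assume U: "U \<in> X"
      show "sub (V \<alpha>) (A U \<alpha>)" by (rule A[OF U \<alpha>(1)])
      show "sub S (prod_sub (A U) B)" by (rule sub_prod_sub) (rule A[OF U])
      fix x y assume xy: "x \<in> A U \<alpha>" "y \<in> prod_sub (A U) B" "inc \<alpha> x \<oplus>\<^bsub>S\<^esub> y = \<zero>\<^bsub>S\<^esub>"
      show "x = \<zero>\<^bsub>V \<alpha>\<^esub> \<and> y = \<zero>\<^bsub>S\<^esub>"
        by (rule prod_sub_insert(2)[OF _ \<alpha>(1,2) xy]) (rule A[OF U])
    next
      show "locpoly (V \<alpha>) (\<lambda>U. A U \<alpha>) (n \<alpha>) U0" by (rule lp[OF \<alpha>(1)])
      show "locpoly S (\<lambda>U. prod_sub (A U) B) (\<Sum>\<alpha>\<in>B. n \<alpha>) U0" by (rule insert.IH[OF \<alpha>(3)])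
    qed
    have "prod_sub (A U) (insert \<alpha> B) = {inc \<alpha> x \<oplus>\<^bsub>S\<^esub> y | x y. x \<in> A U \<alpha> \<and> y \<in> prod_sub (A U) B}"
      if U: "U \<in> X" for U by (rule prod_sub_insert(1)[OF _ \<alpha>(1,2)]) (rule A[OF U])
    then have "locpoly S (\<lambda>U. prod_sub (A U) (insert \<alpha> B)) (n \<alpha> + (\<Sum>\<alpha>\<in>B. n \<alpha>)) U0"
      by (intro locpoly_cong[OF sum]) (rule sym)
    then show ?case using insert.hyps by simp
  qed
  from this[OF order_refl] show ?thesis unfolding prod_sub_whole .
qed

text \<open>Forms on \<open>K\<close> extend to \<open>E\<close>, and the coordinates of a subspace of \<open>K\<close> do not see the extension.\<close>

lemma locpoly_restrict:
  assumes E: "vsp E" "fdim E" and K: "sub E K" and S: "\<And>U. U \<in> X \<Longrightarrow> S U \<subseteq> K"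
    and lp: "locpoly E S n U0"
  shows "locpoly (E\<lparr>carrier := K\<rparr>) S n U0"
proof -
  obtain N e b c P where "chart E S n N e b c P" "U0 \<in> N"
    using lp unfolding locpoly_def by blast
  note N = chartD[OF this]
  have NX: "U \<in> X" if "U \<in> N" for U using openin_sub[OF N(1)] that by blast
  show ?thesis
  proof (rule locpolyI[where N = N and b = b and c = c and e = e])
    fix U assume U: "U \<in> N"
    show "frame (E\<lparr>carrier := K\<rparr>) (S U) (b U)" using frame_sub_iff[OF K S[OF NX[OF U]]] N(3)[OF U] by blast
  next
    fix \<xi>s assume \<xi>s: "set \<xi>s \<subseteq> forms (E\<lparr>carrier := K\<rparr>)" "length \<xi>s = n"
    have "\<exists>\<eta>. \<xi> \<in> set \<xi>s \<longrightarrow> \<eta> \<in> forms E \<and> (\<forall>x\<in>K. \<eta> x = \<xi> x)" for \<xi>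
    proof (cases "\<xi> \<in> set \<xi>s")
      case True
      then have "\<xi> \<in> forms (E\<lparr>carrier := K\<rparr>)" using \<xi>s(1) by blast
      then obtain \<eta> where "\<eta> \<in> forms E" "\<And>x. x \<in> K \<Longrightarrow> \<eta> x = \<xi> x" by (rule form_extend[OF E K]) blast
      then show ?thesis by blast
    qed simp
    then obtain \<epsilon> where \<epsilon>: "\<And>\<xi>. \<xi> \<in> set \<xi>s \<Longrightarrow> \<epsilon> \<xi> \<in> forms E \<and> (\<forall>x\<in>K. \<epsilon> \<xi> x = \<xi> x)" by metis
    have \<eta>s: "set (map \<epsilon> \<xi>s) \<subseteq> forms E" "length (map \<epsilon> \<xi>s) = n" using \<epsilon> \<xi>s(2) by auto
    show "\<exists>P. mh e P \<and> (\<forall>U\<in>N. pluecker_coord \<xi>s (b U) = c U * P (fr U))"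
    proof (intro exI conjI ballI)
      show "mh e (P (map \<epsilon> \<xi>s))" by (rule N(6)[OF \<eta>s])
      fix U assume U: "U \<in> N"
      have bK: "set (b U) \<subseteq> K" using frameD(1)[OF N(3)[OF U]] S[OF NX[OF U]] by blast
      have "value_mat \<xi>s (b U) = value_mat (map \<epsilon> \<xi>s) (b U)"
      proof (rule eq_matI)
        fix s t assume "s < dim_row (value_mat (map \<epsilon> \<xi>s) (b U))" "t < dim_col (value_mat (map \<epsilon> \<xi>s) (b U))"
        then have st: "s < length (b U)" "t < length (b U)" by (simp_all add: value_mat_def)
        then have "s < length \<xi>s" using N(4)[OF U] \<xi>s(2) by simp
        moreover have "b U ! t \<in> K" using st(2) bK by (meson nth_mem subsetD)
        ultimately show "value_mat \<xi>s (b U) $$ (s, t) = value_mat (map \<epsilon> \<xi>s) (b U) $$ (s, t)"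
          using st \<epsilon>[of "\<xi>s ! s"] by (simp add: value_mat_def)
      qed (simp_all add: value_mat_def)
      then show "pluecker_coord \<xi>s (b U) = c U * P (map \<epsilon> \<xi>s) (fr U)"
        using N(7)[OF \<eta>s U] by (simp add: pluecker_det)
    qed
  qed (use N(1,2,4,5) in blast)+
qed

lemma locpoly_num:
  assumes lp: "locpoly E S n U0" and S: "sub E (S U0)" shows "vdim (E\<lparr>carrier := S U0\<rparr>) = n"
proof -
  obtain N e b c P where "chart E S n N e b c P" "U0 \<in> N"
    using lp unfolding locpoly_def by blast
  note N = chartD[OF this]
  show ?thesis using frame_dim(1)[OF S N(3)[OF N(2)]] N(4)[OF N(2)] by simp
qed

end

section \<open>A criterion for morphisms\<close>

locale flag_map = S: flags Q \<nu> d M X + T: flags Q' \<nu> d' M' Y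
  for Q :: "('i, 'e) pre_digraph" and \<nu> d and M :: "('i, 'e, 'k::field, 'v) quiver_rep" and X
    and Q' :: "('j, 'f) pre_digraph" and d' and M' :: "('j, 'f, 'k, 'w) quiver_rep" and Y +
  fixes g :: "('i, 'v) flag \<Rightarrow> ('j, 'w) flag"
  assumes maps: "U \<in> X \<Longrightarrow> g U \<in> Y"
    and locally_polynomial: "U \<in> X \<Longrightarrow> l \<le> \<nu> \<Longrightarrow> i \<in> verts Q' \<Longrightarrow>
      \<exists>n. S.locpoly (rspace M' i) (\<lambda>U. g U l i) n U"
begin

lemma locpoly:
  assumes U: "U \<in> X" and li: "l \<le> \<nu>" "i \<in> verts Q'"
  shows "S.locpoly (rspace M' i) (\<lambda>U. g U l i) (nat (d' l i)) U"
proof -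
  obtain n where n: "S.locpoly (rspace M' i) (\<lambda>U. g U l i) n U" using locally_polynomial[OF U li] ..
  have "n = nat (d' l i)"
    using S.locpoly_num[OF n T.flag_sub[OF maps[OF U] li]] T.flag_dim[OF maps[OF U] li] by simp
  then show ?thesis using n by simp
qed

abbreviation "pairs \<equiv> {..\<nu>} \<times> verts Q'"

lemma finite_pairs: "finite pairs"
  using T.finQ by simp

lemma pullback_coord:
  assumes U0: "U0 \<in> X" and li: "l \<le> \<nu>" "i \<in> verts Q'"
  shows "\<exists>N e c P. openin S.Zar N \<and> U0 \<in> N \<and> (\<forall>U\<in>N. c U \<noteq> 0) \<and>
    (\<forall>\<xi>s. set \<xi>s \<subseteq> forms (rspace M' i) \<and> int (length \<xi>s) = d' l i \<longrightarrow>
      S.mh e (P \<xi>s) \<and> (\<forall>U\<in>N. pluecker_coord \<xi>s (T.fr (g U) l i) = c U * P \<xi>s (S.fr U)))"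
proof -
  obtain N e b c P where "S.chart (rspace M' i) (\<lambda>U. g U l i) (nat (d' l i)) N e b c P" "U0 \<in> N"
    using locpoly[OF U0 li] unfolding S.locpoly_def by blast
  note N = S.chartD[OF this]
  define good where "good U D \<longleftrightarrow> D \<noteq> 0 \<and>
    (\<forall>\<xi>s. set \<xi>s \<subseteq> forms (rspace M' i) \<and> int (length \<xi>s) = d' l i \<longrightarrow>
      pluecker_coord \<xi>s (T.fr (g U) l i) = D * pluecker_coord \<xi>s (b U))" for U D
  have "\<exists>D. good U D" if U: "U \<in> N" for U
  proof -
    have Y: "g U \<in> Y" using S.openin_sub[OF N(1)] U maps by blast
    note len = N(4)[OF U]
    have d: "int (length (T.fr (g U) l i)) = d' l i" by (rule T.frame_fr(2)[OF Y li])
    obtain D where D: "D \<noteq> 0" "\<And>\<xi>s. set \<xi>s \<subseteq> forms (rspace M' i) \<Longrightarrow> length \<xi>s = length (b U) \<Longrightarrow>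
        pluecker_coord \<xi>s (T.fr (g U) l i) = D * pluecker_coord \<xi>s (b U)"
      by (rule pluecker_frames[OF T.rspace_vsp[OF li(2)] T.flag_sub[OF Y li] N(3)[OF U] T.frame_fr(1)[OF Y li]]) blast
    have "length \<xi>s = length (b U)" if "int (length \<xi>s) = d' l i" for \<xi>s :: "('w \<Rightarrow> 'k) list"
      using that d len by linarith
    then have "good U D" unfolding good_def using D by simp
    then show ?thesis ..
  qed
  then obtain D where good: "\<And>U. U \<in> N \<Longrightarrow> good U (D U)" by metis
  show ?thesis
  proof (rule exI[of _ N], rule exI[of _ e], rule exI[of _ "\<lambda>U. D U * c U"], rule exI[of _ P],
      intro conjI allI impI ballI)
    fix U assume U: "U \<in> N"
    show "D U * c U \<noteq> 0" using good[OF U] N(5)[OF U] by (simp add: good_def)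
  next
    fix \<xi>s :: "('w \<Rightarrow> 'k) list"
    assume \<xi>s: "set \<xi>s \<subseteq> forms (rspace M' i) \<and> int (length \<xi>s) = d' l i"
    then have \<xi>s': "set \<xi>s \<subseteq> forms (rspace M' i)" "length \<xi>s = nat (d' l i)" by linarith+
    show "S.mh e (P \<xi>s)" by (rule N(6)[OF \<xi>s'])
    fix U assume U: "U \<in> N"
    show "pluecker_coord \<xi>s (T.fr (g U) l i) = D U * c U * P \<xi>s (S.fr U)"
      using good[OF U] \<xi>s N(7)[OF \<xi>s' U] by (simp add: good_def)
  qed (use N(1,2) in simp_all)
qed

text \<open>Substituting the coordinates of \<open>g U\<close> multiplies a monomial of multidegree \<open>m\<close> by \<open>C m U\<close>, the product of
  the factors \<open>c\<^sub>l\<^sub>i\<close> to the powers \<open>m l i\<close>. This depends on the multidegree alone, so it comes out of a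
  multihomogeneous polynomial. As there are only finitely many pairs \<open>(l, i)\<close>, one open set serves for all.\<close>

lemma pullback:
  assumes U0: "U0 \<in> X"
  shows "\<exists>N e C. openin S.Zar N \<and> U0 \<in> N \<and> (\<forall>m F. multihom Q' \<nu> d' M' m F \<longrightarrow>
    (\<exists>P. S.mh (e m) P \<and> (\<forall>U\<in>N. C m U \<noteq> 0 \<and> F (T.fr (g U)) = C m U * P (S.fr U))))"
proof -
  define good where "good l i N e c P \<longleftrightarrow> openin S.Zar N \<and> U0 \<in> N \<and> (\<forall>U\<in>N. c U \<noteq> 0) \<and>
    (\<forall>\<xi>s. set \<xi>s \<subseteq> forms (rspace M' i) \<and> int (length \<xi>s) = d' l i \<longrightarrow>
      S.mh e (P \<xi>s) \<and> (\<forall>U\<in>N. pluecker_coord \<xi>s (T.fr (g U) l i) = c U * P \<xi>s (S.fr U)))" for l i N e c P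
  have ex: "\<exists>N e c P. good l i N e c P" if "l \<le> \<nu>" "i \<in> verts Q'" for l i
    unfolding good_def by (rule pullback_coord[OF U0 that])
  then obtain N0 e0 c0 P0 where good: "\<And>l i. l \<le> \<nu> \<Longrightarrow> i \<in> verts Q' \<Longrightarrow> good l i (N0 l i) (e0 l i) (c0 l i) (P0 l i)"
    by metis
  define N where "N = X \<inter> (\<Inter>p\<in>pairs. N0 (fst p) (snd p))"
  define e where "e m = (\<lambda>l i. \<Sum>p\<in>pairs. m (fst p) (snd p) * e0 (fst p) (snd p) l i)" for m :: "nat \<Rightarrow> 'j \<Rightarrow> nat"
  define C where "C m U = (\<Prod>p\<in>pairs. c0 (fst p) (snd p) U ^ m (fst p) (snd p))" for m :: "nat \<Rightarrow> 'j \<Rightarrow> nat" and U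
  have op: "openin S.Zar N"
  proof (cases "pairs = {}")
    case True
    then show ?thesis by (simp add: N_def S.openin_whole)
  next
    case False
    have "openin S.Zar (\<Inter>p\<in>pairs. N0 (fst p) (snd p))"
      by (rule openin_INT2[OF finite_pairs False]) (use good in \<open>auto simp: good_def\<close>)
    then show ?thesis unfolding N_def by (intro openin_Int S.openin_whole)
  qed
  have U0N: "U0 \<in> N" using U0 good by (auto simp: N_def good_def)
  have NN: "U \<in> N0 l i" if "U \<in> N" "l \<le> \<nu>" "i \<in> verts Q'" for U l i
    using that by (auto simp: N_def)
  have C0: "C m U \<noteq> 0" if U: "U \<in> N" for m U
  proof -
    have "c0 (fst p) (snd p) U \<noteq> 0" if "p \<in> pairs" for p
      using good[of "fst p" "snd p"] NN[OF U, of "fst p" "snd p"] that by (auto simp: good_def)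
    then show ?thesis unfolding C_def prod_zero_iff[OF finite_pairs] by auto
  qed
  have "\<exists>P. S.mh (e m) P \<and> (\<forall>U\<in>N. F (T.fr (g U)) = C m U * P (S.fr U))" if "multihom Q' \<nu> d' M' m F" for m F
    using that
  proof (induction rule: multihom.induct)
    case (const c)
    show ?case by (rule exI[of _ "\<lambda>b. c"]) (use multihom.const[of Q \<nu> d M c] in \<open>simp add: e_def C_def\<close>)
  next
    case (coord l i \<xi>s)
    let ?m = "\<lambda>l' i'. if l' = l \<and> i' = i then 1 else 0 :: nat"
    note gd = good[OF coord(1,2), unfolded good_def]
    have mem: "(l, i) \<in> pairs" using coord by simp
    have "e ?m l' i' = e0 l i l' i'" for l' i'
    proof -
      have "e ?m l' i' = (\<Sum>p\<in>pairs. if p = (l, i) then e0 l i l' i' else 0)"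
        unfolding e_def by (rule sum.cong) auto
      then show ?thesis using mem finite_pairs by simp
    qed
    then have "e ?m = e0 l i" by (simp add: fun_eq_iff)
    moreover have "C ?m U = c0 l i U" for U
    proof -
      have "C ?m U = (\<Prod>p\<in>pairs. if p = (l, i) then c0 l i U else 1)"
        unfolding C_def by (rule prod.cong) auto
      then show ?thesis using mem finite_pairs by simp
    qed
    ultimately show ?case using gd coord NN[OF _ coord(1,2)] by (intro exI[of _ "P0 l i \<xi>s"]) simp
  next
    case (add m F G)
    then obtain P R where PR: "S.mh (e m) P" "\<forall>U\<in>N. F (T.fr (g U)) = C m U * P (S.fr U)"
      "S.mh (e m) R" "\<forall>U\<in>N. G (T.fr (g U)) = C m U * R (S.fr U)" by blast
    show ?case
      by (rule exI[of _ "\<lambda>b. P b + R b"]) (use PR in \<open>simp add: multihom.add algebra_simps\<close>)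
  next
    case (mult m F n G)
    then obtain P R where PR: "S.mh (e m) P" "\<forall>U\<in>N. F (T.fr (g U)) = C m U * P (S.fr U)"
      "S.mh (e n) R" "\<forall>U\<in>N. G (T.fr (g U)) = C n U * R (S.fr U)" by blast
    have "e (\<lambda>l i. m l i + n l i) = (\<lambda>l i. e m l i + e n l i)"
      by (simp add: e_def fun_eq_iff sum.distrib algebra_simps)
    moreover have "C (\<lambda>l i. m l i + n l i) U = C m U * C n U" for U
      by (simp add: C_def prod.distrib power_add)
    ultimately show ?case
      by (intro exI[of _ "\<lambda>b. P b * R b"]) (use PR multihom.mult[OF PR(1,3)] in simp)
  qed
  then have "\<forall>m F. multihom Q' \<nu> d' M' m F \<longrightarrow>
    (\<exists>P. S.mh (e m) P \<and> (\<forall>U\<in>N. C m U \<noteq> 0 \<and> F (T.fr (g U)) = C m U * P (S.fr U)))"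
    using C0 by blast
  with op U0N show ?thesis by blast
qed

lemma continuous: "continuous_map S.Zar T.Zar g"
  unfolding zariski_topology_def[of Q' \<nu> d' M' Y]
proof (rule continuous_on_generated_topo)
  fix B assume "B \<in> {{U \<in> Y. F (T.fr U) \<noteq> 0} | m F. multihom Q' \<nu> d' M' m F}"
  then obtain m F where B: "B = {U \<in> Y. F (T.fr U) \<noteq> 0}" and F: "multihom Q' \<nu> d' M' m F" by blast
  show "openin S.Zar (g -` B \<inter> topspace S.Zar)"
  proof (subst openin_subopen, safe)
    fix U0 assume "g U0 \<in> B" "U0 \<in> topspace S.Zar"
    then have U0: "U0 \<in> X" "F (T.fr (g U0)) \<noteq> 0" by (simp_all add: B S.topspace_Zar)
    obtain N e C where N: "openin S.Zar N" "U0 \<in> N" "\<forall>m F. multihom Q' \<nu> d' M' m F \<longrightarrow>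
        (\<exists>P. S.mh (e m) P \<and> (\<forall>U\<in>N. C m U \<noteq> 0 \<and> F (T.fr (g U)) = C m U * P (S.fr U)))"
      using pullback[OF U0(1)] by (elim exE conjE) (rule that)
    obtain P where P: "S.mh (e m) P" "\<forall>U\<in>N. C m U \<noteq> 0 \<and> F (T.fr (g U)) = C m U * P (S.fr U)"
      using N(3) F by blast
    have "openin S.Zar (N \<inter> {U \<in> X. P (S.fr U) \<noteq> 0})" by (intro openin_Int N(1) S.openin_nonvanishing[OF P(1)])
    moreover have "U0 \<in> N \<inter> {U \<in> X. P (S.fr U) \<noteq> 0}" using U0 N(2) P(2) by auto
    moreover have "N \<inter> {U \<in> X. P (S.fr U) \<noteq> 0} \<subseteq> g -` B \<inter> topspace S.Zar"
      using P(2) maps by (auto simp: B S.topspace_Zar)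
    ultimately show "\<exists>V. openin S.Zar V \<and> U0 \<in> V \<and> V \<subseteq> g -` B \<inter> topspace S.Zar" by blast
  qed
next
  have "topspace T.Zar = \<Union>{{U \<in> Y. F (T.fr U) \<noteq> 0} | m F. multihom Q' \<nu> d' M' m F}"
    unfolding zariski_topology_def by (rule topology_generated_by_topspace)
  then show "g ` topspace S.Zar \<subseteq> \<Union>{{U \<in> Y. F (T.fr U) \<noteq> 0} | m F. multihom Q' \<nu> d' M' m F}"
    using maps by (auto simp: T.topspace_Zar S.topspace_Zar)
qed

text \<open>Numerator and denominator of a regular function have the same multidegree, so they acquire the same
  factor.\<close>

lemma morphism: "variety_morphism (flag_variety Q \<nu> d M X) (flag_variety Q' \<nu> d' M' Y) g"
  unfolding variety_morphism_def
proof (intro conjI allI impI)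
  show "continuous_map (ztop (flag_variety Q \<nu> d M X)) (ztop (flag_variety Q' \<nu> d' M' Y)) g"
    using continuous by (simp add: flag_variety_def)
  fix W f assume Wf: "openin (ztop (flag_variety Q' \<nu> d' M' Y)) W \<and> f \<in> regular (flag_variety Q' \<nu> d' M' Y) W"
  let ?W = "{x \<in> topspace (ztop (flag_variety Q \<nu> d M X)). g x \<in> W}"
  show "f \<circ> g \<in> regular (flag_variety Q \<nu> d M X) ?W"
    unfolding flag_variety_def[of Q] variety.simps mem_Collect_eq
  proof (intro ballI)
    fix U0 assume "U0 \<in> {x \<in> topspace S.Zar. g x \<in> W}"
    then have U0: "U0 \<in> X" "g U0 \<in> W" by (simp_all add: S.topspace_Zar)
    obtain B m F G where B: "openin T.Zar B" "g U0 \<in> B" "B \<subseteq> W" "multihom Q' \<nu> d' M' m F" "multihom Q' \<nu> d' M' m G"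
      "\<forall>V\<in>B. G (T.fr V) \<noteq> 0 \<and> f V = F (T.fr V) / G (T.fr V)"
      using Wf U0(2) by (auto simp: flag_variety_def)
    obtain N e C where N: "openin S.Zar N" "U0 \<in> N" "\<forall>m F. multihom Q' \<nu> d' M' m F \<longrightarrow>
        (\<exists>P. S.mh (e m) P \<and> (\<forall>U\<in>N. C m U \<noteq> 0 \<and> F (T.fr (g U)) = C m U * P (S.fr U)))"
      using pullback[OF U0(1)] by (elim exE conjE) (rule that)
    obtain P where P: "S.mh (e m) P" "\<forall>U\<in>N. C m U \<noteq> 0 \<and> F (T.fr (g U)) = C m U * P (S.fr U)"
      using N(3) B(4) by blast
    obtain R where R: "S.mh (e m) R" "\<forall>U\<in>N. C m U \<noteq> 0 \<and> G (T.fr (g U)) = C m U * R (S.fr U)"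
      using N(3) B(5) by blast
    have pre: "openin S.Zar {U \<in> topspace S.Zar. g U \<in> B}"
      by (rule openin_continuous_map_preimage[OF continuous B(1)])
    define N' where "N' = N \<inter> {U \<in> topspace S.Zar. g U \<in> B}"
    have N': "U \<in> N" "U \<in> X" "g U \<in> B" if "U \<in> N'" for U using that by (simp_all add: N'_def S.topspace_Zar)
    have "openin S.Zar N'" unfolding N'_def by (rule openin_Int[OF N(1) pre])
    moreover have "U0 \<in> N'" using U0 N(2) B(2) by (simp add: N'_def S.topspace_Zar)
    moreover have "N' \<subseteq> {x \<in> topspace S.Zar. g x \<in> W}" using N' B(3) by (auto simp: S.topspace_Zar)
    moreover have "R (S.fr U) \<noteq> 0 \<and> (f \<circ> g) U = P (S.fr U) / R (S.fr U)" if U: "U \<in> N'" for U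
      using B(6) N'[OF U] P(2) R(2) by auto
    ultimately show "\<exists>N m F G. openin S.Zar N \<and> U0 \<in> N \<and> N \<subseteq> {x \<in> topspace S.Zar. g x \<in> W} \<and>
       S.mh m F \<and> S.mh m G \<and> (\<forall>U'\<in>N. G (S.fr U') \<noteq> 0 \<and> (f \<circ> g) U' = F (S.fr U') / G (S.fr U'))"
      using P(1) R(1) by (intro exI[of _ N'] exI[of _ "e m"] exI[of _ P] exI[of _ R]) simp
  qed
qed

end

section \<open>Reflection at a source\<close>

text \<open>Membership in a set of arcs at \<open>a\<close> selects the cases of the definitions; it should not be unfolded
  into an equation on heads or tails.\<close>

declare in_in_arcs_conv [simp del] in_out_arcs_conv [simp del]

lemma refl_quiver_simps [simp]:
  "verts (refl_quiver a Q) = verts Q" "arcs (refl_quiver a Q) = arcs Q"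
  "tail (refl_quiver a Q) \<alpha> = (if tail Q \<alpha> = a \<or> head Q \<alpha> = a then head Q \<alpha> else tail Q \<alpha>)"
  "head (refl_quiver a Q) \<alpha> = (if tail Q \<alpha> = a \<or> head Q \<alpha> = a then tail Q \<alpha> else head Q \<alpha>)"
  by (simp_all add: refl_quiver_def)

lemma op_quiver_simps [simp]:
  "verts (op_quiver Q) = verts Q" "arcs (op_quiver Q) = arcs Q"
  "tail (op_quiver Q) = head Q" "head (op_quiver Q) = tail Q"
  "in_arcs (op_quiver Q) a = out_arcs Q a" "out_arcs (op_quiver Q) a = in_arcs Q a"
  by (auto simp: op_quiver_def in_arcs_def out_arcs_def)

locale source_rep =
  fixes R :: "('i, 'e) pre_digraph" and a :: 'i and N :: "('i, 'e, 'k::field, 'v) quiver_rep"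
  assumes fin: "fin_digraph R" and av: "a \<in> verts R" and source: "in_arcs R a = {}" and repN: "is_rep R N"
begin

sublocale G: fin_digraph R by (rule fin)

abbreviation "Os \<equiv> out_arcs R a"

lemma arcD:
  assumes "\<alpha> \<in> arcs R"
  shows "tail R \<alpha> \<in> verts R" "head R \<alpha> \<in> verts R" "head R \<alpha> \<noteq> a" "\<alpha> \<notin> Os \<Longrightarrow> tail R \<alpha> \<noteq> a"
  using assms G.wellformed source by (auto simp: in_arcs_def out_arcs_def)

lemma OsD: "\<alpha> \<in> Os \<Longrightarrow> \<alpha> \<in> arcs R" "\<alpha> \<in> Os \<Longrightarrow> tail R \<alpha> = a" "\<alpha> \<in> Os \<Longrightarrow> head R \<alpha> \<in> verts R" "\<alpha> \<in> Os \<Longrightarrow> head R \<alpha> \<noteq> a"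
  using arcD(1-3)[of \<alpha>] by (simp_all add: out_arcs_def)

lemma N_vsp: "i \<in> verts R \<Longrightarrow> vsp (rspace N i)" "i \<in> verts R \<Longrightarrow> fdim (rspace N i)"
  using repN by (auto simp: is_rep_def)

lemma N_lin: "\<alpha> \<in> arcs R \<Longrightarrow> lin (rspace N (tail R \<alpha>)) (rspace N (head R \<alpha>)) (rmap N \<alpha>)"
  using repN by (auto simp: is_rep_def)

sublocale sum_spaces Os "\<lambda>\<alpha>. rspace N (head R \<alpha>)"
proof (rule sum_spaces.intro)
  show "finite Os" using G.finite_arcs by (simp add: out_arcs_def)
  show "vsp (rspace N (head R \<alpha>))" "fdim (rspace N (head R \<alpha>))" if "\<alpha> \<in> Os" for \<alpha>
    by (rule N_vsp[OF OsD(3)[OF that]])+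
qed

lemma source_sum_eq: "source_sum R a N = S"
  by (simp add: source_sum_def)

abbreviation "src \<equiv> source_map R a N"
abbreviation "Na \<equiv> rspace N a"
abbreviation "B \<equiv> src ` carrier Na"

lemma N_lin_Os: "\<alpha> \<in> Os \<Longrightarrow> lin Na (rspace N (head R \<alpha>)) (rmap N \<alpha>)"
  using N_lin[OF OsD(1)] OsD(2) by metis

lemma lin_src: "lin Na S src"
proof (rule linI[OF N_vsp(1)[OF av] vsp_S])
  show "src x \<in> carrier S" if "x \<in> carrier Na" for x
    unfolding sum_simps source_map_def
    by (rule restrict_PiE_iff[THEN iffD2]) (use linD(3)[OF N_lin_Os that] in blast)
  show "src (x \<oplus>\<^bsub>Na\<^esub> y) = src x \<oplus>\<^bsub>S\<^esub> src y" if "x \<in> carrier Na" "y \<in> carrier Na" for x y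
    unfolding sum_simps source_map_def using linD(4)[OF N_lin_Os that] by (auto intro!: restrict_ext)
  show "src (c \<odot>\<^bsub>Na\<^esub> x) = c \<odot>\<^bsub>S\<^esub> src x" if "x \<in> carrier Na" for c x
    unfolding sum_simps source_map_def using linD(5)[OF N_lin_Os that] by (auto intro!: restrict_ext)
qed

lemma sub_B: "sub S B"
  by (rule lin_image_sub[OF lin_src sub_carrier[OF N_vsp(1)[OF av]]])

abbreviation "q \<equiv> source_class R a N"

lemma q_eq: "q = coset S B"
  by (simp add: source_class_def fun_eq_iff source_sum_eq)

abbreviation "Sm \<equiv> S_minus R a N"

lemma Sm_space:
  "i \<noteq> a \<Longrightarrow> rspace Sm i = transport_space Inl (rspace N i)"
  "rspace Sm a = transport_space Inr (quot_space S B)"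
  by (simp_all add: S_minus_def source_sum_eq)

lemma Sm_carrier:
  "i \<noteq> a \<Longrightarrow> carrier (rspace Sm i) = Inl ` carrier (rspace N i)"
  "carrier (rspace Sm a) = Inr ` q ` carrier S"
  by (simp_all add: Sm_space transport_simps quot_simps[OF sub_B] q_eq)

lemma Sm_map:
  "\<alpha> \<in> Os \<Longrightarrow> rmap Sm \<alpha> x = Inr (q (inc \<alpha> (projl x)))"
  "\<alpha> \<notin> Os \<Longrightarrow> rmap Sm \<alpha> x = Inl (rmap N \<alpha> (projl x))"
  by (simp_all add: S_minus_def inj_sum_def)

lemma lin_Inr_q: "lin S (rspace Sm a) (\<lambda>f. Inr (q f))"
  unfolding Sm_space q_eq
  by (rule lin_comp[OF quot_space(2)[OF sub_B] transport(2)]) (simp_all add: quot_space(1)[OF sub_B])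

lemma lin_from_Sm_a:
  assumes F: "lin S Z F" and g: "\<And>f. f \<in> carrier S \<Longrightarrow> g (Inr (q f)) = F f"
  shows "lin (rspace Sm a) Z g"
  by (rule lin_factor[OF lin_Inr_q _ F g]) (auto simp: Sm_carrier)

text \<open>The first isomorphism theorem for the quotient of \<open>S\<close> by \<open>B\<close>.\<close>

lemma bij_from_Sm_a:
  assumes F: "lin S Z F" and g: "\<And>f. f \<in> carrier S \<Longrightarrow> g (Inr (q f)) = F f"
    and ker: "\<And>f. f \<in> carrier S \<Longrightarrow> F f = \<zero>\<^bsub>Z\<^esub> \<Longrightarrow> f \<in> B"
    and surj: "F ` carrier S = carrier Z"
  shows "bij_betw g (carrier (rspace Sm a)) (carrier Z)"
  unfolding bij_betw_def
proof
  note S = vsp_S and Z = linD(2)[OF F]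
  show "g ` carrier (rspace Sm a) = carrier Z"
    unfolding Sm_carrier image_image using g surj by (simp cong: image_cong)
  show "inj_on g (carrier (rspace Sm a))"
  proof (rule inj_onI)
    fix x y assume "x \<in> carrier (rspace Sm a)" "y \<in> carrier (rspace Sm a)" and eq: "g x = g y"
    then obtain f h where fh: "f \<in> carrier S" "x = Inr (q f)" "h \<in> carrier S" "y = Inr (q h)"
      unfolding Sm_carrier by blast
    have "F (f \<oplus>\<^bsub>S\<^esub> (- 1) \<odot>\<^bsub>S\<^esub> h) = F f \<oplus>\<^bsub>Z\<^esub> (- 1) \<odot>\<^bsub>Z\<^esub> F f"
      using fh eq g by (simp add: linD(4,5)[OF F] vsp_smult[OF S])
    also have "\<dots> = \<zero>\<^bsub>Z\<^esub>" by (rule vsp_neg[OF Z linD(3)[OF F fh(1)]])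
    finally have "f \<oplus>\<^bsub>S\<^esub> (- 1) \<odot>\<^bsub>S\<^esub> h \<in> B"
      using fh by (intro ker vsp_add[OF S] vsp_smult[OF S])
    then have "q f = q h" unfolding q_eq by (simp add: coset_eq_iff[OF sub_B fh(1,3)])
    then show "x = y" using fh by simp
  qed
qed

lemma some_class: "f \<in> carrier S \<Longrightarrow> lin S Z F \<Longrightarrow> (\<And>b. b \<in> B \<Longrightarrow> F b = \<zero>\<^bsub>Z\<^esub>) \<Longrightarrow>
  F (SOME g. g \<in> q f) = F f"
  unfolding q_eq by (rule lin_some_coset[OF sub_B])

subsection \<open>The dual description\<close>

abbreviation "DN \<equiv> dual_rep R N"
abbreviation "Sp \<equiv> S_plus (op_quiver R) a DN"

lemma DN_space: "rspace DN i = dual_space (rspace N i)"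
  by (simp add: dual_rep_def)

sublocale D: sum_spaces Os "\<lambda>\<alpha>. dual_space (rspace N (head R \<alpha>))"
proof (rule sum_spaces.intro)
  show "finite Os" by (rule finE)
  fix \<alpha> assume "\<alpha> \<in> Os"
  note V = N_vsp[OF OsD(3)[OF this]]
  show "vsp (dual_space (rspace N (head R \<alpha>)))" "fdim (dual_space (rspace N (head R \<alpha>)))"
    by (rule vsp_dual_space[OF V(1)] fdim_dual_space[OF V])+
qed

text \<open>The space of \<open>S\<^sub>a\<^sup>+ D N\<close> at \<open>a\<close>: the families of forms whose sum vanishes on \<open>N\<^sub>a\<close>, in other words on the
  image \<open>B\<close> of \<open>N\<^sub>a\<close> in \<open>S\<close>.\<close>

definition relations :: "('e \<Rightarrow> 'v \<Rightarrow> 'k) set" where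
  "relations = {\<xi> \<in> carrier D.S. sink_map (op_quiver R) a DN \<xi> = \<zero>\<^bsub>rspace DN a\<^esub>}"

lemma D_carrier: "carrier D.S = (\<Pi>\<^sub>E \<alpha>\<in>Os. forms (rspace N (head R \<alpha>)))"
  by (simp add: sum_simps)

lemma D_mem: "\<xi> \<in> carrier D.S \<Longrightarrow> \<alpha> \<in> Os \<Longrightarrow> \<xi> \<alpha> \<in> forms (rspace N (head R \<alpha>))"
  unfolding D_carrier by (rule PiE_mem)

lemma DN_map: "\<alpha> \<in> arcs R \<Longrightarrow> lin (rspace DN (head R \<alpha>)) (rspace DN (tail R \<alpha>)) (rmap DN \<alpha>)"
proof -
  assume \<alpha>: "\<alpha> \<in> arcs R"
  note f = N_lin[OF \<alpha>]
  show ?thesis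
    unfolding DN_space
    using lin_transpose[OF f] by (simp add: dual_rep_def)
qed

lemma sink_map_DN: "sink_map (op_quiver R) a DN \<xi> = (\<Oplus>\<^bsub>rspace DN a\<^esub>\<alpha>\<in>Os. rmap DN \<alpha> (\<xi> \<alpha>))"
  by (simp add: sink_map_def)

lemma lin_sink_DN: "lin D.S (rspace DN a) (sink_map (op_quiver R) a DN)"
  unfolding sink_map_DN[abs_def]
proof (rule D.lin_sum)
  show "vsp (rspace DN a)" unfolding DN_space by (rule vsp_dual_space[OF N_vsp(1)[OF av]])
  fix \<alpha> assume \<alpha>: "\<alpha> \<in> Os"
  show "lin (dual_space (rspace N (head R \<alpha>))) (rspace DN a) (rmap DN \<alpha>)"
    using DN_map[OF OsD(1)[OF \<alpha>]] unfolding OsD(2)[OF \<alpha>] by (simp add: DN_space)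
qed

lemma sub_relations: "sub D.S relations"
  unfolding relations_def by (rule lin_kernel_sub[OF lin_sink_DN sub_carrier[OF D.vsp_S]])

text \<open>The sink map of the dual is the transpose of the source map.\<close>

lemma sink_DN_apply:
  assumes \<xi>: "\<xi> \<in> carrier D.S" and x: "x \<in> carrier Na"
  shows "sink_map (op_quiver R) a DN \<xi> x = sum_form \<xi> (src x)"
proof -
  have "sink_map (op_quiver R) a DN \<xi> x = (\<Sum>\<alpha>\<in>Os. rmap DN \<alpha> (\<xi> \<alpha>) x)"
    unfolding sink_map_DN DN_space
  proof (rule dual_finsum_apply[OF N_vsp(1)[OF av] finE _ x])
    fix \<alpha> assume \<alpha>: "\<alpha> \<in> Os"
    show "rmap DN \<alpha> (\<xi> \<alpha>) \<in> forms Na"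
      using linD(3)[OF DN_map[OF OsD(1)[OF \<alpha>]]] D_mem[OF \<xi> \<alpha>] OsD(2)[OF \<alpha>] by (simp add: DN_space)
  qed
  also have "\<dots> = (\<Sum>\<alpha>\<in>Os. \<xi> \<alpha> (src x \<alpha>))"
    by (rule sum.cong[OF refl]) (use x OsD(2) in \<open>auto simp: dual_rep_def source_map_def\<close>)
  finally show ?thesis using linD(3)[OF lin_src x] by (simp add: sum_form_def)
qed

lemma relations_iff:
  "\<xi> \<in> relations \<longleftrightarrow> \<xi> \<in> carrier D.S \<and> (\<forall>b\<in>B. sum_form \<xi> b = 0)"
proof (cases "\<xi> \<in> carrier D.S")
  case True
  have "sink_map (op_quiver R) a DN \<xi> \<in> forms Na" using linD(3)[OF lin_sink_DN True] by (simp add: DN_space)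
  note ext = formD(1)[OF this]
  have "sink_map (op_quiver R) a DN \<xi> = \<zero>\<^bsub>rspace DN a\<^esub> \<longleftrightarrow> (\<forall>x\<in>carrier Na. sink_map (op_quiver R) a DN \<xi> x = 0)"
    unfolding DN_space dual_space_simps using extensional_arb[OF ext] by (auto simp: fun_eq_iff)
  then show ?thesis using True by (simp add: relations_def sink_DN_apply[OF True])
qed (simp add: relations_def)

lemma Sp_space:
  "i \<noteq> a \<Longrightarrow> rspace Sp i = transport_space Inl (dual_space (rspace N i))"
  "rspace Sp a = transport_space Inr (D.S\<lparr>carrier := relations\<rparr>)"
  by (simp_all add: S_plus_def Let_def DN_space relations_def)

lemma Sp_carrier:
  "i \<noteq> a \<Longrightarrow> carrier (rspace Sp i) = Inl ` forms (rspace N i)"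
  "carrier (rspace Sp a) = Inr ` relations"
  by (simp_all add: Sp_space transport_simps)

lemma sum_form_lin: "lin D.S (dual_space S) sum_form"
proof (rule linI[OF D.vsp_S vsp_dual_space[OF vsp_S]])
  show "sum_form \<xi> \<in> forms S" if "\<xi> \<in> carrier D.S" for \<xi>
    by (rule sum_form) (rule D_mem[OF that])
  show "sum_form (\<xi> \<oplus>\<^bsub>D.S\<^esub> \<eta>) = sum_form \<xi> \<oplus>\<^bsub>dual_space S\<^esub> sum_form \<eta>" for \<xi> \<eta>
  proof -
    have "(\<Sum>\<alpha>\<in>Os. (\<xi> \<oplus>\<^bsub>D.S\<^esub> \<eta>) \<alpha> (f \<alpha>)) = (\<Sum>\<alpha>\<in>Os. \<xi> \<alpha> (f \<alpha>)) + (\<Sum>\<alpha>\<in>Os. \<eta> \<alpha> (f \<alpha>))"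
      if f: "f \<in> carrier S" for f
    proof -
      have "(\<xi> \<oplus>\<^bsub>D.S\<^esub> \<eta>) \<alpha> (f \<alpha>) = \<xi> \<alpha> (f \<alpha>) + \<eta> \<alpha> (f \<alpha>)" if "\<alpha> \<in> Os" for \<alpha>
        using S_mem[OF f that] that by (simp add: sum_simps(3))
      then show ?thesis by (simp add: sum.distrib)
    qed
    then show ?thesis unfolding dual_space_simps sum_form_def by (intro restrict_ext) simp
  qed
  show "sum_form (c \<odot>\<^bsub>D.S\<^esub> \<xi>) = c \<odot>\<^bsub>dual_space S\<^esub> sum_form \<xi>" for c \<xi>
  proof -
    have "(\<Sum>\<alpha>\<in>Os. (c \<odot>\<^bsub>D.S\<^esub> \<xi>) \<alpha> (f \<alpha>)) = c * (\<Sum>\<alpha>\<in>Os. \<xi> \<alpha> (f \<alpha>))"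
      if f: "f \<in> carrier S" for f
    proof -
      have "(c \<odot>\<^bsub>D.S\<^esub> \<xi>) \<alpha> (f \<alpha>) = c * \<xi> \<alpha> (f \<alpha>)" if "\<alpha> \<in> Os" for \<alpha>
        using S_mem[OF f that] that by (simp add: sum_simps(4))
      then show ?thesis by (simp add: sum_distrib_left)
    qed
    then show ?thesis unfolding dual_space_simps sum_form_def by (intro restrict_ext) simp
  qed
qed

text \<open>\<open>sum_form\<close> identifies the dual of \<open>S\<close> with families of forms, and \<open>relations_iff\<close> singles out the
  families that annihilate \<open>B\<close>.\<close>

lemma annihilator_a: "annihilator S B (rspace Sp a) (\<lambda>\<eta>. sum_form (projr \<eta>))"
proof (rule annihilator.intro)
  have r: "vsp (D.S\<lparr>carrier := relations\<rparr>)" by (rule sub_vsp[OF D.vsp_S sub_relations])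
  show "vsp S" "fdim S" by (rule vsp_S fdim_S)+
  show "sub S B" by (rule sub_B)
  show "lin (rspace Sp a) (dual_space S) (\<lambda>\<eta>. sum_form (projr \<eta>))"
    unfolding Sp_space by (rule lin_comp[OF transport_projr[OF r] lin_restrict[OF sum_form_lin sub_relations]])
next
  fix \<eta> assume \<eta>: "\<eta> \<in> carrier (rspace Sp a)" and 0: "sum_form (projr \<eta>) = \<zero>\<^bsub>dual_space S\<^esub>"
  obtain \<xi> where \<xi>: "\<xi> \<in> relations" "\<eta> = Inr \<xi>" using \<eta> unfolding Sp_carrier by blast
  have \<xi>D: "\<xi> \<in> carrier D.S" using \<xi>(1) by (simp add: relations_def)
  have "sum_form \<xi> = sum_form \<zero>\<^bsub>D.S\<^esub>" using 0 \<xi>(2) lin_zero[OF sum_form_lin] by simp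
  then have "component_forms (sum_form \<xi>) = component_forms (sum_form \<zero>\<^bsub>D.S\<^esub>)" by simp
  then have "\<xi> = \<zero>\<^bsub>D.S\<^esub>"
    using component_sum_form \<xi>D vsp_zero[OF D.vsp_S] unfolding D_carrier by metis
  then show "\<eta> = \<zero>\<^bsub>rspace Sp a\<^esub>" by (simp add: \<xi>(2) Sp_space transport_simps)
next
  show "(\<lambda>\<eta>. sum_form (projr \<eta>)) ` carrier (rspace Sp a)
      = {\<xi> \<in> forms S. \<forall>b\<in>B. \<xi> b = 0}"
  proof (intro equalityI subsetI)
    fix \<Xi> assume "\<Xi> \<in> (\<lambda>\<eta>. sum_form (projr \<eta>)) ` carrier (rspace Sp a)"
    then obtain \<xi> where \<xi>: "\<xi> \<in> relations" "\<Xi> = sum_form \<xi>" unfolding Sp_carrier by auto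
    then show "\<Xi> \<in> {\<xi> \<in> forms S. \<forall>b\<in>B. \<xi> b = 0}"
      using linD(3)[OF sum_form_lin, of \<xi>] unfolding relations_iff by blast
  next
    fix \<Xi> assume X: "\<Xi> \<in> {\<xi> \<in> forms S. \<forall>b\<in>B. \<xi> b = 0}"
    then have X': "\<Xi> \<in> forms S" by simp
    have "component_forms \<Xi> \<in> relations"
      unfolding relations_iff D_carrier using component_forms[OF X'] sum_component_forms[OF X'] X by simp
    then have "Inr (component_forms \<Xi>) \<in> carrier (rspace Sp a)" unfolding Sp_carrier by blast
    moreover have "\<Xi> = sum_form (projr (Inr (component_forms \<Xi>)))" using sum_component_forms[OF X'] by simp
    ultimately show "\<Xi> \<in> (\<lambda>\<eta>. sum_form (projr \<eta>)) ` carrier (rspace Sp a)" by (rule rev_image_eqI)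
  qed
qed

lemma annihilator_i:
  assumes i: "i \<in> verts R" "i \<noteq> a"
  shows "annihilator (rspace N i) {\<zero>\<^bsub>rspace N i\<^esub>} (rspace Sp i) projl"
proof (rule annihilator.intro)
  note V = N_vsp[OF i(1)]
  show "vsp (rspace N i)" "fdim (rspace N i)" by (rule V)+
  show "sub (rspace N i) {\<zero>\<^bsub>rspace N i\<^esub>}" by (simp add: sub_iff[OF V(1)] vsp_simps[OF V(1)])
  show "lin (rspace Sp i) (dual_space (rspace N i)) projl"
    unfolding Sp_space(1)[OF i(2)] by (rule transport_projl[OF vsp_dual_space[OF V(1)]])
  fix \<eta> assume "\<eta> \<in> carrier (rspace Sp i)" "projl \<eta> = \<zero>\<^bsub>dual_space (rspace N i)\<^esub>"
  then show "\<eta> = \<zero>\<^bsub>rspace Sp i\<^esub>" using i(2) by (auto simp: Sp_carrier Sp_space transport_simps)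
next
  show "projl ` carrier (rspace Sp i) = {\<xi> \<in> forms (rspace N i). \<forall>b\<in>{\<zero>\<^bsub>rspace N i\<^esub>}. \<xi> b = 0}"
    using i form_zero[OF _ N_vsp(1)[OF i(1)]] by (auto simp: Sp_carrier image_image)
qed

abbreviation "\<Psi> \<equiv> refl_dual_map R a N"

lemma Psi_i:
  "i \<noteq> a \<Longrightarrow> \<Psi> i (Inl n) = (\<lambda>\<eta>\<in>carrier (rspace Sp i). projl \<eta> n)"
  by (simp add: refl_dual_map_def)

lemma Psi_a:
  assumes f: "f \<in> carrier S"
  shows "\<Psi> a (Inr (q f)) = (\<lambda>\<eta>\<in>carrier (rspace Sp a). sum_form (projr \<eta>) f)"
proof -
  interpret A: annihilator "S" B "rspace Sp a" "\<lambda>\<eta>. sum_form (projr \<eta>)" by (rule annihilator_a)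
  define g where "g = (SOME g. g \<in> q f)"
  have gq: "g \<in> q f" unfolding g_def q_eq by (rule some_coset[OF sub_B f])
  then have gS: "g \<in> carrier S" unfolding q_eq by (rule coset_carrier[OF sub_B f])
  have "sum_form (projr \<eta>) g = sum_form (projr \<eta>) f" if \<eta>: "\<eta> \<in> carrier (rspace Sp a)" for \<eta>
  proof -
    obtain b where b: "b \<in> B" "g = b \<oplus>\<^bsub>S\<^esub> f" using gq unfolding q_eq coset_mem by blast
    have "b \<in> carrier S" using subD(2)[OF sub_B] b(1) by blast
    then show ?thesis unfolding b(2) using formD(2)[OF A.p_form[OF \<eta>] _ f] A.p_zero[OF \<eta> b(1)] by simp
  qed
  then show ?thesis
    unfolding refl_dual_map_def using gS by (auto intro!: restrict_ext simp: sum_form_def g_def[symmetric])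
qed

lemma out_op: "\<alpha> \<in> arcs R \<Longrightarrow> tail (refl_quiver a (op_quiver R)) \<alpha> = (if \<alpha> \<in> Os then a else head R \<alpha>)"
proof (cases "\<alpha> \<in> Os")
  case True
  then show ?thesis using OsD(2)[OF True] by simp
next
  case False
  assume "\<alpha> \<in> arcs R"
  then show ?thesis using arcD(3) arcD(4)[OF _ False] False by simp
qed

lemma out_refl: "\<alpha> \<in> arcs R \<Longrightarrow> tail (refl_quiver a R) \<alpha> = (if \<alpha> \<in> Os then head R \<alpha> else tail R \<alpha>)"
  "\<alpha> \<in> arcs R \<Longrightarrow> head (refl_quiver a R) \<alpha> = (if \<alpha> \<in> Os then a else head R \<alpha>)"
proof -
  assume \<alpha>: "\<alpha> \<in> arcs R"
  have "tail R \<alpha> = a \<longleftrightarrow> \<alpha> \<in> Os" using \<alpha> by (simp add: out_arcs_def)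
  then show "tail (refl_quiver a R) \<alpha> = (if \<alpha> \<in> Os then head R \<alpha> else tail R \<alpha>)"
    "head (refl_quiver a R) \<alpha> = (if \<alpha> \<in> Os then a else head R \<alpha>)"
    using arcD(3)[OF \<alpha>] by auto
qed

abbreviation "DSD \<equiv> D_S_plus_D R a N"

lemma DSD_space: "rspace DSD i = dual_space (rspace Sp i)"
  by (simp add: D_S_plus_D_def dual_rep_def)

lemma Psi_lin: "i \<in> verts R \<Longrightarrow> lin (rspace Sm i) (rspace DSD i) (\<Psi> i)"
proof (cases "i = a")
  case True
  interpret A: annihilator "S" B "rspace Sp a" "\<lambda>\<eta>. sum_form (projr \<eta>)" by (rule annihilator_a)
  show ?thesis unfolding True DSD_space by (rule lin_from_Sm_a[OF lin_eval[OF A.p A.V(1)] Psi_a])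
next
  case False
  assume i: "i \<in> verts R"
  interpret A: annihilator "rspace N i" "{\<zero>\<^bsub>rspace N i\<^esub>}" "rspace Sp i" projl by (rule annihilator_i[OF i False])
  show ?thesis
    unfolding DSD_space Sm_space(1)[OF False]
    by (rule lin_from_transport[OF inj_Inl lin_eval[OF A.p A.V(1)] Psi_i[OF False]])
qed

lemma Psi_bij: "i \<in> verts R \<Longrightarrow> bij_betw (\<Psi> i) (carrier (rspace Sm i)) (carrier (rspace DSD i))"
proof (cases "i = a")
  case True
  interpret A: annihilator "S" B "rspace Sp a" "\<lambda>\<eta>. sum_form (projr \<eta>)" by (rule annihilator_a)
  note e = lin_eval[OF A.p A.V(1)]
  show ?thesis unfolding True DSD_space
  proof (rule bij_from_Sm_a[OF e Psi_a])
    show "f \<in> B" if "f \<in> carrier S" "A.ev f = \<zero>\<^bsub>dual_space (rspace Sp a)\<^esub>" for f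
      using A.ev_zero_iff[OF that(1)] that(2) by simp
    show "A.ev ` carrier S = forms (rspace Sp a)"
      using A.ev_surj linD(3)[OF e] by blast
  qed
next
  case False
  assume i: "i \<in> verts R"
  interpret A: annihilator "rspace N i" "{\<zero>\<^bsub>rspace N i\<^esub>}" "rspace Sp i" projl by (rule annihilator_i[OF i False])
  note e = lin_eval[OF A.p A.V(1)]
  have "inj_on (\<Psi> i) (carrier (rspace Sm i))"
  proof (rule inj_onI)
    fix x y assume "x \<in> carrier (rspace Sm i)" "y \<in> carrier (rspace Sm i)" and eq: "\<Psi> i x = \<Psi> i y"
    then obtain m n where mn: "m \<in> carrier (rspace N i)" "x = Inl m" "n \<in> carrier (rspace N i)" "y = Inl n"
      unfolding Sm_carrier(1)[OF False] by blast
    have eq': "A.ev m = A.ev n" using eq unfolding mn(2,4) Psi_i[OF False] .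
    let ?d = "m \<oplus>\<^bsub>rspace N i\<^esub> (- 1) \<odot>\<^bsub>rspace N i\<^esub> n"
    have d: "?d \<in> carrier (rspace N i)" using mn by (intro vsp_add[OF A.V(1)] vsp_smult[OF A.V(1)])
    have "A.ev ?d = A.ev m \<oplus>\<^bsub>dual_space (rspace Sp i)\<^esub> (- 1) \<odot>\<^bsub>dual_space (rspace Sp i)\<^esub> A.ev n"
      by (simp only: linD(4)[OF e mn(1) vsp_smult[OF A.V(1) mn(3)]] linD(5)[OF e mn(3)])
    also have "\<dots> = \<zero>\<^bsub>dual_space (rspace Sp i)\<^esub>"
      unfolding eq' by (rule vsp_neg[OF linD(2)[OF e] linD(3)[OF e mn(3)]])
    finally have "?d = \<zero>\<^bsub>rspace N i\<^esub>" using A.ev_zero_iff[OF d] by simp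
    then have "?d \<oplus>\<^bsub>rspace N i\<^esub> n = n" using mn(3) by (simp add: vsp_l0[OF A.V(1)])
    then have "m = n" using mn by (simp add: vsp_assoc[OF A.V(1)] vsp_smult[OF A.V(1)] vsp_neg'[OF A.V(1)] vsp_r0[OF A.V(1)])
    then show "x = y" using mn by simp
  qed
  moreover have "\<Psi> i ` carrier (rspace Sm i) = forms (rspace Sp i)"
    unfolding Sm_carrier(1)[OF False] image_image Psi_i[OF False] using A.ev_surj linD(3)[OF e] by blast
  ultimately show ?thesis unfolding DSD_space bij_betw_def by blast
qed

lemma DSD_map:
  assumes "\<alpha> \<in> arcs R"
  shows "rmap DSD \<alpha> \<Lambda> = (\<lambda>\<kappa>\<in>carrier (rspace Sp (if \<alpha> \<in> Os then a else head R \<alpha>)).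
    \<Lambda> (if \<alpha> \<in> Os then Inl (projr \<kappa> \<alpha>) else Inl (rmap DN \<alpha> (projl \<kappa>))))"
  unfolding D_S_plus_D_def dual_rep_def[of "refl_quiver a (op_quiver R)"] quiver_rep.simps out_op[OF assms]
  by (auto simp: S_plus_def Let_def intro!: restrict_ext)

text \<open>At \<open>a\<close> this is the isomorphism of \<open>S/B\<close> with the dual of the annihilator of \<open>B\<close>, elsewhere the
  isomorphism of a space with its bidual; the arrows are compared on elements.\<close>

theorem source_reflection_dual: "rep_iso (refl_quiver a R) Sm DSD \<Psi>"
  unfolding rep_iso_def rep_hom_def mem_Collect_eq
proof (intro conjI ballI)
  show "lin (rspace Sm i) (rspace DSD i) (\<Psi> i)" if "i \<in> verts (refl_quiver a R)" for i
    using Psi_lin that by simp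
  show "bij_betw (\<Psi> i) (carrier (rspace Sm i)) (carrier (rspace DSD i))" if "i \<in> verts (refl_quiver a R)" for i
    using Psi_bij that by simp
  fix \<alpha> x assume "\<alpha> \<in> arcs (refl_quiver a R)" and x: "x \<in> carrier (rspace Sm (tail (refl_quiver a R) \<alpha>))"
  then have \<alpha>: "\<alpha> \<in> arcs R" by simp
  show "\<Psi> (head (refl_quiver a R) \<alpha>) (rmap Sm \<alpha> x) = rmap DSD \<alpha> (\<Psi> (tail (refl_quiver a R) \<alpha>) x)"
  proof (cases "\<alpha> \<in> Os")
    case True
    obtain n where n: "n \<in> carrier (rspace N (head R \<alpha>))" "x = Inl n"
      using x True OsD(4)[OF True] unfolding out_refl(1)[OF \<alpha>] by (auto simp: Sm_carrier)
    have "\<Psi> a (rmap Sm \<alpha> x) = (\<lambda>\<kappa>\<in>carrier (rspace Sp a). sum_form (projr \<kappa>) (inc \<alpha> n))"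
      unfolding Sm_map(1)[OF True] n(2) sum.sel by (rule Psi_a[OF linD(3)[OF lin_inc[OF True] n(1)]])
    also have "\<dots> = (\<lambda>\<kappa>\<in>carrier (rspace Sp a). \<Psi> (head R \<alpha>) x (Inl (projr \<kappa> \<alpha>)))"
    proof (rule restrict_ext)
      fix \<kappa> assume "\<kappa> \<in> carrier (rspace Sp a)"
      then obtain \<xi> where \<xi>: "\<xi> \<in> carrier D.S" "\<kappa> = Inr \<xi>" by (auto simp: Sp_carrier relations_def)
      have "sum_form \<xi> (inc \<alpha> n) = component_forms (sum_form \<xi>) \<alpha> n"
        using True n(1) by (simp add: component_forms_def)
      also have "\<dots> = \<xi> \<alpha> n" using component_sum_form \<xi>(1) unfolding D_carrier by simp
      finally have "sum_form \<xi> (inc \<alpha> n) = \<xi> \<alpha> n" .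
      moreover have "Inl (\<xi> \<alpha>) \<in> carrier (rspace Sp (head R \<alpha>))"
        using D_mem[OF \<xi>(1) True] OsD(4)[OF True] by (simp add: Sp_carrier)
      ultimately show "sum_form (projr \<kappa>) (inc \<alpha> n) = \<Psi> (head R \<alpha>) x (Inl (projr \<kappa> \<alpha>))"
        unfolding n(2) \<xi>(2) Psi_i[OF OsD(4)[OF True]] by simp
    qed
    finally show ?thesis unfolding DSD_map[OF \<alpha>] out_refl[OF \<alpha>] using True by simp
  next
    case False
    note ta = arcD(4)[OF \<alpha> False] and ha = arcD(3)[OF \<alpha>]
    obtain n where n: "n \<in> carrier (rspace N (tail R \<alpha>))" "x = Inl n"
      using x False ta unfolding out_refl(1)[OF \<alpha>] by (auto simp: Sm_carrier)
    have "\<Psi> (head R \<alpha>) (rmap Sm \<alpha> x) = (\<lambda>\<kappa>\<in>carrier (rspace Sp (head R \<alpha>)). projl \<kappa> (rmap N \<alpha> n))"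
      unfolding Sm_map(2)[OF False] n(2) sum.sel by (rule Psi_i[OF ha])
    also have "\<dots> = (\<lambda>\<kappa>\<in>carrier (rspace Sp (head R \<alpha>)). \<Psi> (tail R \<alpha>) x (Inl (rmap DN \<alpha> (projl \<kappa>))))"
    proof (rule restrict_ext)
      fix \<kappa> assume "\<kappa> \<in> carrier (rspace Sp (head R \<alpha>))"
      then obtain \<xi> where \<xi>: "\<xi> \<in> forms (rspace N (head R \<alpha>))" "\<kappa> = Inl \<xi>" using ha by (auto simp: Sp_carrier)
      have "rmap DN \<alpha> \<xi> \<in> forms (rspace N (tail R \<alpha>))"
        using linD(3)[OF DN_map[OF \<alpha>]] \<xi>(1) by (simp add: DN_space)
      then have "Inl (rmap DN \<alpha> \<xi>) \<in> carrier (rspace Sp (tail R \<alpha>))" using ta by (simp add: Sp_carrier)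
      moreover have "rmap DN \<alpha> \<xi> n = \<xi> (rmap N \<alpha> n)" using n(1) by (simp add: dual_rep_def)
      ultimately show "projl \<kappa> (rmap N \<alpha> n) = \<Psi> (tail R \<alpha>) x (Inl (rmap DN \<alpha> (projl \<kappa>)))"
        unfolding n(2) \<xi>(2) Psi_i[OF ta] by simp
    qed
    finally show ?thesis unfolding DSD_map[OF \<alpha>] out_refl[OF \<alpha>] using False by simp
  qed
qed

end

section \<open>Subrepresentations at a source\<close>

lemma subrep_simps [simp]:
  "rspace (subrep M U) i = (rspace M i)\<lparr>carrier := U i\<rparr>" "rmap (subrep M U) = rmap M"
  by (simp_all add: subrep_def)

lemma is_subrepD:
  assumes "is_subrep Q M U"
  shows "\<And>i. i \<in> verts Q \<Longrightarrow> sub (rspace M i) (U i)"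
    "\<And>\<alpha> x. \<alpha> \<in> arcs Q \<Longrightarrow> x \<in> U (tail Q \<alpha>) \<Longrightarrow> rmap M \<alpha> x \<in> U (head Q \<alpha>)"
  using assms by (auto simp: is_subrep_def)

lemma is_rep_subrep:
  assumes fin: "fin_digraph Q" and M: "is_rep Q M" and U: "is_subrep Q M U"
  shows "is_rep Q (subrep M U)"
  unfolding is_rep_def
proof (intro conjI ballI)
  fix i assume i: "i \<in> verts Q"
  have V: "vsp (rspace M i)" "fdim (rspace M i)" using M i by (auto simp: is_rep_def)
  note s = is_subrepD(1)[OF U i]
  show "vsp (rspace (subrep M U) i)" using sub_vsp[OF V(1) s] by simp
  show "fdim (rspace (subrep M U) i)" using fdim_sub[OF V s] by simp
next
  fix \<alpha> assume \<alpha>: "\<alpha> \<in> arcs Q"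
  interpret fin_digraph Q by (rule fin)
  have f: "lin (rspace M (tail Q \<alpha>)) (rspace M (head Q \<alpha>)) (rmap M \<alpha>)" using M \<alpha> by (auto simp: is_rep_def)
  have t: "sub (rspace M (tail Q \<alpha>)) (U (tail Q \<alpha>))" and h: "sub (rspace M (head Q \<alpha>)) (U (head Q \<alpha>))"
    by (rule is_subrepD(1)[OF U], use wellformed[OF \<alpha>] in blast)+
  show "lin (rspace (subrep M U) (tail Q \<alpha>)) (rspace (subrep M U) (head Q \<alpha>)) (rmap (subrep M U) \<alpha>)"
    unfolding subrep_simps
    by (rule lin_corestrict[OF lin_restrict[OF f t] h]) (use is_subrepD(2)[OF U \<alpha>] in simp)
qed

lemma sum_space_restrict:
  "sum_space E (\<lambda>\<alpha>. (V \<alpha>)\<lparr>carrier := U \<alpha>\<rparr>) = (sum_space E V)\<lparr>carrier := \<Pi>\<^sub>E \<alpha>\<in>E. U \<alpha>\<rparr>"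
  by (simp add: sum_space_def)

lemma sub_annihilator:
  assumes V: "vsp V" and X: "X \<subseteq> carrier V"
  shows "sub (dual_space V) {\<xi> \<in> forms V. \<forall>x\<in>X. \<xi> x = 0}"
  unfolding sub_iff[OF vsp_dual_space[OF V]]
proof (intro conjI ballI allI)
  note D = vsp_dual_space[OF V]
  have XV: "x \<in> carrier V" if "x \<in> X" for x using X that by blast
  show "\<zero>\<^bsub>dual_space V\<^esub> \<in> {\<xi> \<in> forms V. \<forall>x\<in>X. \<xi> x = 0}"
    using vsp_zero[OF D] XV by simp
  show "\<xi> \<oplus>\<^bsub>dual_space V\<^esub> \<eta> \<in> {\<xi> \<in> forms V. \<forall>x\<in>X. \<xi> x = 0}"
    if "\<xi> \<in> {\<xi> \<in> forms V. \<forall>x\<in>X. \<xi> x = 0}" "\<eta> \<in> {\<xi> \<in> forms V. \<forall>x\<in>X. \<xi> x = 0}" for \<xi> \<eta>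
    using vsp_add[OF D, of \<xi> \<eta>] XV that by simp
  show "c \<odot>\<^bsub>dual_space V\<^esub> \<xi> \<in> {\<xi> \<in> forms V. \<forall>x\<in>X. \<xi> x = 0}"
    if "\<xi> \<in> {\<xi> \<in> forms V. \<forall>x\<in>X. \<xi> x = 0}" for c \<xi>
    using vsp_smult[OF D, of \<xi> c] XV that by simp
qed blast

context source_rep
begin

definition arrows_into :: "('i \<Rightarrow> 'v set) \<Rightarrow> ('e \<Rightarrow> 'v) set" where
  "arrows_into W = (\<Pi>\<^sub>E \<alpha>\<in>Os. W (head R \<alpha>))"

lemma sub_arrows_into:
  assumes "is_subrep R N W" shows "sub S (arrows_into W)"
  unfolding arrows_into_def by (rule sub_PiE) (rule is_subrepD(1)[OF assms OsD(3)])

text \<open>Coset representatives of one class modulo the image of \<open>W\<^sub>a\<close> differ by elements of \<open>B\<close>, so the union in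
  \<^const>\<open>S_minus_hom\<close> is over a single coset modulo \<open>B\<close>.\<close>

lemma S_minus_subrep:
  assumes W: "is_subrep R N W" and i: "i \<in> verts R"
  shows "S_minus_hom R a N (\<lambda>j x. x) i ` carrier (rspace (S_minus R a (subrep N W)) i)
    = (if i = a then Inr ` q ` arrows_into W else Inl ` W i)"
proof -
  interpret W: source_rep R a "subrep N W"
    by (rule source_rep.intro[OF fin av source is_rep_subrep[OF fin repN W]])
  show ?thesis
  proof (cases "i = a")
    case False
    have "S_minus_hom R a N (\<lambda>j x. x) i (Inl x) = Inl x" for x using False by (simp add: S_minus_hom_def)
    then show ?thesis using False by (simp add: W.Sm_carrier image_image)
  next
    case True
    have WS: "W.S = S\<lparr>carrier := arrows_into W\<rparr>" unfolding subrep_simps arrows_into_def by (rule sum_space_restrict)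
    have src_eq: "source_map R a (subrep N W) = src" by (simp add: source_map_def fun_eq_iff)
    have Wa: "W a \<subseteq> carrier Na" by (rule subD(2)[OF is_subrepD(1)[OF W av]])
    have "S_minus_hom R a N (\<lambda>j x. x) a (Inr (W.q f)) = Inr (q f)" if f: "f \<in> arrows_into W" for f
    proof -
      have fS: "f \<in> carrier S" using f subD(2)[OF sub_arrows_into[OF W]] by blast
      have "source_class R a N (\<lambda>\<alpha>\<in>Os. g \<alpha>) = q f" if g: "g \<in> W.q f" for g
      proof -
        have "g \<in> carrier W.S" using coset_carrier[OF W.sub_B] g f unfolding W.q_eq WS by simp
        then have ext: "(\<lambda>\<alpha>\<in>Os. g \<alpha>) = g" unfolding sum_simps by (intro extensional_restrict) (simp add: PiE_iff)
        obtain b where b: "b \<in> src ` W a" "g = b \<oplus>\<^bsub>S\<^esub> f"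
          using g unfolding W.q_eq coset_mem src_eq WS by auto
        have "b \<in> B" using b(1) Wa by blast
        then have "q g = q f" unfolding q_eq b(2) by (rule coset_shift[OF sub_B fS])
        then show ?thesis unfolding ext .
      qed
      moreover have "f \<in> carrier W.S" unfolding WS using f by simp
      then have "f \<in> W.q f" unfolding W.q_eq by (rule coset_self[OF W.sub_B])
      ultimately have "(\<Union>g\<in>W.q f. source_class R a N (\<lambda>\<alpha>\<in>Os. g \<alpha>)) = q f" by blast
      then show ?thesis by (simp add: S_minus_hom_def)
    qed
    then have "(\<lambda>f. S_minus_hom R a N (\<lambda>j x. x) a (Inr (W.q f))) ` arrows_into W = (\<lambda>f. Inr (q f)) ` arrows_into W"
      by (rule image_cong[OF refl])
    moreover have "carrier W.S = arrows_into W" unfolding WS by simp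
    ultimately show ?thesis unfolding True W.Sm_carrier(2) image_image by simp
  qed
qed

lemma S_minus_flag_eq:
  assumes V: "\<And>l. l \<le> \<nu> \<Longrightarrow> is_subrep R N (V l)"
  shows "S_minus_flag R a \<nu> N V = (\<lambda>l i. if l \<le> \<nu> \<and> i \<in> verts R
    then if i = a then Inr ` q ` arrows_into (V l) else Inl ` V l i else {})"
  unfolding S_minus_flag_def using S_minus_subrep[OF V] by (auto simp: fun_eq_iff)

subsection \<open>Duality on flags\<close>

abbreviation perp :: "('i \<Rightarrow> 'v set) \<Rightarrow> 'i \<Rightarrow> ('v \<Rightarrow> 'k) set" where
  "perp W i \<equiv> {\<xi> \<in> forms (rspace N i). \<forall>x\<in>W i. \<xi> x = 0}"

text \<open>Reflecting the annihilator of \<open>W\<close> gives the annihilator of the reflection of \<open>W\<close>: a family of forms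
  vanishes on the product of the spaces of \<open>W\<close> iff each of its members vanishes on its factor.\<close>

lemma S_plus_perp:
  assumes W: "is_subrep R N W" and W': "\<And>j. j \<in> verts R \<Longrightarrow> W' j = perp W j" and i: "i \<in> verts R"
  shows "carrier (rspace (S_plus (op_quiver R) a (subrep DN W')) i)
    = (if i = a then {\<eta> \<in> carrier (rspace Sp a). \<forall>w\<in>arrows_into W. sum_form (projr \<eta>) w = 0}
       else {\<eta> \<in> carrier (rspace Sp i). \<forall>w\<in>W i. projl \<eta> w = 0})"
proof (cases "i = a")
  case False
  then have "carrier (rspace (S_plus (op_quiver R) a (subrep DN W')) i) = Inl ` perp W i"
    using W'[OF i] by (simp add: S_plus_def Let_def transport_simps)
  then show ?thesis using False by (auto simp: Sp_carrier)
next
  case True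
  have Wc: "sub (rspace N j) (W j)" if "j \<in> verts R" for j using is_subrepD(1)[OF W that] .
  have sP: "sub (rspace DN a) (W' a)"
    unfolding DN_space W'[OF av] by (rule sub_annihilator[OF N_vsp(1)[OF av] subD(2)[OF Wc[OF av]]])
  have sink_eq: "sink_map (op_quiver R) a (subrep DN W') \<xi> = sink_map (op_quiver R) a DN \<xi>"
    if \<xi>: "\<xi> \<in> (\<Pi>\<^sub>E \<alpha>\<in>Os. W' (head R \<alpha>))" for \<xi>
    unfolding sink_map_def op_quiver_simps subrep_simps
  proof (rule sub_finsum_eq[OF vsp_dual_space[OF N_vsp(1)[OF av]], folded DN_space, OF sP])
    fix \<alpha> assume \<alpha>: "\<alpha> \<in> Os"
    have "\<xi> \<alpha> \<in> perp W (head R \<alpha>)" using PiE_mem[OF \<xi> \<alpha>] W'[OF OsD(3)[OF \<alpha>]] by simp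
    then have \<xi>\<alpha>: "\<xi> \<alpha> \<in> forms (rspace N (head R \<alpha>))" "\<And>x. x \<in> W (head R \<alpha>) \<Longrightarrow> \<xi> \<alpha> x = 0" by auto
    have "rmap DN \<alpha> (\<xi> \<alpha>) \<in> forms Na"
      using linD(3)[OF DN_map[OF OsD(1)[OF \<alpha>]]] \<xi>\<alpha>(1) OsD(2)[OF \<alpha>] by (simp add: DN_space)
    moreover have "rmap DN \<alpha> (\<xi> \<alpha>) x = 0" if x: "x \<in> W a" for x
    proof -
      have "x \<in> carrier Na" using subD(2)[OF Wc[OF av]] x by blast
      moreover have "rmap N \<alpha> x \<in> W (head R \<alpha>)"
        using is_subrepD(2)[OF W OsD(1)[OF \<alpha>]] x OsD(2)[OF \<alpha>] by simp
      ultimately show ?thesis using \<xi>\<alpha>(2) OsD(2)[OF \<alpha>] by (simp add: dual_rep_def)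
    qed
    ultimately show "rmap DN \<alpha> (\<xi> \<alpha>) \<in> W' a" unfolding W'[OF av] by simp
  qed
  have car: "carrier (rspace (S_plus (op_quiver R) a (subrep DN W')) a)
    = Inr ` {\<xi> \<in> (\<Pi>\<^sub>E \<alpha>\<in>Os. W' (head R \<alpha>)). sink_map (op_quiver R) a (subrep DN W') \<xi> = \<zero>\<^bsub>rspace DN a\<^esub>}"
    by (simp add: S_plus_def Let_def transport_simps sum_simps)
  have W'D: "\<xi> \<in> (\<Pi>\<^sub>E \<alpha>\<in>Os. W' (head R \<alpha>)) \<longleftrightarrow> \<xi> \<in> carrier D.S \<and> (\<forall>w\<in>arrows_into W. sum_form \<xi> w = 0)" for \<xi>
  proof
    assume \<xi>: "\<xi> \<in> (\<Pi>\<^sub>E \<alpha>\<in>Os. W' (head R \<alpha>))"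
    have m: "\<xi> \<alpha> \<in> perp W (head R \<alpha>)" if "\<alpha> \<in> Os" for \<alpha> using PiE_mem[OF \<xi> that] W'[OF OsD(3)[OF that]] by simp
    have "\<xi> \<in> carrier D.S"
      unfolding D_carrier using \<xi> m by (intro PiE_I) (auto intro: PiE_arb[OF \<xi>])
    moreover have "sum_form \<xi> w = 0" if w: "w \<in> arrows_into W" for w
    proof -
      have "w \<in> carrier S" using w subD(2)[OF sub_arrows_into[OF W]] by blast
      moreover have "\<xi> \<alpha> (w \<alpha>) = 0" if "\<alpha> \<in> Os" for \<alpha>
        using m[OF that] PiE_mem[OF w[unfolded arrows_into_def] that] by simp
      ultimately show ?thesis by (simp add: sum_form_def)
    qed
    ultimately show "\<xi> \<in> carrier D.S \<and> (\<forall>w\<in>arrows_into W. sum_form \<xi> w = 0)" by blast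
  next
    assume \<xi>: "\<xi> \<in> carrier D.S \<and> (\<forall>w\<in>arrows_into W. sum_form \<xi> w = 0)"
    then have \<xi>D: "\<xi> \<in> (\<Pi>\<^sub>E \<alpha>\<in>Os. forms (rspace N (head R \<alpha>)))" by (simp add: D_carrier)
    show "\<xi> \<in> (\<Pi>\<^sub>E \<alpha>\<in>Os. W' (head R \<alpha>))"
    proof (rule PiE_I)
      fix \<alpha> assume \<alpha>: "\<alpha> \<in> Os"
      note h = OsD(3)[OF \<alpha>]
      have "\<xi> \<alpha> x = 0" if x: "x \<in> W (head R \<alpha>)" for x
      proof -
        have xN: "x \<in> carrier (rspace N (head R \<alpha>))" using subD(2)[OF Wc[OF h]] x by blast
        have "inc \<alpha> x \<in> arrows_into W"
          unfolding inj_sum_def arrows_into_def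
          by (rule restrict_PiE_iff[THEN iffD2]) (use x subD(3)[OF Wc[OF OsD(3)]] in auto)
        then have "sum_form \<xi> (inc \<alpha> x) = 0" using \<xi> by blast
        moreover have "sum_form \<xi> (inc \<alpha> x) = component_forms (sum_form \<xi>) \<alpha> x"
          using \<alpha> xN by (simp add: component_forms_def)
        ultimately show ?thesis using component_sum_form[OF \<xi>D] by simp
      qed
      then show "\<xi> \<alpha> \<in> W' (head R \<alpha>)" unfolding W'[OF h] using PiE_mem[OF \<xi>D \<alpha>] by simp
    qed (use PiE_arb[OF \<xi>D] in blast)
  qed
  have "{\<xi> \<in> (\<Pi>\<^sub>E \<alpha>\<in>Os. W' (head R \<alpha>)). sink_map (op_quiver R) a (subrep DN W') \<xi> = \<zero>\<^bsub>rspace DN a\<^esub>}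
    = {\<xi> \<in> relations. \<forall>w\<in>arrows_into W. sum_form \<xi> w = 0}"
    using sink_eq W'D unfolding relations_def by auto
  then show ?thesis using True car by (auto simp: Sp_carrier)
qed

text \<open>The left-hand side takes annihilators twice, around a reflection that turns the first annihilator into
  one in \<open>S\<^sub>a\<^sup>+ D N\<close> (\<open>S_plus_perp\<close>). The double annihilator is the image under evaluation, which is \<open>\<Psi>\<close>.\<close>

theorem D_flag_eq:
  assumes V: "\<And>l. l \<le> \<nu> \<Longrightarrow> is_subrep R N (V l)"
  shows "D_flag (refl_quiver a (op_quiver R)) \<nu> Sp (S_plus_flag (op_quiver R) a \<nu> DN (D_flag R \<nu> N V))
    = map_flag \<Psi> (S_minus_flag R a \<nu> N V)"
proof (intro ext)
  fix l i
  show "D_flag (refl_quiver a (op_quiver R)) \<nu> Sp (S_plus_flag (op_quiver R) a \<nu> DN (D_flag R \<nu> N V)) l i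
    = map_flag \<Psi> (S_minus_flag R a \<nu> N V) l i"
  proof (cases "l \<le> \<nu> \<and> i \<in> verts R")
    case False
    then show ?thesis by (auto simp: D_flag_def map_flag_def S_minus_flag_def)
  next
    case True
    then have l: "l \<le> \<nu>" and i: "i \<in> verts R" by auto
    note W = V[OF l]
    have W': "D_flag R \<nu> N V (\<nu> - l) j = perp (V l) j" if "j \<in> verts R" for j
      using that l by (simp add: D_flag_def DN_space)
    have lhs: "D_flag (refl_quiver a (op_quiver R)) \<nu> Sp (S_plus_flag (op_quiver R) a \<nu> DN (D_flag R \<nu> N V)) l i
      = {\<Lambda> \<in> forms (rspace Sp i). \<forall>\<eta>\<in>carrier (rspace (S_plus (op_quiver R) a (subrep DN (D_flag R \<nu> N V (\<nu> - l)))) i). \<Lambda> \<eta> = 0}"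
      using l i by (simp add: D_flag_def S_plus_flag_def dual_rep_def[of "refl_quiver a (op_quiver R)"])
    have perp: "carrier (rspace (S_plus (op_quiver R) a (subrep DN (D_flag R \<nu> N V (\<nu> - l)))) i)
      = (if i = a then {\<eta> \<in> carrier (rspace Sp a). \<forall>w\<in>arrows_into (V l). sum_form (projr \<eta>) w = 0}
         else {\<eta> \<in> carrier (rspace Sp i). \<forall>w\<in>V l i. projl \<eta> w = 0})"
      by (rule S_plus_perp[OF W _ i]) (rule W')
    show ?thesis
    proof (cases "i = a")
      case True
      interpret A: annihilator S B "rspace Sp a" "\<lambda>\<eta>. sum_form (projr \<eta>)" by (rule annihilator_a)
      have "D_flag (refl_quiver a (op_quiver R)) \<nu> Sp (S_plus_flag (op_quiver R) a \<nu> DN (D_flag R \<nu> N V)) l i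
        = {\<Lambda> \<in> forms (rspace Sp a). \<forall>\<eta>\<in>carrier (rspace Sp a). (\<forall>w\<in>arrows_into (V l). sum_form (projr \<eta>) w = 0) \<longrightarrow> \<Lambda> \<eta> = 0}"
        unfolding lhs perp using True by auto
      also have "\<dots> = A.ev ` arrows_into (V l)" by (rule A.double_annihilator[OF sub_arrows_into[OF W]])
      also have "\<dots> = (\<lambda>f. \<Psi> a (Inr (q f))) ` arrows_into (V l)"
        using Psi_a subD(2)[OF sub_arrows_into[OF W]] by (intro image_cong[OF refl]) (simp add: subset_iff)
      finally show ?thesis using l i True by (simp add: map_flag_def S_minus_flag_eq[OF V] image_image)
    next
      case False
      interpret A: annihilator "rspace N i" "{\<zero>\<^bsub>rspace N i\<^esub>}" "rspace Sp i" projl by (rule annihilator_i[OF i False])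
      have "D_flag (refl_quiver a (op_quiver R)) \<nu> Sp (S_plus_flag (op_quiver R) a \<nu> DN (D_flag R \<nu> N V)) l i
        = {\<Lambda> \<in> forms (rspace Sp i). \<forall>\<eta>\<in>carrier (rspace Sp i). (\<forall>w\<in>V l i. projl \<eta> w = 0) \<longrightarrow> \<Lambda> \<eta> = 0}"
        unfolding lhs perp using False by auto
      also have "\<dots> = A.ev ` V l i" by (rule A.double_annihilator[OF is_subrepD(1)[OF W i]])
      also have "\<dots> = (\<lambda>n. \<Psi> i (Inl n)) ` V l i" by (simp add: Psi_i[OF False])
      finally show ?thesis using l i False by (simp add: map_flag_def S_minus_flag_eq[OF V] image_image)
    qed
  qed
qed

subsection \<open>Morphisms from the simple representation\<close>

lemma quot_rep_simps:
  "rspace (quot_rep R N W) i = quot_space (rspace N i) (W i)"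
  "rmap (quot_rep R N W) \<alpha> C = (\<Union>x\<in>C. coset (rspace N (head R \<alpha>)) (W (head R \<alpha>)) (rmap N \<alpha> x))"
  by (simp_all add: quot_rep_def)

abbreviation Sa :: "('i, 'e, 'k, 'k) quiver_rep" where "Sa \<equiv> simple_rep a"

text \<open>A morphism from the simple representation at the source is a vector of \<open>N\<^sub>a/W\<^sub>a\<close> that all arrows out of
  \<open>a\<close> send to zero.\<close>

lemma hom_from_simple_vanishes_iff:
  assumes W: "is_subrep R N W"
  shows "hom_vanishes R (simple_rep a) (quot_rep R N W) \<longleftrightarrow>
    (\<forall>x\<in>carrier Na. (\<forall>\<alpha>\<in>Os. rmap N \<alpha> x \<in> W (head R \<alpha>)) \<longrightarrow> x \<in> W a)"
proof
  note s = is_subrepD(1)[OF W]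
  assume hv: "hom_vanishes R (simple_rep a) (quot_rep R N W)"
  show "\<forall>x\<in>carrier Na. (\<forall>\<alpha>\<in>Os. rmap N \<alpha> x \<in> W (head R \<alpha>)) \<longrightarrow> x \<in> W a"
  proof (intro ballI impI)
    fix x assume x: "x \<in> carrier Na" and arr: "\<forall>\<alpha>\<in>Os. rmap N \<alpha> x \<in> W (head R \<alpha>)"
    \<comment> \<open>the morphism that sends \<open>1\<close> to the class of \<open>x\<close>; elsewhere its value \<open>W i\<close> is the zero of the quotient\<close>
    define f where "f i c = (if i = a then coset Na (W a) (c \<odot>\<^bsub>Na\<^esub> x) else W i)" for i and c :: 'k
    note VN = N_vsp(1)
    have lin: "lin (rspace (simple_rep a) i) (rspace (quot_rep R N W) i) (f i)" if i: "i \<in> verts R" for i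
    proof (cases "i = a")
      case True
      have "lin ground_space Na (\<lambda>c. c \<odot>\<^bsub>Na\<^esub> x)"
        by (rule linI[OF vsp_ground_space VN[OF av]])
          (simp_all add: ground_space_def vsp_smult[OF VN[OF av]] vsp_distl[OF VN[OF av]] vsp_mult[OF VN[OF av]] x)
      from lin_comp[OF this quot_space(2)[OF s[OF av]]]
      have "lin ground_space (quot_space Na (W a)) (f a)" by (rule lin_sub_cong) (simp add: f_def)
      then show ?thesis using True by (simp add: simple_rep_def quot_rep_simps)
    next
      case False
      have z: "vsp (ground_space\<lparr>carrier := {0::'k}\<rparr>)"
        by (rule sub_vsp[OF vsp_ground_space]) (simp add: sub_iff[OF vsp_ground_space], simp add: ground_space_def)
      have qv: "vsp (quot_space (rspace N i) (W i))" by (rule quot_space(1)[OF s[OF i]])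
      have q0: "W i = \<zero>\<^bsub>quot_space (rspace N i) (W i)\<^esub>" using quot_simps(2)[OF s[OF i]] by simp
      have "lin (ground_space\<lparr>carrier := {0::'k}\<rparr>) (quot_space (rspace N i) (W i)) (f i)"
      proof (rule linI[OF z qv])
        have fi: "f i = (\<lambda>c. \<zero>\<^bsub>quot_space (rspace N i) (W i)\<^esub>)" using False q0 by (simp add: f_def fun_eq_iff)
        show "f i c \<in> carrier (quot_space (rspace N i) (W i))" for c unfolding fi by (rule vsp_zero[OF qv])
        show "f i (c \<oplus>\<^bsub>ground_space\<lparr>carrier := {0}\<rparr>\<^esub> c') = f i c \<oplus>\<^bsub>quot_space (rspace N i) (W i)\<^esub> f i c'" for c c'
          unfolding fi by (simp add: vsp_l0[OF qv vsp_zero[OF qv]])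
        show "f i (r \<odot>\<^bsub>ground_space\<lparr>carrier := {0}\<rparr>\<^esub> c) = r \<odot>\<^bsub>quot_space (rspace N i) (W i)\<^esub> f i c" for r c
          unfolding fi by (simp add: vsp_smult_zero[OF qv])
      qed
      then show ?thesis using False by (simp add: simple_rep_def quot_rep_simps)
    qed
    have "f \<in> rep_hom R (simple_rep a) (quot_rep R N W)"
      unfolding rep_hom_def mem_Collect_eq
    proof (intro conjI ballI)
      show "lin (rspace (simple_rep a) i) (rspace (quot_rep R N W) i) (f i)" if "i \<in> verts R" for i by (rule lin[OF that])
      fix \<alpha> c assume \<alpha>: "\<alpha> \<in> arcs R" and c: "c \<in> carrier (rspace Sa (tail R \<alpha>))"
      let ?t = "tail R \<alpha>" and ?h = "head R \<alpha>"
      have sh: "sub (rspace N ?h) (W ?h)" by (rule s[OF arcD(2)[OF \<alpha>]])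
      have st: "sub (rspace N ?t) (W ?t)" by (rule s[OF arcD(1)[OF \<alpha>]])
      have mem: "y \<in> f ?t c \<Longrightarrow> rmap N \<alpha> y \<in> W ?h" for y
      proof (cases "\<alpha> \<in> Os")
        case True
        assume y: "y \<in> f ?t c"
        note sa = s[OF av] and L = N_lin_Os[OF True]
        obtain w where w: "w \<in> W a" "y = w \<oplus>\<^bsub>Na\<^esub> c \<odot>\<^bsub>Na\<^esub> x"
          using y OsD(2)[OF True] by (auto simp: f_def coset_mem)
        have wN: "w \<in> carrier Na" using subD(2)[OF sa] w(1) by blast
        have "rmap N \<alpha> y = rmap N \<alpha> w \<oplus>\<^bsub>rspace N ?h\<^esub> c \<odot>\<^bsub>rspace N ?h\<^esub> rmap N \<alpha> x"
          unfolding w(2) using linD(4,5)[OF L] wN x vsp_smult[OF VN[OF av] x] by simp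
        moreover have "rmap N \<alpha> w \<in> W ?h" using is_subrepD(2)[OF W \<alpha>, of w] w(1) OsD(2)[OF True] by simp
        ultimately show ?thesis using arr True subD(4,5)[OF sh] by simp
      next
        case False
        assume "y \<in> f ?t c"
        then have "y \<in> W ?t" using arcD(4)[OF \<alpha> False] by (simp add: f_def)
        then show ?thesis by (rule is_subrepD(2)[OF W \<alpha>])
      qed
      have ne: "f ?t c \<noteq> {}"
      proof (cases "?t = a")
        case True
        have "c \<odot>\<^bsub>Na\<^esub> x \<in> f ?t c" using coset_self[OF s[OF av] vsp_smult[OF VN[OF av] x]] True by (simp add: f_def)
        then show ?thesis by blast
      next
        case False
        then show ?thesis using subD(3)[OF st] by (auto simp: f_def)
      qed
      have "coset (rspace N ?h) (W ?h) (rmap N \<alpha> y) = W ?h" if "y \<in> f ?t c" for y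
        using coset_eq_W[OF sh] mem[OF that] subD(2)[OF sh] by blast
      then have "rmap (quot_rep R N W) \<alpha> (f ?t c) = W ?h" unfolding quot_rep_simps using ne by blast
      then show "f ?h (rmap (simple_rep a) \<alpha> c) = rmap (quot_rep R N W) \<alpha> (f ?t c)"
        using arcD(3)[OF \<alpha>] by (simp add: f_def)
    qed
    then have "f a 1 = \<zero>\<^bsub>rspace (quot_rep R N W) a\<^esub>"
      using hv av unfolding hom_vanishes_def by (auto simp: simple_rep_def ground_space_def)
    then have "coset Na (W a) x = W a"
      using x by (simp add: f_def vsp_one[OF VN[OF av]] quot_rep_simps quot_simps(2)[OF s[OF av]])
    then show "x \<in> W a" using coset_eq_W[OF s[OF av] x] by simp
  qed
next
  note s = is_subrepD(1)[OF W]
  assume cond: "\<forall>x\<in>carrier Na. (\<forall>\<alpha>\<in>Os. rmap N \<alpha> x \<in> W (head R \<alpha>)) \<longrightarrow> x \<in> W a"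
  show "hom_vanishes R (simple_rep a) (quot_rep R N W)"
    unfolding hom_vanishes_def
  proof (intro ballI)
    fix f i c assume f: "f \<in> rep_hom R (simple_rep a) (quot_rep R N W)" and i: "i \<in> verts R"
      and c: "c \<in> carrier (rspace Sa i)"
    have flin: "lin (rspace Sa j) (rspace (quot_rep R N W) j) (f j)" if "j \<in> verts R" for j
      using f that by (simp add: rep_hom_def)
    have f0: "f j 0 = \<zero>\<^bsub>rspace (quot_rep R N W) j\<^esub>" if "j \<in> verts R" for j
      using lin_zero[OF flin[OF that]] by (simp add: simple_rep_def ground_space_def split: if_splits)
    show "f i c = \<zero>\<^bsub>rspace (quot_rep R N W) i\<^esub>"
    proof (cases "i = a")
      case False
      then have "c = 0" using c by (simp add: simple_rep_def)
      then show ?thesis using f0[OF i] by simp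
    next
      case True
      have "f a c \<in> carrier (quot_space Na (W a))"
        using linD(3)[OF flin[OF av]] c True by (simp add: quot_rep_simps)
      then obtain y where y: "y \<in> carrier Na" "f a c = coset Na (W a) y"
        unfolding quot_simps(1)[OF s[OF av]] by blast
      have "rmap N \<alpha> y \<in> W (head R \<alpha>)" if \<alpha>: "\<alpha> \<in> Os" for \<alpha>
      proof -
        note h = OsD(3)[OF \<alpha>]
        have com: "\<forall>\<alpha>\<in>arcs R. \<forall>x\<in>carrier (rspace Sa (tail R \<alpha>)).
            f (head R \<alpha>) (rmap (simple_rep a) \<alpha> x) = rmap (quot_rep R N W) \<alpha> (f (tail R \<alpha>) x)"
          using f unfolding rep_hom_def mem_Collect_eq by (rule conjunct2)
        have "c \<in> carrier (rspace Sa (tail R \<alpha>))"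
          unfolding OsD(2)[OF \<alpha>] using c True by simp
        then have "f (head R \<alpha>) (rmap Sa \<alpha> c) = rmap (quot_rep R N W) \<alpha> (f (tail R \<alpha>) c)"
          by (rule com[THEN bspec, OF OsD(1)[OF \<alpha>], THEN bspec])
        also have "rmap Sa \<alpha> c = 0" by (simp add: simple_rep_def)
        finally have eq: "W (head R \<alpha>) = (\<Union>z\<in>coset Na (W a) y. coset (rspace N (head R \<alpha>)) (W (head R \<alpha>)) (rmap N \<alpha> z))"
          unfolding f0[OF h] OsD(2)[OF \<alpha>] y(2) quot_rep_simps quot_simps(2)[OF s[OF h]] .
        have "rmap N \<alpha> y \<in> coset (rspace N (head R \<alpha>)) (W (head R \<alpha>)) (rmap N \<alpha> y)"
          by (rule coset_self[OF s[OF h] linD(3)[OF N_lin_Os[OF \<alpha>] y(1)]])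
        then have "rmap N \<alpha> y \<in> (\<Union>z\<in>coset Na (W a) y. coset (rspace N (head R \<alpha>)) (W (head R \<alpha>)) (rmap N \<alpha> z))"
          by (rule UN_I[OF coset_self[OF s[OF av] y(1)]])
        then show ?thesis by (simp only: eq[symmetric])
      qed
      then have "y \<in> W a" using cond y(1) by blast
      then show ?thesis using True y coset_eq_W[OF s[OF av] y(1)]
        by (simp add: quot_rep_simps quot_simps(2)[OF s[OF av]])
    qed
  qed
qed

end

section \<open>Reflection at a sink\<close>

locale sink_rep =
  fixes Q :: "('i, 'e) pre_digraph" and a :: 'i and M :: "('i, 'e, 'k::field, 'v) quiver_rep"
  assumes fin: "fin_digraph Q" and sink: "is_sink Q a" and repM: "is_rep Q M"
begin

sublocale G: fin_digraph Q by (rule fin)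

abbreviation "Is \<equiv> in_arcs Q a"

lemma av: "a \<in> verts Q" using sink by (simp add: is_sink_def)

lemma arcD:
  assumes "\<alpha> \<in> arcs Q"
  shows "tail Q \<alpha> \<in> verts Q" "head Q \<alpha> \<in> verts Q" "tail Q \<alpha> \<noteq> a" "\<alpha> \<notin> Is \<Longrightarrow> head Q \<alpha> \<noteq> a"
  using assms G.wellformed[OF assms] sink by (auto simp: in_arcs_def out_arcs_def is_sink_def)

lemma IsD:
  assumes "\<alpha> \<in> Is"
  shows "\<alpha> \<in> arcs Q" "head Q \<alpha> = a" "tail Q \<alpha> \<in> verts Q" "tail Q \<alpha> \<noteq> a"
proof -
  show \<alpha>: "\<alpha> \<in> arcs Q" "head Q \<alpha> = a" using assms by (simp_all add: in_arcs_def)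
  show "tail Q \<alpha> \<in> verts Q" "tail Q \<alpha> \<noteq> a" by (rule arcD[OF \<alpha>(1)])+
qed

lemma M_vsp: "i \<in> verts Q \<Longrightarrow> vsp (rspace M i)" "i \<in> verts Q \<Longrightarrow> fdim (rspace M i)"
  using repM by (auto simp: is_rep_def)

lemma M_lin: "\<alpha> \<in> arcs Q \<Longrightarrow> lin (rspace M (tail Q \<alpha>)) (rspace M (head Q \<alpha>)) (rmap M \<alpha>)"
  using repM by (auto simp: is_rep_def)

abbreviation "Ma \<equiv> rspace M a"

lemma M_lin_Is: "\<alpha> \<in> Is \<Longrightarrow> lin (rspace M (tail Q \<alpha>)) Ma (rmap M \<alpha>)"
  using M_lin[OF IsD(1)] IsD(2) by metis

sublocale sum_spaces Is "\<lambda>\<alpha>. rspace M (tail Q \<alpha>)"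
proof (rule sum_spaces.intro)
  show "finite Is" using G.finite_arcs by (simp add: in_arcs_def)
  show "vsp (rspace M (tail Q \<alpha>))" "fdim (rspace M (tail Q \<alpha>))" if "\<alpha> \<in> Is" for \<alpha>
    by (rule M_vsp[OF IsD(3)[OF that]])+
qed

abbreviation "\<phi> \<equiv> sink_map Q a M"

lemma lin_phi: "lin S Ma \<phi>"
  unfolding sink_map_def[abs_def] by (rule lin_sum[OF M_vsp(1)[OF av] M_lin_Is])

lemma phi_inc: "\<alpha> \<in> Is \<Longrightarrow> x \<in> carrier (rspace M (tail Q \<alpha>)) \<Longrightarrow> \<phi> (inc \<alpha> x) = rmap M \<alpha> x"
  unfolding sink_map_def by (rule sum_at_inc[OF M_vsp(1)[OF av] M_lin_Is])

definition kernel :: "('e \<Rightarrow> 'v) set" where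
  "kernel = {f \<in> carrier S. \<phi> f = \<zero>\<^bsub>Ma\<^esub>}"

lemma sub_kernel: "sub S kernel"
  unfolding kernel_def by (rule lin_kernel_sub[OF lin_phi sub_carrier[OF vsp_S]])

lemma vsp_kernel: "vsp (S\<lparr>carrier := kernel\<rparr>)" by (rule sub_vsp[OF vsp_S sub_kernel])

abbreviation Sa :: "('i, 'e, 'k, 'k) quiver_rep" where "Sa \<equiv> simple_rep a"

text \<open>A morphism to the simple representation at the sink is a linear form on the space at \<open>a\<close> that
  vanishes on the images of all arrows, and a proper subspace is killed by some non-zero form.\<close>

theorem hom_to_simple_vanishes_iff:
  "hom_vanishes Q M (simple_rep a) \<longleftrightarrow> \<phi> ` carrier S = carrier Ma"
proof
  assume hv: "hom_vanishes Q M (simple_rep a)"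
  show "\<phi> ` carrier S = carrier Ma"
  proof (rule ccontr)
    assume ne: "\<phi> ` carrier S \<noteq> carrier Ma"
    have im: "sub Ma (\<phi> ` carrier S)" by (rule lin_image_sub[OF lin_phi sub_carrier[OF vsp_S]])
    then obtain v where v: "v \<in> carrier Ma" "v \<notin> \<phi> ` carrier S" using ne subD(2)[OF im] by blast
    obtain \<xi> where \<xi>: "\<xi> \<in> forms Ma" "\<xi> v = 1" "\<And>u. u \<in> \<phi> ` carrier S \<Longrightarrow> \<xi> u = 0"
      by (rule ex_separating_form[OF M_vsp[OF av] im v]) blast
    \<comment> \<open>a form that vanishes on the image of \<open>\<phi>\<close> but not at \<open>v\<close> is a non-zero morphism\<close>
    define f where "f i x = (if i = a then \<xi> x else 0)" for i x
    have "f \<in> rep_hom Q M Sa"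
      unfolding rep_hom_def mem_Collect_eq
    proof (intro conjI ballI)
      fix i assume i: "i \<in> verts Q"
      show "lin (rspace M i) (rspace Sa i) (f i)"
      proof (cases "i = a")
        case True
        have "lin Ma ground_space \<xi>"
          by (rule linI[OF M_vsp(1)[OF av] vsp_ground_space]) (simp_all add: ground_space_def formD(2,3)[OF \<xi>(1)])
        then show ?thesis using True by (simp add: simple_rep_def f_def[abs_def])
      next
        case False
        have z: "vsp (ground_space\<lparr>carrier := {0::'k}\<rparr>)"
          by (rule sub_vsp[OF vsp_ground_space]) (simp add: sub_iff[OF vsp_ground_space], simp add: ground_space_def)
        have "lin (rspace M i) (ground_space\<lparr>carrier := {0::'k}\<rparr>) (\<lambda>x. 0)"
          by (rule linI[OF M_vsp(1)[OF i] z]) (simp_all add: ground_space_def)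
        then show ?thesis using False by (simp add: simple_rep_def f_def[abs_def])
      qed
    next
      fix \<alpha> x assume \<alpha>: "\<alpha> \<in> arcs Q" and x: "x \<in> carrier (rspace M (tail Q \<alpha>))"
      have "f (head Q \<alpha>) (rmap M \<alpha> x) = 0"
      proof (cases "\<alpha> \<in> Is")
        case True
        have "rmap M \<alpha> x \<in> \<phi> ` carrier S"
          using phi_inc[OF True x] linD(3)[OF lin_inc[OF True] x] by (metis imageI)
        then show ?thesis using \<xi>(3) IsD(2)[OF True] by (simp add: f_def)
      next
        case False
        then show ?thesis using arcD(4)[OF \<alpha>] by (simp add: f_def)
      qed
      then show "f (head Q \<alpha>) (rmap M \<alpha> x) = rmap Sa \<alpha> (f (tail Q \<alpha>) x)"
        by (simp add: simple_rep_def)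
    qed
    then have "f a v = \<zero>\<^bsub>rspace Sa a\<^esub>"
      using hv av v(1) unfolding hom_vanishes_def by blast
    then show False using \<xi>(2) by (simp add: f_def simple_rep_def ground_space_def)
  qed
next
  assume surj: "\<phi> ` carrier S = carrier Ma"
  show "hom_vanishes Q M (simple_rep a)"
    unfolding hom_vanishes_def
  proof (intro ballI)
    fix f i x assume f: "f \<in> rep_hom Q M Sa"
      and i: "i \<in> verts Q" and x: "x \<in> carrier (rspace M i)"
    have flin: "lin (rspace M j) (rspace Sa j) (f j)" if "j \<in> verts Q" for j
      using f that by (simp add: rep_hom_def)
    show "f i x = \<zero>\<^bsub>rspace Sa i\<^esub>"
    proof (cases "i = a")
      case False
      then show ?thesis using linD(3)[OF flin[OF i] x] by (simp add: simple_rep_def ground_space_def)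
    next
      case True
      then obtain g where g: "g \<in> carrier S" "x = \<phi> g" using x surj by blast
      have com: "\<forall>\<alpha>\<in>arcs Q. \<forall>x\<in>carrier (rspace M (tail Q \<alpha>)).
          f (head Q \<alpha>) (rmap M \<alpha> x) = rmap Sa \<alpha> (f (tail Q \<alpha>) x)"
        using f unfolding rep_hom_def mem_Collect_eq by (rule conjunct2)
      have gm: "g \<alpha> \<in> carrier (rspace M (tail Q \<alpha>))" if "\<alpha> \<in> Is" for \<alpha> by (rule S_mem[OF g(1) that])
      have fa: "f a (rmap M \<alpha> (g \<alpha>)) = 0" if "\<alpha> \<in> Is" for \<alpha>
        using com[THEN bspec, OF IsD(1)[OF that], THEN bspec, OF gm[OF that]] unfolding IsD(2)[OF that]
        by (simp add: simple_rep_def)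
      have "f a x = finsum (rspace Sa a) (\<lambda>\<alpha>. f a (rmap M \<alpha> (g \<alpha>))) Is"
        unfolding g(2) sink_map_def by (rule lin_finsum[OF flin[OF av]]) (rule linD(3)[OF M_lin_Is gm])
      also have "\<dots> = \<zero>\<^bsub>rspace Sa a\<^esub>"
        by (rule vsp_finsum_zero[OF linD(2)[OF flin[OF av]]]) (simp add: fa simple_rep_def ground_space_def)
      finally show ?thesis using True by simp
    qed
  qed
qed

subsection \<open>The reflected representation\<close>

abbreviation "R \<equiv> refl_quiver a Q"
abbreviation "N \<equiv> S_plus Q a M"

lemma R_arc:
  assumes "\<alpha> \<in> arcs Q"
  shows "tail R \<alpha> = (if \<alpha> \<in> Is then a else tail Q \<alpha>)" "head R \<alpha> = (if \<alpha> \<in> Is then tail Q \<alpha> else head Q \<alpha>)"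
  using arcD(3,4)[OF assms] IsD(2)[of \<alpha>] by auto

lemma out_R: "out_arcs R a = Is"
proof -
  have "\<alpha> \<in> arcs Q \<Longrightarrow> tail R \<alpha> = a \<longleftrightarrow> \<alpha> \<in> Is" for \<alpha> using R_arc(1)[of \<alpha>] arcD(3)[of \<alpha>] by simp
  then show ?thesis unfolding out_arcs_def using IsD(1) by (auto simp del: refl_quiver_simps(3))
qed

lemma in_R: "in_arcs R a = {}"
proof -
  have "head R \<alpha> \<noteq> a" if "\<alpha> \<in> arcs Q" for \<alpha> using R_arc(2)[OF that] arcD(3,4)[OF that] by simp
  then show ?thesis unfolding in_arcs_def by (simp del: refl_quiver_simps(4))
qed

lemma fin_R: "fin_digraph R"
proof
  fix \<alpha> assume "\<alpha> \<in> arcs R"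
  then have "\<alpha> \<in> arcs Q" by simp
  then show "tail R \<alpha> \<in> verts R" "head R \<alpha> \<in> verts R" using arcD(1,2) by auto
qed (use G.finite_arcs G.finite_verts in simp_all)

lemma N_space:
  "i \<noteq> a \<Longrightarrow> rspace N i = transport_space Inl (rspace M i)"
  "rspace N a = transport_space Inr (S\<lparr>carrier := kernel\<rparr>)"
  by (simp_all add: S_plus_def Let_def kernel_def)

lemma N_carrier:
  "i \<noteq> a \<Longrightarrow> carrier (rspace N i) = Inl ` carrier (rspace M i)"
  "carrier (rspace N a) = Inr ` kernel"
  by (simp_all add: N_space transport_simps)

lemma N_map:
  "\<alpha> \<in> Is \<Longrightarrow> rmap N \<alpha> x = Inl (projr x \<alpha>)"
  "\<alpha> \<notin> Is \<Longrightarrow> rmap N \<alpha> x = Inl (rmap M \<alpha> (projl x))"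
  by (simp_all add: S_plus_def Let_def)

lemma lin_Inl: "i \<in> verts Q \<Longrightarrow> i \<noteq> a \<Longrightarrow> lin (rspace M i) (rspace N i) Inl"
  using transport(2)[OF inj_Inl M_vsp(1)] by (simp add: N_space)

lemma lin_projl: "i \<in> verts Q \<Longrightarrow> i \<noteq> a \<Longrightarrow> lin (rspace N i) (rspace M i) projl"
  using transport_projl[OF M_vsp(1)] by (simp add: N_space)

lemma lin_Inr: "lin (S\<lparr>carrier := kernel\<rparr>) (rspace N a) Inr"
  using transport(2)[OF inj_Inr vsp_kernel] by (simp add: N_space)

lemma lin_projr: "lin (rspace N a) S projr"
  using lin_comp[OF transport_projr[OF vsp_kernel] lin_inclusion[OF sub_kernel]] by (simp add: N_space)

lemma is_rep_N: "is_rep R N"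
  unfolding is_rep_def
proof (intro conjI ballI)
  fix i assume "i \<in> verts R"
  then have i: "i \<in> verts Q" by simp
  show "vsp (rspace N i)"
    using linD(2)[OF lin_Inl[OF i]] linD(2)[OF lin_Inr] by (cases "i = a") auto
  show "fdim (rspace N i)"
  proof (cases "i = a")
    case True
    show ?thesis unfolding True N_space(2)
      by (rule fdim_transport[OF inj_Inr vsp_kernel fdim_sub[OF vsp_S fdim_S sub_kernel]])
  next
    case False
    show ?thesis unfolding N_space(1)[OF False] by (rule fdim_transport[OF inj_Inl M_vsp[OF i]])
  qed
next
  fix \<alpha> assume "\<alpha> \<in> arcs R"
  then have \<alpha>: "\<alpha> \<in> arcs Q" by simp
  show "lin (rspace N (tail R \<alpha>)) (rspace N (head R \<alpha>)) (rmap N \<alpha>)"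
  proof (cases "\<alpha> \<in> Is")
    case True
    have "lin (rspace N a) (rspace N (tail Q \<alpha>)) (\<lambda>x. Inl (projr x \<alpha>))"
      by (rule lin_comp[OF lin_comp[OF lin_projr lin_proj[OF True]] lin_Inl[OF IsD(3,4)[OF True]]])
    then show ?thesis using True R_arc[OF \<alpha>] by (simp add: N_map(1)[OF True, abs_def] del: refl_quiver_simps)
  next
    case False
    have "lin (rspace N (tail Q \<alpha>)) (rspace N (head Q \<alpha>)) (\<lambda>x. Inl (rmap M \<alpha> (projl x)))"
      by (rule lin_comp[OF lin_comp[OF lin_projl[OF arcD(1,3)[OF \<alpha>]] M_lin[OF \<alpha>]] lin_Inl[OF arcD(2)[OF \<alpha>] arcD(4)[OF \<alpha> False]]])
    then show ?thesis using False R_arc[OF \<alpha>] by (simp add: N_map(2)[OF False, abs_def] del: refl_quiver_simps)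
  qed
qed

sublocale r: source_rep R a N
  by (rule source_rep.intro[OF fin_R _ in_R is_rep_N]) (simp add: av)

lemma head_R: "\<alpha> \<in> Is \<Longrightarrow> head R \<alpha> = tail Q \<alpha>"
  using R_arc(2)[OF IsD(1)] by simp

text \<open>The sum over the reversed arrows is a copy of the sum over the arrows into \<open>a\<close>.\<close>

definition untag :: "('e \<Rightarrow> 'v + ('e \<Rightarrow> 'v)) \<Rightarrow> 'e \<Rightarrow> 'v" where
  "untag f = (\<lambda>\<alpha>\<in>Is. projl (f \<alpha>))"

lemma rS_mem: "f \<in> carrier r.S \<Longrightarrow> \<alpha> \<in> Is \<Longrightarrow> f \<alpha> \<in> Inl ` carrier (rspace M (tail Q \<alpha>))"
  using r.S_mem[of f \<alpha>] by (simp add: out_R head_R N_carrier IsD(4) del: refl_quiver_simps)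

lemma lin_untag: "lin r.S S untag"
proof (rule linI[OF r.vsp_S vsp_S])
  have comp: "f \<alpha> \<in> carrier (rspace N (tail Q \<alpha>))" if "f \<in> carrier r.S" "\<alpha> \<in> Is" for f \<alpha>
    using rS_mem[OF that] IsD(4)[OF that(2)] by (simp add: N_carrier)
  note L = linD(3-5)[OF lin_projl[OF IsD(3,4)]]
  show "untag f \<in> carrier S" if "f \<in> carrier r.S" for f
    unfolding untag_def sum_simps by (rule restrict_PiE_iff[THEN iffD2]) (use L(1) comp[OF that] in blast)
  show "untag (f \<oplus>\<^bsub>r.S\<^esub> g) = untag f \<oplus>\<^bsub>S\<^esub> untag g" if "f \<in> carrier r.S" "g \<in> carrier r.S" for f g
    unfolding untag_def sum_simps out_R
    by (rule restrict_ext) (simp add: head_R L(2)[OF _ _ comp[OF that(1)] comp[OF that(2)]] del: refl_quiver_simps)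
  show "untag (c \<odot>\<^bsub>r.S\<^esub> f) = c \<odot>\<^bsub>S\<^esub> untag f" if "f \<in> carrier r.S" for c f
    unfolding untag_def sum_simps out_R
    by (rule restrict_ext) (simp add: head_R L(3)[OF _ _ comp[OF that]] del: refl_quiver_simps)
qed

lemma untag_PiE:
  assumes A: "\<And>\<alpha>. \<alpha> \<in> Is \<Longrightarrow> A \<alpha> \<subseteq> range Inl"
  shows "untag ` (\<Pi>\<^sub>E \<alpha>\<in>Is. A \<alpha>) = (\<Pi>\<^sub>E \<alpha>\<in>Is. projl ` A \<alpha>)"
proof (intro equalityI subsetI)
  fix g assume "g \<in> untag ` (\<Pi>\<^sub>E \<alpha>\<in>Is. A \<alpha>)"
  then obtain f where f: "f \<in> (\<Pi>\<^sub>E \<alpha>\<in>Is. A \<alpha>)" "g = untag f" by blast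
  show "g \<in> (\<Pi>\<^sub>E \<alpha>\<in>Is. projl ` A \<alpha>)"
    unfolding f(2) untag_def by (rule restrict_PiE_iff[THEN iffD2]) (use PiE_mem[OF f(1)] in blast)
next
  fix g assume g: "g \<in> (\<Pi>\<^sub>E \<alpha>\<in>Is. projl ` A \<alpha>)"
  define f :: "'e \<Rightarrow> 'v + ('e \<Rightarrow> 'v)" where "f = (\<lambda>\<alpha>\<in>Is. Inl (g \<alpha>))"
  have "f \<in> (\<Pi>\<^sub>E \<alpha>\<in>Is. A \<alpha>)"
    unfolding f_def
  proof (rule restrict_PiE_iff[THEN iffD2], rule ballI)
    fix \<alpha> assume \<alpha>: "\<alpha> \<in> Is"
    obtain y where y: "y \<in> A \<alpha>" "g \<alpha> = projl y" using PiE_mem[OF g \<alpha>] by blast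
    then obtain z where "y = Inl z" using A[OF \<alpha>] by blast
    then show "Inl (g \<alpha>) \<in> A \<alpha>" using y by simp
  qed
  moreover have "untag f = g"
    using g by (intro PiE_ext[of "untag f" Is "\<lambda>_. UNIV" g])
      (auto simp: untag_def f_def PiE_iff)
  ultimately show "g \<in> untag ` (\<Pi>\<^sub>E \<alpha>\<in>Is. A \<alpha>)" by blast
qed

lemma rS_carrier: "carrier r.S = (\<Pi>\<^sub>E \<alpha>\<in>Is. Inl ` carrier (rspace M (tail Q \<alpha>)))"
  unfolding sum_simps out_R by (rule PiE_cong) (simp add: head_R N_carrier IsD(4) del: refl_quiver_simps)

lemma untag_surj: "untag ` carrier r.S = carrier S"
  unfolding rS_carrier by (subst untag_PiE) (auto simp: sum_simps image_image)

lemma untag_src: "k \<in> kernel \<Longrightarrow> untag (r.src (Inr k)) = k"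
proof -
  assume k: "k \<in> kernel"
  then have "k \<in> carrier S" by (simp add: kernel_def)
  then have ext: "k \<in> extensional Is" by (auto simp: sum_simps PiE_iff)
  have "untag (r.src (Inr k)) = (\<lambda>\<alpha>\<in>Is. k \<alpha>)"
    unfolding untag_def source_map_def out_R by (rule restrict_ext) (simp add: N_map)
  then show ?thesis using extensional_restrict[OF ext] by simp
qed

lemma src_untag:
  assumes f: "f \<in> carrier r.S" and k: "untag f \<in> kernel" shows "f = r.src (Inr (untag f))"
proof (rule r.S_eqI[OF f])
  show "r.src (Inr (untag f)) \<in> carrier r.S"
    by (rule linD(3)[OF r.lin_src]) (use k in \<open>simp add: N_carrier\<close>)
  fix \<alpha> assume "\<alpha> \<in> out_arcs R a"
  then have \<alpha>: "\<alpha> \<in> Is" by (simp add: out_R)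
  then show "f \<alpha> = r.src (Inr (untag f)) \<alpha>"
    using rS_mem[OF f \<alpha>] by (auto simp: source_map_def out_R N_map untag_def)
qed

abbreviation "\<Theta> \<equiv> refl_counit Q a M"

lemma Theta_i: "i \<noteq> a \<Longrightarrow> \<Theta> i y = projl (projl y)"
  by (simp add: refl_counit_def)

lemma lin_phi_untag: "lin r.S Ma (\<lambda>f. \<phi> (untag f))"
  by (rule lin_comp[OF lin_untag lin_phi])

lemma Theta_a: "f \<in> carrier r.S \<Longrightarrow> \<Theta> a (Inr (r.q f)) = \<phi> (untag f)"
proof -
  assume f: "f \<in> carrier r.S"
  have "\<phi> (untag b) = \<zero>\<^bsub>Ma\<^esub>" if b: "b \<in> r.B" for b
  proof -
    obtain k where "k \<in> kernel" "b = r.src (Inr k)" using b unfolding N_carrier by blast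
    then show ?thesis by (simp add: untag_src kernel_def)
  qed
  from r.some_class[OF f lin_phi_untag this] show ?thesis
    by (simp add: refl_counit_def untag_def)
qed

text \<open>At \<open>a\<close> the counit is the map induced by \<open>\<phi>\<close> on the cokernel of the inclusion of its kernel: injective
  always, and surjective as \<open>\<phi>\<close> is.\<close>

theorem counit_iso:
  assumes surj: "\<phi> ` carrier S = carrier Ma"
  shows "rep_iso Q r.Sm M \<Theta>"
  unfolding rep_iso_def rep_hom_def mem_Collect_eq
proof (intro conjI ballI)
  fix i assume i: "i \<in> verts Q"
  show "lin (rspace r.Sm i) (rspace M i) (\<Theta> i)"
  proof (cases "i = a")
    case True
    show ?thesis unfolding True by (rule r.lin_from_Sm_a[OF lin_phi_untag Theta_a])
  next
    case False
    have "lin (rspace r.Sm i) (rspace M i) (\<lambda>y. projl (projl y))"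
      unfolding r.Sm_space(1)[OF False]
      by (rule lin_comp[OF transport_projl[OF linD(1)[OF lin_projl[OF i False]]] lin_projl[OF i False]])
    then show ?thesis by (simp add: Theta_i[OF False, abs_def])
  qed
  show "bij_betw (\<Theta> i) (carrier (rspace r.Sm i)) (carrier (rspace M i))"
  proof (cases "i = a")
    case True
    show ?thesis unfolding True
    proof (rule r.bij_from_Sm_a[OF lin_phi_untag Theta_a])
      show "f \<in> r.B" if "f \<in> carrier r.S" "\<phi> (untag f) = \<zero>\<^bsub>Ma\<^esub>" for f
      proof -
        have "untag f \<in> kernel" using that linD(3)[OF lin_untag] by (simp add: kernel_def)
        then show ?thesis using src_untag[OF that(1)] N_carrier(2) by blast
      qed
      show "(\<lambda>f. \<phi> (untag f)) ` carrier r.S = carrier Ma"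
        using untag_surj surj image_image[of \<phi> untag "carrier r.S"] by simp
    qed
  next
    case False
    show ?thesis unfolding r.Sm_carrier(1)[OF False] N_carrier(1)[OF False]
      by (rule bij_betwI[where g = "\<lambda>x. Inl (Inl x)"]) (auto simp: Theta_i[OF False])
  qed
next
  fix \<alpha> x assume \<alpha>: "\<alpha> \<in> arcs Q" and x: "x \<in> carrier (rspace r.Sm (tail Q \<alpha>))"
  note ta = arcD(3)[OF \<alpha>]
  obtain m where m: "m \<in> carrier (rspace M (tail Q \<alpha>))" "x = Inl (Inl m)"
    using x unfolding r.Sm_carrier(1)[OF ta] N_carrier(1)[OF ta] by blast
  show "\<Theta> (head Q \<alpha>) (rmap r.Sm \<alpha> x) = rmap M \<alpha> (\<Theta> (tail Q \<alpha>) x)"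
  proof (cases "\<alpha> \<in> Is")
    case True
    then have \<alpha>R: "\<alpha> \<in> out_arcs R a" by (simp add: out_R)
    have mN: "Inl m \<in> carrier (rspace N (head R \<alpha>))"
      using m(1) ta by (simp add: head_R[OF True] N_carrier del: refl_quiver_simps)
    have "untag (r.inc \<alpha> (Inl m)) = inc \<alpha> m"
      unfolding untag_def inj_sum_def out_R
      by (rule restrict_ext) (auto simp: head_R N_space IsD(4) transport_simps simp del: refl_quiver_simps)
    then have "\<Theta> a (Inr (r.q (r.inc \<alpha> (Inl m)))) = rmap M \<alpha> m"
      using Theta_a[OF linD(3)[OF r.lin_inc[OF \<alpha>R] mN]] phi_inc[OF True m(1)] by simp
    then show ?thesis unfolding r.Sm_map(1)[OF \<alpha>R] IsD(2)[OF True] Theta_i[OF ta] m(2) by simp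
  next
    case False
    then have \<alpha>R: "\<alpha> \<notin> out_arcs R a" by (simp add: out_R)
    show ?thesis unfolding r.Sm_map(2)[OF \<alpha>R] Theta_i[OF ta] Theta_i[OF arcD(4)[OF \<alpha> False]] m(2)
      by (simp add: N_map(2)[OF False])
  qed
qed

subsection \<open>Subrepresentations\<close>

definition arrows_from :: "('i \<Rightarrow> 'v set) \<Rightarrow> ('e \<Rightarrow> 'v) set" where
  "arrows_from W = (\<Pi>\<^sub>E \<alpha>\<in>Is. W (tail Q \<alpha>))"

lemma sub_arrows_from:
  assumes "\<And>i. i \<in> verts Q \<Longrightarrow> i \<noteq> a \<Longrightarrow> sub (rspace M i) (W i)" shows "sub S (arrows_from W)"
  unfolding arrows_from_def by (rule sub_PiE) (rule assms[OF IsD(3,4)])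

lemma sink_map_subrep:
  assumes W: "is_subrep Q M W" and f: "f \<in> arrows_from W"
  shows "sink_map Q a (subrep M W) f = \<phi> f"
  unfolding sink_map_def subrep_simps
proof (rule sub_finsum_eq[OF M_vsp(1)[OF av] is_subrepD(1)[OF W av]])
  fix \<alpha> assume \<alpha>: "\<alpha> \<in> Is"
  have "f \<alpha> \<in> W (tail Q \<alpha>)" using f \<alpha> unfolding arrows_from_def by (rule PiE_mem)
  then show "rmap M \<alpha> (f \<alpha>) \<in> W a" using is_subrepD(2)[OF W IsD(1)[OF \<alpha>]] IsD(2)[OF \<alpha>] by simp
qed

lemma hom_subrep_to_simple_iff:
  assumes W: "is_subrep Q M W"
  shows "hom_vanishes Q (subrep M W) (simple_rep a) \<longleftrightarrow> \<phi> ` arrows_from W = W a"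
proof -
  interpret W: sink_rep Q a "subrep M W"
    by (rule sink_rep.intro[OF fin sink is_rep_subrep[OF fin repM W]])
  have "carrier W.S = arrows_from W" by (simp add: sum_simps arrows_from_def)
  moreover have "sink_map Q a (subrep M W) ` arrows_from W = \<phi> ` arrows_from W"
    by (rule image_cong[OF refl sink_map_subrep[OF W]])
  ultimately show ?thesis using W.hom_to_simple_vanishes_iff by simp
qed

lemma S_plus_subrep:
  assumes W: "is_subrep Q M W"
  shows "carrier (rspace (S_plus Q a (subrep M W)) i)
    = (if i = a then Inr ` {f \<in> arrows_from W. \<phi> f = \<zero>\<^bsub>Ma\<^esub>} else Inl ` W i)"
proof -
  have "{f \<in> arrows_from W. sink_map Q a (subrep M W) f = \<zero>\<^bsub>Ma\<^esub>} = {f \<in> arrows_from W. \<phi> f = \<zero>\<^bsub>Ma\<^esub>}"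
    using sink_map_subrep[OF W] by auto
  then show ?thesis by (simp add: S_plus_def Let_def transport_simps sum_simps arrows_from_def)
qed

text \<open>\<open>S\<^sub>a\<^sup>+ W\<close> as a subrepresentation of \<open>N\<close>, and the image in \<open>M\<close> of \<open>S\<^sub>a\<^sup>- V\<close> for a subrepresentation \<open>V\<close> of \<open>N\<close>.\<close>

definition refl_up :: "('i \<Rightarrow> 'v set) \<Rightarrow> 'i \<Rightarrow> ('v + ('e \<Rightarrow> 'v)) set" where
  "refl_up W i = (if i = a then Inr ` {f \<in> arrows_from W. \<phi> f = \<zero>\<^bsub>Ma\<^esub>} else Inl ` W i)"

definition refl_down :: "('i \<Rightarrow> ('v + ('e \<Rightarrow> 'v)) set) \<Rightarrow> 'i \<Rightarrow> 'v set" where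
  "refl_down V i = (if i = a then \<phi> ` arrows_from (\<lambda>j. projl ` V j) else projl ` V i)"

lemma refl_up_sub:
  assumes W: "is_subrep Q M W" and i: "i \<in> verts Q" shows "sub (rspace N i) (refl_up W i)"
proof (cases "i = a")
  case True
  have P: "sub S (arrows_from W)" by (rule sub_arrows_from) (rule is_subrepD(1)[OF W])
  have "sub (S\<lparr>carrier := kernel\<rparr>) {f \<in> arrows_from W. \<phi> f = \<zero>\<^bsub>Ma\<^esub>}"
    unfolding sub_sub_iff[OF sub_kernel]
    using lin_kernel_sub[OF lin_phi P] subD(2)[OF P] by (auto simp: kernel_def)
  from lin_image_sub[OF lin_Inr this] show ?thesis using True by (simp add: refl_up_def)
next
  case False
  then show ?thesis using lin_image_sub[OF lin_Inl[OF i False] is_subrepD(1)[OF W i]] by (simp add: refl_up_def)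
qed

lemma refl_up_subrep:
  assumes W: "is_subrep Q M W" shows "is_subrep R N (refl_up W)"
  unfolding is_subrep_def
proof (intro conjI ballI)
  show "sub (rspace N i) (refl_up W i)" if "i \<in> verts R" for i using refl_up_sub[OF W] that by simp
  fix \<alpha> assume "\<alpha> \<in> arcs R"
  then have \<alpha>: "\<alpha> \<in> arcs Q" by simp
  show "rmap N \<alpha> ` refl_up W (tail R \<alpha>) \<subseteq> refl_up W (head R \<alpha>)"
  proof (cases "\<alpha> \<in> Is")
    case True
    have "f \<alpha> \<in> W (tail Q \<alpha>)" if "f \<in> arrows_from W" for f
      using that True unfolding arrows_from_def by (rule PiE_mem)
    then show ?thesis unfolding R_arc[OF \<alpha>] using True IsD(4)[OF True] by (auto simp: refl_up_def N_map(1))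
  next
    case False
    then show ?thesis unfolding R_arc[OF \<alpha>] using arcD(3)[OF \<alpha>] arcD(4)[OF \<alpha>] is_subrepD(2)[OF W \<alpha>]
      by (auto simp: refl_up_def N_map(2))
  qed
qed

lemma V_range:
  assumes V: "is_subrep R N V" and i: "i \<in> verts Q"
  shows "i \<noteq> a \<Longrightarrow> V i \<subseteq> range Inl" "V a \<subseteq> range Inr" "V a \<subseteq> Inr ` kernel"
proof -
  have "V j \<subseteq> carrier (rspace N j)" if "j \<in> verts Q" for j
    using subD(2)[OF is_subrepD(1)[OF V]] that by simp
  then show "i \<noteq> a \<Longrightarrow> V i \<subseteq> range Inl" "V a \<subseteq> range Inr" "V a \<subseteq> Inr ` kernel"
    using i av N_carrier by blast+
qed

lemma projl_sub:
  assumes V: "is_subrep R N V" and i: "i \<in> verts Q" "i \<noteq> a"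
  shows "sub (rspace M i) (projl ` V i)"
  by (rule lin_image_sub[OF lin_projl[OF i]]) (use is_subrepD(1)[OF V] i in simp)

lemma sub_arrows_from_projl:
  assumes V: "is_subrep R N V" shows "sub S (arrows_from (\<lambda>j. projl ` V j))"
  by (rule sub_arrows_from) (rule projl_sub[OF V])

lemma refl_down_subrep:
  assumes V: "is_subrep R N V" shows "is_subrep Q M (refl_down V)"
  unfolding is_subrep_def
proof (intro conjI ballI)
  fix i assume i: "i \<in> verts Q"
  show "sub (rspace M i) (refl_down V i)"
    using lin_image_sub[OF lin_phi sub_arrows_from_projl[OF V]] projl_sub[OF V i]
    by (cases "i = a") (simp_all add: refl_down_def)
next
  fix \<alpha> assume \<alpha>: "\<alpha> \<in> arcs Q"
  have ta: "tail Q \<alpha> \<noteq> a" by (rule arcD(3)[OF \<alpha>])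
  show "rmap M \<alpha> ` refl_down V (tail Q \<alpha>) \<subseteq> refl_down V (head Q \<alpha>)"
  proof (cases "\<alpha> \<in> Is")
    case True
    have "rmap M \<alpha> x \<in> \<phi> ` arrows_from (\<lambda>j. projl ` V j)" if x: "x \<in> projl ` V (tail Q \<alpha>)" for x
    proof -
      have "inc \<alpha> x \<in> arrows_from (\<lambda>j. projl ` V j)"
        unfolding inj_sum_def arrows_from_def
        by (rule restrict_PiE_iff[THEN iffD2]) (use x subD(3)[OF projl_sub[OF V IsD(3,4)]] in auto)
      moreover have "x \<in> carrier (rspace M (tail Q \<alpha>))" using subD(2)[OF projl_sub[OF V IsD(3,4)[OF True]]] x by blast
      ultimately show ?thesis using phi_inc[OF True] by (metis imageI)
    qed
    then show ?thesis using ta IsD(2)[OF True] by (auto simp: refl_down_def)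
  next
    case False
    have "rmap M \<alpha> x \<in> projl ` V (head Q \<alpha>)" if x: "x \<in> projl ` V (tail Q \<alpha>)" for x
    proof -
      obtain y where y: "y \<in> V (tail Q \<alpha>)" "x = projl y" using x by blast
      have "rmap N \<alpha> y \<in> V (head Q \<alpha>)"
        using is_subrepD(2)[OF V, of \<alpha> y] y(1) \<alpha> R_arc[OF \<alpha>] False by (simp del: refl_quiver_simps(3,4))
      then show ?thesis unfolding N_map(2)[OF False] y(2) by (metis imageI sum.sel(1))
    qed
    then show ?thesis using ta arcD(4)[OF \<alpha> False] by (auto simp: refl_down_def)
  qed
qed

text \<open>The arrow \<open>\<alpha>\<^sup>*\<close> sends an element of \<open>ker \<phi>\<close> to its component at \<open>\<alpha>\<close>. An element that all arrows send into
  \<open>V\<close> is thus an element of \<open>ker \<phi>\<close> with all components in \<open>V\<close>.\<close>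

lemma source_condition_iff:
  assumes V: "is_subrep R N V"
  shows "hom_vanishes R (simple_rep a) (quot_rep R N V) \<longleftrightarrow>
    V a = Inr ` {f \<in> arrows_from (\<lambda>j. projl ` V j). \<phi> f = \<zero>\<^bsub>Ma\<^esub>}"
proof -
  have mem: "rmap N \<alpha> (Inr k) \<in> V (head R \<alpha>) \<longleftrightarrow> k \<alpha> \<in> projl ` V (tail Q \<alpha>)" if "\<alpha> \<in> Is" for k \<alpha>
  proof -
    have "V (tail Q \<alpha>) \<subseteq> range Inl" by (rule V_range(1)[OF V IsD(3,4)[OF that]])
    then have "Inl (k \<alpha>) \<in> V (tail Q \<alpha>) \<longleftrightarrow> k \<alpha> \<in> projl ` V (tail Q \<alpha>)" by (force simp: image_iff)
    then show ?thesis by (simp add: N_map(1)[OF that] head_R[OF that] del: refl_quiver_simps)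
  qed
  have arr: "(\<forall>\<alpha>\<in>out_arcs R a. rmap N \<alpha> (Inr k) \<in> V (head R \<alpha>)) \<longleftrightarrow> k \<in> arrows_from (\<lambda>j. projl ` V j)"
    if k: "k \<in> kernel" for k
  proof -
    have "k \<in> extensional Is" using k by (auto simp: kernel_def sum_simps PiE_iff)
    then show ?thesis unfolding out_R arrows_from_def PiE_iff using mem by blast
  qed
  have sub: "arrows_from (\<lambda>j. projl ` V j) \<subseteq> carrier S" by (rule subD(2)[OF sub_arrows_from_projl[OF V]])
  have up: "V a \<subseteq> Inr ` {f \<in> arrows_from (\<lambda>j. projl ` V j). \<phi> f = \<zero>\<^bsub>Ma\<^esub>}"
  proof
    fix x assume x: "x \<in> V a"
    then obtain k where k: "k \<in> kernel" "x = Inr k" using V_range(3)[OF V av] by blast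
    have "rmap N \<alpha> (Inr k) \<in> V (head R \<alpha>)" if "\<alpha> \<in> out_arcs R a" for \<alpha>
      using is_subrepD(2)[OF V r.OsD(1)[OF that], of "Inr k"] r.OsD(2)[OF that] x k(2) by simp
    then have "k \<in> arrows_from (\<lambda>j. projl ` V j)" using arr[OF k(1)] by blast
    then show "x \<in> Inr ` {f \<in> arrows_from (\<lambda>j. projl ` V j). \<phi> f = \<zero>\<^bsub>Ma\<^esub>}" using k by (simp add: kernel_def)
  qed
  have "(\<forall>x\<in>carrier (rspace N a). (\<forall>\<alpha>\<in>out_arcs R a. rmap N \<alpha> x \<in> V (head R \<alpha>)) \<longrightarrow> x \<in> V a)
    \<longleftrightarrow> Inr ` {f \<in> arrows_from (\<lambda>j. projl ` V j). \<phi> f = \<zero>\<^bsub>Ma\<^esub>} \<subseteq> V a"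
    unfolding N_carrier using arr sub by (auto simp: kernel_def)
  then show ?thesis unfolding r.hom_from_simple_vanishes_iff[OF V] using up by blast
qed

lemma refl_down_up:
  assumes W: "is_subrep Q M W" and hv: "\<phi> ` arrows_from W = W a"
  shows "refl_down (refl_up W) i = W i"
proof -
  have p: "projl ` refl_up W j = W j" if "j \<noteq> a" for j using that by (simp add: refl_up_def image_image)
  have "arrows_from (\<lambda>j. projl ` refl_up W j) = arrows_from W"
    unfolding arrows_from_def by (rule PiE_cong) (rule p[OF IsD(4)])
  then show ?thesis using p hv by (simp add: refl_down_def)
qed

lemma refl_up_down:
  assumes V: "is_subrep R N V" and hv: "V a = Inr ` {f \<in> arrows_from (\<lambda>j. projl ` V j). \<phi> f = \<zero>\<^bsub>Ma\<^esub>}"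
    and i: "i \<in> verts Q"
  shows "refl_up (refl_down V) i = V i"
proof (cases "i = a")
  case True
  have "arrows_from (refl_down V) = arrows_from (\<lambda>j. projl ` V j)"
    unfolding arrows_from_def by (rule PiE_cong) (simp add: refl_down_def IsD(4))
  then show ?thesis using True hv by (simp add: refl_up_def)
next
  case False
  have "V i \<subseteq> range Inl" by (rule V_range(1)[OF V i False])
  then have "Inl ` projl ` V i = V i" by (force simp: image_image)
  then show ?thesis using False by (simp add: refl_up_def refl_down_def)
qed

text \<open>The counit takes the concrete realisation of \<open>S\<^sub>a\<^sup>- V\<close> inside \<open>S\<^sub>a\<^sup>- N\<close> to the subspaces \<open>refl_down V\<close> of \<open>M\<close>.\<close>

lemma Theta_image:
  assumes V: "is_subrep R N V"
  shows "\<Theta> i ` (if i = a then Inr ` r.q ` r.arrows_into V else Inl ` V i) = refl_down V i"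
proof (cases "i = a")
  case True
  have eq: "r.arrows_into V = (\<Pi>\<^sub>E \<alpha>\<in>Is. V (tail Q \<alpha>))"
    unfolding r.arrows_into_def out_R by (rule PiE_cong) (simp add: head_R del: refl_quiver_simps)
  have "\<Theta> a ` Inr ` r.q ` r.arrows_into V = (\<lambda>f. \<phi> (untag f)) ` r.arrows_into V"
    unfolding image_image using Theta_a subD(2)[OF r.sub_arrows_into[OF V]] by (intro image_cong[OF refl]) blast
  also have "\<dots> = \<phi> ` untag ` (\<Pi>\<^sub>E \<alpha>\<in>Is. V (tail Q \<alpha>))" unfolding eq image_image ..
  also have "untag ` (\<Pi>\<^sub>E \<alpha>\<in>Is. V (tail Q \<alpha>)) = arrows_from (\<lambda>j. projl ` V j)"
    unfolding arrows_from_def by (rule untag_PiE) (rule V_range(1)[OF V IsD(3,4)])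
  finally show ?thesis using True by (simp add: refl_down_def)
next
  case False
  then show ?thesis by (simp add: refl_down_def Theta_i[OF False] image_image)
qed

subsection \<open>Dimensions\<close>

text \<open>Since no arrow leaves \<open>a\<close>, the symmetrised form of \<open>e\<close> with the unit vector at \<open>a\<close> is \<open>2 e\<^sub>a\<close> minus the sum of
  \<open>e\<close> over the tails of the arrows into \<open>a\<close>.\<close>

lemma refl_dim_at: "refl_dim Q a e i = (if i = a then (\<Sum>\<alpha>\<in>Is. e (tail Q \<alpha>)) - e a else e i)"
proof -
  have fin: "finite (verts Q)" "finite (arcs Q)" by simp_all
  have Is: "Is = {\<alpha> \<in> arcs Q. head Q \<alpha> = a}" by (auto simp: in_arcs_def)
  have v: "(\<Sum>i\<in>verts Q. e i * unit_dim a i) = e a" "(\<Sum>i\<in>verts Q. unit_dim a i * e i) = e a"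
    using fin(1) av by (simp_all add: unit_dim_def if_distrib[of "(*) _"] if_distrib[of "\<lambda>x. x * _"] cong: if_cong)
  have h: "(\<Sum>\<alpha>\<in>arcs Q. e (tail Q \<alpha>) * unit_dim a (head Q \<alpha>)) = (\<Sum>\<alpha>\<in>Is. e (tail Q \<alpha>))"
    unfolding Is using fin(2) by (simp add: sum.inter_filter unit_dim_def if_distrib[of "(*) _"] cong: if_cong)
  have t: "(\<Sum>\<alpha>\<in>arcs Q. unit_dim a (tail Q \<alpha>) * e (head Q \<alpha>)) = 0"
    by (rule sum.neutral) (simp add: unit_dim_def arcD(3))
  show ?thesis by (simp add: refl_dim_def sym_euler_form_def euler_form_def v h t, simp add: unit_dim_def)
qed

text \<open>Count dimensions in \<open>0 \<rightarrow> ker \<phi> \<inter> A(W) \<rightarrow> A(W) \<rightarrow> W\<^sub>a \<rightarrow> 0\<close>.\<close>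

lemma refl_up_dim:
  assumes W: "is_subrep Q M W" and hv: "\<phi> ` arrows_from W = W a" and i: "i \<in> verts Q"
  shows "int (vdim ((rspace N i)\<lparr>carrier := refl_up W i\<rparr>))
    = refl_dim Q a (\<lambda>j. int (vdim ((rspace M j)\<lparr>carrier := W j\<rparr>))) i"
proof (cases "i = a")
  case True
  let ?P = "arrows_from W" and ?K = "{f \<in> arrows_from W. \<phi> f = \<zero>\<^bsub>Ma\<^esub>}"
  have P: "sub S ?P" by (rule sub_arrows_from) (rule is_subrepD(1)[OF W])
  have K: "sub (S\<lparr>carrier := kernel\<rparr>) ?K"
    unfolding sub_sub_iff[OF sub_kernel]
    using lin_kernel_sub[OF lin_phi P] subD(2)[OF P] by (auto simp: kernel_def)
  have "vdim ((rspace N a)\<lparr>carrier := Inr ` ?K\<rparr>) = vdim ((S\<lparr>carrier := kernel\<rparr>)\<lparr>carrier := ?K\<rparr>)"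
    by (rule vdim_image[OF lin_Inr fdim_sub[OF vsp_S fdim_S sub_kernel] K])
      (simp add: N_space transport_simps)
  then have up: "vdim ((rspace N a)\<lparr>carrier := refl_up W a\<rparr>) = vdim (S\<lparr>carrier := ?K\<rparr>)"
    by (simp add: refl_up_def)
  have "vdim (S\<lparr>carrier := ?P\<rparr>) = vdim (S\<lparr>carrier := ?K\<rparr>) + vdim (Ma\<lparr>carrier := \<phi> ` ?P\<rparr>)"
    by (rule vdim_exact[OF lin_phi fdim_S M_vsp(2)[OF av] P])
  moreover have "vdim (S\<lparr>carrier := ?P\<rparr>) = (\<Sum>\<alpha>\<in>Is. vdim ((rspace M (tail Q \<alpha>))\<lparr>carrier := W (tail Q \<alpha>)\<rparr>))"
    unfolding arrows_from_def by (rule vdim_PiE) (rule is_subrepD(1)[OF W IsD(3)])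
  ultimately show ?thesis unfolding True refl_dim_at using hv up by (simp flip: of_nat_sum)
next
  case False
  have "vdim ((rspace N i)\<lparr>carrier := Inl ` W i\<rparr>) = vdim ((rspace M i)\<lparr>carrier := W i\<rparr>)"
    by (rule vdim_image[OF lin_Inl[OF i False] M_vsp(2)[OF i] is_subrepD(1)[OF W i]])
      (simp add: N_space(1)[OF False] transport_simps)
  then show ?thesis using False by (simp add: refl_dim_at refl_up_def)
qed

lemma arrows_from_refl_down: "arrows_from (refl_down V) = arrows_from (\<lambda>j. projl ` V j)"
  unfolding arrows_from_def by (rule PiE_cong) (simp add: refl_down_def IsD(4))

lemma refl_down_spanned: "\<phi> ` arrows_from (refl_down V) = refl_down V a"
  unfolding arrows_from_refl_down by (simp add: refl_down_def)

text \<open>This gives the dimensions of \<open>refl_down V\<close> from those of \<open>V\<close> without a second count: reflect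
  \<open>refl_down V\<close> up again and compare.\<close>

lemma refl_dim_inj:
  assumes "\<And>j. j \<in> verts Q \<Longrightarrow> refl_dim Q a e j = refl_dim Q a e' j" and i: "i \<in> verts Q"
  shows "e i = e' i"
proof -
  have off: "e j = e' j" if "j \<in> verts Q" "j \<noteq> a" for j using assms(1)[OF that(1)] that(2) by (simp add: refl_dim_at)
  have "(\<Sum>\<alpha>\<in>Is. e (tail Q \<alpha>)) = (\<Sum>\<alpha>\<in>Is. e' (tail Q \<alpha>))" by (rule sum.cong[OF refl]) (rule off[OF IsD(3,4)])
  then have "e a = e' a" using assms(1)[OF av] by (simp add: refl_dim_at)
  then show ?thesis using off[OF i] by blast
qed

lemma arrows_from_mono:
  assumes "\<And>i. i \<in> verts Q \<Longrightarrow> i \<noteq> a \<Longrightarrow> W i \<subseteq> W' i" shows "arrows_from W \<subseteq> arrows_from W'"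
  unfolding arrows_from_def by (rule PiE_mono) (rule assms[OF IsD(3,4)])

lemma refl_up_mono:
  assumes "\<And>i. i \<in> verts Q \<Longrightarrow> W i \<subseteq> W' i" "i \<in> verts Q" shows "refl_up W i \<subseteq> refl_up W' i"
  using arrows_from_mono[of W W'] assms by (auto simp: refl_up_def)

lemma refl_down_mono:
  assumes "\<And>i. i \<in> verts Q \<Longrightarrow> V i \<subseteq> V' i" "i \<in> verts Q" shows "refl_down V i \<subseteq> refl_down V' i"
proof -
  have "arrows_from (\<lambda>j. projl ` V j) \<subseteq> arrows_from (\<lambda>j. projl ` V' j)"
    by (rule arrows_from_mono) (rule image_mono[OF assms(1)])
  then show ?thesis using assms by (auto simp: refl_down_def)
qed

end

section \<open>Reflection of flags\<close>

text \<open>The condition on \<open>M\<close> enters as the surjectivity of \<open>\<phi>\<close>.\<close>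

locale flag_reflection = sink_rep Q a M
  for Q :: "('i, 'e) pre_digraph" and a :: 'i and M :: "('i, 'e, 'k::field, 'v) quiver_rep" +
  fixes \<nu> :: nat and d :: "nat \<Rightarrow> 'i \<Rightarrow> int"
  assumes filt: "filtration Q \<nu> d" and dimM: "\<And>i. i \<in> verts Q \<Longrightarrow> dimension_vector M i = d \<nu> i"
    and surj: "\<phi> ` carrier S = carrier Ma"
begin

abbreviation "d' \<equiv> \<lambda>l. refl_dim Q a (d l)"
abbreviation "X \<equiv> Fl_sink Q \<nu> d M a"
abbreviation "Y \<equiv> Fl_source R \<nu> d' N a"
abbreviation "up \<equiv> S_plus_flag Q a \<nu> M"
abbreviation "down V \<equiv> map_flag \<Theta> (S_minus_flag R a \<nu> N V)"

lemma FlD: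
  assumes "U \<in> Fl Q' \<nu> e M'"
  shows "l \<le> \<nu> \<Longrightarrow> is_subrep Q' M' (U l)"
    "l \<le> \<nu> \<Longrightarrow> i \<in> verts Q' \<Longrightarrow> int (vdim ((rspace M' i)\<lparr>carrier := U l i\<rparr>)) = e l i"
    "l < \<nu> \<Longrightarrow> i \<in> verts Q' \<Longrightarrow> U l i \<subseteq> U (Suc l) i"
    "i \<in> verts Q' \<Longrightarrow> U \<nu> i = carrier (rspace M' i)"
    "\<not> (l \<le> \<nu> \<and> i \<in> verts Q') \<Longrightarrow> U l i = {}"
  using assms by (simp_all add: Fl_def dimension_vector_def subrep_simps)

lemma X_D:
  assumes U: "U \<in> X"
  shows "U \<in> Fl Q \<nu> d M" "l \<le> \<nu> \<Longrightarrow> \<phi> ` arrows_from (U l) = U l a"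
proof -
  show "U \<in> Fl Q \<nu> d M" using U by (simp add: Fl_sink_def)
  from FlD(1)[OF this] show "l \<le> \<nu> \<Longrightarrow> \<phi> ` arrows_from (U l) = U l a"
    using U hom_subrep_to_simple_iff by (simp add: Fl_sink_def)
qed

lemma Y_D:
  assumes V: "V \<in> Y"
  shows "V \<in> Fl R \<nu> d' N"
    "l \<le> \<nu> \<Longrightarrow> V l a = Inr ` {f \<in> arrows_from (\<lambda>j. projl ` V l j). \<phi> f = \<zero>\<^bsub>Ma\<^esub>}"
proof -
  show "V \<in> Fl R \<nu> d' N" using V by (simp add: Fl_source_def)
  from FlD(1)[OF this] show "l \<le> \<nu> \<Longrightarrow> V l a = Inr ` {f \<in> arrows_from (\<lambda>j. projl ` V l j). \<phi> f = \<zero>\<^bsub>Ma\<^esub>}"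
    using V source_condition_iff by (simp add: Fl_source_def)
qed

lemma up_eq:
  assumes "U \<in> X" shows "up U = (\<lambda>l i. if l \<le> \<nu> \<and> i \<in> verts Q then refl_up (U l) i else {})"
  using FlD(1)[OF X_D(1)[OF assms]] by (auto simp: fun_eq_iff S_plus_flag_def S_plus_subrep refl_up_def)

lemma down_eq:
  assumes V: "V \<in> Y" shows "down V = (\<lambda>l i. if l \<le> \<nu> \<and> i \<in> verts Q then refl_down (V l) i else {})"
proof -
  have sr: "is_subrep R N (V l)" if "l \<le> \<nu>" for l by (rule FlD(1)[OF Y_D(1)[OF V] that])
  have eq: "S_minus_flag R a \<nu> N V = (\<lambda>l i. if l \<le> \<nu> \<and> i \<in> verts R
      then if i = a then Inr ` r.q ` r.arrows_into (V l) else Inl ` V l i else {})"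
    by (rule r.S_minus_flag_eq) (rule sr)
  show ?thesis
  proof (intro ext)
    fix l i
    show "down V l i = (if l \<le> \<nu> \<and> i \<in> verts Q then refl_down (V l) i else {})"
      unfolding map_flag_def eq using Theta_image[OF sr] by simp
  qed
qed

lemma X_I:
  assumes "\<And>l. l \<le> \<nu> \<Longrightarrow> is_subrep Q M (U l)" "\<And>l i. l \<le> \<nu> \<Longrightarrow> i \<in> verts Q \<Longrightarrow> int (vdim ((rspace M i)\<lparr>carrier := U l i\<rparr>)) = d l i"
    "\<And>l i. l < \<nu> \<Longrightarrow> i \<in> verts Q \<Longrightarrow> U l i \<subseteq> U (Suc l) i" "\<And>i. i \<in> verts Q \<Longrightarrow> U \<nu> i = carrier (rspace M i)"
    "\<And>l i. \<not> (l \<le> \<nu> \<and> i \<in> verts Q) \<Longrightarrow> U l i = {}" "\<And>l. l \<le> \<nu> \<Longrightarrow> \<phi> ` arrows_from (U l) = U l a"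
  shows "U \<in> X"
  using assms hom_subrep_to_simple_iff filt dimM
  by (auto simp: Fl_sink_def Fl_def dimension_vector_def subrep_simps)

lemma is_subrep_cong:
  assumes "\<And>i. i \<in> verts Q' \<Longrightarrow> W i = W' i" "fin_digraph Q'" "is_subrep Q' M' W" shows "is_subrep Q' M' W'"
proof -
  interpret fin_digraph Q' by (rule assms(2))
  show ?thesis using assms(1,3) wellformed by (auto simp: is_subrep_def)
qed

lemma arrows_from_cong: "(\<And>i. i \<in> verts Q \<Longrightarrow> i \<noteq> a \<Longrightarrow> W i = W' i) \<Longrightarrow> arrows_from W = arrows_from W'"
  unfolding arrows_from_def by (rule PiE_cong) (simp add: IsD)

text \<open>Besides the conditions on the subspaces, membership in \<open>Y\<close> asks that the reflected dimension vectors
  form a filtration. They do, being the dimension vectors of an increasing chain of subspaces that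
  starts at zero.\<close>

lemma up_in_Y:
  assumes U: "U \<in> X" shows "up U \<in> Y"
proof -
  note F = FlD[OF X_D(1)[OF U]] and c = X_D(2)[OF U]
  have sr: "is_subrep R N (up U l)" if l: "l \<le> \<nu>" for l
    by (rule is_subrep_cong[OF _ fin_R refl_up_subrep[OF F(1)[OF l]]]) (simp add: up_eq[OF U] l)
  have dim: "int (vdim ((rspace N i)\<lparr>carrier := up U l i\<rparr>)) = d' l i" if l: "l \<le> \<nu>" and i: "i \<in> verts Q" for l i
  proof -
    have "(\<Sum>\<alpha>\<in>Is. int (vdim ((rspace M (tail Q \<alpha>))\<lparr>carrier := U l (tail Q \<alpha>)\<rparr>))) = (\<Sum>\<alpha>\<in>Is. d l (tail Q \<alpha>))"
      by (rule sum.cong[OF refl]) (rule F(2)[OF l IsD(3)])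
    then have "refl_dim Q a (\<lambda>j. int (vdim ((rspace M j)\<lparr>carrier := U l j\<rparr>))) i = d' l i"
      using F(2)[OF l] i av by (simp add: refl_dim_at)
    then show ?thesis using refl_up_dim[OF F(1)[OF l] c[OF l] i] by (simp add: up_eq[OF U] l i)
  qed
  have mono: "up U l i \<subseteq> up U (Suc l) i" if l: "l < \<nu>" and i: "i \<in> verts Q" for l i
    unfolding up_eq[OF U] using refl_up_mono[of "U l" "U (Suc l)" i] F(3)[OF l] l i by simp
  have top: "up U \<nu> i = carrier (rspace N i)" if i: "i \<in> verts Q" for i
  proof -
    have "arrows_from (U \<nu>) = carrier S"
      unfolding arrows_from_def sum_simps by (rule PiE_cong) (rule F(4)[OF IsD(3)])
    then show ?thesis using i F(4)[OF i] by (simp add: up_eq[OF U] refl_up_def N_carrier kernel_def)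
  qed
  have zero: "d' 0 i = 0" if i: "i \<in> verts Q" for i
  proof -
    have "(\<Sum>\<alpha>\<in>Is. d 0 (tail Q \<alpha>)) = 0"
      by (rule sum.neutral) (use filt IsD(3) in \<open>auto simp: filtration_def\<close>)
    then show ?thesis using filt i av by (simp add: refl_dim_at filtration_def)
  qed
  have N_vsp: "vsp (rspace N i)" "fdim (rspace N i)" if "i \<in> verts Q" for i
    using is_rep_N that by (simp_all add: is_rep_def)
  have filt': "filtration R \<nu> d'"
    unfolding filtration_def
  proof (intro conjI ballI allI impI)
    fix l i assume l: "l < \<nu>" and "i \<in> verts R"
    then have i: "i \<in> verts Q" by simp
    have "vdim ((rspace N i)\<lparr>carrier := up U l i\<rparr>) \<le> vdim ((rspace N i)\<lparr>carrier := up U (Suc l) i\<rparr>)"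
      using sr[of l] sr[of "Suc l"] l i by (intro vdim_mono[OF N_vsp[OF i] _ _ mono[OF l i]]) (simp_all add: is_subrep_def)
    then show "d' l i \<le> d' (Suc l) i" using dim[OF _ i, of l] dim[OF _ i, of "Suc l"] l by simp
  qed (use zero in simp)
  have dimN: "d' \<nu> i = dimension_vector N i" if i: "i \<in> verts Q" for i
    using dim[OF order_refl i] top[OF i] by (simp add: dimension_vector_def)
  have cond: "up U l a = Inr ` {f \<in> arrows_from (\<lambda>j. projl ` up U l j). \<phi> f = \<zero>\<^bsub>Ma\<^esub>}" if l: "l \<le> \<nu>" for l
  proof -
    have "arrows_from (\<lambda>j. projl ` up U l j) = arrows_from (U l)"
      by (rule arrows_from_cong) (simp add: up_eq[OF U] l refl_up_def image_image)
    then show ?thesis by (simp add: up_eq[OF U] l av refl_up_def)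
  qed
  have out: "up U l i = {}" if "\<not> (l \<le> \<nu> \<and> i \<in> verts R)" for l i
    using that by (simp only: up_eq[OF U] refl_quiver_simps if_False)
  show ?thesis
    unfolding Fl_source_def Fl_def mem_Collect_eq
  proof (intro conjI allI ballI impI filt')
    show "hom_vanishes R (simple_rep a) (quot_rep R N (up U l))" if "l \<le> \<nu>" for l
      by (rule source_condition_iff[OF sr[OF that], THEN iffD2]) (rule cond[OF that])
  qed (use sr dim mono top dimN out in \<open>simp_all add: dimension_vector_def subrep_simps\<close>)
qed

lemma down_up:
  assumes U: "U \<in> X" shows "down (up U) = U"
proof (intro ext)
  fix l i
  note F = FlD[OF X_D(1)[OF U]] and c = X_D(2)[OF U]
  show "down (up U) l i = U l i"
  proof (cases "l \<le> \<nu> \<and> i \<in> verts Q")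
    case True
    then have l: "l \<le> \<nu>" and i: "i \<in> verts Q" by auto
    have "arrows_from (\<lambda>j. projl ` up U l j) = arrows_from (\<lambda>j. projl ` refl_up (U l) j)"
      by (rule arrows_from_cong) (simp add: up_eq[OF U] l)
    then have "refl_down (up U l) i = refl_down (refl_up (U l)) i"
      using i l by (simp add: refl_down_def up_eq[OF U])
    then show ?thesis using refl_down_up[OF F(1)[OF l] c[OF l]] True by (simp add: down_eq[OF up_in_Y[OF U]])
  next
    case False
    then show ?thesis using F(5)[OF False] by (simp only: down_eq[OF up_in_Y[OF U]] if_False)
  qed
qed

lemma down_in_X:
  assumes V: "V \<in> Y" shows "down V \<in> X"
proof (rule X_I)
  note F = FlD[OF Y_D(1)[OF V]] and c = Y_D(2)[OF V]
  fix l
  show sr: "is_subrep Q M (down V l)" if l: "l \<le> \<nu>"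
    by (rule is_subrep_cong[OF _ fin refl_down_subrep[OF F(1)[OF l]]]) (simp add: down_eq[OF V] l)
  show "\<phi> ` arrows_from (down V l) = down V l a" if l: "l \<le> \<nu>"
  proof -
    have "arrows_from (down V l) = arrows_from (refl_down (V l))"
      by (rule arrows_from_cong) (simp add: down_eq[OF V] l)
    then show ?thesis using refl_down_spanned[of "V l"] by (simp add: down_eq[OF V] l av)
  qed
  fix i
  show "\<not> (l \<le> \<nu> \<and> i \<in> verts Q) \<Longrightarrow> down V l i = {}" by (simp only: down_eq[OF V] if_False)
  show "down V l i \<subseteq> down V (Suc l) i" if l: "l < \<nu>" and i: "i \<in> verts Q"
    unfolding down_eq[OF V] using refl_down_mono[of "V l" "V (Suc l)" i] F(3)[OF l] l i by simp
  show "int (vdim ((rspace M i)\<lparr>carrier := down V l i\<rparr>)) = d l i" if l: "l \<le> \<nu>" and i: "i \<in> verts Q"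
  proof -
    have "int (vdim ((rspace M i)\<lparr>carrier := refl_down (V l) i\<rparr>)) = d l i"
    proof (rule refl_dim_inj[OF _ i])
      fix j assume j: "j \<in> verts Q"
      have "refl_dim Q a (\<lambda>j. int (vdim ((rspace M j)\<lparr>carrier := refl_down (V l) j\<rparr>))) j
        = int (vdim ((rspace N j)\<lparr>carrier := refl_up (refl_down (V l)) j\<rparr>))"
        by (rule refl_up_dim[OF refl_down_subrep[OF F(1)[OF l]] refl_down_spanned j, symmetric])
      also have "\<dots> = d' l j" using refl_up_down[OF F(1)[OF l] c[OF l] j] F(2)[OF l] j by simp
      finally show "refl_dim Q a (\<lambda>j. int (vdim ((rspace M j)\<lparr>carrier := refl_down (V l) j\<rparr>))) j = d' l j" .
    qed
    then show ?thesis by (simp add: down_eq[OF V] l i)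
  qed
  show "down V \<nu> i = carrier (rspace M i)" if i: "i \<in> verts Q"
  proof -
    have off: "projl ` V \<nu> j = carrier (rspace M j)" if "j \<in> verts Q" "j \<noteq> a" for j
      using F(4)[of j] that by (simp add: N_carrier image_image)
    have "arrows_from (\<lambda>j. projl ` V \<nu> j) = carrier S"
      unfolding arrows_from_def sum_simps by (rule PiE_cong) (rule off[OF IsD(3,4)])
    then show ?thesis using off[OF i] surj i by (simp add: down_eq[OF V] refl_down_def)
  qed
qed

lemma up_down:
  assumes V: "V \<in> Y" shows "up (down V) = V"
proof (intro ext)
  fix l i
  note F = FlD[OF Y_D(1)[OF V]] and c = Y_D(2)[OF V]
  show "up (down V) l i = V l i"
  proof (cases "l \<le> \<nu> \<and> i \<in> verts Q")
    case True
    then have l: "l \<le> \<nu>" and i: "i \<in> verts Q" by auto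
    have "arrows_from (down V l) = arrows_from (refl_down (V l))"
      by (rule arrows_from_cong) (simp add: down_eq[OF V] l)
    then have "refl_up (down V l) i = refl_up (refl_down (V l)) i"
      using i l by (simp add: refl_up_def down_eq[OF V])
    then show ?thesis using refl_up_down[OF F(1)[OF l] c[OF l] i] True by (simp add: up_eq[OF down_in_X[OF V]])
  next
    case False
    then show ?thesis using F(5)[of l i] by (simp only: up_eq[OF down_in_X[OF V]] if_False refl_quiver_simps simp_thms)
  qed
qed

subsection \<open>Both maps are morphisms\<close>

sublocale XV: flags Q \<nu> d M X
proof (rule flags.intro)
  show "X \<subseteq> Fl Q \<nu> d M" unfolding Fl_sink_def by (rule Collect_restrict)
qed (simp_all add: repM)

sublocale YV: flags R \<nu> d' N Y
proof (rule flags.intro)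
  show "Y \<subseteq> Fl R \<nu> d' N" unfolding Fl_source_def by (rule Collect_restrict)
qed (simp_all add: is_rep_N)

text \<open>Away from \<open>a\<close> the spaces are copies of those of \<open>U\<close>. At \<open>a\<close> the middle term \<open>A\<close> and the image \<open>U\<^sub>a\<close> of \<open>\<phi>\<close> are
  known, and the kernel is wanted.\<close>

lemma morphism_up: "variety_morphism (flag_variety Q \<nu> d M X) (flag_variety R \<nu> d' N Y) up"
proof (rule flag_map.morphism, intro flag_map.intro flag_map_axioms.intro XV.flags_axioms YV.flags_axioms)
  show "up U \<in> Y" if "U \<in> X" for U by (rule up_in_Y[OF that])
next
  fix U0 l i assume U0: "U0 \<in> X" and l: "l \<le> \<nu>" and "i \<in> verts R"
  then have i: "i \<in> verts Q" by simp
  show "\<exists>n. XV.locpoly (rspace N i) (\<lambda>U. up U l i) n U0"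
  proof (cases "i = a")
    case False
    have lp: "XV.locpoly (rspace N i) (\<lambda>U. Inl ` U l i) (nat (d l i)) U0"
      by (rule XV.locpoly_image[OF lin_Inl[OF i False] _ _ XV.locpoly_coord[OF U0 l i]])
        (simp_all add: N_space(1)[OF False] transport_simps XV.flag_sub l i)
    have eq: "Inl ` U l i = up U l i" if "U \<in> X" for U using False l i by (simp add: up_eq[OF that] refl_up_def)
    show ?thesis by (rule exI, rule XV.locpoly_cong[OF lp], rule eq)
  next
    case True
    let ?P = "\<lambda>U. arrows_from (U l)" and ?K = "\<lambda>U. {f \<in> arrows_from (U l). \<phi> f = \<zero>\<^bsub>Ma\<^esub>}"
    have Psub: "sub S (?P U)" if U: "U \<in> X" for U by (rule sub_arrows_from) (rule XV.flag_sub[OF U l])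
    have P: "XV.locpoly S ?P (\<Sum>\<alpha>\<in>Is. nat (d l (tail Q \<alpha>))) U0"
      unfolding arrows_from_def
      by (rule XV.locpoly_PiE[OF sum_spaces_axioms U0])
        (rule XV.flag_sub[OF _ l IsD(3)] XV.locpoly_coord[OF U0 l IsD(3)]; assumption)+
    have im: "U l a = \<phi> ` ?P U" if "U \<in> X" for U using X_D(2)[OF that l] by simp
    have "XV.locpoly Ma (\<lambda>U. \<phi> ` ?P U) (nat (d l a)) U0"
      by (rule XV.locpoly_cong[OF XV.locpoly_coord[OF U0 l av]]) (rule im)
    from XV.locpoly_kernel[OF lin_phi fdim_S M_vsp(2)[OF av] _ P this]
    have K: "XV.locpoly S ?K ((\<Sum>\<alpha>\<in>Is. nat (d l (tail Q \<alpha>))) - nat (d l a)) U0"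
      using Psub by blast
    have Kk: "?K U \<subseteq> kernel" if "U \<in> X" for U using subD(2)[OF Psub[OF that]] by (auto simp: kernel_def)
    have Ksub: "sub (S\<lparr>carrier := kernel\<rparr>) (?K U)" if "U \<in> X" for U
      unfolding sub_sub_iff[OF sub_kernel] using lin_kernel_sub[OF lin_phi Psub[OF that]] Kk[OF that] by simp
    have lp: "XV.locpoly (rspace N a) (\<lambda>U. Inr ` ?K U) ((\<Sum>\<alpha>\<in>Is. nat (d l (tail Q \<alpha>))) - nat (d l a)) U0"
      by (rule XV.locpoly_image[OF lin_Inr _ _ XV.locpoly_restrict[OF vsp_S fdim_S sub_kernel _ K]])
        (simp_all only: Kk Ksub, simp add: N_space(2) transport_simps)
    have eq: "Inr ` ?K U = up U l a" if "U \<in> X" for U using l av by (simp add: up_eq[OF that] refl_up_def)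
    show ?thesis unfolding True by (rule exI, rule XV.locpoly_cong[OF lp], rule eq)
  qed
qed

text \<open>At \<open>a\<close> the middle term \<open>A\<close> and the kernel \<open>V\<^sub>a\<close> of \<open>\<phi>\<close> are known, and the image is wanted.\<close>

lemma morphism_down: "variety_morphism (flag_variety R \<nu> d' N Y) (flag_variety Q \<nu> d M X) down"
proof (rule flag_map.morphism, intro flag_map.intro flag_map_axioms.intro YV.flags_axioms XV.flags_axioms)
  show "down U \<in> X" if "U \<in> Y" for U by (rule down_in_X[OF that])
next
  fix V0 l i assume V0: "V0 \<in> Y" and l: "l \<le> \<nu>" and i: "i \<in> verts Q"
  have vR: "j \<in> verts R" if "j \<in> verts Q" for j using that by simp
  have sr: "is_subrep R N (V l)" if "V \<in> Y" for V by (rule FlD(1)[OF Y_D(1)[OF that] l])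
  have off: "YV.locpoly (rspace M j) (\<lambda>V. projl ` V l j) (nat (d' l j)) V0" if j: "j \<in> verts Q" "j \<noteq> a" for j
  proof (rule YV.locpoly_image[OF lin_projl[OF j] _ _ YV.locpoly_coord[OF V0 l vR[OF j(1)]]])
    show "sub (rspace N j) (V l j)" if "V \<in> Y" for V by (rule YV.flag_sub[OF that l vR[OF j(1)]])
    fix V x assume V: "V \<in> Y" and x: "x \<in> V l j" "projl x = \<zero>\<^bsub>rspace M j\<^esub>"
    obtain y where "x = Inl y" using V_range(1)[OF sr[OF V] j] x(1) by blast
    then show "x = \<zero>\<^bsub>rspace N j\<^esub>" using x(2) by (simp add: N_space(1)[OF j(2)] transport_simps)
  qed
  show "\<exists>n. YV.locpoly (rspace M i) (\<lambda>V. down V l i) n V0"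
  proof (cases "i = a")
    case False
    have eq: "projl ` V l i = down V l i" if "V \<in> Y" for V using False l i by (simp add: down_eq[OF that] refl_down_def)
    show ?thesis by (rule exI, rule YV.locpoly_cong[OF off[OF i False]], rule eq)
  next
    case True
    let ?P = "\<lambda>V. arrows_from (\<lambda>j. projl ` V l j)"
    have Psub: "sub S (?P V)" if V: "V \<in> Y" for V by (rule sub_arrows_from_projl[OF sr[OF V]])
    have P: "YV.locpoly S ?P (\<Sum>\<alpha>\<in>Is. nat (d' l (tail Q \<alpha>))) V0"
      unfolding arrows_from_def
      by (rule YV.locpoly_PiE[OF sum_spaces_axioms V0])
        (rule projl_sub[OF sr IsD(3,4)] off[OF IsD(3,4)]; assumption)+
    have ker: "projr ` V l a = {f \<in> ?P V. \<phi> f = \<zero>\<^bsub>Ma\<^esub>}" if "V \<in> Y" for V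
      by (subst Y_D(2)[OF that l]) (simp add: image_image)
    have K: "YV.locpoly S (\<lambda>V. projr ` V l a) (nat (d' l a)) V0"
    proof (rule YV.locpoly_image[OF lin_projr _ _ YV.locpoly_coord[OF V0 l vR[OF av]]])
      show "sub (rspace N a) (V l a)" if "V \<in> Y" for V by (rule YV.flag_sub[OF that l vR[OF av]])
      fix V x assume V: "V \<in> Y" and x: "x \<in> V l a" "projr x = \<zero>\<^bsub>S\<^esub>"
      obtain y where "x = Inr y" using V_range(2)[OF sr[OF V] av] x(1) by blast
      then show "x = \<zero>\<^bsub>rspace N a\<^esub>" using x(2) by (simp add: N_space(2) transport_simps)
    qed
    have "YV.locpoly S (\<lambda>V. {f \<in> ?P V. \<phi> f = \<zero>\<^bsub>Ma\<^esub>}) (nat (d' l a)) V0"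
      by (rule YV.locpoly_cong[OF K]) (rule ker)
    from YV.locpoly_quotient[OF lin_phi fdim_S M_vsp(2)[OF av] _ P this]
    have lp: "YV.locpoly Ma (\<lambda>V. \<phi> ` ?P V) ((\<Sum>\<alpha>\<in>Is. nat (d' l (tail Q \<alpha>))) - nat (d' l a)) V0"
      using Psub by blast
    have eq: "\<phi> ` ?P V = down V l a" if "V \<in> Y" for V using l av by (simp add: down_eq[OF that] refl_down_def)
    show ?thesis unfolding True by (rule exI, rule YV.locpoly_cong[OF lp], rule eq)
  qed
qed

theorem flag_iso: "variety_iso_with_inverse (flag_variety Q \<nu> d M X) (flag_variety R \<nu> d' N Y) up down"
  unfolding variety_iso_with_inverse_def topspace_flag_variety
  using morphism_up morphism_down down_up up_down by blast

end

section \<open>The reflection isomorphism\<close>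

theorem theorem5p16:
  fixes Q :: "('i, 'e) pre_digraph" and a :: 'i and \<nu> :: nat
    and d :: "nat \<Rightarrow> 'i \<Rightarrow> int" and M :: "('i, 'e, 'k::field, 'v) quiver_rep"
  assumes "fin_digraph Q" and "acyclic (arcs_ends Q)" and "is_sink Q a"
    and "filtration Q \<nu> d"
    and "M \<in> Rep Q (d \<nu>)" and "hom_vanishes Q M (simple_rep a)"
  shows
    "let Q' = refl_quiver a Q; d' = (\<lambda>l. refl_dim Q a (d l)); N = S_plus Q a M;
         X = Fl_sink Q \<nu> d M a; Y = Fl_source Q' \<nu> d' N a;
         \<Theta> = refl_counit Q a M; \<Psi> = refl_dual_map Q' a N
     in rep_iso Q (S_minus Q' a N) M \<Theta> \<and>
        rep_iso Q (S_minus Q' a N) (D_S_plus_D Q' a N) \<Psi> \<and>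
        variety_iso_with_inverse (flag_variety Q \<nu> d M X) (flag_variety Q' \<nu> d' N Y)
          (S_plus_flag Q a \<nu> M)
          (\<lambda>V. map_flag \<Theta> (S_minus_flag Q' a \<nu> N V)) \<and>
        (\<forall>V\<in>Y. D_flag (refl_quiver a (op_quiver Q')) \<nu> (S_plus (op_quiver Q') a (dual_rep Q' N))
                 (S_plus_flag (op_quiver Q') a \<nu> (dual_rep Q' N) (D_flag Q' \<nu> N V))
               = map_flag \<Psi> (S_minus_flag Q' a \<nu> N V))"
proof -
  have M: "is_rep Q M" "\<And>i. i \<in> verts Q \<Longrightarrow> dimension_vector M i = d \<nu> i"
    using assms(5) by (simp_all add: Rep_def)
  interpret sink_rep Q a M by (rule sink_rep.intro[OF assms(1,3) M(1)])
  have surj: "\<phi> ` carrier S = carrier Ma" using assms(6) hom_to_simple_vanishes_iff by blast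
  interpret flag_reflection Q a M \<nu> d
    by (rule flag_reflection.intro[OF sink_rep_axioms flag_reflection_axioms.intro[OF assms(4) M(2) surj]])
  have "rep_iso Q r.Sm r.DSD r.\<Psi>" using r.source_reflection_dual by simp
  moreover have "\<forall>V\<in>Y. D_flag (refl_quiver a (op_quiver R)) \<nu> r.Sp (S_plus_flag (op_quiver R) a \<nu> r.DN (D_flag R \<nu> N V))
    = map_flag r.\<Psi> (S_minus_flag R a \<nu> N V)"
  proof
    fix V assume V: "V \<in> Y"
    show "D_flag (refl_quiver a (op_quiver R)) \<nu> r.Sp (S_plus_flag (op_quiver R) a \<nu> r.DN (D_flag R \<nu> N V))
      = map_flag r.\<Psi> (S_minus_flag R a \<nu> N V)"
      by (rule r.D_flag_eq) (rule FlD(1)[OF Y_D(1)[OF V]])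
  qed
  ultimately show ?thesis
    unfolding Let_def using counit_iso[OF surj] flag_iso by (intro conjI) assumption+
qed

end
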